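(* Let $\mathcal S=\coprod_{n\in\mathbb N}\Sigma_n$ be the disjoint union of the underlying sets of all the symmetric groups. The category $\mathbf{AOp}$ of action operads is a variety of $\mathcal S$-sorted finitary algebras, and therefore is a finitary monadic category over the slice category $\mathbf{Sets}/\mathcal S$. In particular, $\mathbf{AOp}$ is locally finitely presentable.
   Context: $\mathbb N\ni 0$; permutations compose as functions. A (non-symmetric) operad $O$ in sets: sets $O(n)$ ($n\in\mathbb N$), $\mathrm{id}\in O(1)$, functions $\mu:O(n)\times O(k_1)\times\cdots\times O(k_n)\to O(k_1+\cdots+k_n)$, unital and associative in the usual sense; maps preserve $\mathrm{id}$ and $\mu$. The operad $\Sigma$ of symmetric groups has $\mu(\sigma;\tau_1,\dots,\tau_n)=\delta(\sigma)\cdot\beta(\tau_1,\dots,\tau_n)$, with $\beta$ the block sum of the permutations $\tau_i\in\Sigma_{k_i}$ and $\delta(\sigma)=\delta_{n;k_1,\dots,k_n}(\sigma)$ sending $k_1+\cdots+k_{i-1}+a$ ($1\le a\le k_i$) to $(\sum_{\sigma(i')<\sigma(i)}k_{i'})+a$. An action operad $(\Lambda,\pi)$: an operad $\Lambda$ in sets with a group structure on each $\Lambda(n)$ and a map of operads $\pi:\Lambda\to\Sigma$ whose components are group homomorphisms, such that, writing $g(i)=\pi_n(g)(i)$, $\mu(g';f_1',\dots,f_n')\mu(g;f_1,\dots,f_n)=\mu(g'g;f'_{g(1)}f_1,\dots,f'_{g(n)}f_n)$ for $g,g'\in\Lambda(n)$, $f_i\in\Lambda(k_i)$, $f_i'\in\Lambda(k_{g^{-1}(i)})$.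 Maps of action operads (the morphisms of $\mathbf{AOp}$) are maps of operads $f:\Lambda\to\Lambda'$ with $\pi^{\Lambda'}f=\pi^{\Lambda}$ and each $f_n$ a group homomorphism. An object of $\mathbf{Sets}/\mathcal S$ is a set over $\mathcal S$, equivalently an $\mathcal S$-indexed family of sets. The forgetful functor $\mathbf{AOp}\to\mathbf{Sets}/\mathcal S$ sends $(\Lambda,\pi)$ to $\coprod_n\Lambda(n)\xrightarrow{\coprod\pi_n}\mathcal S$. "Variety of $\mathcal S$-sorted finitary algebras" means: isomorphic, compatibly with this forgetful functor, to the category of $\mathcal S$-sorted algebras for a set of finitary operation symbols satisfying a set of equations. "Finitary monadic" means the forgetful functor is monadic with the induced monad preserving filtered colimits. *)

theory Defs
  imports "HOL-Algebra.Sym_Groups" "HOL-Library.Equipollence"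
begin

section \<open>Smallness\<close>

text \<open>
  A set is a member of a fixed family U of subsets of a type \<open>'u\<close>, closed under replacement,
  subsets and small unions and containing an infinite set. Every Grothendieck universe with an
  infinite member has these properties. Closure under power sets is not demanded, as HOL cannot
  prove that such a family exists; without it, \<^term>\<open>UNIV\<close> is an example for every
  infinite type \<open>'u\<close>.
\<close>

definition universe :: "'u set set \<Rightarrow> bool" where
  "universe U \<longleftrightarrow>
     (\<exists>X\<in>U. infinite X) \<and>
     (\<forall>X\<in>U. \<forall>Y. Y \<subseteq> X \<longrightarrow> Y \<in> U) \<and>
     (\<forall>X\<in>U. \<forall>f. f ` X \<in> U) \<and>
     (\<forall>X\<in>U. \<forall>F. (\<forall>x\<in>X. F x \<in> U) \<longrightarrow> (\<Union>x\<in>X. F x) \<in> U)"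

definition small :: "'u set set \<Rightarrow> 'a set \<Rightarrow> bool" where
  "small U A \<longleftrightarrow> (\<exists>X\<in>U. A \<lesssim> X)"


section \<open>Categories\<close>

record ('o, 'm) cat =
  Ob :: "'o set"
  Ar :: "'m set"
  Src :: "'m \<Rightarrow> 'o"
  Tgt :: "'m \<Rightarrow> 'o"
  Ide :: "'o \<Rightarrow> 'm"
  Cmp :: "'m \<Rightarrow> 'm \<Rightarrow> 'm"

definition arrows :: "('o, 'm) cat \<Rightarrow> 'o \<Rightarrow> 'o \<Rightarrow> 'm set" where
  "arrows C a b = {f \<in> Ar C. Src C f = a \<and> Tgt C f = b}"

definition is_cat :: "('o, 'm) cat \<Rightarrow> bool" where
  "is_cat C \<longleftrightarrow>
     (\<forall>f\<in>Ar C. Src C f \<in> Ob C \<and> Tgt C f \<in> Ob C) \<and>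
     (\<forall>a\<in>Ob C. Ide C a \<in> arrows C a a) \<and>
     (\<forall>f\<in>Ar C. \<forall>g\<in>Ar C. Src C g = Tgt C f \<longrightarrow> Cmp C g f \<in> arrows C (Src C f) (Tgt C g)) \<and>
     (\<forall>f\<in>Ar C. Cmp C f (Ide C (Src C f)) = f \<and> Cmp C (Ide C (Tgt C f)) f = f) \<and>
     (\<forall>f\<in>Ar C. \<forall>g\<in>Ar C. \<forall>h\<in>Ar C. Src C g = Tgt C f \<longrightarrow> Src C h = Tgt C g \<longrightarrow>
        Cmp C h (Cmp C g f) = Cmp C (Cmp C h g) f)"

definition is_iso :: "('o, 'm) cat \<Rightarrow> 'm \<Rightarrow> bool" where
  "is_iso C f \<longleftrightarrow> f \<in> Ar C \<and>
     (\<exists>g \<in> arrows C (Tgt C f) (Src C f).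
        Cmp C g f = Ide C (Src C f) \<and> Cmp C f g = Ide C (Tgt C f))"

record ('o, 'm, 'p, 'n) fctr =
  fob :: "'o \<Rightarrow> 'p"
  far :: "'m \<Rightarrow> 'n"

definition is_functor ::
  "('o, 'm) cat \<Rightarrow> ('p, 'n) cat \<Rightarrow> ('o, 'm, 'p, 'n) fctr \<Rightarrow> bool" where
  "is_functor C D F \<longleftrightarrow> is_cat C \<and> is_cat D \<and>
     (\<forall>a\<in>Ob C. fob F a \<in> Ob D) \<and>
     (\<forall>f\<in>Ar C. far F f \<in> arrows D (fob F (Src C f)) (fob F (Tgt C f))) \<and>
     (\<forall>a\<in>Ob C. far F (Ide C a) = Ide D (fob F a)) \<and>
     (\<forall>f\<in>Ar C. \<forall>g\<in>Ar C. Src C g = Tgt C f \<longrightarrow>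
        far F (Cmp C g f) = Cmp D (far F g) (far F f))"

definition id_fctr :: "('o, 'm, 'o, 'm) fctr" where
  "id_fctr = \<lparr>fob = id, far = id\<rparr>"

definition comp_fctr ::
  "('p, 'n, 'q, 'k) fctr \<Rightarrow> ('o, 'm, 'p, 'n) fctr \<Rightarrow> ('o, 'm, 'q, 'k) fctr" where
  "comp_fctr G F = \<lparr>fob = fob G \<circ> fob F, far = far G \<circ> far F\<rparr>"

definition is_nat ::
  "('o, 'm) cat \<Rightarrow> ('p, 'n) cat \<Rightarrow> ('o, 'm, 'p, 'n) fctr \<Rightarrow> ('o, 'm, 'p, 'n) fctr \<Rightarrow>
   ('o \<Rightarrow> 'n) \<Rightarrow> bool" where
  "is_nat C D F G t \<longleftrightarrow> is_functor C D F \<and> is_functor C D G \<and>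
     (\<forall>a\<in>Ob C. t a \<in> arrows D (fob F a) (fob G a)) \<and>
     (\<forall>f\<in>Ar C. Cmp D (t (Tgt C f)) (far F f) = Cmp D (far G f) (t (Src C f)))"

definition is_isomorphism ::
  "('o, 'm) cat \<Rightarrow> ('p, 'n) cat \<Rightarrow> ('o, 'm, 'p, 'n) fctr \<Rightarrow> bool" where
  "is_isomorphism C D F \<longleftrightarrow> is_functor C D F \<and>
     (\<exists>G. is_functor D C G \<and>
        (\<forall>a\<in>Ob C. fob G (fob F a) = a) \<and> (\<forall>f\<in>Ar C. far G (far F f) = f) \<and>
        (\<forall>b\<in>Ob D. fob F (fob G b) = b) \<and> (\<forall>g\<in>Ar D. far F (far G g) = g))"

definition is_equivalence ::
  "('o, 'm) cat \<Rightarrow> ('p, 'n) cat \<Rightarrow> ('o, 'm, 'p, 'n) fctr \<Rightarrow> bool" where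
  "is_equivalence C D F \<longleftrightarrow> is_functor C D F \<and>
     (\<exists>G s t. is_nat C C id_fctr (comp_fctr G F) s \<and> (\<forall>a\<in>Ob C. is_iso C (s a)) \<and>
        is_nat D D (comp_fctr F G) id_fctr t \<and> (\<forall>b\<in>Ob D. is_iso D (t b)))"

text \<open>
  The category with objects A, arrows a to b the elements f of \<open>H a b\<close>, tagged with their source
  and target; \<open>m a g f\<close> is the composite of g after f, where f has source a.
\<close>

definition mk_cat ::
  "'o set \<Rightarrow> ('o \<Rightarrow> 'o \<Rightarrow> 'f set) \<Rightarrow> ('o \<Rightarrow> 'f) \<Rightarrow> ('o \<Rightarrow> 'f \<Rightarrow> 'f \<Rightarrow> 'f) \<Rightarrow>
   ('o, 'o \<times> 'f \<times> 'o) cat" where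
  "mk_cat A H i m =
     \<lparr>Ob = A,
      Ar = {(a, f, b). a \<in> A \<and> b \<in> A \<and> f \<in> H a b},
      Src = (\<lambda>(a, f, b). a),
      Tgt = (\<lambda>(a, f, b). b),
      Ide = (\<lambda>a. (a, i a, a)),
      Cmp = (\<lambda>(b', g, c) (a, f, b). (a, m a g f, c))\<rparr>"

definition set_cat :: "('x set, 'x set \<times> ('x \<Rightarrow> 'x) \<times> 'x set) cat" where
  "set_cat = mk_cat UNIV (\<lambda>X Y. X \<rightarrow>\<^sub>E Y) (\<lambda>X. \<lambda>x\<in>X. x) compose"

text \<open>The slice of the category of small sets over S.\<close>

type_synonym ('u, 's) over = "'u set \<times> ('u \<Rightarrow> 's)"

definition sets_over ::
  "'u set set \<Rightarrow> 's set \<Rightarrow>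
   (('u, 's) over, ('u, 's) over \<times> ('u \<Rightarrow> 'u) \<times> ('u, 's) over) cat" where
  "sets_over U S = mk_cat
     {(X, p). X \<in> U \<and> p \<in> X \<rightarrow>\<^sub>E S}
     (\<lambda>(X, p) (Y, q). {h \<in> X \<rightarrow>\<^sub>E Y. \<forall>x\<in>X. q (h x) = p x})
     (\<lambda>(X, p). \<lambda>x\<in>X. x)
     (\<lambda>(X, p). compose X)"


section \<open>Colimits and local finite presentability\<close>

definition is_cocone ::
  "('o, 'm) cat \<Rightarrow> ('i, 'j) cat \<Rightarrow> ('i, 'j, 'o, 'm) fctr \<Rightarrow> 'o \<Rightarrow> ('i \<Rightarrow> 'm) \<Rightarrow> bool" where
  "is_cocone C J D c l \<longleftrightarrow> c \<in> Ob C \<and>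
     (\<forall>i\<in>Ob J. l i \<in> arrows C (fob D i) c) \<and>
     (\<forall>u\<in>Ar J. Cmp C (l (Tgt J u)) (far D u) = l (Src J u))"

definition is_colimit ::
  "('o, 'm) cat \<Rightarrow> ('i, 'j) cat \<Rightarrow> ('i, 'j, 'o, 'm) fctr \<Rightarrow> 'o \<Rightarrow> ('i \<Rightarrow> 'm) \<Rightarrow> bool" where
  "is_colimit C J D c l \<longleftrightarrow> is_cocone C J D c l \<and>
     (\<forall>d k. is_cocone C J D d k \<longrightarrow>
        (\<exists>!h. h \<in> arrows C c d \<and> (\<forall>i\<in>Ob J. Cmp C h (l i) = k i)))"

text \<open>Up to isomorphism, every small category has this form.\<close>

definition small_cat :: "'u set set \<Rightarrow> ('u, 'u) cat \<Rightarrow> bool" where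
  "small_cat U J \<longleftrightarrow> is_cat J \<and> Ob J \<in> U \<and> Ar J \<in> U"

definition filtered :: "('i, 'j) cat \<Rightarrow> bool" where
  "filtered J \<longleftrightarrow> Ob J \<noteq> {} \<and>
     (\<forall>a\<in>Ob J. \<forall>b\<in>Ob J. \<exists>c\<in>Ob J. arrows J a c \<noteq> {} \<and> arrows J b c \<noteq> {}) \<and>
     (\<forall>a\<in>Ob J. \<forall>b\<in>Ob J. \<forall>f\<in>arrows J a b. \<forall>g\<in>arrows J a b.
        \<exists>c\<in>Ob J. \<exists>h\<in>arrows J b c. Cmp J h f = Cmp J h g)"

definition preserves_filtered_colimits ::
  "'u set set \<Rightarrow> ('o, 'm) cat \<Rightarrow> ('p, 'n) cat \<Rightarrow> ('o, 'm, 'p, 'n) fctr \<Rightarrow> bool" where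
  "preserves_filtered_colimits U C D F \<longleftrightarrow>
     (\<forall>(J :: ('u, 'u) cat) X c l.
        small_cat U J \<and> filtered J \<and> is_functor J C X \<and> is_colimit C J X c l \<longrightarrow>
        is_colimit D J (comp_fctr F X) (fob F c) (\<lambda>i. far F (l i)))"

definition cocomplete :: "'u set set \<Rightarrow> ('o, 'm) cat \<Rightarrow> bool" where
  "cocomplete U C \<longleftrightarrow>
     (\<forall>(J :: ('u, 'u) cat) X. small_cat U J \<and> is_functor J C X \<longrightarrow> (\<exists>c l. is_colimit C J X c l))"

definition hom_fctr ::
  "('o, 'm) cat \<Rightarrow> 'o \<Rightarrow> ('o, 'm, 'm set, 'm set \<times> ('m \<Rightarrow> 'm) \<times> 'm set) fctr" where
  "hom_fctr C a =
     \<lparr>fob = arrows C a,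
      far = (\<lambda>f. (arrows C a (Src C f), \<lambda>g\<in>arrows C a (Src C f). Cmp C f g, arrows C a (Tgt C f)))\<rparr>"

definition finitely_presentable :: "'u set set \<Rightarrow> ('o, 'm) cat \<Rightarrow> 'o \<Rightarrow> bool" where
  "finitely_presentable U C a \<longleftrightarrow>
     a \<in> Ob C \<and> preserves_filtered_colimits U C set_cat (hom_fctr C a)"

text \<open>
  When U is closed under power sets, this says precisely that all hom-sets are small. For other U
  not even the hom-sets between small sets are members of U, and the condition says that hom-sets
  are no larger than those.
\<close>

definition locally_small :: "'u set set \<Rightarrow> ('o, 'm) cat \<Rightarrow> bool" where
  "locally_small U C \<longleftrightarrow> (\<forall>a\<in>Ob C. \<forall>b\<in>Ob C. \<exists>X\<in>U. arrows C a b \<lesssim> Pow X)"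

definition locally_finitely_presentable :: "'u set set \<Rightarrow> ('o, 'm) cat \<Rightarrow> bool" where
  "locally_finitely_presentable U C \<longleftrightarrow>
     is_cat C \<and> locally_small U C \<and> cocomplete U C \<and>
     (\<exists>P. small U P \<and> (\<forall>a\<in>P. finitely_presentable U C a) \<and>
        (\<forall>c\<in>Ob C. \<exists>(J :: ('u, 'u) cat) X l.
           small_cat U J \<and> filtered J \<and> is_functor J C X \<and>
           (\<forall>i\<in>Ob J. fob X i \<in> P) \<and> is_colimit C J X c l))"


section \<open>Monadicity\<close>

definition adjunction ::
  "('o, 'm) cat \<Rightarrow> ('p, 'n) cat \<Rightarrow> ('p, 'n, 'o, 'm) fctr \<Rightarrow> ('o, 'm, 'p, 'n) fctr \<Rightarrow>
   ('p \<Rightarrow> 'n) \<Rightarrow> ('o \<Rightarrow> 'm) \<Rightarrow> bool" where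
  "adjunction A X F G \<eta> \<epsilon> \<longleftrightarrow>
     is_functor X A F \<and> is_functor A X G \<and>
     is_nat X X id_fctr (comp_fctr G F) \<eta> \<and>
     is_nat A A (comp_fctr F G) id_fctr \<epsilon> \<and>
     (\<forall>a\<in>Ob A. Cmp X (far G (\<epsilon> a)) (\<eta> (fob G a)) = Ide X (fob G a)) \<and>
     (\<forall>x\<in>Ob X. Cmp A (\<epsilon> (fob F x)) (far F (\<eta> x)) = Ide A (fob F x))"

text \<open>The Eilenberg-Moore category of the monad \<open>(T, \<eta>, \<mu>)\<close> on X.\<close>

definition em_cat ::
  "('p, 'n) cat \<Rightarrow> ('p, 'n, 'p, 'n) fctr \<Rightarrow> ('p \<Rightarrow> 'n) \<Rightarrow> ('p \<Rightarrow> 'n) \<Rightarrow>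
   ('p \<times> 'n, ('p \<times> 'n) \<times> 'n \<times> ('p \<times> 'n)) cat" where
  "em_cat X T \<eta> \<mu> = mk_cat
     {(x, a). x \<in> Ob X \<and> a \<in> arrows X (fob T x) x \<and>
        Cmp X a (\<eta> x) = Ide X x \<and> Cmp X a (far T a) = Cmp X a (\<mu> x)}
     (\<lambda>(x, a) (y, b). {h \<in> arrows X x y. Cmp X h a = Cmp X b (far T h)})
     (\<lambda>(x, a). Ide X x)
     (\<lambda>_. Cmp X)"

definition comparison ::
  "('o, 'm) cat \<Rightarrow> ('o, 'm, 'p, 'n) fctr \<Rightarrow> ('o \<Rightarrow> 'm) \<Rightarrow>
   ('o, 'm, 'p \<times> 'n, ('p \<times> 'n) \<times> 'n \<times> ('p \<times> 'n)) fctr" where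
  "comparison A G \<epsilon> =
     (let K = (\<lambda>a. (fob G a, far G (\<epsilon> a)))
      in \<lparr>fob = K, far = (\<lambda>f. (K (Src A f), far G f, K (Tgt A f)))\<rparr>)"

definition finitary_monadic ::
  "'u set set \<Rightarrow> ('o, 'm) cat \<Rightarrow> ('p, 'n) cat \<Rightarrow> ('o, 'm, 'p, 'n) fctr \<Rightarrow> bool" where
  "finitary_monadic U A X G \<longleftrightarrow>
     (\<exists>F \<eta> \<epsilon>. adjunction A X F G \<eta> \<epsilon> \<and>
        is_equivalence A (em_cat X (comp_fctr G F) \<eta> (\<lambda>x. far G (\<epsilon> (fob F x)))) (comparison A G \<epsilon>) \<and>
        preserves_filtered_colimits U X X (comp_fctr G F))"


section \<open>Varieties of many-sorted finitary algebras\<close>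

record ('f, 's) signature =
  symbols :: "'f set"
  arity :: "'f \<Rightarrow> 's list"
  result :: "'f \<Rightarrow> 's"

text \<open>The variables are the pairs (i, s), where s is the sort.\<close>

datatype ('f, 's) trm = Var "nat \<times> 's" | App 'f "('f, 's) trm list"

fun tsort :: "('f, 's) signature \<Rightarrow> ('f, 's) trm \<Rightarrow> 's" where
  "tsort Sg (Var x) = snd x"
| "tsort Sg (App f ts) = result Sg f"

primrec well_sorted :: "'s set \<Rightarrow> ('f, 's) signature \<Rightarrow> ('f, 's) trm \<Rightarrow> bool" where
  "well_sorted S Sg (Var x) \<longleftrightarrow> snd x \<in> S"
| "well_sorted S Sg (App f ts) \<longleftrightarrow>
     f \<in> symbols Sg \<and> list_all (well_sorted S Sg) ts \<and> map (tsort Sg) ts = arity Sg f"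

primrec tvars :: "('f, 's) trm \<Rightarrow> (nat \<times> 's) set" where
  "tvars (Var x) = {x}"
| "tvars (App f ts) = \<Union> (set (map tvars ts))"

primrec teval :: "('f \<Rightarrow> 'u list \<Rightarrow> 'u) \<Rightarrow> (nat \<times> 's \<Rightarrow> 'u) \<Rightarrow> ('f, 's) trm \<Rightarrow> 'u" where
  "teval I v (Var x) = v x"
| "teval I v (App f ts) = I f (map (teval I v) ts)"

record ('f, 's, 'u) alg =
  acarrier :: "'u set"
  asort :: "'u \<Rightarrow> 's"
  aint :: "'f \<Rightarrow> 'u list \<Rightarrow> 'u"

definition aargs :: "('f, 's) signature \<Rightarrow> ('f, 's, 'u) alg \<Rightarrow> 'f \<Rightarrow> 'u list set" where
  "aargs Sg A f = {xs. set xs \<subseteq> acarrier A \<and> map (asort A) xs = arity Sg f}"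

text \<open>
  Only the values of the interpretation on well-sorted arguments are data; the condition on
  the others makes equality of algebras the mathematical one.
\<close>

definition is_alg ::
  "'u set set \<Rightarrow> 's set \<Rightarrow> ('f, 's) signature \<Rightarrow> ('f, 's, 'u) alg \<Rightarrow> bool" where
  "is_alg U S Sg A \<longleftrightarrow>
     acarrier A \<in> U \<and> asort A \<in> acarrier A \<rightarrow>\<^sub>E S \<and>
     (\<forall>f xs. if f \<in> symbols Sg \<and> xs \<in> aargs Sg A f
             then aint A f xs \<in> acarrier A \<and> asort A (aint A f xs) = result Sg f
             else aint A f xs = undefined)"

text \<open>
  Only the variables that occur in the equation are assigned values: other sorts may be empty.
\<close>

definition satisfies :: "('f, 's, 'u) alg \<Rightarrow> ('f, 's) trm \<times> ('f, 's) trm \<Rightarrow> bool" where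
  "satisfies A = (\<lambda>(t, t').
     \<forall>v. (\<forall>x\<in>tvars t \<union> tvars t'. v x \<in> acarrier A \<and> asort A (v x) = snd x) \<longrightarrow>
        teval (aint A) v t = teval (aint A) v t')"

definition alg_cat ::
  "'u set set \<Rightarrow> 's set \<Rightarrow> ('f, 's) signature \<Rightarrow> (('f, 's) trm \<times> ('f, 's) trm) set \<Rightarrow>
   (('f, 's, 'u) alg, ('f, 's, 'u) alg \<times> ('u \<Rightarrow> 'u) \<times> ('f, 's, 'u) alg) cat" where
  "alg_cat U S Sg E = mk_cat
     {A. is_alg U S Sg A \<and> (\<forall>e\<in>E. satisfies A e)}
     (\<lambda>A B. {h \<in> acarrier A \<rightarrow>\<^sub>E acarrier B.
        (\<forall>x\<in>acarrier A. asort B (h x) = asort A x) \<and>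
        (\<forall>f\<in>symbols Sg. \<forall>xs\<in>aargs Sg A f. h (aint A f xs) = aint B f (map h xs))})
     (\<lambda>A. \<lambda>x\<in>acarrier A. x)
     (\<lambda>A. compose (acarrier A))"

definition alg_forget ::
  "(('f, 's, 'u) alg, ('f, 's, 'u) alg \<times> ('u \<Rightarrow> 'u) \<times> ('f, 's, 'u) alg,
    ('u, 's) over, ('u, 's) over \<times> ('u \<Rightarrow> 'u) \<times> ('u, 's) over) fctr" where
  "alg_forget =
     (let V = (\<lambda>A. (acarrier A, asort A))
      in \<lparr>fob = V, far = (\<lambda>(A, h, B). (V A, h, V B))\<rparr>)"

definition variety ::
  "'u set set \<Rightarrow> 's set \<Rightarrow> ('o, 'm) cat \<Rightarrow>
   ('o, 'm, ('u, 's) over, ('u, 's) over \<times> ('u \<Rightarrow> 'u) \<times> ('u, 's) over) fctr \<Rightarrow> bool" where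
  "variety U S C G \<longleftrightarrow> is_functor C (sets_over U S) G \<and>
     (\<exists>(Sg :: ('u, 's) signature) E \<Phi>.
        symbols Sg \<in> U \<and>
        (\<forall>f\<in>symbols Sg. set (arity Sg f) \<subseteq> S \<and> result Sg f \<in> S) \<and>
        (\<forall>(t, t')\<in>E. well_sorted S Sg t \<and> well_sorted S Sg t' \<and> tsort Sg t = tsort Sg t') \<and>
        is_isomorphism C (alg_cat U S Sg E) \<Phi> \<and>
        (\<forall>a\<in>Ob C. fob alg_forget (fob \<Phi> a) = fob G a) \<and>
        (\<forall>f\<in>Ar C. far alg_forget (far \<Phi> f) = far G f))"


section \<open>Operads\<close>

text \<open>
  The sets of an operad need not be disjoint, so the composition
  \<open>O(n) \<times> O(k\<^sub>1) \<times> \<dots> \<times> O(k\<^sub>n) \<rightarrow> O(k\<^sub>1 + \<dots> + k\<^sub>n)\<close> takes the list of the \<open>k\<^sub>i\<close>, of length n, as an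
  argument.
\<close>

record 'a operad =
  op_set :: "nat \<Rightarrow> 'a set"
  op_id :: 'a
  op_mu :: "nat list \<Rightarrow> 'a \<Rightarrow> 'a list \<Rightarrow> 'a"

abbreviation op_list :: "('a, 'z) operad_scheme \<Rightarrow> nat list \<Rightarrow> 'a list \<Rightarrow> bool" where
  "op_list P ks fs \<equiv> list_all2 (\<lambda>k f. f \<in> op_set P k) ks fs"

definition is_operad :: "('a, 'z) operad_scheme \<Rightarrow> bool" where
  "is_operad P \<longleftrightarrow>
     op_id P \<in> op_set P 1 \<and>
     (\<forall>ks. \<forall>g\<in>op_set P (length ks). \<forall>fs. op_list P ks fs \<longrightarrow>
        op_mu P ks g fs \<in> op_set P (sum_list ks)) \<and>
     (\<forall>n. \<forall>g\<in>op_set P n.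
        op_mu P [n] (op_id P) [g] = g \<and>
        op_mu P (replicate n 1) g (replicate n (op_id P)) = g) \<and>
     (\<forall>jss. \<forall>g\<in>op_set P (length jss). \<forall>fs hss.
        op_list P (map length jss) fs \<and> list_all2 (op_list P) jss hss \<longrightarrow>
        op_mu P (concat jss) (op_mu P (map length jss) g fs) (concat hss) =
        op_mu P (map sum_list jss) g
          (map (\<lambda>i. op_mu P (jss ! i) (fs ! i) (hss ! i)) [0..<length jss]))"

definition is_operad_map ::
  "('a, 'y) operad_scheme \<Rightarrow> ('b, 'z) operad_scheme \<Rightarrow> (nat \<Rightarrow> 'a \<Rightarrow> 'b) \<Rightarrow> bool" where
  "is_operad_map P Q f \<longleftrightarrow>
     (\<forall>n. f n \<in> op_set P n \<rightarrow> op_set Q n) \<and>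
     f 1 (op_id P) = op_id Q \<and>
     (\<forall>ks. \<forall>g\<in>op_set P (length ks). \<forall>fs. op_list P ks fs \<longrightarrow>
        f (sum_list ks) (op_mu P ks g fs) = op_mu Q ks (f (length ks) g) (map2 f ks fs))"

text \<open>
  The number m in \<open>{1..k\<^sub>1 + \<dots> + k\<^sub>n}\<close> is \<open>k\<^sub>1 + \<dots> + k\<^sub>i\<^sub>-\<^sub>1 + a\<close> with \<open>1 \<le> a \<le> k\<^sub>i\<close> for
  \<open>i = block ks m\<close> and \<open>a = offset ks m\<close>. As lists are indexed from 0, \<open>k\<^sub>i\<close> is \<open>ks ! (i - 1)\<close>.
\<close>

definition block :: "nat list \<Rightarrow> nat \<Rightarrow> nat" where
  "block ks m = (LEAST i. m \<le> sum_list (take i ks))"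

definition offset :: "nat list \<Rightarrow> nat \<Rightarrow> nat" where
  "offset ks m = m - sum_list (take (block ks m - 1) ks)"

definition block_sum :: "nat list \<Rightarrow> (nat \<Rightarrow> nat) list \<Rightarrow> nat \<Rightarrow> nat" where
  "block_sum ks \<tau>s m =
     (if m \<in> {1..sum_list ks}
      then sum_list (take (block ks m - 1) ks) + (\<tau>s ! (block ks m - 1)) (offset ks m)
      else m)"

definition block_perm :: "nat list \<Rightarrow> (nat \<Rightarrow> nat) \<Rightarrow> nat \<Rightarrow> nat" where
  "block_perm ks \<sigma> m =
     (if m \<in> {1..sum_list ks}
      then (\<Sum>i' | i' \<in> {1..length ks} \<and> \<sigma> i' < \<sigma> (block ks m). ks ! (i' - 1)) + offset ks m
      else m)"

definition sym_operad :: "(nat \<Rightarrow> nat) operad" where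
  "sym_operad =
     \<lparr>op_set = (\<lambda>n. carrier (sym_group n)),
      op_id = id,
      op_mu = (\<lambda>ks \<sigma> \<tau>s. block_perm ks \<sigma> \<circ> block_sum ks \<tau>s)\<rparr>"


section \<open>Action operads\<close>

record 'a action_operad = "'a operad" +
  op_mult :: "nat \<Rightarrow> 'a \<Rightarrow> 'a \<Rightarrow> 'a"
  op_one :: "nat \<Rightarrow> 'a"
  op_pi :: "nat \<Rightarrow> 'a \<Rightarrow> (nat \<Rightarrow> nat)"

definition op_group :: "'a action_operad \<Rightarrow> nat \<Rightarrow> 'a monoid" where
  "op_group L n = \<lparr>carrier = op_set L n, mult = op_mult L n, one = op_one L n\<rparr>"

definition is_action_operad :: "'a action_operad \<Rightarrow> bool" where
  "is_action_operad L \<longleftrightarrow>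
     is_operad L \<and>
     (\<forall>n. group (op_group L n)) \<and>
     is_operad_map L sym_operad (op_pi L) \<and>
     (\<forall>n. op_pi L n \<in> hom (op_group L n) (sym_group n)) \<and>
     (\<forall>ks. \<forall>g\<in>op_set L (length ks). \<forall>g'\<in>op_set L (length ks). \<forall>fs fs'.
        let n = length ks;
            \<sigma> = op_pi L n g;
            ks' = map (\<lambda>i. ks ! (inv' \<sigma> i - 1)) [1..<Suc n]
        in op_list L ks fs \<and> op_list L ks' fs' \<longrightarrow>
           op_mult L (sum_list ks) (op_mu L ks' g' fs') (op_mu L ks g fs) =
           op_mu L ks (op_mult L n g' g)
             (map (\<lambda>i. op_mult L (ks ! (i - 1)) (fs' ! (\<sigma> i - 1)) (fs ! (i - 1))) [1..<Suc n]))"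

definition is_action_operad_map ::
  "'a action_operad \<Rightarrow> 'b action_operad \<Rightarrow> (nat \<Rightarrow> 'a \<Rightarrow> 'b) \<Rightarrow> bool" where
  "is_action_operad_map L M f \<longleftrightarrow>
     is_operad_map L M f \<and>
     (\<forall>n. \<forall>x\<in>op_set L n. op_pi M n (f n x) = op_pi L n x) \<and>
     (\<forall>n. f n \<in> hom (op_group L n) (op_group M n))"

text \<open>
  HOL functions are total. With their values outside the intended domains fixed, two action operads
  are equal if and only if they have the same sets and the same structure on them.
\<close>

definition op_extensional :: "'a action_operad \<Rightarrow> bool" where
  "op_extensional L \<longleftrightarrow>
     (\<forall>ks g fs. \<not> (g \<in> op_set L (length ks) \<and> op_list L ks fs) \<longrightarrow> op_mu L ks g fs = undefined) \<and>
     (\<forall>n x y. \<not> (x \<in> op_set L n \<and> y \<in> op_set L n) \<longrightarrow> op_mult L n x y = undefined) \<and>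
     (\<forall>n. op_pi L n \<in> extensional (op_set L n))"

text \<open>
  The sets of an object of AOp are taken to be pairwise disjoint, as is usual for the hom-sets of a
  category, and their coproduct is then their union. Each action operad is isomorphic to one of this
  form. Without a convention of this kind the coproduct, and with it the isomorphism of categories
  in the definition of a variety, would be determined only up to isomorphism.
\<close>

definition AOp ::
  "'u set set \<Rightarrow>
   ('u action_operad, 'u action_operad \<times> (nat \<Rightarrow> 'u \<Rightarrow> 'u) \<times> 'u action_operad) cat" where
  "AOp U = mk_cat
     {L. is_action_operad L \<and> op_extensional L \<and>
         (\<forall>n. op_set L n \<in> U) \<and> (\<forall>m n. m \<noteq> n \<longrightarrow> op_set L m \<inter> op_set L n = {})}
     (\<lambda>L M. {f. is_action_operad_map L M f \<and> (\<forall>n. f n \<in> extensional (op_set L n))})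
     (\<lambda>L n. \<lambda>x\<in>op_set L n. x)
     (\<lambda>L g f n. compose (op_set L n) (g n) (f n))"

definition all_perms :: "(nat \<times> (nat \<Rightarrow> nat)) set" where
  "all_perms = (SIGMA n:UNIV. carrier (sym_group n))"

definition op_total :: "'a action_operad \<Rightarrow> 'a set" where
  "op_total L = (\<Union>n. op_set L n)"

definition op_degree :: "'a action_operad \<Rightarrow> 'a \<Rightarrow> nat" where
  "op_degree L x = (THE n. x \<in> op_set L n)"

definition AOp_forget ::
  "('u action_operad, 'u action_operad \<times> (nat \<Rightarrow> 'u \<Rightarrow> 'u) \<times> 'u action_operad,
    ('u, nat \<times> (nat \<Rightarrow> nat)) over,
    ('u, nat \<times> (nat \<Rightarrow> nat)) over \<times> ('u \<Rightarrow> 'u) \<times> ('u, nat \<times> (nat \<Rightarrow> nat)) over) fctr" where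
  "AOp_forget =
     (let V = (\<lambda>L. (op_total L, \<lambda>x\<in>op_total L. (op_degree L x, op_pi L (op_degree L x) x)))
      in \<lparr>fob = V, far = (\<lambda>(L, f, M). (V L, \<lambda>x\<in>op_total L. f (op_degree L x) x, V M))\<rparr>)"

end

theory Submission
  imports Defs
begin

text \<open>
  An action operad is an algebra whose sorts are the pairs of an arity n and a permutation of n
  letters: the sort of an element records its image in the symmetric group, so that all operations
  become total operations between sorts and all axioms become equations. Such an equation has a sort
  because the corresponding law holds in the operad of symmetric groups.

  For varieties with a small set of operation symbols, everything is derived from presentations by
  generators and relators. Free algebras and colimits are presented algebras; filtered colimits are
  computed on underlying sets because the operations are finitary, so finitely presented algebras are
  finitely presentable, and each algebra is the directed colimit of the algebras presented by finitely
  many of its elements and finitely many relations between them.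
\<close>

section \<open>Small sets\<close>

text \<open>The equations of the variety are not listed. \<open>valid_eqs\<close> takes every
  equation that holds in all algebras coming from action operads, so that these are models is
  immediate, and the work lies in the converse: a model satisfies each law of an action operad. For
  this an instance of a law is turned into a pair of terms by renaming the elements involved as
  variables. Inversion is one of the operations, since the existence of inverses is not an equation.

  Two constraints of typing shape the rest. Algebras, operation symbols and index categories must
  live in the one type of the universe, so quotients, symbols and arrows of index categories are
  coded there by injections, which exist for reasons of cardinality. And finite presentability
  refers to colimits in a category of sets whose element type is the arrow type of the given
  category; it is therefore handled in an elementwise form that passes along isomorphisms between
  categories of different types.\<close>

lemma universe_subset: "universe U \<Longrightarrow> X \<in> U \<Longrightarrow> Y \<subseteq> X \<Longrightarrow> Y \<in> U"
  unfolding universe_def by blast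

lemma universe_UN: "universe U \<Longrightarrow> X \<in> U \<Longrightarrow> (\<And>x. x \<in> X \<Longrightarrow> F x \<in> U) \<Longrightarrow> (\<Union>x\<in>X. F x) \<in> U"
  unfolding universe_def by blast

text \<open>An injection into a member has its image in \<open>U\<close> as well, by closure under
  subsets. This form yields an actual copy of the set inside the type of the universe.\<close>

lemma small_iff: "universe U \<Longrightarrow> small U A \<longleftrightarrow> (\<exists>f. inj_on f A \<and> f ` A \<in> U)"
  unfolding small_def lepoll_def by (meson order_refl universe_subset)

lemma small_subset: "small U A \<Longrightarrow> B \<subseteq> A \<Longrightarrow> small U B"
  unfolding small_def by (meson lepoll_trans subset_imp_lepoll)

lemma small_image: "small U A \<Longrightarrow> small U (f ` A)"
  unfolding small_def by (meson image_lepoll lepoll_trans)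

lemma small_member: "X \<in> U \<Longrightarrow> small U X"
  unfolding small_def by blast

text \<open>Some member of \<open>U\<close> is infinite, and every countable set embeds into it. The
  sorts and the operation symbols of action operads are small for this reason.\<close>

lemma small_countable: "universe U \<Longrightarrow> countable A \<Longrightarrow> small U A"
proof -
  assume U: "universe U" and A: "countable A"
  obtain I where I: "I \<in> U" "infinite I" using U unfolding universe_def by blast
  have "A \<lesssim> (UNIV :: nat set)" using A unfolding countable_def lepoll_def by blast
  also have "\<dots> \<lesssim> I" using I(2) by (simp add: infinite_le_lepoll)
  finally show ?thesis using I(1) unfolding small_def by blast
qed

text \<open>Closure under unions is given for index sets that are members of \<open>U\<close>; an
  index set of another type is first replaced by its image under a coding injection.\<close>

lemma small_UN_aux:
  assumes "universe U" "small U A" "\<And>a. a \<in> A \<Longrightarrow> F a \<in> U"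
  shows "(\<Union>a\<in>A. F a) \<in> U"
proof -
  obtain f where f: "inj_on f A" "f ` A \<in> U" using assms small_iff by blast
  have "(\<Union>a\<in>A. F a) = (\<Union>x\<in>f ` A. F (inv_into A f x))" using f by auto
  also have "\<dots> \<in> U" using assms f by (intro universe_UN) auto
  finally show ?thesis .
qed

text \<open>The type of the universe carries no pairing, so no product is formed there. Both factors
  embed into an infinite member Z, and Z x Z is equipollent to Z.\<close>

lemma small_Times:
  assumes U: "universe U" and "small U A" "small U B"
  shows "small U (A \<times> B)"
proof -
  obtain I where I: "I \<in> U" "infinite I" using U unfolding universe_def by blast
  obtain X Y where XY: "X \<in> U" "A \<lesssim> X" "Y \<in> U" "B \<lesssim> Y" using assms unfolding small_def by blast
  \<comment> \<open>The union of three members, written with a small index set because the closure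
    property of \<open>universe\<close> speaks of indexed unions.\<close>
  define Z where "Z = (\<Union>i\<in>{0,1,2::nat}. if i = 0 then I else if i = 1 then X else Y)"
  have ZU: "Z \<in> U" unfolding Z_def
    by (rule small_UN_aux[OF U small_countable[OF U]]) (use XY I in auto)
  have sub: "I \<subseteq> Z" "X \<subseteq> Z" "Y \<subseteq> Z" by (auto simp: Z_def)
  have "infinite Z" using sub I infinite_super by blast
  then have "Z \<times> Z \<approx> Z" unfolding eqpoll_def card_of_ordIso by (rule card_of_Times_same_infinite)
  moreover have "A \<lesssim> Z" "B \<lesssim> Z"
    using XY(2,4) sub(2,3) by (blast intro: lepoll_trans subset_imp_lepoll)+
  then have "A \<times> B \<lesssim> Z \<times> Z"
    by (rule times_lepoll_mono)
  ultimately show ?thesis using ZU unfolding small_def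
    by (blast intro: eqpoll_imp_lepoll lepoll_trans)
qed

text \<open>The sets \<open>F a\<close> may have any element type. With a coding \<open>f a\<close>
  for each of them the union is covered by an image of A x Y: the pair (a, y) names the element of
  \<open>F a\<close> with code y.\<close>

lemma small_UN:
  assumes U: "universe U" and A: "small U A" and F: "\<And>a. a \<in> A \<Longrightarrow> small U (F a)"
  shows "small U (\<Union>a\<in>A. F a)"
proof -
  have "\<forall>a\<in>A. \<exists>f. inj_on f (F a) \<and> f ` F a \<in> U" using F small_iff[OF U] by blast
  then obtain f where f: "\<And>a. a \<in> A \<Longrightarrow> inj_on (f a) (F a)" "\<And>a. a \<in> A \<Longrightarrow> f a ` F a \<in> U" by metis
  define Y where "Y = (\<Union>a\<in>A. f a ` F a)"
  have "Y \<in> U" unfolding Y_def by (rule small_UN_aux) (use assms f in auto)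
  then have "small U (A \<times> Y)" using A U by (simp add: small_Times small_member)
  moreover have "(\<Union>a\<in>A. F a) \<subseteq> (\<lambda>(a, y). inv_into (F a) (f a) y) ` (A \<times> Y)"
    unfolding Y_def using f(1) by (force simp: image_iff inv_into_f_f)
  ultimately show ?thesis by (blast intro: small_subset small_image)
qed

lemma small_Sigma:
  assumes "universe U" "small U A" "\<And>a. a \<in> A \<Longrightarrow> small U (F a)"
  shows "small U (Sigma A F)"
proof -
  have "Sigma A F = (\<Union>a\<in>A. Pair a ` F a)" by auto
  then show ?thesis using assms by (simp add: small_UN small_image)
qed

lemma small_lists:
  assumes U: "universe U" and A: "small U A"
  shows "small U {xs. set xs \<subseteq> A}"
proof -
  have "small U {xs. set xs \<subseteq> A \<and> length xs = n}" for n
  proof (induction n)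
    case 0
    then show ?case using small_countable[OF U, of "{[]}"] by (auto elim: small_subset)
  next
    case (Suc n)
    have "{xs. set xs \<subseteq> A \<and> length xs = Suc n} \<subseteq> (\<lambda>(x, xs). x # xs) ` (A \<times> {xs. set xs \<subseteq> A \<and> length xs = n})"
      by (auto simp: image_iff length_Suc_conv)
    then show ?case using small_image[OF small_Times[OF U A Suc]] by (rule small_subset[rotated])
  qed
  then have "small U (\<Union>n. {xs. set xs \<subseteq> A \<and> length xs = n})"
    by (intro small_UN[OF U small_countable[OF U]]) simp_all
  then show ?thesis by (rule small_subset) auto
qed

lemma small_finite_subsets:
  assumes "universe U" "small U A"
  shows "small U {F. finite F \<and> F \<subseteq> A}"
proof -
  have "{F. finite F \<and> F \<subseteq> A} \<subseteq> set ` {xs. set xs \<subseteq> A}"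
    using finite_list by (fastforce simp: image_iff)
  then show ?thesis using small_image[OF small_lists[OF assms]] by (rule small_subset[rotated])
qed

text \<open>Terms of bounded height form small sets by induction on the bound, and there are
  countably many bounds.\<close>

lemma small_terms:
  fixes F :: "'f set" and G :: "(nat \<times> 's) set"
  assumes U: "universe U" and F: "small U F" and G: "small U G"
  shows "small U {t :: ('f, 's) trm. set1_trm t \<subseteq> F \<and> tvars t \<subseteq> G}"
proof -
  \<comment> \<open>\<open>T n\<close> holds the terms of height at most n, variables and constants
    having height 1.\<close>
  define T where "T = rec_nat ({} :: ('f, 's) trm set)
    (\<lambda>_ X. Var ` G \<union> (\<lambda>(f, ts). App f ts) ` (F \<times> {ts. set ts \<subseteq> X}))"
  have T0: "T 0 = {}" by (simp add: T_def)
  have TS: "T (Suc n) = Var ` G \<union> (\<lambda>(f, ts). App f ts) ` (F \<times> {ts. set ts \<subseteq> T n})" for n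
    by (simp add: T_def)
  have Un: "small U (A \<union> B)" if "small U A" "small U B" for A B :: "('f, 's) trm set"
    using small_UN[OF U small_countable[OF U, of "{A, B}"], of id] that by auto
  have sm: "small U (T n)" for n
  proof (induction n)
    case 0 then show ?case by (simp add: T0 small_countable[OF U])
  next
    case (Suc n)
    show ?case unfolding TS
      using small_image[OF small_Times[OF U F small_lists[OF U Suc.IH]]] Un[OF small_image[OF G]] by blast
  qed
  have mono: "T n \<subseteq> T (Suc n)" for n
  proof (induction n)
    case (Suc n)
    have "X \<subseteq> Y \<Longrightarrow> F \<times> {ts. set ts \<subseteq> X} \<subseteq> F \<times> {ts. set ts \<subseteq> Y}" for X Y :: "('f, 's) trm set"
      by auto
    then show ?case using Suc TS[of n] TS[of "Suc n"] by (metis Un_mono image_mono order_refl)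
  qed (simp add: T0)
  then have mono': "m \<le> n \<Longrightarrow> T m \<subseteq> T n" for m n by (rule lift_Suc_mono_le)
  have "set1_trm t \<subseteq> F \<Longrightarrow> tvars t \<subseteq> G \<Longrightarrow> \<exists>n. t \<in> T n" for t
  proof (induction t)
    case (Var x)
    then have "Var x \<in> T (Suc 0)" by (auto simp: TS)
    then show ?case by blast
  next
    case (App f ts)
    then have "\<forall>t\<in>set ts. \<exists>n. t \<in> T n" by (auto simp: UN_subset_iff)
    then obtain n where n: "\<And>t. t \<in> set ts \<Longrightarrow> t \<in> T (n t)" by metis
    \<comment> \<open>For empty \<open>ts\<close> the value of \<open>Max\<close> is unspecified,
      but then the inclusion is vacuous.\<close>
    have "set ts \<subseteq> T (Max (n ` set ts))"
    proof
      fix t assume t: "t \<in> set ts"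
      then have "n t \<le> Max (n ` set ts)" by simp
      then show "t \<in> T (Max (n ` set ts))" using n[OF t] mono' by blast
    qed
    then have "App f ts \<in> T (Suc (Max (n ` set ts)))" using App.prems by (auto simp: TS)
    then show ?case by blast
  qed
  then have sub: "{t. set1_trm t \<subseteq> F \<and> tvars t \<subseteq> G} \<subseteq> (\<Union>n. T n)" by auto
  have "small U (\<Union>n. T n)" using small_UN[OF U small_countable[OF U], of UNIV T] sm by simp
  then show ?thesis using sub by (rule small_subset)
qed

text \<open>Quotients of small sets are realised inside the type underlying the universe.\<close>

lemma small_quotient_code:
  assumes U: "universe U" and T: "small U T" and r: "\<And>x. x \<in> T \<Longrightarrow> r x x"
    and s: "\<And>x y. x \<in> T \<Longrightarrow> y \<in> T \<Longrightarrow> r x y \<Longrightarrow> r y x"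
    and t: "\<And>x y z. x \<in> T \<Longrightarrow> y \<in> T \<Longrightarrow> z \<in> T \<Longrightarrow> r x y \<Longrightarrow> r y z \<Longrightarrow> r x z"
  obtains e :: "'t \<Rightarrow> 'u" where "e ` T \<in> U" "\<And>x y. x \<in> T \<Longrightarrow> y \<in> T \<Longrightarrow> e x = e y \<longleftrightarrow> r x y"
proof -
  \<comment> \<open>The quotient is the set of the classes \<open>c x\<close>, an image of T and
    therefore small; an injection of the classes into the universe gives the code.\<close>
  define c where "c x = {y \<in> T. r x y}" for x
  have cc: "c x = c y \<longleftrightarrow> r x y" if "x \<in> T" "y \<in> T" for x y
    using that r s t unfolding c_def by blast
  have "small U (c ` T)" using T by (rule small_image)
  then obtain g where g: "inj_on g (c ` T)" "g ` c ` T \<in> U" using small_iff[OF U] by blast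
  show thesis
  proof (rule that[of "g \<circ> c"])
    show "(g \<circ> c) ` T \<in> U" using g by (simp add: image_comp)
    show "(g \<circ> c) x = (g \<circ> c) y \<longleftrightarrow> r x y" if "x \<in> T" "y \<in> T" for x y
      using that g(1) cc[OF that] by (simp add: inj_on_eq_iff)
  qed
qed

section \<open>Categories\<close>

lemma mk_cat_simps [simp]:
  "Ob (mk_cat A H i m) = A"
  "(a, f, b) \<in> Ar (mk_cat A H i m) \<longleftrightarrow> a \<in> A \<and> b \<in> A \<and> f \<in> H a b"
  "Src (mk_cat A H i m) (a, f, b) = a"
  "Tgt (mk_cat A H i m) (a, f, b) = b"
  "Ide (mk_cat A H i m) a = (a, i a, a)"
  "Cmp (mk_cat A H i m) (b', g, c) (a, f, b) = (a, m a g f, c)"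
  by (simp_all add: mk_cat_def)

lemma arrows_mk_cat:
  "x \<in> arrows (mk_cat A H i m) a b \<longleftrightarrow> (\<exists>f. x = (a, f, b) \<and> a \<in> A \<and> b \<in> A \<and> f \<in> H a b)"
  by (cases x) (auto simp: arrows_def)

lemma is_cat_mk_cat:
  assumes "\<And>a. a \<in> A \<Longrightarrow> i a \<in> H a a"
    and "\<And>a b c f g. a \<in> A \<Longrightarrow> b \<in> A \<Longrightarrow> c \<in> A \<Longrightarrow> f \<in> H a b \<Longrightarrow> g \<in> H b c \<Longrightarrow> m a g f \<in> H a c"
    and "\<And>a b f. a \<in> A \<Longrightarrow> b \<in> A \<Longrightarrow> f \<in> H a b \<Longrightarrow> m a f (i a) = f"
    and "\<And>a b f. a \<in> A \<Longrightarrow> b \<in> A \<Longrightarrow> f \<in> H a b \<Longrightarrow> m a (i b) f = f"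
    and "\<And>a b c d f g h. a \<in> A \<Longrightarrow> b \<in> A \<Longrightarrow> c \<in> A \<Longrightarrow> d \<in> A \<Longrightarrow> f \<in> H a b \<Longrightarrow> g \<in> H b c \<Longrightarrow>
      h \<in> H c d \<Longrightarrow> m a h (m a g f) = m a (m b h g) f"
  shows "is_cat (mk_cat A H i m)"
proof -
  have [simp]: "x \<in> Ar (mk_cat A H i m) \<longleftrightarrow> (\<exists>a f b. x = (a, f, b) \<and> a \<in> A \<and> b \<in> A \<and> f \<in> H a b)" for x
    by (cases x) simp
  show ?thesis unfolding is_cat_def by (auto simp: arrows_mk_cat assms)
qed

lemma arrowsD:
  assumes "is_cat C" "f \<in> arrows C a b"
  shows "a \<in> Ob C" "b \<in> Ob C" "f \<in> Ar C" "Src C f = a" "Tgt C f = b"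
  using assms unfolding is_cat_def arrows_def by auto

lemma arrow_Ar: "is_cat C \<Longrightarrow> f \<in> Ar C \<Longrightarrow> f \<in> arrows C (Src C f) (Tgt C f)"
  unfolding arrows_def by simp

lemma Cmp_arrow: "is_cat C \<Longrightarrow> g \<in> arrows C b c \<Longrightarrow> f \<in> arrows C a b \<Longrightarrow> Cmp C g f \<in> arrows C a c"
  unfolding is_cat_def arrows_def by auto

lemma Ide_arrow: "is_cat C \<Longrightarrow> a \<in> Ob C \<Longrightarrow> Ide C a \<in> arrows C a a"
  unfolding is_cat_def by auto

lemma Cmp_Ide:
  assumes "is_cat C" "f \<in> arrows C a b"
  shows "Cmp C f (Ide C a) = f" "Cmp C (Ide C b) f = f"
  using assms unfolding is_cat_def arrows_def by auto

lemma Cmp_assoc: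
  "is_cat C \<Longrightarrow> h \<in> arrows C c d \<Longrightarrow> g \<in> arrows C b c \<Longrightarrow> f \<in> arrows C a b \<Longrightarrow>
     Cmp C h (Cmp C g f) = Cmp C (Cmp C h g) f"
  unfolding is_cat_def arrows_def by auto

lemma functor_cats: "is_functor C D F \<Longrightarrow> is_cat C" "is_functor C D F \<Longrightarrow> is_cat D"
  unfolding is_functor_def by auto

lemma functor_ob: "is_functor C D F \<Longrightarrow> a \<in> Ob C \<Longrightarrow> fob F a \<in> Ob D"
  unfolding is_functor_def by auto

lemma functor_arrow: "is_functor C D F \<Longrightarrow> f \<in> arrows C a b \<Longrightarrow> far F f \<in> arrows D (fob F a) (fob F b)"
  unfolding is_functor_def arrows_def by auto

lemma functor_Ide: "is_functor C D F \<Longrightarrow> a \<in> Ob C \<Longrightarrow> far F (Ide C a) = Ide D (fob F a)"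
  unfolding is_functor_def by auto

lemma functor_Cmp:
  "is_functor C D F \<Longrightarrow> g \<in> arrows C b c \<Longrightarrow> f \<in> arrows C a b \<Longrightarrow>
    far F (Cmp C g f) = Cmp D (far F g) (far F f)"
  unfolding is_functor_def arrows_def by auto

lemma is_functorI:
  assumes "is_cat C" "is_cat D" "\<And>a. a \<in> Ob C \<Longrightarrow> fob F a \<in> Ob D"
    and "\<And>a b f. f \<in> arrows C a b \<Longrightarrow> far F f \<in> arrows D (fob F a) (fob F b)"
    and "\<And>a. a \<in> Ob C \<Longrightarrow> far F (Ide C a) = Ide D (fob F a)"
    and "\<And>a b c f g. f \<in> arrows C a b \<Longrightarrow> g \<in> arrows C b c \<Longrightarrow>
      far F (Cmp C g f) = Cmp D (far F g) (far F f)"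
  shows "is_functor C D F"
  unfolding is_functor_def
proof (intro conjI ballI impI)
  fix f g assume "f \<in> Ar C" "g \<in> Ar C" "Src C g = Tgt C f"
  then show "far F (Cmp C g f) = Cmp D (far F g) (far F f)"
    using assms(6)[of f "Src C f" "Tgt C f" g "Tgt C g"] by (simp add: arrows_def)
qed (use assms in \<open>auto simp: arrows_def\<close>)

lemma comp_fctr_simps [simp]:
  "fob (comp_fctr G F) a = fob G (fob F a)" "far (comp_fctr G F) f = far G (far F f)"
  "fob id_fctr a = a" "far id_fctr f = f"
  by (simp_all add: comp_fctr_def id_fctr_def)

lemma functor_comp: "is_functor C D F \<Longrightarrow> is_functor D E G \<Longrightarrow> is_functor C E (comp_fctr G F)"
  by (rule is_functorI)
    (auto simp: functor_cats functor_ob functor_Ide functor_Cmp[of C D F]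
      functor_Cmp[OF _ functor_arrow[of C D F] functor_arrow[of C D F]] intro!: functor_arrow)

lemma functor_id: "is_cat C \<Longrightarrow> is_functor C C id_fctr"
  by (rule is_functorI) auto

text \<open>Functors have arbitrary values off objects and arrows, so they are compared on these
  only; a composite of a functor with its inverse equals the identity in this sense.\<close>

lemma functor_cong:
  assumes "is_functor C D F" "\<And>a. a \<in> Ob C \<Longrightarrow> fob F a = fob F' a"
    and "\<And>f. f \<in> Ar C \<Longrightarrow> far F f = far F' f"
  shows "is_functor C D F'"
proof (rule is_functorI)
  note [simp] = functor_cats[OF assms(1)]
  show "is_cat C" "is_cat D" by simp_all
  show "fob F' a \<in> Ob D" if "a \<in> Ob C" for a
    using that assms functor_ob by metis
  show "far F' f \<in> arrows D (fob F' a) (fob F' b)" if "f \<in> arrows C a b" for a b f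
    using functor_arrow[OF assms(1) that] arrowsD[OF _ that] assms(2,3) by simp
  show "far F' (Ide C a) = Ide D (fob F' a)" if "a \<in> Ob C" for a
    using functor_Ide[OF assms(1) that] assms(2,3) that arrowsD(3)[OF _ Ide_arrow] by (metis functor_cats(1) assms(1))
  show "far F' (Cmp C g f) = Cmp D (far F' g) (far F' f)" if "f \<in> arrows C a b" "g \<in> arrows C b c" for a b c f g
    using functor_Cmp[OF assms(1) that(2,1)] that arrowsD(3)[OF _ Cmp_arrow[OF _ that(2,1)]]
      arrowsD(3)[OF _ that(1)] arrowsD(3)[OF _ that(2)] assms(3) by simp
qed

lemma nat_cong:
  assumes "is_nat C D F G t" "\<And>a. a \<in> Ob C \<Longrightarrow> fob F a = fob F' a" "\<And>f. f \<in> Ar C \<Longrightarrow> far F f = far F' f"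
    and "\<And>a. a \<in> Ob C \<Longrightarrow> fob G a = fob G' a" "\<And>f. f \<in> Ar C \<Longrightarrow> far G f = far G' f"
  shows "is_nat C D F' G' t"
  using assms functor_cong[of C D F F'] functor_cong[of C D G G'] unfolding is_nat_def by simp

text \<open>Only functoriality of the inverse needs an argument: identities and composites are
  compared after applying F, which is injective.\<close>

lemma bijective_functor_isomorphism:
  assumes F: "is_functor C D F" and ob: "bij_betw (fob F) (Ob C) (Ob D)" and ar: "bij_betw (far F) (Ar C) (Ar D)"
  shows "is_isomorphism C D F"
proof -
  note cats = functor_cats[OF F]
  define G where "G = \<lparr>fob = inv_into (Ob C) (fob F), far = inv_into (Ar C) (far F)\<rparr>"
  have Gob: "fob G b \<in> Ob C" "fob F (fob G b) = b" if "b \<in> Ob D" for b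
    using ob that by (auto simp: G_def bij_betw_def inv_into_into f_inv_into_f)
  have Gar: "far G g \<in> Ar C" "far F (far G g) = g" if "g \<in> Ar D" for g
    using ar that by (auto simp: G_def bij_betw_def inv_into_into f_inv_into_f)
  have GFob: "fob G (fob F a) = a" if "a \<in> Ob C" for a
    using ob that by (auto simp: G_def bij_betw_def)
  have GFar: "far G (far F f) = f" if "f \<in> Ar C" for f
    using ar that by (auto simp: G_def bij_betw_def)
  have Garr: "far G g \<in> arrows C (fob G a) (fob G b)" if g: "g \<in> arrows D a b" for a b g
  proof -
    have *: "far G g \<in> arrows C (Src C (far G g)) (Tgt C (far G g))"
      using arrow_Ar[OF cats(1)] Gar(1) arrowsD(3)[OF cats(2) g] by simp
    \<comment> \<open>An arrow has one source and one target, so those of g are the images of those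
      of its preimage.\<close>
    have "g \<in> arrows D (fob F (Src C (far G g))) (fob F (Tgt C (far G g)))"
      using functor_arrow[OF F *] Gar(2) arrowsD(3)[OF cats(2) g] by simp
    then have "a = fob F (Src C (far G g))" "b = fob F (Tgt C (far G g))"
      using arrowsD(4,5)[OF cats(2)] g by metis+
    then show ?thesis using * arrowsD(1,2)[OF cats(1) *] GFob by simp
  qed
  have "is_functor D C G"
  proof (rule is_functorI[OF cats(2,1)])
    fix a assume a: "a \<in> Ob D"
    then show "fob G a \<in> Ob C" by (rule Gob)
    have "far F (Ide C (fob G a)) = Ide D a" using functor_Ide[OF F Gob(1)[OF a]] Gob(2)[OF a] by simp
    then show "far G (Ide D a) = Ide C (fob G a)"
      using GFar[OF arrowsD(3)[OF cats(1) Ide_arrow[OF cats(1) Gob(1)[OF a]]]] by simp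
  next
    fix a b c f g assume f: "f \<in> arrows D a b" and g: "g \<in> arrows D b c"
    have "far F (Cmp C (far G g) (far G f)) = Cmp D g f"
      using functor_Cmp[OF F Garr[OF g] Garr[OF f]] Gar(2) arrowsD(3)[OF cats(2)] f g by metis
    then show "far G (Cmp D g f) = Cmp C (far G g) (far G f)"
      using GFar[OF arrowsD(3)[OF cats(1) Cmp_arrow[OF cats(1) Garr[OF g] Garr[OF f]]]] by simp
  qed (rule Garr)
  then show ?thesis unfolding is_isomorphism_def using F Gob Gar GFob GFar by blast
qed

lemma Ide_nat:
  assumes E: "is_cat E"
  shows "is_nat E E id_fctr id_fctr (Ide E)" "\<forall>a\<in>Ob E. is_iso E (Ide E a)"
proof -
  show "is_nat E E id_fctr id_fctr (Ide E)" unfolding is_nat_def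
    using functor_id[OF E] Ide_arrow[OF E] Cmp_Ide[OF E arrow_Ar[OF E]] by simp
  show "\<forall>a\<in>Ob E. is_iso E (Ide E a)" unfolding is_iso_def
    using Ide_arrow[OF E] arrowsD(3,4,5)[OF E Ide_arrow[OF E]] Cmp_Ide[OF E Ide_arrow[OF E]] by metis
qed

text \<open>Unit and counit are families of identities; \<open>nat_cong\<close> enters because the
  composites agree with the identity functors only on objects and arrows.\<close>

lemma isomorphism_equivalence:
  assumes "is_isomorphism C D F"
  shows "is_equivalence C D F"
proof -
  obtain G where F: "is_functor C D F" and G: "is_functor D C G"
    and GF: "\<And>a. a \<in> Ob C \<Longrightarrow> fob G (fob F a) = a" "\<And>f. f \<in> Ar C \<Longrightarrow> far G (far F f) = f"
    and FG: "\<And>b. b \<in> Ob D \<Longrightarrow> fob F (fob G b) = b" "\<And>g. g \<in> Ar D \<Longrightarrow> far F (far G g) = g"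
    using assms unfolding is_isomorphism_def by blast
  note cats = functor_cats[OF F]
  have "is_nat C C id_fctr (comp_fctr G F) (Ide C)"
    by (rule nat_cong[OF Ide_nat(1)[OF cats(1)]]) (simp_all add: GF)
  moreover have "is_nat D D (comp_fctr F G) id_fctr (Ide D)"
    by (rule nat_cong[OF Ide_nat(1)[OF cats(2)]]) (simp_all add: FG)
  ultimately show ?thesis unfolding is_equivalence_def
    using F Ide_nat(2)[OF cats(1)] Ide_nat(2)[OF cats(2)] by blast
qed

lemma isomorphism_cong:
  assumes "is_isomorphism C D F" "\<And>a. a \<in> Ob C \<Longrightarrow> fob F a = fob F' a"
    and "\<And>f. f \<in> Ar C \<Longrightarrow> far F f = far F' f"
  shows "is_isomorphism C D F'"
proof -
  obtain G where F: "is_functor C D F" and G: "is_functor D C G"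
    and "\<forall>a\<in>Ob C. fob G (fob F a) = a" "\<forall>f\<in>Ar C. far G (far F f) = f"
    and "\<forall>b\<in>Ob D. fob F (fob G b) = b" "\<forall>g\<in>Ar D. far F (far G g) = g"
    using assms(1) unfolding is_isomorphism_def by blast
  moreover have "far G g \<in> Ar C" if "g \<in> Ar D" for g
    using functor_arrow[OF G arrow_Ar[OF functor_cats(1)[OF G] that]] arrowsD(3)[OF functor_cats(2)[OF G]] by blast
  ultimately show ?thesis unfolding is_isomorphism_def
    using functor_cong[OF F assms(2,3)] assms(2,3) functor_ob[OF G] by (metis (no_types, lifting))
qed

lemma isomorphism_comp:
  assumes "is_isomorphism C D F" "is_isomorphism D E G"
  shows "is_isomorphism C E (comp_fctr G F)"
proof -
  obtain F' where F: "is_functor C D F" and F': "is_functor D C F'"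
    and 1: "\<forall>a\<in>Ob C. fob F' (fob F a) = a" "\<forall>f\<in>Ar C. far F' (far F f) = f"
      "\<forall>b\<in>Ob D. fob F (fob F' b) = b" "\<forall>g\<in>Ar D. far F (far F' g) = g"
    using assms(1) unfolding is_isomorphism_def by blast
  obtain G' where G: "is_functor D E G" and G': "is_functor E D G'"
    and 2: "\<forall>a\<in>Ob D. fob G' (fob G a) = a" "\<forall>f\<in>Ar D. far G' (far G f) = f"
      "\<forall>b\<in>Ob E. fob G (fob G' b) = b" "\<forall>g\<in>Ar E. far G (far G' g) = g"
    using assms(2) unfolding is_isomorphism_def by blast
  have *: "far F f \<in> Ar D" if "f \<in> Ar C" for f
    using functor_arrow[OF F arrow_Ar[OF functor_cats(1)[OF F] that]] arrowsD(3)[OF functor_cats(2)[OF F]] by blast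
  have **: "far G' f \<in> Ar D" if "f \<in> Ar E" for f
    using functor_arrow[OF G' arrow_Ar[OF functor_cats(1)[OF G'] that]] arrowsD(3)[OF functor_cats(2)[OF G']] by blast
  show ?thesis unfolding is_isomorphism_def
    using functor_comp[OF F G] functor_comp[OF G' F'] 1 2 * ** functor_ob[OF F] functor_ob[OF G']
    by (intro conjI exI[of _ "comp_fctr F' G'"]) simp_all
qed

section \<open>Cocones and colimits\<close>

lemma colimitD:
  assumes "is_colimit C J X c l"
  shows "is_cocone C J X c l" "c \<in> Ob C" "i \<in> Ob J \<Longrightarrow> l i \<in> arrows C (fob X i) c"
    "u \<in> arrows J i j \<Longrightarrow> Cmp C (l j) (far X u) = l i"
  using assms unfolding is_colimit_def is_cocone_def arrows_def by auto

lemma colimit_ex: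
  assumes "is_colimit C J X c l" "is_cocone C J X d k"
  obtains h where "h \<in> arrows C c d" "\<And>i. i \<in> Ob J \<Longrightarrow> Cmp C h (l i) = k i"
  using assms unfolding is_colimit_def by blast

text \<open>The definition gives uniqueness only for factorisations of a given cocone, so the
  composites of h with the legs are shown to form a cocone.\<close>

lemma colimit_unique:
  assumes "is_cat C" "is_colimit C J X c l" "h \<in> arrows C c d" "h' \<in> arrows C c d"
    and eq: "\<And>i. i \<in> Ob J \<Longrightarrow> Cmp C h (l i) = Cmp C h' (l i)"
    and X: "is_functor J C X"
  shows "h = h'"
proof -
  have "is_cocone C J X d (\<lambda>i. Cmp C h (l i))" unfolding is_cocone_def
  proof (intro conjI ballI)
    show "d \<in> Ob C" using arrowsD(2)[OF assms(1,3)] .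
    show "Cmp C h (l i) \<in> arrows C (fob X i) d" if "i \<in> Ob J" for i
      using Cmp_arrow[OF assms(1,3) colimitD(3)[OF assms(2) that]] .
    fix u assume u: "u \<in> Ar J"
    have u': "u \<in> arrows J (Src J u) (Tgt J u)" using u by (simp add: arrows_def)
    show "Cmp C (Cmp C h (l (Tgt J u))) (far X u) = Cmp C h (l (Src J u))"
      using Cmp_assoc[OF assms(1,3) colimitD(3)[OF assms(2)] functor_arrow[OF X u']] colimitD(4)[OF assms(2) u']
        arrowsD(2)[OF functor_cats(1)[OF X] u'] by simp
  qed
  then show ?thesis using assms(2,3,4) eq unfolding is_colimit_def by metis
qed

lemma is_coconeI:
  assumes "is_cat J" "d \<in> Ob C" "\<And>i. i \<in> Ob J \<Longrightarrow> k i \<in> arrows C (fob X i) d"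
    and "\<And>u i j. u \<in> arrows J i j \<Longrightarrow> Cmp C (k j) (far X u) = k i"
  shows "is_cocone C J X d k"
  using assms arrow_Ar unfolding is_cocone_def by metis

lemma is_colimitI:
  assumes "is_cocone C J X c l"
    and "\<And>d k. is_cocone C J X d k \<Longrightarrow> \<exists>h\<in>arrows C c d. \<forall>i\<in>Ob J. Cmp C h (l i) = k i"
    and "\<And>d h h'. h \<in> arrows C c d \<Longrightarrow> h' \<in> arrows C c d \<Longrightarrow>
      (\<And>i. i \<in> Ob J \<Longrightarrow> Cmp C h (l i) = Cmp C h' (l i)) \<Longrightarrow> h = h'"
  shows "is_colimit C J X c l"
  unfolding is_colimit_def
proof (intro conjI allI impI assms(1))
  fix d k assume "is_cocone C J X d k"
  from assms(2)[OF this] show "\<exists>!h. h \<in> arrows C c d \<and> (\<forall>i\<in>Ob J. Cmp C h (l i) = k i)"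
    using assms(3) by (metis (no_types, lifting))
qed

lemma colimit_cong:
  assumes "is_colimit C J X c l" "\<And>i. i \<in> Ob J \<Longrightarrow> fob X i = fob X' i" "\<And>u. u \<in> Ar J \<Longrightarrow> far X u = far X' u"
    and "c = c'" "\<And>i. i \<in> Ob J \<Longrightarrow> l i = l' i" and "is_cat J"
  shows "is_colimit C J X' c' l'"
proof -
  have "is_cocone C J X d k = is_cocone C J X' d k" for d k
    unfolding is_cocone_def using assms(2,3) by simp
  moreover have "is_cocone C J X c l = is_cocone C J X c l'"
    unfolding is_cocone_def using assms(5,6) by (simp add: is_cat_def)
  ultimately show ?thesis using assms(1,4,5) unfolding is_colimit_def by simp
qed

text \<open>The comparison arrows are exported together with their compatibility with the legs,
  which serves to carry an explicit description of one colimit over to any other.\<close>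

lemma colimits_isomorphic:
  assumes C: "is_cat C" and X: "is_functor J C X" and "is_colimit C J X c l" "is_colimit C J X d k"
  obtains h g where "h \<in> arrows C c d" "g \<in> arrows C d c" "Cmp C g h = Ide C c" "Cmp C h g = Ide C d"
    "\<And>i. i \<in> Ob J \<Longrightarrow> Cmp C h (l i) = k i" "\<And>i. i \<in> Ob J \<Longrightarrow> Cmp C g (k i) = l i"
proof -
  note c = colimitD[OF assms(3)] and d = colimitD[OF assms(4)]
  obtain h where h: "h \<in> arrows C c d" "\<And>i. i \<in> Ob J \<Longrightarrow> Cmp C h (l i) = k i"
    using colimit_ex[OF assms(3) d(1)] by blast
  obtain g where g: "g \<in> arrows C d c" "\<And>i. i \<in> Ob J \<Longrightarrow> Cmp C g (k i) = l i"
    using colimit_ex[OF assms(4) c(1)] by blast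
  have "Cmp C (Cmp C g h) (l i) = Cmp C (Ide C c) (l i)" if "i \<in> Ob J" for i
    using Cmp_assoc[OF C g(1) h(1) c(3)[OF that]] h(2)[OF that] g(2)[OF that] Cmp_Ide(2)[OF C c(3)[OF that]] by simp
  then have 1: "Cmp C g h = Ide C c"
    by (rule colimit_unique[OF C assms(3) Cmp_arrow[OF C g(1) h(1)] Ide_arrow[OF C c(2)] _ X])
  have "Cmp C (Cmp C h g) (k i) = Cmp C (Ide C d) (k i)" if "i \<in> Ob J" for i
    using Cmp_assoc[OF C h(1) g(1) d(3)[OF that]] h(2)[OF that] g(2)[OF that] Cmp_Ide(2)[OF C d(3)[OF that]] by simp
  then have 2: "Cmp C h g = Ide C d"
    by (rule colimit_unique[OF C assms(4) Cmp_arrow[OF C h(1) g(1)] Ide_arrow[OF C d(2)] _ X])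
  show ?thesis using that[OF h(1) g(1) 1 2 h(2) g(2)] .
qed

section \<open>Adjunctions\<close>

text \<open>Arrows out of \<open>F0 x\<close> are compared through their restrictions along the
  unit, so functoriality, naturality and the triangle identities all follow from
  \<open>uniq\<close>. That \<open>fob F = F0\<close> is part of the conclusion allows computations
  in a chosen free algebra.\<close>

lemma adjunction_from_universal_arrows:
  assumes G: "is_functor A X G"
    and F0: "\<And>x. x \<in> Ob X \<Longrightarrow> F0 x \<in> Ob A"
    and \<eta>: "\<And>x. x \<in> Ob X \<Longrightarrow> \<eta> x \<in> arrows X x (fob G (F0 x))"
    and ex: "\<And>x a f. x \<in> Ob X \<Longrightarrow> a \<in> Ob A \<Longrightarrow> f \<in> arrows X x (fob G a) \<Longrightarrow>
      \<exists>h\<in>arrows A (F0 x) a. Cmp X (far G h) (\<eta> x) = f"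
    and uniq: "\<And>x a h h'. x \<in> Ob X \<Longrightarrow> h \<in> arrows A (F0 x) a \<Longrightarrow> h' \<in> arrows A (F0 x) a \<Longrightarrow>
      Cmp X (far G h) (\<eta> x) = Cmp X (far G h') (\<eta> x) \<Longrightarrow> h = h'"
  obtains F \<epsilon> where "adjunction A X F G \<eta> \<epsilon>" "fob F = F0"
proof -
  note A = functor_cats(1)[OF G] and X = functor_cats(2)[OF G]
  define ext where "ext x a f = (SOME h. h \<in> arrows A (F0 x) a \<and> Cmp X (far G h) (\<eta> x) = f)" for x a f
  have ext: "ext x a f \<in> arrows A (F0 x) a" "Cmp X (far G (ext x a f)) (\<eta> x) = f"
    if "x \<in> Ob X" "a \<in> Ob A" "f \<in> arrows X x (fob G a)" for x a f
    using someI_ex[of "\<lambda>h. h \<in> arrows A (F0 x) a \<and> Cmp X (far G h) (\<eta> x) = f"] ex[OF that]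
    unfolding ext_def by blast+
  define F where "F = \<lparr>fob = F0, far = (\<lambda>f. ext (Src X f) (F0 (Tgt X f)) (Cmp X (\<eta> (Tgt X f)) f))\<rparr>"
  define \<epsilon> where "\<epsilon> a = ext (fob G a) a (Ide X (fob G a))" for a
  have Far: "far F f \<in> arrows A (F0 x) (F0 y)" "Cmp X (far G (far F f)) (\<eta> x) = Cmp X (\<eta> y) f"
    if f: "f \<in> arrows X x y" for f x y
  proof -
    note fD = arrowsD[OF X f]
    show "far F f \<in> arrows A (F0 x) (F0 y)" "Cmp X (far G (far F f)) (\<eta> x) = Cmp X (\<eta> y) f"
      using ext[OF fD(1) F0[OF fD(2)] Cmp_arrow[OF X \<eta>[OF fD(2)] f]] by (simp_all add: F_def fD)
  qed
  have Fob: "fob F = F0" by (simp add: F_def)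
  have F: "is_functor X A F"
  proof (rule is_functorI[OF X A], unfold Fob)
    fix x assume x: "x \<in> Ob X"
    show "far F (Ide X x) = Ide A (F0 x)"
    proof (rule uniq[OF x Far(1)[OF Ide_arrow[OF X x]] Ide_arrow[OF A F0[OF x]]])
      show "Cmp X (far G (far F (Ide X x))) (\<eta> x) = Cmp X (far G (Ide A (F0 x))) (\<eta> x)"
        unfolding Far(2)[OF Ide_arrow[OF X x]] functor_Ide[OF G F0[OF x]]
        using Cmp_Ide[OF X \<eta>[OF x]] by simp
    qed
  next
    fix x y z f g assume f: "f \<in> arrows X x y" and g: "g \<in> arrows X y z"
    note gf = Cmp_arrow[OF X g f] and x = arrowsD(1)[OF X f] and y = arrowsD(1)[OF X g] and z = arrowsD(2)[OF X g]
    note GF = functor_arrow[OF G Far(1)]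
    show "far F (Cmp X g f) = Cmp A (far F g) (far F f)"
    proof (rule uniq[OF x Far(1)[OF gf] Cmp_arrow[OF A Far(1)[OF g] Far(1)[OF f]]])
      show "Cmp X (far G (far F (Cmp X g f))) (\<eta> x) = Cmp X (far G (Cmp A (far F g) (far F f))) (\<eta> x)"
        unfolding Far(2)[OF gf] functor_Cmp[OF G Far(1)[OF g] Far(1)[OF f]]
          Cmp_assoc[OF X GF[OF g] GF[OF f] \<eta>[OF x], symmetric] Far(2)[OF f]
        unfolding Cmp_assoc[OF X GF[OF g] \<eta>[OF y] f] Far(2)[OF g] Cmp_assoc[OF X \<eta>[OF z] g f] ..
    qed
  qed (use F0 Far in auto)
  have eps: "\<epsilon> a \<in> arrows A (F0 (fob G a)) a" "Cmp X (far G (\<epsilon> a)) (\<eta> (fob G a)) = Ide X (fob G a)"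
    if a: "a \<in> Ob A" for a
    using ext[OF functor_ob[OF G a] a Ide_arrow[OF X functor_ob[OF G a]]] unfolding \<epsilon>_def by auto
  have "adjunction A X F G \<eta> \<epsilon>" unfolding adjunction_def
  proof (intro conjI ballI F G)
    show "is_nat X X id_fctr (comp_fctr G F) \<eta>" unfolding is_nat_def
      using functor_id[OF X] functor_comp[OF F G] \<eta> Far(2)[OF arrow_Ar[OF X]] by (simp add: Fob)
    show "is_nat A A (comp_fctr F G) id_fctr \<epsilon>" unfolding is_nat_def
    proof (intro conjI ballI functor_id[OF A] functor_comp[OF G F])
      fix f assume "f \<in> Ar A"
      then obtain a b where f: "f \<in> arrows A a b" and ab: "Src A f = a" "Tgt A f = b" using arrow_Ar[OF A] by blast
      note a = arrowsD(1)[OF A f] and b = arrowsD(2)[OF A f]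
      note Gf = functor_arrow[OF G f]
      note FGf = Far(1)[OF Gf]
      have "Cmp A (\<epsilon> b) (far F (far G f)) = Cmp A f (\<epsilon> a)"
      proof (rule uniq[OF functor_ob[OF G a] Cmp_arrow[OF A eps(1)[OF b] FGf] Cmp_arrow[OF A f eps(1)[OF a]]])
        note \<eta>a = \<eta>[OF functor_ob[OF G a]] and \<eta>b = \<eta>[OF functor_ob[OF G b]]
        have "Cmp X (far G (Cmp A (\<epsilon> b) (far F (far G f)))) (\<eta> (fob G a)) = far G f"
          unfolding functor_Cmp[OF G eps(1)[OF b] FGf]
            Cmp_assoc[OF X functor_arrow[OF G eps(1)[OF b]] functor_arrow[OF G FGf] \<eta>a, symmetric] Far(2)[OF Gf]
            Cmp_assoc[OF X functor_arrow[OF G eps(1)[OF b]] \<eta>b Gf] eps(2)[OF b] Cmp_Ide[OF X Gf] ..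
        moreover have "Cmp X (far G (Cmp A f (\<epsilon> a))) (\<eta> (fob G a)) = far G f"
          unfolding functor_Cmp[OF G f eps(1)[OF a]]
            Cmp_assoc[OF X Gf functor_arrow[OF G eps(1)[OF a]] \<eta>a, symmetric] eps(2)[OF a] Cmp_Ide[OF X Gf] ..
        ultimately show "Cmp X (far G (Cmp A (\<epsilon> b) (far F (far G f)))) (\<eta> (fob G a)) =
          Cmp X (far G (Cmp A f (\<epsilon> a))) (\<eta> (fob G a))" by simp
      qed
      then show "Cmp A (\<epsilon> (Tgt A f)) (far (comp_fctr F G) f) = Cmp A (far id_fctr f) (\<epsilon> (Src A f))"
        by (simp add: ab)
    qed (use eps in \<open>simp_all add: Fob\<close>)
  next
    fix a assume "a \<in> Ob A"
    then show "Cmp X (far G (\<epsilon> a)) (\<eta> (fob G a)) = Ide X (fob G a)" by (rule eps)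
  next
    fix x assume x: "x \<in> Ob X"
    note Fx = F0[OF x]
    note GFx = functor_ob[OF G Fx]
    note F\<eta> = Far(1)[OF \<eta>[OF x]]
    show "Cmp A (\<epsilon> (fob F x)) (far F (\<eta> x)) = Ide A (fob F x)" unfolding Fob
    proof (rule uniq[OF x Cmp_arrow[OF A eps(1)[OF Fx] F\<eta>] Ide_arrow[OF A Fx]])
      show "Cmp X (far G (Cmp A (\<epsilon> (F0 x)) (far F (\<eta> x)))) (\<eta> x) = Cmp X (far G (Ide A (F0 x))) (\<eta> x)"
        unfolding functor_Cmp[OF G eps(1)[OF Fx] F\<eta>] functor_Ide[OF G Fx]
          Cmp_assoc[OF X functor_arrow[OF G eps(1)[OF Fx]] functor_arrow[OF G F\<eta>] \<eta>[OF x], symmetric] Far(2)[OF \<eta>[OF x]]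
          Cmp_assoc[OF X functor_arrow[OF G eps(1)[OF Fx]] \<eta>[OF GFx] \<eta>[OF x]] eps(2)[OF Fx] Cmp_Ide[OF X \<eta>[OF x]] ..
    qed
  qed
  then show ?thesis using that Fob by blast
qed

lemma adjunctionD:
  assumes "adjunction A X F G \<eta> \<epsilon>"
  shows "is_functor X A F" "is_functor A X G" "x \<in> Ob X \<Longrightarrow> \<eta> x \<in> arrows X x (fob G (fob F x))"
    "a \<in> Ob A \<Longrightarrow> \<epsilon> a \<in> arrows A (fob F (fob G a)) a"
    "f \<in> arrows X x y \<Longrightarrow> Cmp X (\<eta> y) f = Cmp X (far G (far F f)) (\<eta> x)"
    "g \<in> arrows A a b \<Longrightarrow> Cmp A (\<epsilon> b) (far F (far G g)) = Cmp A g (\<epsilon> a)"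
    "a \<in> Ob A \<Longrightarrow> Cmp X (far G (\<epsilon> a)) (\<eta> (fob G a)) = Ide X (fob G a)"
    "x \<in> Ob X \<Longrightarrow> Cmp A (\<epsilon> (fob F x)) (far F (\<eta> x)) = Ide A (fob F x)"
  using assms unfolding adjunction_def is_nat_def by (auto simp: arrows_def)

text \<open>Cocones under the image of the diagram correspond to cocones under the diagram by
  transposition. The lemma serves for free algebras and, through \<open>colimit_transfer\<close>,
  for isomorphisms of categories.\<close>

lemma left_adjoint_preserves_colimit:
  assumes adj: "adjunction A X F G \<eta> \<epsilon>" and Y: "is_functor J X Y" and col: "is_colimit X J Y c l"
  shows "is_colimit A J (comp_fctr F Y) (fob F c) (\<lambda>i. far F (l i))"
proof -
  note F = adjunctionD(1)[OF adj] and G = adjunctionD(2)[OF adj] and \<eta> = adjunctionD(3)[OF adj]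
    and \<epsilon> = adjunctionD(4)[OF adj] and \<eta>nat = adjunctionD(5)[OF adj] and \<epsilon>nat = adjunctionD(6)[OF adj]
    and tri1 = adjunctionD(7)[OF adj] and tri2 = adjunctionD(8)[OF adj]
  note A = functor_cats(1)[OF G] and X = functor_cats(2)[OF G] and J = functor_cats(1)[OF Y]
  note c = colimitD(2)[OF col] and l = colimitD(3)[OF col] and lY = colimitD(4)[OF col]
  note Fc = functor_ob[OF F c]
  show ?thesis
  proof (rule is_colimitI)
    show "is_cocone A J (comp_fctr F Y) (fob F c) (\<lambda>i. far F (l i))"
    proof (rule is_coconeI[OF J Fc])
      fix u i j assume u: "u \<in> arrows J i j"
      show "Cmp A (far F (l j)) (far (comp_fctr F Y) u) = far F (l i)"
        using functor_Cmp[OF F l[OF arrowsD(2)[OF J u]] functor_arrow[OF Y u]] lY[OF u] by simp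
    qed (use functor_arrow[OF F l] in simp)
  next
    fix d k assume cc: "is_cocone A J (comp_fctr F Y) d k"
    then have d: "d \<in> Ob A" and k: "\<And>i. i \<in> Ob J \<Longrightarrow> k i \<in> arrows A (fob F (fob Y i)) d"
      and kY: "\<And>u i j. u \<in> arrows J i j \<Longrightarrow> Cmp A (k j) (far F (far Y u)) = k i"
      unfolding is_cocone_def arrows_def by auto
    have "is_cocone X J Y (fob G d) (\<lambda>i. Cmp X (far G (k i)) (\<eta> (fob Y i)))"
    proof (rule is_coconeI[OF J functor_ob[OF G d]])
      show "Cmp X (far G (k i)) (\<eta> (fob Y i)) \<in> arrows X (fob Y i) (fob G d)" if "i \<in> Ob J" for i
        using Cmp_arrow[OF X functor_arrow[OF G k[OF that]] \<eta>[OF functor_ob[OF Y that]]] .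
      fix u i j assume u: "u \<in> arrows J i j"
      note i = arrowsD(1)[OF J u] and j = arrowsD(2)[OF J u]
      note Yu = functor_arrow[OF Y u]
      note FYu = functor_arrow[OF F Yu]
      show "Cmp X (Cmp X (far G (k j)) (\<eta> (fob Y j))) (far Y u) = Cmp X (far G (k i)) (\<eta> (fob Y i))"
        unfolding Cmp_assoc[OF X functor_arrow[OF G k[OF j]] \<eta>[OF functor_ob[OF Y j]] Yu, symmetric] \<eta>nat[OF Yu]
          Cmp_assoc[OF X functor_arrow[OF G k[OF j]] functor_arrow[OF G FYu] \<eta>[OF functor_ob[OF Y i]]]
          functor_Cmp[OF G k[OF j] FYu, symmetric] kY[OF u] ..
    qed
    from colimit_ex[OF col this] obtain h where h: "h \<in> arrows X c (fob G d)"
      and hl: "\<And>i. i \<in> Ob J \<Longrightarrow> Cmp X h (l i) = Cmp X (far G (k i)) (\<eta> (fob Y i))" by metis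
    note Fh = functor_arrow[OF F h]
    show "\<exists>h\<in>arrows A (fob F c) d. \<forall>i\<in>Ob J. Cmp A h (far F (l i)) = k i"
    proof (intro bexI[of _ "Cmp A (\<epsilon> d) (far F h)"] ballI)
      show "Cmp A (\<epsilon> d) (far F h) \<in> arrows A (fob F c) d" by (rule Cmp_arrow[OF A \<epsilon>[OF d] Fh])
      fix i assume i: "i \<in> Ob J"
      note Yi = functor_ob[OF Y i]
      note F\<eta> = functor_arrow[OF F \<eta>[OF Yi]] and Gk = functor_arrow[OF G k[OF i]]
      show "Cmp A (Cmp A (\<epsilon> d) (far F h)) (far F (l i)) = k i"
        unfolding Cmp_assoc[OF A \<epsilon>[OF d] Fh functor_arrow[OF F l[OF i]], symmetric]
          functor_Cmp[OF F h l[OF i], symmetric] hl[OF i] functor_Cmp[OF F Gk \<eta>[OF Yi]]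
          Cmp_assoc[OF A \<epsilon>[OF d] functor_arrow[OF F Gk] F\<eta>] \<epsilon>nat[OF k[OF i]]
          Cmp_assoc[OF A k[OF i] \<epsilon>[OF functor_ob[OF F Yi]] F\<eta>, symmetric] tri2[OF Yi]
        by (rule Cmp_Ide[OF A k[OF i]])
    qed
  next
    fix d h h' assume h: "h \<in> arrows A (fob F c) d" and h': "h' \<in> arrows A (fob F c) d"
      and eq: "\<And>i. i \<in> Ob J \<Longrightarrow> Cmp A h (far F (l i)) = Cmp A h' (far F (l i))"
    note d = arrowsD(2)[OF A h]
    \<comment> \<open>An arrow out of \<open>F c\<close> is recovered from its transpose, by
      naturality of the counit and a triangle identity.\<close>
    have tr: "g = Cmp A (\<epsilon> d) (far F (Cmp X (far G g) (\<eta> c)))" if g: "g \<in> arrows A (fob F c) d" for g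
    proof -
      note F\<eta> = functor_arrow[OF F \<eta>[OF c]] and Gg = functor_arrow[OF G g]
      show ?thesis unfolding functor_Cmp[OF F Gg \<eta>[OF c]] Cmp_assoc[OF A \<epsilon>[OF d] functor_arrow[OF F Gg] F\<eta>] \<epsilon>nat[OF g]
          Cmp_assoc[OF A g \<epsilon>[OF Fc] F\<eta>, symmetric] tri2[OF c] Cmp_Ide[OF A g] ..
    qed
    have eq': "Cmp X (Cmp X (far G g) (\<eta> c)) (l i) = Cmp X (far G (Cmp A g (far F (l i)))) (\<eta> (fob Y i))"
      if g: "g \<in> arrows A (fob F c) d" and i: "i \<in> Ob J" for g i
    proof -
      note Fl = functor_arrow[OF F l[OF i]] and Gg = functor_arrow[OF G g] and Yi = functor_ob[OF Y i]
      show ?thesis unfolding Cmp_assoc[OF X Gg \<eta>[OF c] l[OF i], symmetric] \<eta>nat[OF l[OF i]]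
        Cmp_assoc[OF X Gg functor_arrow[OF G Fl] \<eta>[OF Yi]] functor_Cmp[OF G g Fl] ..
    qed
    have "Cmp X (far G h) (\<eta> c) = Cmp X (far G h') (\<eta> c)"
      by (rule colimit_unique[OF X col Cmp_arrow[OF X functor_arrow[OF G h] \<eta>[OF c]]
            Cmp_arrow[OF X functor_arrow[OF G h'] \<eta>[OF c]] _ Y]) (simp add: eq' h h' eq)
    then show "h = h'" using tr[OF h] tr[OF h'] by simp
  qed
qed

text \<open>An isomorphism of categories is left adjoint to its inverse, with identities as unit and
  counit.\<close>

lemma colimit_transfer:
  assumes F: "is_functor C D F" and G: "is_functor D C G" and X: "is_functor J C X"
    and GF: "\<And>a. a \<in> Ob C \<Longrightarrow> fob G (fob F a) = a" "\<And>f. f \<in> Ar C \<Longrightarrow> far G (far F f) = f"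
    and FG: "\<And>b. b \<in> Ob D \<Longrightarrow> fob F (fob G b) = b" "\<And>g. g \<in> Ar D \<Longrightarrow> far F (far G g) = g"
    and col: "is_colimit C J X c l"
  shows "is_colimit D J (comp_fctr F X) (fob F c) (\<lambda>i. far F (l i))"
proof (rule left_adjoint_preserves_colimit[OF _ X col])
  note C = functor_cats(1)[OF F] and D = functor_cats(2)[OF F]
  show "adjunction D C F G (Ide C) (Ide D)" unfolding adjunction_def
  proof (intro conjI ballI F G)
    show "is_nat C C id_fctr (comp_fctr G F) (Ide C)"
      by (rule nat_cong[OF Ide_nat(1)[OF C]]) (simp_all add: GF)
    show "is_nat D D (comp_fctr F G) id_fctr (Ide D)"
      by (rule nat_cong[OF Ide_nat(1)[OF D]]) (simp_all add: FG)
    show "Cmp C (far G (Ide D b)) (Ide C (fob G b)) = Ide C (fob G b)" if "b \<in> Ob D" for b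
      using functor_Ide[OF G that] Cmp_Ide[OF C Ide_arrow[OF C functor_ob[OF G that]]] by simp
    show "Cmp D (Ide D (fob F a)) (far F (Ide C a)) = Ide D (fob F a)" if "a \<in> Ob C" for a
      using functor_Ide[OF F that] Cmp_Ide[OF D Ide_arrow[OF D functor_ob[OF F that]]] by simp
  qed
qed

section \<open>Filtered colimits\<close>

text \<open>The identification made in a filtered colimit of sets. The stages i and j are arguments
  because the sets at different stages may overlap, so that an element does not determine its
  stage.\<close>

definition merges :: "('i, 'j) cat \<Rightarrow> ('j \<Rightarrow> 'a \<Rightarrow> 'a) \<Rightarrow> 'i \<Rightarrow> 'a \<Rightarrow> 'i \<Rightarrow> 'a \<Rightarrow> bool" where
  "merges J Xm i x j y \<longleftrightarrow> (\<exists>k u v. u \<in> arrows J i k \<and> v \<in> arrows J j k \<and> Xm u x = Xm v y)"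

text \<open>Diagrams of sets are given by plain functions instead of functors, so that the same
  lemmas apply to carriers of algebras, to sets over S and to hom-sets.\<close>

locale filtered_diagram =
  fixes J :: "('i, 'j) cat" and Xo :: "'i \<Rightarrow> 'a set" and Xm :: "'j \<Rightarrow> 'a \<Rightarrow> 'a"
  assumes J: "is_cat J" and filt: "filtered J"
    and Xm: "\<And>u i j x. u \<in> arrows J i j \<Longrightarrow> x \<in> Xo i \<Longrightarrow> Xm u x \<in> Xo j"
    and Xm_Cmp: "\<And>u v i j k x. u \<in> arrows J i j \<Longrightarrow> v \<in> arrows J j k \<Longrightarrow> x \<in> Xo i \<Longrightarrow> Xm (Cmp J v u) x = Xm v (Xm u x)"
    and Xm_Ide: "\<And>i x. i \<in> Ob J \<Longrightarrow> x \<in> Xo i \<Longrightarrow> Xm (Ide J i) x = x"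
begin

lemma upper_bound:
  assumes "i \<in> Ob J" "j \<in> Ob J"
  obtains k u v where "u \<in> arrows J i k" "v \<in> arrows J j k"
  using assms filt unfolding filtered_def by blast

lemma equalize:
  assumes "u \<in> arrows J i j" "v \<in> arrows J i j"
  obtains k w where "w \<in> arrows J j k" "Cmp J w u = Cmp J w v"
  using assms filt arrowsD(1,2)[OF J assms(1)] unfolding filtered_def by blast

lemma merges_arrow: "u \<in> arrows J i j \<Longrightarrow> x \<in> Xo i \<Longrightarrow> merges J Xm i x j (Xm u x)"
  unfolding merges_def using Xm Xm_Ide Ide_arrow[OF J] arrowsD(2)[OF J] by metis

lemma merges_refl: "i \<in> Ob J \<Longrightarrow> merges J Xm i x i x"
  unfolding merges_def using Ide_arrow[OF J] by blast

lemma merges_sym: "merges J Xm i x j y \<Longrightarrow> merges J Xm j y i x"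
  unfolding merges_def by metis

text \<open>The two targets have an upper bound, and the two resulting parallel arrows out of i are
  then equalized.\<close>

lemma span:
  assumes "u \<in> arrows J i j" "v \<in> arrows J i k"
  obtains m p q where "p \<in> arrows J j m" "q \<in> arrows J k m" "Cmp J p u = Cmp J q v"
proof -
  obtain n p q where pq: "p \<in> arrows J j n" "q \<in> arrows J k n"
    using upper_bound arrowsD(2)[OF J] assms by metis
  obtain m w where w: "w \<in> arrows J n m" "Cmp J w (Cmp J p u) = Cmp J w (Cmp J q v)"
    using equalize[OF Cmp_arrow[OF J pq(1) assms(1)] Cmp_arrow[OF J pq(2) assms(2)]] .
  show ?thesis
    using that[OF Cmp_arrow[OF J w(1) pq(1)] Cmp_arrow[OF J w(1) pq(2)]] w(2)
      Cmp_assoc[OF J w(1) pq(1) assms(1)] Cmp_assoc[OF J w(1) pq(2) assms(2)] by simp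
qed

lemma merges_trans:
  assumes "merges J Xm i x j y" "merges J Xm j y k z" "x \<in> Xo i" "y \<in> Xo j" "z \<in> Xo k"
  shows "merges J Xm i x k z"
proof -
  obtain m u v where uv: "u \<in> arrows J i m" "v \<in> arrows J j m" "Xm u x = Xm v y"
    using assms(1) unfolding merges_def by blast
  obtain n u' v' where uv': "u' \<in> arrows J j n" "v' \<in> arrows J k n" "Xm u' y = Xm v' z"
    using assms(2) unfolding merges_def by blast
  obtain r p q where pq: "p \<in> arrows J m r" "q \<in> arrows J n r" "Cmp J p v = Cmp J q u'"
    using span[OF uv(2) uv'(1)] .
  have "Xm (Cmp J p u) x = Xm (Cmp J q v') z"
    using Xm_Cmp[OF uv(1) pq(1) assms(3)] Xm_Cmp[OF uv(2) pq(1) assms(4)] Xm_Cmp[OF uv'(1) pq(2) assms(4)]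
      Xm_Cmp[OF uv'(2) pq(2) assms(5)] uv(3) uv'(3) pq(3) by simp
  then show ?thesis unfolding merges_def
    using Cmp_arrow[OF J pq(1) uv(1)] Cmp_arrow[OF J pq(2) uv'(2)] by blast
qed

text \<open>Each pair merges at a stage of its own. These stages are brought together one at a time,
  keeping a single arrow out of i and a single arrow out of j for all pairs.\<close>

lemma finite_merge:
  assumes "finite W" "i \<in> Ob J" "j \<in> Ob J"
    and "\<And>x y. (x, y) \<in> W \<Longrightarrow> x \<in> Xo i \<and> y \<in> Xo j \<and> merges J Xm i x j y"
  obtains k u v where "u \<in> arrows J i k" "v \<in> arrows J j k" "\<And>x y. (x, y) \<in> W \<Longrightarrow> Xm u x = Xm v y"
proof -
  have "\<exists>k u v. u \<in> arrows J i k \<and> v \<in> arrows J j k \<and> (\<forall>(x, y)\<in>W. Xm u x = Xm v y)"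
    using assms(1,4)
  proof (induction W rule: finite_induct)
    case empty
    then show ?case using upper_bound[OF assms(2,3)] by (metis empty_iff)
  next
    case (insert p W)
    have "\<exists>k u v. u \<in> arrows J i k \<and> v \<in> arrows J j k \<and> (\<forall>(x, y)\<in>W. Xm u x = Xm v y)"
      using insert.prems by (intro insert.IH) blast
    then obtain k u v where k: "u \<in> arrows J i k" "v \<in> arrows J j k" "\<forall>(x, y)\<in>W. Xm u x = Xm v y" by blast
    obtain x y where p: "p = (x, y)" by (cases p)
    with insert.prems have xy: "x \<in> Xo i" "y \<in> Xo j" "merges J Xm i x j y" by auto
    then obtain k' u' v' where k': "u' \<in> arrows J i k'" "v' \<in> arrows J j k'" "Xm u' x = Xm v' y"
      unfolding merges_def by blast
    \<comment> \<open>\<open>span\<close> makes the two arrows out of i agree. The two arrows out of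
      j may still differ afterwards, which the further arrow w repairs.\<close>
    obtain m a b where m: "a \<in> arrows J k m" "b \<in> arrows J k' m" "Cmp J a u = Cmp J b u'" using span[OF k(1) k'(1)] .
    obtain n w where n: "w \<in> arrows J m n" "Cmp J w (Cmp J a v) = Cmp J w (Cmp J b v')"
      using equalize[OF Cmp_arrow[OF J m(1) k(2)] Cmp_arrow[OF J m(2) k'(2)]] .
    have 1: "Xm (Cmp J w (Cmp J a u)) x' = Xm w (Xm a (Xm u x'))" if "x' \<in> Xo i" for x'
      using Xm_Cmp[OF Cmp_arrow[OF J m(1) k(1)] n(1) that] Xm_Cmp[OF k(1) m(1) that] by simp
    have 2: "Xm (Cmp J w (Cmp J a v)) y' = Xm w (Xm a (Xm v y'))" if "y' \<in> Xo j" for y'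
      using Xm_Cmp[OF Cmp_arrow[OF J m(1) k(2)] n(1) that] Xm_Cmp[OF k(2) m(1) that] by simp
    have 3: "Xm (Cmp J w (Cmp J b u')) x = Xm w (Xm b (Xm u' x))"
      using Xm_Cmp[OF Cmp_arrow[OF J m(2) k'(1)] n(1) xy(1)] Xm_Cmp[OF k'(1) m(2) xy(1)] by simp
    have 4: "Xm (Cmp J w (Cmp J b v')) y = Xm w (Xm b (Xm v' y))"
      using Xm_Cmp[OF Cmp_arrow[OF J m(2) k'(2)] n(1) xy(2)] Xm_Cmp[OF k'(2) m(2) xy(2)] by simp
    have "Xm (Cmp J w (Cmp J a u)) x' = Xm (Cmp J w (Cmp J a v)) y'" if "(x', y') \<in> insert p W" for x' y'
    proof (cases "(x', y') \<in> W")
      case True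
      then show ?thesis using 1[of x'] 2[of y'] insert.prems[of x' y'] k(3) by auto
    next
      case False
      then have "x' = x" "y' = y" using that p by auto
      then show ?thesis using 3 4 m(3) n(2) k'(3) by simp
    qed
    then show ?case
      using Cmp_arrow[OF J n(1) Cmp_arrow[OF J m(1) k(1)]] Cmp_arrow[OF J n(1) Cmp_arrow[OF J m(1) k(2)]] by blast
  qed
  then show ?thesis using that by fast
qed

text \<open>Both elements of a pair lie at the same stage and one arrow must serve for both, so the
  two arrows given by \<open>finite_merge\<close> are equalized.\<close>

lemma finite_merge_single:
  assumes "finite W" "i \<in> Ob J" "\<And>x y. (x, y) \<in> W \<Longrightarrow> x \<in> Xo i \<and> y \<in> Xo i \<and> merges J Xm i x i y"
  obtains k w where "w \<in> arrows J i k" "\<And>x y. (x, y) \<in> W \<Longrightarrow> Xm w x = Xm w y"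
proof -
  obtain k u v where k: "u \<in> arrows J i k" "v \<in> arrows J i k" "\<And>x y. (x, y) \<in> W \<Longrightarrow> Xm u x = Xm v y"
    using finite_merge[OF assms(1,2,2)] assms(3) by metis
  obtain m w where w: "w \<in> arrows J k m" "Cmp J w u = Cmp J w v" using equalize[OF k(1,2)] .
  have "Xm (Cmp J w u) x = Xm (Cmp J w u) y" if "(x, y) \<in> W" for x y
    using Xm_Cmp[OF k(1) w(1), of x] Xm_Cmp[OF k(2) w(1), of y] assms(3)[OF that] k(3)[OF that] w(2) by simp
  then show ?thesis using that[OF Cmp_arrow[OF J w(1) k(1)]] by blast
qed

end

text \<open>A filtered colimit of sets described without a universal property. As no ambient
  category of sets occurs in it, the description is shared by carriers and hom-sets and passes along
  isomorphisms of categories.\<close>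

definition elementwise_colimit ::
  "('i, 'j) cat \<Rightarrow> ('i \<Rightarrow> 'a set) \<Rightarrow> ('j \<Rightarrow> 'a \<Rightarrow> 'a) \<Rightarrow> 'b set \<Rightarrow> ('i \<Rightarrow> 'a \<Rightarrow> 'b) \<Rightarrow> bool" where
  "elementwise_colimit J Xo Xm C l \<longleftrightarrow>
     (\<forall>i\<in>Ob J. \<forall>x\<in>Xo i. l i x \<in> C) \<and> (\<forall>c\<in>C. \<exists>i\<in>Ob J. \<exists>x\<in>Xo i. l i x = c) \<and>
     (\<forall>i\<in>Ob J. \<forall>j\<in>Ob J. \<forall>x\<in>Xo i. \<forall>y\<in>Xo j. l i x = l j y \<longleftrightarrow> merges J Xm i x j y)"

locale filtered_colimit = filtered_diagram +
  fixes C :: "'b set" and l :: "'i \<Rightarrow> 'a \<Rightarrow> 'b"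
  assumes col: "elementwise_colimit J Xo Xm C l"
begin

lemma leg: "i \<in> Ob J \<Longrightarrow> x \<in> Xo i \<Longrightarrow> l i x \<in> C"
  and leg_surj: "c \<in> C \<Longrightarrow> \<exists>i\<in>Ob J. \<exists>x\<in>Xo i. l i x = c"
  and leg_eq: "i \<in> Ob J \<Longrightarrow> j \<in> Ob J \<Longrightarrow> x \<in> Xo i \<Longrightarrow> y \<in> Xo j \<Longrightarrow> l i x = l j y \<longleftrightarrow> merges J Xm i x j y"
  using col unfolding elementwise_colimit_def by blast+

lemma leg_Xm: "u \<in> arrows J i j \<Longrightarrow> x \<in> Xo i \<Longrightarrow> l j (Xm u x) = l i x"
  using leg_eq[of i j x "Xm u x"] merges_arrow Xm arrowsD[OF J] by metis

text \<open>The stages of finitely many elements have a common upper bound. Arguments of finitary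
  operations and finite sets of generators are lifted to a stage through this lemma.\<close>

lemma finite_stage:
  assumes "finite W" "W \<subseteq> C"
  obtains i s where "i \<in> Ob J" "\<And>c. c \<in> W \<Longrightarrow> s c \<in> Xo i \<and> l i (s c) = c"
proof -
  have "\<exists>i\<in>Ob J. \<forall>c\<in>W. \<exists>x\<in>Xo i. l i x = c"
    using assms
  proof (induction W rule: finite_induct)
    case empty
    \<comment> \<open>Even an empty set of elements needs a stage, which exists because filtered
      categories are non-empty; this is the case of a constant.\<close>
    then show ?case using filt unfolding filtered_def by blast
  next
    case (insert c W)
    then obtain i where i: "i \<in> Ob J" "\<forall>c\<in>W. \<exists>x\<in>Xo i. l i x = c" by blast
    obtain j y where j: "j \<in> Ob J" "y \<in> Xo j" "l j y = c" using leg_surj insert by blast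
    obtain k u v where uv: "u \<in> arrows J i k" "v \<in> arrows J j k" using upper_bound[OF i(1) j(1)] .
    have "\<exists>x\<in>Xo k. l k x = c'" if "c' \<in> insert c W" for c'
    proof (cases "c' \<in> W")
      case True
      then obtain x where "x \<in> Xo i" "l i x = c'" using i by blast
      then show ?thesis using Xm[OF uv(1)] leg_Xm[OF uv(1)] by blast
    next
      case False
      then show ?thesis using that j Xm[OF uv(2) j(2)] leg_Xm[OF uv(2) j(2)] by blast
    qed
    then show ?case using arrowsD(2)[OF J uv(1)] by blast
  qed
  then obtain i where "i \<in> Ob J" "\<forall>c\<in>W. \<exists>x\<in>Xo i. l i x = c" by blast
  moreover then obtain s where "\<forall>c\<in>W. s c \<in> Xo i \<and> l i (s c) = c" by metis
  ultimately show ?thesis using that by blast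
qed

text \<open>A compatible family respects \<open>merges\<close>, since both elements can be moved to
  the stage where they become equal; h is defined on one chosen representative of each
  element.\<close>

lemma factor:
  assumes "\<And>u i j x. u \<in> arrows J i j \<Longrightarrow> x \<in> Xo i \<Longrightarrow> k j (Xm u x) = k i x"
  obtains h where "\<And>i x. i \<in> Ob J \<Longrightarrow> x \<in> Xo i \<Longrightarrow> h (l i x) = k i x"
proof -
  have k: "k i x = k j y" if *: "i \<in> Ob J" "j \<in> Ob J" "x \<in> Xo i" "y \<in> Xo j" "l i x = l j y" for i j x y
  proof -
    obtain m u v where "u \<in> arrows J i m" "v \<in> arrows J j m" "Xm u x = Xm v y"
      using * leg_eq unfolding merges_def by blast
    then show ?thesis using assms[of u i m x] assms[of v j m y] * by simp
  qed
  have "\<exists>i x. i \<in> Ob J \<and> x \<in> Xo i \<and> l i x = c" if "c \<in> C" for c using leg_surj[OF that] by blast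
  then obtain I S where IS: "\<And>c. c \<in> C \<Longrightarrow> I c \<in> Ob J \<and> S c \<in> Xo (I c) \<and> l (I c) (S c) = c" by metis
  show ?thesis
    by (rule that[of "\<lambda>c. k (I c) (S c)"]) (metis IS k leg)
qed

end

text \<open>Finite presentability with the colimit of hom-sets spelled out: every arrow from a into
  a filtered colimit factors through a stage, and two such factorisations become equal at a later
  stage.\<close>

definition fp_object :: "'u set set \<Rightarrow> ('o, 'm) cat \<Rightarrow> 'o \<Rightarrow> bool" where
  "fp_object U C a \<longleftrightarrow> a \<in> Ob C \<and>
     (\<forall>(J :: ('u, 'u) cat) X c l. small_cat U J \<and> filtered J \<and> is_functor J C X \<and> is_colimit C J X c l \<longrightarrow>
        elementwise_colimit J (\<lambda>i. arrows C a (fob X i)) (\<lambda>u. Cmp C (far X u)) (arrows C a c) (\<lambda>i. Cmp C (l i)))"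

lemma set_cat_arrows [simp]: "x \<in> arrows set_cat A B \<longleftrightarrow> (\<exists>f. x = (A, f, B) \<and> f \<in> A \<rightarrow>\<^sub>E B)"
  by (simp add: set_cat_def arrows_mk_cat)

lemma set_cat_simps [simp]: "Ob set_cat = UNIV" "Cmp set_cat (B', g, C) (A, f, B) = (A, compose A g f, C)"
  by (simp_all add: set_cat_def)

text \<open>The elementwise description of the hom-sets yields the universal property in
  \<open>set_cat\<close>: existence by \<open>factor\<close>, uniqueness by joint surjectivity of
  the legs.\<close>

lemma finitely_presentableI:
  fixes C :: "('o, 'm) cat"
  assumes "fp_object U C a"
  shows "finitely_presentable U C a"
  unfolding finitely_presentable_def preserves_filtered_colimits_def
proof (intro conjI allI impI, goal_cases)
  case 1
  then show ?case using assms by (simp add: fp_object_def)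
next
  case (2 J X c l)
  then have J: "small_cat U J" "filtered J" and X: "is_functor J C X" and col: "is_colimit C J X c l" by auto
  note JC = functor_cats[OF X] and c = colimitD[OF col]
  let ?Xo = "\<lambda>i. arrows C a (fob X i)" and ?Xm = "\<lambda>u. Cmp C (far X u)"
  have "filtered_diagram J ?Xo ?Xm"
  proof
    fix u v i j k x assume u: "u \<in> arrows J i j" and v: "v \<in> arrows J j k" and x: "x \<in> ?Xo i"
    show "?Xm (Cmp J v u) x = ?Xm v (?Xm u x)"
      using functor_Cmp[OF X v u] Cmp_assoc[OF JC(2) functor_arrow[OF X v] functor_arrow[OF X u] x] by simp
  qed (use JC J functor_Ide[OF X] Cmp_Ide[OF JC(2)] Cmp_arrow[OF JC(2) functor_arrow[OF X]] in auto)
  moreover have "elementwise_colimit J ?Xo ?Xm (arrows C a c) (\<lambda>i. Cmp C (l i))"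
    using assms J X col unfolding fp_object_def by blast
  ultimately interpret filtered_colimit J ?Xo ?Xm "arrows C a c" "\<lambda>i. Cmp C (l i)"
    by (simp add: filtered_colimit_def filtered_colimit_axioms_def)
  have hl: "far (hom_fctr C a) (l i) = (?Xo i, \<lambda>g\<in>?Xo i. Cmp C (l i) g, arrows C a c)" if "i \<in> Ob J" for i
    using arrowsD[OF JC(2) c(3)[OF that]] by (simp add: hom_fctr_def)
  have hX: "far (hom_fctr C a) (far X u) = (?Xo i, \<lambda>g\<in>?Xo i. Cmp C (far X u) g, ?Xo j)" if "u \<in> arrows J i j" for u i j
    using arrowsD[OF JC(2) functor_arrow[OF X that]] by (simp add: hom_fctr_def)
  have ho: "fob (hom_fctr C a) b = arrows C a b" for b by (simp add: hom_fctr_def)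
  show ?case
  proof (rule is_colimitI)
    show "is_cocone set_cat J (comp_fctr (hom_fctr C a) X) (fob (hom_fctr C a) c) (\<lambda>i. far (hom_fctr C a) (l i))"
    proof (rule is_coconeI[OF JC(1)])
      show "far (hom_fctr C a) (l i) \<in> arrows set_cat (fob (comp_fctr (hom_fctr C a) X) i) (fob (hom_fctr C a) c)"
        if "i \<in> Ob J" for i
        using leg[OF that] by (auto simp: hl[OF that] ho)
      fix u i j assume u: "u \<in> arrows J i j"
      show "Cmp set_cat (far (hom_fctr C a) (l j)) (far (comp_fctr (hom_fctr C a) X) u) = far (hom_fctr C a) (l i)"
        using hl[OF arrowsD(1)[OF JC(1) u]] hl[OF arrowsD(2)[OF JC(1) u]] hX[OF u] leg_Xm[OF u] Xm[OF u]
        by (auto simp: compose_def fun_eq_iff)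
    qed simp
  next
    fix d k assume cc: "is_cocone set_cat J (comp_fctr (hom_fctr C a) X) d k"
    then have "\<forall>i\<in>Ob J. \<exists>f. k i = (?Xo i, f, d) \<and> f \<in> ?Xo i \<rightarrow>\<^sub>E d" by (auto simp: is_cocone_def ho)
    then obtain \<kappa> where k: "\<And>i. i \<in> Ob J \<Longrightarrow> k i = (?Xo i, \<kappa> i, d) \<and> \<kappa> i \<in> ?Xo i \<rightarrow>\<^sub>E d" by metis
    have kX: "\<kappa> j (?Xm u x) = \<kappa> i x" if u: "u \<in> arrows J i j" and x: "x \<in> ?Xo i" for u i j x
    proof -
      have "Cmp set_cat (k j) (far (hom_fctr C a) (far X u)) = k i"
        using cc arrowsD[OF JC(1) u] unfolding is_cocone_def by auto
      then have "compose (?Xo i) (\<kappa> j) (\<lambda>g\<in>?Xo i. Cmp C (far X u) g) = \<kappa> i"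
        using k arrowsD[OF JC(1) u] hX[OF u] by simp
      from fun_cong[OF this, of x] show ?thesis using x by (simp add: compose_def)
    qed
    obtain h where h: "\<And>i x. i \<in> Ob J \<Longrightarrow> x \<in> ?Xo i \<Longrightarrow> h (Cmp C (l i) x) = \<kappa> i x"
      using factor[of \<kappa>, OF kX] by blast
    have hd: "h x \<in> d" if "x \<in> arrows C a c" for x
      using leg_surj[OF that] h k by (metis PiE_mem)
    show "\<exists>h\<in>arrows set_cat (fob (hom_fctr C a) c) d. \<forall>i\<in>Ob J. Cmp set_cat h (far (hom_fctr C a) (l i)) = k i"
    proof (intro bexI[of _ "(arrows C a c, restrict h (arrows C a c), d)"] ballI)
      fix i assume i: "i \<in> Ob J"
      \<comment> \<open>Arrows of \<open>set_cat\<close> are extensional functions, so the two sides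
        must also be compared outside the hom-set.\<close>
      have "\<kappa> i x = undefined" if "x \<notin> ?Xo i" for x using k[OF i] that by (auto simp: PiE_def extensional_def)
      then show "Cmp set_cat (arrows C a c, restrict h (arrows C a c), d) (far (hom_fctr C a) (l i)) = k i"
        using k[OF i] hl[OF i] h[OF i] leg[OF i] by (auto simp: compose_def fun_eq_iff)
    qed (use hd in \<open>auto simp: ho\<close>)
  next
    fix d h h' assume "h \<in> arrows set_cat (fob (hom_fctr C a) c) d" "h' \<in> arrows set_cat (fob (hom_fctr C a) c) d"
      and eq: "\<And>i. i \<in> Ob J \<Longrightarrow> Cmp set_cat h (far (hom_fctr C a) (l i)) = Cmp set_cat h' (far (hom_fctr C a) (l i))"
    then obtain g g' where g: "h = (arrows C a c, g, d)" "g \<in> arrows C a c \<rightarrow>\<^sub>E d"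
      and g': "h' = (arrows C a c, g', d)" "g' \<in> arrows C a c \<rightarrow>\<^sub>E d" by (auto simp: ho)
    have "g x = g' x" if x: "x \<in> arrows C a c" for x
    proof -
      obtain i y where i: "i \<in> Ob J" "y \<in> ?Xo i" "Cmp C (l i) y = x" using leg_surj[OF x] by blast
      have "compose (?Xo i) g (\<lambda>g\<in>?Xo i. Cmp C (l i) g) y = compose (?Xo i) g' (\<lambda>g\<in>?Xo i. Cmp C (l i) g) y"
        using eq[OF i(1)] hl[OF i(1)] g g' by simp
      then show ?thesis using i by (simp add: compose_def)
    qed
    then have "g = g'" using g(2) g'(2) by (rule PiE_ext[rotated 2])
    then show "h = h'" using g g' by simp
  qed
qed

section \<open>Terms and algebras\<close>

text \<open>The result may have variables of another type, so that sorted variables can be replaced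
  by terms in generators, and generators by sorted variables.\<close>

primrec tsubst :: "(nat \<times> 's \<Rightarrow> ('f, 'r) trm) \<Rightarrow> ('f, 's) trm \<Rightarrow> ('f, 'r) trm" where
  "tsubst \<sigma> (Var x) = \<sigma> x"
| "tsubst \<sigma> (App f ts) = App f (map (tsubst \<sigma>) ts)"

lemma teval_cong: "(\<And>x. x \<in> tvars t \<Longrightarrow> v x = w x) \<Longrightarrow> teval I v t = teval I w t"
proof (induction t)
  case (App f ts)
  then have "map (teval I v) ts = map (teval I w) ts" by auto
  then show ?case by (simp only: teval.simps)
qed simp

lemma teval_tsubst: "teval I v (tsubst \<sigma> t) = teval I (\<lambda>x. teval I v (\<sigma> x)) t"
  by (induction t) (auto intro!: arg_cong[of _ _ "I _"])

lemma tvars_tsubst: "tvars (tsubst \<sigma> t) = (\<Union>x\<in>tvars t. tvars (\<sigma> x))"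
  by (induction t) auto

lemma tsubst_Var: "tsubst Var t = t"
  by (induction t) (auto intro!: map_idI)

text \<open>
  Terms whose variables are generators of a presentation: the sort of the generator x is \<open>p x\<close>.
  The terms of the equations of a variety are the case \<open>p = snd\<close>.
\<close>

primrec psort :: "('f, 's) signature \<Rightarrow> (nat \<times> 'x \<Rightarrow> 's) \<Rightarrow> ('f, 'x) trm \<Rightarrow> 's" where
  "psort Sg p (Var x) = p x"
| "psort Sg p (App f ts) = result Sg f"

primrec wtm :: "('f, 's) signature \<Rightarrow> (nat \<times> 'x \<Rightarrow> 's) \<Rightarrow> ('f, 'x) trm \<Rightarrow> bool" where
  "wtm Sg p (Var x) \<longleftrightarrow> True"
| "wtm Sg p (App f ts) \<longleftrightarrow> f \<in> symbols Sg \<and> list_all (wtm Sg p) ts \<and> map (psort Sg p) ts = arity Sg f"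

lemma tsort_psort: "tsort Sg t = psort Sg snd t"
  by (cases t) auto

lemma well_sorted_wtm: "well_sorted S Sg t \<longleftrightarrow> wtm Sg snd t \<and> tvars t \<subseteq> {x. snd x \<in> S}"
proof (induction t)
  case (App f ts)
  have "map (tsort Sg) ts = map (psort Sg snd) ts" by (simp add: tsort_psort)
  then show ?case using App by (auto simp: list_all_iff simp del: map_eq_conv)
qed simp

lemma wtm_symbols: "wtm Sg p t \<Longrightarrow> set1_trm t \<subseteq> symbols Sg"
  by (induction t) (auto simp: list_all_iff)

lemma wtm_tsubst:
  assumes "wtm Sg p' t" "\<And>x. x \<in> tvars t \<Longrightarrow> wtm Sg p (\<sigma> x) \<and> psort Sg p (\<sigma> x) = p' x"
  shows "wtm Sg p (tsubst \<sigma> t) \<and> psort Sg p (tsubst \<sigma> t) = psort Sg p' t"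
  using assms
proof (induction t)
  case (App f ts)
  then have "wtm Sg p (tsubst \<sigma> t) \<and> psort Sg p (tsubst \<sigma> t) = psort Sg p' t" if "t \<in> set ts" for t
    using that by (auto simp: list_all_iff)
  then have "map (psort Sg p) (map (tsubst \<sigma>) ts) = map (psort Sg p') ts" "list_all (wtm Sg p) (map (tsubst \<sigma>) ts)"
    by (auto simp: list_all_iff)
  then show ?case using App.prems(1) by (simp only: tsubst.simps wtm.simps psort.simps)
qed simp

text \<open>By induction on t, since e turns formal application into application of the operations.
  With \<open>p' = snd\<close> the lemma serves to check equations in a quotient of terms; with
  \<open>\<sigma> = Var\<close> it evaluates a term at the generators.\<close>

lemma teval_tsubst_quotient:
  assumes I: "\<And>f ts. wtm Sg p (App f ts) \<Longrightarrow> tvars (App f ts) \<subseteq> G \<Longrightarrow> I f (map e ts) = e (App f ts)"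
    and "wtm Sg p' t" "\<And>x. x \<in> tvars t \<Longrightarrow> wtm Sg p (\<sigma> x) \<and> psort Sg p (\<sigma> x) = p' x \<and> tvars (\<sigma> x) \<subseteq> G"
  shows "teval I (\<lambda>x. e (\<sigma> x)) t = e (tsubst \<sigma> t)"
  using assms(2,3)
proof (induction t)
  case (App f ts)
  have "wtm Sg p (App f (map (tsubst \<sigma>) ts)) \<and> tvars (App f (map (tsubst \<sigma>) ts)) \<subseteq> G"
    using wtm_tsubst[OF App.prems(1), of p \<sigma>] App.prems(2) tvars_tsubst[of \<sigma> "App f ts"] by fastforce
  then have "I f (map e (map (tsubst \<sigma>) ts)) = e (App f (map (tsubst \<sigma>) ts))" using I by blast
  moreover have "map (teval I (\<lambda>x. e (\<sigma> x))) ts = map e (map (tsubst \<sigma>) ts)"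
    using App by (auto simp: list_all_iff)
  ultimately show ?case by (simp only: teval.simps tsubst.simps)
qed simp

definition model :: "'u set set \<Rightarrow> 's set \<Rightarrow> ('f, 's) signature \<Rightarrow> (('f, 's) trm \<times> ('f, 's) trm) set \<Rightarrow>
    ('f, 's, 'u) alg \<Rightarrow> bool" where
  "model U S Sg E A \<longleftrightarrow> is_alg U S Sg A \<and> (\<forall>e\<in>E. satisfies A e)"

definition ahom :: "('f, 's) signature \<Rightarrow> ('f, 's, 'u) alg \<Rightarrow> ('f, 's, 'u) alg \<Rightarrow> ('u \<Rightarrow> 'u) set" where
  "ahom Sg A B = {h \<in> acarrier A \<rightarrow>\<^sub>E acarrier B.
     (\<forall>x\<in>acarrier A. asort B (h x) = asort A x) \<and>
     (\<forall>f\<in>symbols Sg. \<forall>xs\<in>aargs Sg A f. h (aint A f xs) = aint B f (map h xs))}"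

lemma ahomD:
  assumes "h \<in> ahom Sg A B"
  shows "x \<in> acarrier A \<Longrightarrow> h x \<in> acarrier B" "x \<in> acarrier A \<Longrightarrow> asort B (h x) = asort A x"
    "x \<notin> acarrier A \<Longrightarrow> h x = undefined"
    "f \<in> symbols Sg \<Longrightarrow> xs \<in> aargs Sg A f \<Longrightarrow> h (aint A f xs) = aint B f (map h xs)"
    "xs \<in> aargs Sg A f \<Longrightarrow> map h xs \<in> aargs Sg B f"
proof -
  have 1: "map (asort B) (map h xs) = map (asort A) xs" if "set xs \<subseteq> acarrier A" for xs
    using assms that by (auto simp: ahom_def)
  show "xs \<in> aargs Sg A f \<Longrightarrow> map h xs \<in> aargs Sg B f"
    using assms 1[of xs] by (auto simp: ahom_def aargs_def)
qed (use assms in \<open>auto simp: ahom_def PiE_def extensional_def\<close>)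

lemma ahom_ext:
  assumes "h \<in> ahom Sg A B" "h' \<in> ahom Sg A B" "\<And>x. x \<in> acarrier A \<Longrightarrow> h x = h' x"
  shows "h = h'"
  using ahomD(3)[OF assms(1)] ahomD(3)[OF assms(2)] assms(3) by (metis ext)

lemma is_algD:
  assumes "is_alg U S Sg A"
  shows "acarrier A \<in> U" "x \<in> acarrier A \<Longrightarrow> asort A x \<in> S" "x \<notin> acarrier A \<Longrightarrow> asort A x = undefined"
    "f \<in> symbols Sg \<Longrightarrow> xs \<in> aargs Sg A f \<Longrightarrow> aint A f xs \<in> acarrier A"
    "f \<in> symbols Sg \<Longrightarrow> xs \<in> aargs Sg A f \<Longrightarrow> asort A (aint A f xs) = result Sg f"
    "\<not> (f \<in> symbols Sg \<and> xs \<in> aargs Sg A f) \<Longrightarrow> aint A f xs = undefined"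
  using assms unfolding is_alg_def by (auto simp: PiE_def extensional_def split: if_splits)

lemma teval_wtm:
  assumes "is_alg U S Sg B" "wtm Sg p t" "\<And>x. x \<in> tvars t \<Longrightarrow> v x \<in> acarrier B \<and> asort B (v x) = p x"
  shows "teval (aint B) v t \<in> acarrier B \<and> asort B (teval (aint B) v t) = psort Sg p t"
  using assms(2,3)
proof (induction t)
  case (App f ts)
  then have *: "teval (aint B) v t \<in> acarrier B \<and> asort B (teval (aint B) v t) = psort Sg p t" if "t \<in> set ts" for t
    using that by (auto simp: list_all_iff)
  have "map (asort B) (map (teval (aint B) v) ts) = map (psort Sg p) ts" using * by simp
  then have "map (teval (aint B) v) ts \<in> aargs Sg B f"
    using * App.prems(1) by (auto simp: aargs_def simp del: map_map map_eq_conv)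
  then show ?case using App.prems(1) is_algD(4,5)[OF assms(1)] by simp
qed simp

lemma teval_aargs:
  assumes "is_alg U S Sg B" "wtm Sg p (App f ts)"
    and "\<And>x. x \<in> tvars (App f ts) \<Longrightarrow> v x \<in> acarrier B \<and> asort B (v x) = p x"
  shows "map (teval (aint B) v) ts \<in> aargs Sg B f"
proof -
  have *: "teval (aint B) v t \<in> acarrier B \<and> asort B (teval (aint B) v t) = psort Sg p t" if "t \<in> set ts" for t
    by (rule teval_wtm[OF assms(1)]) (use assms that in \<open>auto simp: list_all_iff\<close>)
  then have "map (asort B) (map (teval (aint B) v) ts) = map (psort Sg p) ts" by simp
  then show ?thesis using * assms(2) by (auto simp: aargs_def simp del: map_map map_eq_conv)
qed

lemma ahom_teval:
  assumes "is_alg U S Sg A" "h \<in> ahom Sg A B" "wtm Sg p t" "\<And>x. x \<in> tvars t \<Longrightarrow> v x \<in> acarrier A \<and> asort A (v x) = p x"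
  shows "h (teval (aint A) v t) = teval (aint B) (\<lambda>x. h (v x)) t"
  using assms(3,4)
proof (induction t)
  case (App f ts)
  have "h (teval (aint A) v t) = teval (aint B) (\<lambda>x. h (v x)) t" if "t \<in> set ts" for t
    using App that by (auto simp: list_all_iff)
  then have "map h (map (teval (aint A) v) ts) = map (teval (aint B) (\<lambda>x. h (v x))) ts" by simp
  moreover have "f \<in> symbols Sg" using App.prems(1) by simp
  ultimately show ?case using ahomD(4)[OF assms(2) _ teval_aargs[OF assms(1) App.prems]]
    by (simp only: teval.simps)
qed simp

section \<open>Presentations\<close>

text \<open>The functor that a presented algebra represents. Generators have type
  \<open>nat \<times> 'x\<close> because variables of terms are pairs with a number; their sorts are
  given by p.\<close>

definition assign :: "(nat \<times> 'x \<Rightarrow> 's) \<Rightarrow> (nat \<times> 'x) set \<Rightarrow> (('f, 'x) trm \<times> ('f, 'x) trm) set \<Rightarrow>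
    ('f, 's, 'u) alg \<Rightarrow> (nat \<times> 'x \<Rightarrow> 'u) \<Rightarrow> bool" where
  "assign p G R B v \<longleftrightarrow> (\<forall>x\<in>G. v x \<in> acarrier B \<and> asort B (v x) = p x) \<and>
     (\<forall>(t, t')\<in>R. teval (aint B) v t = teval (aint B) v t')"

definition relators :: "('f, 's) signature \<Rightarrow> (nat \<times> 'x \<Rightarrow> 's) \<Rightarrow> (nat \<times> 'x) set \<Rightarrow> (('f, 'x) trm \<times> ('f, 'x) trm) set" where
  "relators Sg p G = {(t, t'). wtm Sg p t \<and> wtm Sg p t' \<and> tvars t \<subseteq> G \<and> tvars t' \<subseteq> G \<and> psort Sg p t = psort Sg p t'}"

lemma assign_ahom:
  assumes "is_alg U S Sg A" "R \<subseteq> relators Sg p G" "assign p G R A v" "h \<in> ahom Sg A B"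
  shows "assign p G R B (\<lambda>x. h (v x))"
proof -
  have "teval (aint B) (\<lambda>x. h (v x)) t = teval (aint B) (\<lambda>x. h (v x)) t'" if "(t, t') \<in> R" for t t'
  proof -
    have *: "(t, t') \<in> relators Sg p G" using that assms(2) by blast
    have "h (teval (aint A) v s) = teval (aint B) (\<lambda>x. h (v x)) s" if "s = t \<or> s = t'" for s
      by (rule ahom_teval[OF assms(1,4), where p=p]) (use that * assms(3) in \<open>auto simp: relators_def assign_def\<close>)
    moreover have "teval (aint A) v t = teval (aint A) v t'" using assms(3) that by (auto simp: assign_def)
    ultimately show ?thesis by metis
  qed
  then show ?thesis using assms(3) ahomD(1,2)[OF assms(4)] unfolding assign_def by auto
qed

locale variety_spec =
  fixes U :: "'u set set" and S :: "'s set" and Sg :: "('f, 's) signature" and E :: "(('f, 's) trm \<times> ('f, 's) trm) set"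
  assumes univ: "universe U" and small_symbols: "small U (symbols Sg)"
    and sig: "\<And>f. f \<in> symbols Sg \<Longrightarrow> set (arity Sg f) \<subseteq> S \<and> result Sg f \<in> S"
    and eqs: "\<And>t t'. (t, t') \<in> E \<Longrightarrow> well_sorted S Sg t \<and> well_sorted S Sg t' \<and> tsort Sg t = tsort Sg t'"
begin

abbreviation "Model \<equiv> model U S Sg E"
abbreviation "Hom \<equiv> ahom Sg"
abbreviation "D \<equiv> alg_cat U S Sg E"

text \<open>A representation of the functor of assignments, with q as the universal assignment.
  Uniqueness can be literal equality because homomorphisms are extensional functions.\<close>

definition presents :: "(nat \<times> 'x \<Rightarrow> 's) \<Rightarrow> (nat \<times> 'x) set \<Rightarrow> (('f, 'x) trm \<times> ('f, 'x) trm) set \<Rightarrow>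
    ('f, 's, 'u) alg \<Rightarrow> (nat \<times> 'x \<Rightarrow> 'u) \<Rightarrow> bool" where
  "presents p G R A q \<longleftrightarrow> Model A \<and> R \<subseteq> relators Sg p G \<and> assign p G R A q \<and>
     (\<forall>B v. Model B \<and> assign p G R B v \<longrightarrow> (\<exists>h\<in>Hom A B. \<forall>x\<in>G. h (q x) = v x)) \<and>
     (\<forall>B. \<forall>h\<in>Hom A B. \<forall>h'\<in>Hom A B. Model B \<and> (\<forall>x\<in>G. h (q x) = h' (q x)) \<longrightarrow> h = h')"

text \<open>
  Two terms are identified if they are equal in every model in which the relators hold. This gives
  the congruence generated by the relators and the equations without any syntactic deduction.
\<close>

lemma presentation_exists:
  fixes p :: "nat \<times> 'x \<Rightarrow> 's"
  assumes G: "small U G" and p: "\<And>x. x \<in> G \<Longrightarrow> p x \<in> S" and R: "R \<subseteq> relators Sg p G"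
  obtains A q where "presents p G R A q"
proof -
  define T where "T = {t. wtm Sg p t \<and> tvars t \<subseteq> G}"
  \<comment> \<open>Equality of sorts is a clause of its own: equality of values forces it only
    where some model with an assignment is available.\<close>
  define r where "r t t' \<longleftrightarrow> psort Sg p t = psort Sg p t' \<and>
    (\<forall>B v. Model B \<and> assign p G R B v \<longrightarrow> teval (aint B) v t = teval (aint B) v t')" for t t'
  have "small U T" unfolding T_def
    by (rule small_subset[OF small_terms[OF univ small_symbols G]]) (auto dest: wtm_symbols)
  then obtain e :: "('f, 'x) trm \<Rightarrow> 'u" where eU: "e ` T \<in> U" and e: "\<And>t t'. t \<in> T \<Longrightarrow> t' \<in> T \<Longrightarrow> e t = e t' \<longleftrightarrow> r t t'"
    by (rule small_quotient_code[OF univ, of T r]) (auto simp: r_def)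
  \<comment> \<open>A representative term for each code; the choice matters only up to
    \<open>r\<close>.\<close>
  define q where "q a = (SOME t. t \<in> T \<and> e t = a)" for a
  have q: "q a \<in> T" "e (q a) = a" if "a \<in> e ` T" for a
    using someI_ex[of "\<lambda>t. t \<in> T \<and> e t = a"] that unfolding q_def by auto
  have qe: "r (q (e t)) t" if "t \<in> T" for t using e[of "q (e t)" t] q[of "e t"] that by auto
  \<comment> \<open>The operations act on representatives. Off the well-sorted arguments the value
    is \<open>undefined\<close>, as \<open>is_alg\<close> demands.\<close>
  define A where "A = \<lparr>acarrier = e ` T, asort = (\<lambda>a\<in>e ` T. psort Sg p (q a)),
    aint = (\<lambda>f xs. if f \<in> symbols Sg \<and> set xs \<subseteq> e ` T \<and> map (\<lambda>a\<in>e ` T. psort Sg p (q a)) xs = arity Sg f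
      then e (App f (map q xs)) else undefined)\<rparr>"
  have car: "acarrier A = e ` T" by (simp add: A_def)
  have srt: "asort A (e t) = psort Sg p t" if "t \<in> T" for t
    using that qe[OF that] by (auto simp: A_def r_def)
  have args: "xs \<in> aargs Sg A f \<longleftrightarrow> set xs \<subseteq> e ` T \<and> map (\<lambda>a\<in>e ` T. psort Sg p (q a)) xs = arity Sg f" for xs f
    by (simp add: aargs_def A_def)
  have psort_S: "psort Sg p t \<in> S" if "t \<in> T" for t
    using that p sig by (cases t) (auto simp: T_def)
  have AppT: "App f (map q xs) \<in> T" "map e (map q xs) = xs" if "f \<in> symbols Sg" "xs \<in> aargs Sg A f" for f xs
  proof -
    have "map (psort Sg p) (map q xs) = map (\<lambda>a\<in>e ` T. psort Sg p (q a)) xs"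
      using that(2) unfolding args map_map by (intro map_cong) auto
    moreover have "q x \<in> T" if "x \<in> set xs" for x using that \<open>xs \<in> aargs Sg A f\<close> q(1) by (auto simp: args)
    ultimately show "App f (map q xs) \<in> T" using that
      by (auto simp: args T_def list_all_iff simp del: map_map map_eq_conv)
    have "e (q x) = x" if "x \<in> set xs" for x using that \<open>xs \<in> aargs Sg A f\<close> q(2) by (auto simp: args)
    then show "map e (map q xs) = xs" by (simp add: map_idI)
  qed
  have aint_e: "aint A f (map e ts) = e (App f ts)" "map e ts \<in> aargs Sg A f" if "App f ts \<in> T" for f ts
  proof -
    have ts: "t \<in> T" if "t \<in> set ts" for t using \<open>App f ts \<in> T\<close> that by (auto simp: T_def list_all_iff)
    have f: "f \<in> symbols Sg" using that by (simp add: T_def)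
    have "map (asort A) (map e ts) = map (psort Sg p) ts" using ts srt by simp
    then show args': "map e ts \<in> aargs Sg A f" using ts that by (auto simp: aargs_def car T_def simp del: map_map map_eq_conv)
    have "aint A f (map e ts) = e (App f (map q (map e ts)))" using args' f unfolding args by (simp add: A_def)
    \<comment> \<open>\<open>r\<close> is a congruence: the value of \<open>App f ts\<close> depends
      on the arguments only through their values.\<close>
    also have "\<dots> = e (App f ts)"
    proof (subst e[OF AppT(1)[OF f args'] that])
      have "teval (aint B) v (q (e t)) = teval (aint B) v t" if "t \<in> set ts" "Model B" "assign p G R B v" for B v t
        using qe[OF ts[OF that(1)]] that unfolding r_def by blast
      then have "map (teval (aint B) v) (map q (map e ts)) = map (teval (aint B) v) ts"
        if "Model B" "assign p G R B v" for B v
        using that by simp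
      then show "r (App f (map q (map e ts))) (App f ts)" unfolding r_def by (simp del: map_map map_eq_conv)
    qed
    finally show "aint A f (map e ts) = e (App f ts)" .
  qed
  have aintA: "aint A f xs = e (App f (map q xs))" if "f \<in> symbols Sg" "xs \<in> aargs Sg A f" for f xs
    using aint_e(1)[OF AppT(1)[OF that]] AppT(2)[OF that] by simp
  have algA: "is_alg U S Sg A" unfolding is_alg_def
  proof (intro conjI allI)
    show "acarrier A \<in> U" by (simp add: car eU)
    show "asort A \<in> acarrier A \<rightarrow>\<^sub>E S" using psort_S q(1) by (auto simp: A_def)
    show "if f \<in> symbols Sg \<and> xs \<in> aargs Sg A f then aint A f xs \<in> acarrier A \<and> asort A (aint A f xs) = result Sg f
      else aint A f xs = undefined" for f xs
    proof (cases "f \<in> symbols Sg \<and> xs \<in> aargs Sg A f")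
      case True
      then show ?thesis using aintA[of f xs] AppT(1)[of f xs] srt[of "App f (map q xs)"] by (simp add: car)
    next
      case False
      then show ?thesis unfolding args by (auto simp: A_def)
    qed
  qed
  have sat: "satisfies A (t, t')" if tt': "(t, t') \<in> E" for t t'
    unfolding satisfies_def prod.case
  proof (intro allI impI)
    fix v :: "nat \<times> 's \<Rightarrow> 'u" assume v: "\<forall>x\<in>tvars t \<union> tvars t'. v x \<in> acarrier A \<and> asort A (v x) = snd x"
    have wt: "wtm Sg snd t" "wtm Sg snd t'" "psort Sg snd t = psort Sg snd t'"
      using eqs[OF tt'] by (auto simp: well_sorted_wtm tsort_psort)
    \<comment> \<open>The values of the variables are classes of terms, so choosing representatives
      turns the valuation into a substitution.\<close>
    define \<sigma> where "\<sigma> x = q (v x)" for x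
    have \<sigma>: "wtm Sg p (\<sigma> x) \<and> psort Sg p (\<sigma> x) = snd x \<and> tvars (\<sigma> x) \<subseteq> G" "e (\<sigma> x) = v x" if "x \<in> tvars t \<union> tvars t'" for x
    proof -
      have vx: "v x \<in> e ` T" "asort A (v x) = snd x" using v that by (auto simp: car)
      then show "wtm Sg p (\<sigma> x) \<and> psort Sg p (\<sigma> x) = snd x \<and> tvars (\<sigma> x) \<subseteq> G" "e (\<sigma> x) = v x"
        using q[OF vx(1)] srt[OF q(1)[OF vx(1)]] by (auto simp: \<sigma>_def T_def)
    qed
    have ev: "teval (aint A) v s = e (tsubst \<sigma> s)" "tsubst \<sigma> s \<in> T" "psort Sg p (tsubst \<sigma> s) = psort Sg snd s"
      if s: "s = t \<or> s = t'" for s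
    proof -
      have \<sigma>s: "x \<in> tvars s \<Longrightarrow> wtm Sg p (\<sigma> x) \<and> psort Sg p (\<sigma> x) = snd x \<and> tvars (\<sigma> x) \<subseteq> G" for x using \<sigma>(1) s by blast
      have wts: "wtm Sg snd s" using s wt by blast
      have "teval (aint A) v s = teval (aint A) (\<lambda>x. e (\<sigma> x)) s" by (rule teval_cong) (use \<sigma>(2) s in auto)
      also have "\<dots> = e (tsubst \<sigma> s)"
        by (rule teval_tsubst_quotient[where G=G and p=p and p'=snd and Sg=Sg])
          (use aint_e(1) wts \<sigma>s in \<open>auto simp: T_def\<close>)
      finally show "teval (aint A) v s = e (tsubst \<sigma> s)" .
      show "tsubst \<sigma> s \<in> T" "psort Sg p (tsubst \<sigma> s) = psort Sg snd s"
        using wtm_tsubst[OF wts, of p \<sigma>] \<sigma>s unfolding T_def by (auto simp: tvars_tsubst)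
    qed
    \<comment> \<open>In a model B with an assignment, the substituted terms are the two sides of
      the equation taken at the values of the \<open>\<sigma> x\<close>, so the equation in B
      applies.\<close>
    have "r (tsubst \<sigma> t) (tsubst \<sigma> t')" unfolding r_def
    proof (intro conjI allI impI)
      show "psort Sg p (tsubst \<sigma> t) = psort Sg p (tsubst \<sigma> t')" using ev(3) wt(3) by simp
      fix B w assume Bw: "Model B \<and> assign p G R B w"
      then have B: "is_alg U S Sg B" "satisfies B (t, t')" using tt' by (auto simp: model_def)
      have "teval (aint B) w (\<sigma> x) \<in> acarrier B \<and> asort B (teval (aint B) w (\<sigma> x)) = snd x" if "x \<in> tvars t \<union> tvars t'" for x
        using teval_wtm[OF B(1), of p "\<sigma> x" w] \<sigma>(1)[OF that] Bw by (auto simp: assign_def)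
      then have "teval (aint B) (\<lambda>x. teval (aint B) w (\<sigma> x)) t = teval (aint B) (\<lambda>x. teval (aint B) w (\<sigma> x)) t'"
        using B(2) unfolding satisfies_def by auto
      then show "teval (aint B) w (tsubst \<sigma> t) = teval (aint B) w (tsubst \<sigma> t')" by (simp add: teval_tsubst)
    qed
    then show "teval (aint A) v t = teval (aint A) v t'" using ev e by auto
  qed
  have modA: "Model A" using algA sat by (auto simp: model_def)
  have VarT: "Var x \<in> T" if "x \<in> G" for x using that by (simp add: T_def)
  have evA: "teval (aint A) (\<lambda>x. e (Var x)) t = e t" if "t \<in> T" for t
    using teval_tsubst_quotient[where G=G and p=p and p'=p and Sg=Sg and t=t and \<sigma>=Var and e=e and I="aint A"] aint_e(1) that
    by (auto simp: T_def tsubst_Var)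
  have "assign p G R A (\<lambda>x. e (Var x))" unfolding assign_def
  proof (intro conjI ballI, goal_cases)
    case (3 z)
    obtain t t' where z: "z = (t, t')" by (cases z)
    then have tt: "t \<in> T" "t' \<in> T" "psort Sg p t = psort Sg p t'" using 3 R by (auto simp: relators_def T_def)
    have "r t t'" unfolding r_def using tt(3) 3 z by (auto simp: assign_def)
    then show ?case using evA tt e z by auto
  qed (use VarT srt car in auto)
  moreover have "\<exists>h\<in>Hom A B. \<forall>x\<in>G. h (e (Var x)) = v x" if B: "Model B" and v: "assign p G R B v" for B v
  proof -
    \<comment> \<open>Independent of representatives because B and v are among the models and
      assignments quantified over in \<open>r\<close>.\<close>
    define h where "h = (\<lambda>a\<in>e ` T. teval (aint B) v (q a))"
    have he: "h (e t) = teval (aint B) v t" if "t \<in> T" for t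
      using qe[OF that] B v that unfolding h_def r_def by auto
    have algB: "is_alg U S Sg B" using B by (simp add: model_def)
    have tv: "teval (aint B) v t \<in> acarrier B \<and> asort B (teval (aint B) v t) = psort Sg p t" if "t \<in> T" for t
      by (rule teval_wtm[OF algB]) (use that v in \<open>auto simp: T_def assign_def\<close>)
    have "h \<in> Hom A B" unfolding ahom_def
    proof (intro CollectI conjI ballI)
      show "h \<in> acarrier A \<rightarrow>\<^sub>E acarrier B" using he tv by (auto simp: car h_def q(1))
      show "asort B (h x) = asort A x" if "x \<in> acarrier A" for x using that he tv srt by (auto simp: car)
      fix f xs assume f: "f \<in> symbols Sg" and xs: "xs \<in> aargs Sg A f"
      have "map h xs = map (teval (aint B) v) (map q xs)" using xs by (auto simp: h_def args)
      then show "h (aint A f xs) = aint B f (map h xs)" using aintA[OF f xs] he[OF AppT(1)[OF f xs]] by (simp only: teval.simps)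
    qed
    then show ?thesis using he VarT by (intro bexI[of _ h]) auto
  qed
  \<comment> \<open>Homomorphisms that agree on generators are equal because every class is the
    value of a term at the generators.\<close>
  moreover have "h = h'" if h: "h \<in> Hom A B" "h' \<in> Hom A B" "Model B" "\<forall>x\<in>G. h (e (Var x)) = h' (e (Var x))" for B h h'
  proof (rule ahom_ext[OF h(1,2)])
    fix x assume "x \<in> acarrier A"
    then obtain t where t: "t \<in> T" "x = e t" by (auto simp: car)
    have "e (Var x) \<in> acarrier A \<and> asort A (e (Var x)) = p x" if "x \<in> tvars t" for x
    proof -
      have "x \<in> G" using that t(1) by (auto simp: T_def)
      then show ?thesis using VarT srt[OF VarT] by (simp add: car)
    qed
    then have *: "g (e t) = teval (aint B) (\<lambda>x. g (e (Var x))) t" if "g \<in> Hom A B" for g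
      using ahom_teval[OF algA that, of p t "\<lambda>x. e (Var x)"] evA[OF t(1)] t(1) by (simp add: T_def)
    have "teval (aint B) (\<lambda>x. h (e (Var x))) t = teval (aint B) (\<lambda>x. h' (e (Var x))) t"
      by (rule teval_cong) (use t(1) h(4) in \<open>auto simp: T_def\<close>)
    then show "h x = h' x" using * h t(2) by simp
  qed
  ultimately show ?thesis using that[of A "\<lambda>x. e (Var x)"] modA R unfolding presents_def by blast
qed

end

section \<open>Categories of algebras\<close>

lemma alg_cat_eq:
  "alg_cat U S Sg E = mk_cat (Collect (model U S Sg E)) (ahom Sg) (\<lambda>A. \<lambda>x\<in>acarrier A. x) (\<lambda>A. compose (acarrier A))"
  unfolding alg_cat_def model_def ahom_def ..

lemma ahom_compose:
  assumes "is_alg U S Sg A" "h \<in> ahom Sg A B" "g \<in> ahom Sg B C"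
  shows "compose (acarrier A) g h \<in> ahom Sg A C"
proof -
  have "map (compose (acarrier A) g h) xs = map g (map h xs)" if "xs \<in> aargs Sg A f" for xs f
    using that by (auto simp: aargs_def compose_def)
  then show ?thesis
    using ahomD[OF assms(2)] ahomD[OF assms(3)] is_algD(4)[OF assms(1)]
    unfolding ahom_def by (auto simp: compose_def simp del: map_map)
qed

lemma ahom_id:
  assumes "is_alg U S Sg A"
  shows "(\<lambda>x\<in>acarrier A. x) \<in> ahom Sg A A"
proof -
  have "map (\<lambda>x\<in>acarrier A. x) xs = xs" if "xs \<in> aargs Sg A f" for xs f
    using that by (auto simp: aargs_def intro!: map_idI)
  then show ?thesis using is_algD(4)[OF assms] unfolding ahom_def by auto
qed

lemma is_cat_alg_cat: "is_cat (alg_cat U S Sg E)"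
  unfolding alg_cat_eq
proof (rule is_cat_mk_cat)
  fix A B f assume f: "f \<in> ahom Sg A B"
  then have "f \<in> acarrier A \<rightarrow> acarrier B" "f \<in> extensional (acarrier A)" by (auto simp: ahom_def PiE_def)
  then show "compose (acarrier A) f (\<lambda>x\<in>acarrier A. x) = f" "compose (acarrier A) (\<lambda>x\<in>acarrier B. x) f = f"
    by (auto simp: compose_def extensional_def fun_eq_iff Pi_def)
next
  fix A B C f g and D :: "('a, 'b, 'c) alg" and h assume "f \<in> ahom Sg A B" "g \<in> ahom Sg B C" "h \<in> ahom Sg C D"
  then show "compose (acarrier A) h (compose (acarrier A) g f) = compose (acarrier A) (compose (acarrier B) h g) f"
    by (auto simp: compose_def fun_eq_iff ahomD(1))
qed (auto simp: model_def intro: ahom_id ahom_compose)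

lemma sets_over_Ob: "(X, p) \<in> Ob (sets_over U S) \<longleftrightarrow> X \<in> U \<and> p \<in> X \<rightarrow>\<^sub>E S"
  by (simp add: sets_over_def)

lemma sets_over_arrows:
  "x \<in> arrows (sets_over U S) A B \<longleftrightarrow> (\<exists>h. x = (A, h, B) \<and> A \<in> Ob (sets_over U S) \<and> B \<in> Ob (sets_over U S) \<and>
     h \<in> fst A \<rightarrow>\<^sub>E fst B \<and> (\<forall>x\<in>fst A. snd B (h x) = snd A x))"
  by (cases A; cases B) (auto simp: sets_over_def arrows_mk_cat)

lemma sets_over_Cmp: "Cmp (sets_over U S) (B', g, C) (A, f, B) = (A, compose (fst A) g f, C)"
  by (cases A) (simp add: sets_over_def)

lemma sets_over_Cmp_eq:
  "f = (A, f', B) \<Longrightarrow> g = (B', g', C) \<Longrightarrow> Cmp (sets_over U S) g f = (A, compose (fst A) g' f', C)"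
  by (simp add: sets_over_Cmp)

lemma sets_over_Ide: "Ide (sets_over U S) A = (A, \<lambda>x\<in>fst A. x, A)"
  by (cases A) (simp add: sets_over_def)

lemma is_cat_sets_over: "is_cat (sets_over U S)"
  unfolding sets_over_def
proof (rule is_cat_mk_cat, goal_cases)
  case (1 A)
  then show ?case by (cases A) auto
next
  case (2 A B C f g)
  then show ?case by (cases A; cases B; cases C) (simp add: compose_def PiE_iff)
next
  case (3 A B f)
  then show ?case by (cases A; cases B) (simp add: compose_def fun_eq_iff PiE_iff extensional_def)
next
  case (4 A B f)
  then show ?case by (cases A; cases B) (simp add: compose_def fun_eq_iff PiE_iff extensional_def)
next
  case (5 A B C D f g h)
  then show ?case by (cases A; cases B; cases C; cases D) (simp add: compose_def fun_eq_iff PiE_iff)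
qed

lemma alg_forget_simps [simp]:
  "fob alg_forget A = (acarrier A, asort A)"
  "far alg_forget (A, h, B) = ((acarrier A, asort A), h, (acarrier B, asort B))"
  by (simp_all add: alg_forget_def)

context variety_spec
begin

abbreviation "SO \<equiv> sets_over U S"

lemma Ob_D: "A \<in> Ob D \<longleftrightarrow> Model A"
  by (simp add: alg_cat_eq)

lemma arrows_D: "x \<in> arrows D A B \<longleftrightarrow> (\<exists>h. x = (A, h, B) \<and> Model A \<and> Model B \<and> h \<in> Hom A B)"
  by (simp add: alg_cat_eq arrows_mk_cat)

lemma Cmp_D: "Cmp D (B', g, C) (A, h, B) = (A, compose (acarrier A) g h, C)"
  by (simp add: alg_cat_eq)

lemma Ide_D: "Ide D A = (A, \<lambda>x\<in>acarrier A. x, A)"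
  by (simp add: alg_cat_eq)

lemma Model_alg: "Model A \<Longrightarrow> is_alg U S Sg A"
  by (simp add: model_def)

lemma forget_Ob: "Model A \<Longrightarrow> (acarrier A, asort A) \<in> Ob SO"
  by (simp add: sets_over_Ob model_def is_alg_def)

lemma forget_functor: "is_functor D SO alg_forget"
proof (rule is_functorI[OF is_cat_alg_cat is_cat_sets_over])
  show "far alg_forget f \<in> arrows SO (fob alg_forget A) (fob alg_forget B)" if "f \<in> arrows D A B" for f A B
    using that forget_Ob[of A] forget_Ob[of B] by (auto simp: arrows_D sets_over_arrows ahom_def)
qed (auto simp: Ob_D forget_Ob Ide_D sets_over_Ide arrows_D Cmp_D sets_over_Cmp)

abbreviation "fun_of x \<equiv> fst (snd x)"

lemma diagram_arrow:
  assumes "is_functor J D X" "u \<in> arrows J i j"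
  shows "far X u = (fob X i, fun_of (far X u), fob X j)" "fun_of (far X u) \<in> Hom (fob X i) (fob X j)"
  using functor_arrow[OF assms] by (auto simp: arrows_D)

lemma diagram_Model: "is_functor J D X \<Longrightarrow> i \<in> Ob J \<Longrightarrow> Model (fob X i)"
  by (metis functor_ob Ob_D)

lemma diagram_filtered:
  assumes X: "is_functor J D X" and filt: "filtered J"
  shows "filtered_diagram J (\<lambda>i. acarrier (fob X i)) (\<lambda>u. fun_of (far X u))"
proof
  show "is_cat J" "filtered J" by (rule functor_cats[OF X], rule filt)
  show "fun_of (far X u) x \<in> acarrier (fob X j)" if "u \<in> arrows J i j" "x \<in> acarrier (fob X i)" for u i j x
    using ahomD(1)[OF diagram_arrow(2)[OF X that(1)] that(2)] .
  fix u v i j k x assume u: "u \<in> arrows J i j" and v: "v \<in> arrows J j k" and x: "x \<in> acarrier (fob X i)"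
  have "far X (Cmp J v u) = Cmp D (fob X j, fun_of (far X v), fob X k) (fob X i, fun_of (far X u), fob X j)"
    using functor_Cmp[OF X v u] diagram_arrow(1)[OF X u] diagram_arrow(1)[OF X v] by simp
  then show "fun_of (far X (Cmp J v u)) x = fun_of (far X v) (fun_of (far X u) x)"
    using x by (simp add: Cmp_D compose_def)
next
  fix i x assume "i \<in> Ob J" "x \<in> acarrier (fob X i)"
  then show "fun_of (far X (Ide J i)) x = x" using functor_Ide[OF X] by (simp add: Ide_D)
qed

text \<open>It suffices that the carriers form the filtered colimit of sets. The induced function
  preserves an operation because its finitely many arguments come from a single stage, whose leg and
  cocone arrow are homomorphisms.\<close>

lemma elementwise_alg_colimit:
  assumes X: "is_functor J D X" and filt: "filtered J" and C: "Model C"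
    and l: "\<And>i. i \<in> Ob J \<Longrightarrow> l i \<in> arrows D (fob X i) C"
    and el: "elementwise_colimit J (\<lambda>i. acarrier (fob X i)) (\<lambda>u. fun_of (far X u)) (acarrier C) (\<lambda>i. fun_of (l i))"
  shows "is_colimit D J X C l"
proof -
  interpret filtered_colimit J "\<lambda>i. acarrier (fob X i)" "\<lambda>u. fun_of (far X u)" "acarrier C" "\<lambda>i. fun_of (l i)"
    using diagram_filtered[OF X filt] el by (simp add: filtered_colimit_def filtered_colimit_axioms_def)
  have lD: "l i = (fob X i, fun_of (l i), C)" "fun_of (l i) \<in> Hom (fob X i) C" if "i \<in> Ob J" for i
    using l[OF that] by (auto simp: arrows_D)
  have eqI: "fun_of f = fun_of g \<Longrightarrow> f = g" if "f \<in> arrows D A B" "g \<in> arrows D A B" for f g A B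
    using that by (auto simp: arrows_D)
  show ?thesis
  proof (rule is_colimitI)
    show "is_cocone D J X C l"
    proof (rule is_coconeI[OF J])
      fix u i j assume u: "u \<in> arrows J i j"
      note i = arrowsD(1)[OF J u] and j = arrowsD(2)[OF J u]
      have "compose (acarrier (fob X i)) (fun_of (l j)) (fun_of (far X u)) = fun_of (l i)"
        using leg_Xm[OF u] ahomD(3)[OF lD(2)[OF i]] by (auto simp: compose_def fun_eq_iff)
      then show "Cmp D (l j) (far X u) = l i"
        using lD(1)[OF i] lD(1)[OF j] diagram_arrow(1)[OF X u] Cmp_D by metis
    qed (simp_all add: Ob_D C l)
  next
    fix B k assume cc: "is_cocone D J X B k"
    then have B: "Model B" and karr: "\<And>i. i \<in> Ob J \<Longrightarrow> k i \<in> arrows D (fob X i) B"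
      and kX: "\<And>u i j. u \<in> arrows J i j \<Longrightarrow> Cmp D (k j) (far X u) = k i"
      by (auto simp: is_cocone_def Ob_D arrows_def)
    have kD: "k i = (fob X i, fun_of (k i), B)" "fun_of (k i) \<in> Hom (fob X i) B" if "i \<in> Ob J" for i
      using karr[OF that] by (auto simp: arrows_D)
    have "fun_of (k j) (fun_of (far X u) x) = fun_of (k i) x" if u: "u \<in> arrows J i j" and x: "x \<in> acarrier (fob X i)" for u i j x
    proof -
      have "fun_of (k i) = compose (acarrier (fob X i)) (fun_of (k j)) (fun_of (far X u))"
        using kX[OF u] kD(1)[OF arrowsD(2)[OF J u]] diagram_arrow(1)[OF X u] Cmp_D by (metis fst_conv snd_conv)
      then show ?thesis using x by (simp add: compose_def)
    qed
    then obtain h0 where h0: "\<And>i x. i \<in> Ob J \<Longrightarrow> x \<in> acarrier (fob X i) \<Longrightarrow> h0 (fun_of (l i) x) = fun_of (k i) x"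
      using factor[of "\<lambda>i. fun_of (k i)"] by blast
    define h where "h = restrict h0 (acarrier C)"
    have hl: "h (fun_of (l i) x) = fun_of (k i) x" if "i \<in> Ob J" "x \<in> acarrier (fob X i)" for i x
      using h0[OF that] leg[OF that] by (simp add: h_def)
    have hB: "h c \<in> acarrier B \<and> asort B (h c) = asort C c" if c: "c \<in> acarrier C" for c
    proof -
      obtain i x where i: "i \<in> Ob J" "x \<in> acarrier (fob X i)" "fun_of (l i) x = c" using leg_surj[OF c] by blast
      then show ?thesis using hl[OF i(1,2)] ahomD(1,2)[OF kD(2)[OF i(1)] i(2)] ahomD(2)[OF lD(2)[OF i(1)] i(2)] by simp
    qed
    have "h \<in> Hom C B" unfolding ahom_def
    proof (intro CollectI conjI ballI)
      show "h \<in> acarrier C \<rightarrow>\<^sub>E acarrier B" using hB by (auto simp: h_def)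
      show "asort B (h c) = asort C c" if "c \<in> acarrier C" for c using hB that by blast
      fix f cs assume f: "f \<in> symbols Sg" and cs: "cs \<in> aargs Sg C f"
      obtain i s where i: "i \<in> Ob J" and s: "\<And>c. c \<in> set cs \<Longrightarrow> s c \<in> acarrier (fob X i) \<and> fun_of (l i) (s c) = c"
        using finite_stage[of "set cs"] cs by (auto simp: aargs_def)
      have eq: "map (fun_of (l i)) (map s cs) = cs" using s by (simp add: map_idI)
      have "map (asort (fob X i)) (map s cs) = map (asort C) cs" using ahomD(2)[OF lD(2)[OF i]] s by force
      then have xs: "map s cs \<in> aargs Sg (fob X i) f" using cs s by (auto simp: aargs_def simp del: map_map map_eq_conv)
      have "h (aint C f cs) = h (fun_of (l i) (aint (fob X i) f (map s cs)))"
        using ahomD(4)[OF lD(2)[OF i] f xs] eq by simp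
      also have "\<dots> = fun_of (k i) (aint (fob X i) f (map s cs))"
        using hl[OF i is_algD(4)[OF Model_alg[OF diagram_Model[OF X i]] f xs]] .
      also have "\<dots> = aint B f (map (fun_of (k i)) (map s cs))" using ahomD(4)[OF kD(2)[OF i] f xs] .
      also have "map (fun_of (k i)) (map s cs) = map h (map (fun_of (l i)) (map s cs))"
      proof -
        have "fun_of (k i) (s c) = h c" if "c \<in> set cs" for c
          using hl[OF i, of "s c"] s[OF that] by simp
        then show ?thesis unfolding eq by simp
      qed
      finally show "h (aint C f cs) = aint B f (map h cs)" by (simp only: eq)
    qed
    then have harr: "(C, h, B) \<in> arrows D C B" by (simp add: arrows_D B C)
    show "\<exists>h\<in>arrows D C B. \<forall>i\<in>Ob J. Cmp D h (l i) = k i"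
    proof (intro bexI[OF _ harr] ballI)
      fix i assume i: "i \<in> Ob J"
      have "compose (acarrier (fob X i)) h (fun_of (l i)) = fun_of (k i)"
        using hl[OF i] ahomD(3)[OF kD(2)[OF i]] by (auto simp: compose_def fun_eq_iff)
      then show "Cmp D (C, h, B) (l i) = k i" using lD(1)[OF i] kD(1)[OF i] Cmp_D by metis
    qed
  next
    fix B h h' assume h: "h \<in> arrows D C B" and h': "h' \<in> arrows D C B"
      and eq: "\<And>i. i \<in> Ob J \<Longrightarrow> Cmp D h (l i) = Cmp D h' (l i)"
    have ev: "fun_of (Cmp D g (l i)) x = fun_of g (fun_of (l i) x)"
      if "g \<in> arrows D C B" "i \<in> Ob J" "x \<in> acarrier (fob X i)" for g i x
    proof -
      have "g = (C, fun_of g, B)" using that(1) by (auto simp: arrows_D)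
      then have "fun_of (Cmp D g (l i)) = compose (acarrier (fob X i)) (fun_of g) (fun_of (l i))"
        using lD(1)[OF that(2)] Cmp_D by (metis fst_conv snd_conv)
      then show ?thesis using that(3) by (simp add: compose_def)
    qed
    show "h = h'"
    proof (rule eqI[OF h h'], rule ahom_ext)
      show "fun_of h \<in> Hom C B" "fun_of h' \<in> Hom C B" using h h' by (auto simp: arrows_D)
      fix c assume "c \<in> acarrier C"
      then obtain i x where i: "i \<in> Ob J" "x \<in> acarrier (fob X i)" "fun_of (l i) x = c" using leg_surj by blast
      show "fun_of h c = fun_of h' c" using ev[OF h i(1,2)] ev[OF h' i(1,2)] eq[OF i(1)] i(3) by simp
    qed
  qed
qed

text \<open>The colimit of the carriers inherits sorts, operations and equations from the stages, as
  each instance of these involves finitely many elements.\<close>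

lemma alg_filtered_colimit_exists:
  assumes X: "is_functor J D X" and filt: "filtered J" and small: "small_cat U J"
  obtains C l where "Model C" "\<And>i. i \<in> Ob J \<Longrightarrow> l i \<in> arrows D (fob X i) C"
    "elementwise_colimit J (\<lambda>i. acarrier (fob X i)) (\<lambda>u. fun_of (far X u)) (acarrier C) (\<lambda>i. fun_of (l i))"
proof -
  let ?X = "\<lambda>i. acarrier (fob X i)" and ?m = "\<lambda>u. fun_of (far X u)"
  interpret fd: filtered_diagram J ?X ?m by (rule diagram_filtered[OF X filt])
  note XM = diagram_Model[OF X] and Xh = diagram_arrow(2)[OF X]
  \<comment> \<open>The disjoint union of the carriers; its quotient by \<open>merges\<close> is
    coded in the universe.\<close>
  define T where "T = Sigma (Ob J) ?X"
  have smT: "small U T" unfolding T_def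
    using small XM by (intro small_Sigma univ small_member) (auto simp: small_cat_def model_def is_alg_def)
  obtain e where eU: "e ` T \<in> U"
    and e': "\<And>a b. a \<in> T \<Longrightarrow> b \<in> T \<Longrightarrow> e a = e b \<longleftrightarrow> merges J ?m (fst a) (snd a) (fst b) (snd b)"
    by (rule small_quotient_code[OF univ smT, of "\<lambda>a b. merges J ?m (fst a) (snd a) (fst b) (snd b)"])
      (auto simp: T_def intro: fd.merges_refl fd.merges_sym fd.merges_trans)
  have el: "elementwise_colimit J ?X ?m (e ` T) (\<lambda>i x. e (i, x))"
    unfolding elementwise_colimit_def using e' by (force simp: T_def)
  interpret filtered_colimit J ?X ?m "e ` T" "\<lambda>i x. e (i, x)"
    by unfold_locales (rule el)
  \<comment> \<open>Transition maps preserve sorts, so sorts descend to the quotient.\<close>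
  have "\<exists>s. \<forall>i x. i \<in> Ob J \<longrightarrow> x \<in> ?X i \<longrightarrow> s (e (i, x)) = asort (fob X i) x"
    using factor[of "\<lambda>i. asort (fob X i)"] ahomD(2)[OF Xh] by metis
  then obtain s where s: "\<And>i x. i \<in> Ob J \<Longrightarrow> x \<in> ?X i \<Longrightarrow> s (e (i, x)) = asort (fob X i) x" by blast
  \<comment> \<open>An operation may be computed at any stage: the two argument lists agree position
    by position in the colimit, hence at one common later stage, and the transition maps commute
    with the operation.\<close>
  have wd: "e (i, aint (fob X i) f xs) = e (j, aint (fob X j) f ys)"
    if "i \<in> Ob J" "j \<in> Ob J" and f: "f \<in> symbols Sg" and xs: "xs \<in> aargs Sg (fob X i) f" and ys: "ys \<in> aargs Sg (fob X j) f"
      and eq: "map (\<lambda>x. e (i, x)) xs = map (\<lambda>y. e (j, y)) ys" for i j f xs ys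
  proof -
    have len: "length xs = length ys" using eq by (rule map_eq_imp_length_eq)
    have mm: "x \<in> ?X i \<and> y \<in> ?X j \<and> merges J ?m i x j y" if "(x, y) \<in> set (zip xs ys)" for x y
    proof -
      from that obtain n where n: "n < length xs" "x = xs ! n" "y = ys ! n" by (auto simp: set_zip)
      have "e (i, xs ! n) = e (j, ys ! n)" using eq n(1) len by (metis nth_map)
      then show ?thesis using leg_eq[OF \<open>i \<in> Ob J\<close> \<open>j \<in> Ob J\<close>, of x y] n len xs ys by (auto simp: aargs_def subset_iff)
    qed
    obtain k u v where uv: "u \<in> arrows J i k" "v \<in> arrows J j k"
      and m: "\<And>x y. (x, y) \<in> set (zip xs ys) \<Longrightarrow> ?m u x = ?m v y"
      by (rule fd.finite_merge[OF finite_set \<open>i \<in> Ob J\<close> \<open>j \<in> Ob J\<close> mm]) blast+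
    have "map (?m u) xs = map (?m v) ys"
      using m len by (auto simp: list_eq_iff_nth_eq set_zip)
    then have "?m u (aint (fob X i) f xs) = ?m v (aint (fob X j) f ys)"
      using ahomD(4)[OF Xh[OF uv(1)] f xs] ahomD(4)[OF Xh[OF uv(2)] f ys] by simp
    then have "merges J ?m i (aint (fob X i) f xs) j (aint (fob X j) f ys)" unfolding merges_def using uv by blast
    then show ?thesis
      using leg_eq[OF \<open>i \<in> Ob J\<close> \<open>j \<in> Ob J\<close> is_algD(4)[OF Model_alg[OF XM[OF \<open>i \<in> Ob J\<close>]] f xs]
          is_algD(4)[OF Model_alg[OF XM[OF \<open>j \<in> Ob J\<close>]] f ys]] by simp
  qed
  define op where "op f cs = (SOME c. \<exists>i xs. i \<in> Ob J \<and> xs \<in> aargs Sg (fob X i) f \<and> map (\<lambda>x. e (i, x)) xs = cs \<and>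
    c = e (i, aint (fob X i) f xs))" for f cs
  have op: "op f (map (\<lambda>x. e (i, x)) xs) = e (i, aint (fob X i) f xs)"
    if "i \<in> Ob J" "f \<in> symbols Sg" "xs \<in> aargs Sg (fob X i) f" for i f xs
    unfolding op_def by (rule some_equality) (use that wd in \<open>blast, metis\<close>)
  define C where "C = \<lparr>acarrier = e ` T, asort = restrict s (e ` T),
    aint = (\<lambda>f cs. if f \<in> symbols Sg \<and> set cs \<subseteq> e ` T \<and> map (restrict s (e ` T)) cs = arity Sg f then op f cs else undefined)\<rparr>"
  have C: "acarrier C = e ` T" "asort C = restrict s (e ` T)" by (simp_all add: C_def)
  have args: "cs \<in> aargs Sg C f \<longleftrightarrow> set cs \<subseteq> e ` T \<and> map (restrict s (e ` T)) cs = arity Sg f" for cs f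
    by (simp add: aargs_def C)
  have aint: "aint C f cs = (if f \<in> symbols Sg \<and> cs \<in> aargs Sg C f then op f cs else undefined)" for f cs
    unfolding args by (simp add: C_def)
  have srt: "asort C (e (i, x)) = asort (fob X i) x" if "i \<in> Ob J" "x \<in> ?X i" for i x
    using s[OF that] leg[OF that] by (simp add: C)
  have stage: "\<exists>i xs. i \<in> Ob J \<and> xs \<in> aargs Sg (fob X i) f \<and> map (\<lambda>x. e (i, x)) xs = cs" if cs: "cs \<in> aargs Sg C f" for cs f
  proof -
    obtain i t where i: "i \<in> Ob J" and t: "\<And>c. c \<in> set cs \<Longrightarrow> t c \<in> ?X i \<and> e (i, t c) = c"
      using finite_stage[of "set cs"] cs by (auto simp: args)
    have "asort (fob X i) (t c) = asort C c" if "c \<in> set cs" for c using srt[OF i, of "t c"] t[OF that] by simp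
    then have "map (asort (fob X i)) (map t cs) = map (asort C) cs" by simp
    then have "map t cs \<in> aargs Sg (fob X i) f" using cs t by (auto simp: aargs_def simp del: map_map map_eq_conv)
    moreover have "map (\<lambda>x. e (i, x)) (map t cs) = cs" using t by (simp add: map_idI)
    ultimately show ?thesis using i by blast
  qed
  have algC: "is_alg U S Sg C" unfolding is_alg_def
  proof (intro conjI allI)
    show "acarrier C \<in> U" by (simp add: C eU)
    have "restrict s (e ` T) c \<in> S" if "c \<in> e ` T" for c
      using that s is_algD(2)[OF Model_alg[OF XM]] by (auto simp: T_def)
    then show "asort C \<in> acarrier C \<rightarrow>\<^sub>E S" by (auto simp: C)
    show "if f \<in> symbols Sg \<and> cs \<in> aargs Sg C f then aint C f cs \<in> acarrier C \<and> asort C (aint C f cs) = result Sg f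
      else aint C f cs = undefined" for f cs
    proof (cases "f \<in> symbols Sg \<and> cs \<in> aargs Sg C f")
      case True
      then obtain i xs where i: "i \<in> Ob J" "xs \<in> aargs Sg (fob X i) f" "map (\<lambda>x. e (i, x)) xs = cs" using stage by blast
      then have "aint C f cs = e (i, aint (fob X i) f xs)" using True op[OF i(1) _ i(2)] by (simp add: aint)
      then show ?thesis
        using True is_algD(4,5)[OF Model_alg[OF XM[OF i(1)]] _ i(2)] srt[OF i(1)] leg[OF i(1)] by (simp add: C(1))
    next
      case False
      then show ?thesis unfolding aint by (simp only: if_False)
    qed
  qed
  define l where "l i = (\<lambda>x\<in>?X i. e (i, x))" for i
  have lhom: "l i \<in> Hom (fob X i) C" if i: "i \<in> Ob J" for i unfolding ahom_def
  proof (intro CollectI conjI ballI)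
    show "l i \<in> ?X i \<rightarrow>\<^sub>E acarrier C" using leg[OF i] by (auto simp: l_def C(1))
    show "asort C (l i x) = asort (fob X i) x" if "x \<in> ?X i" for x using srt[OF i that] that by (simp add: l_def)
    fix f xs assume f: "f \<in> symbols Sg" and xs: "xs \<in> aargs Sg (fob X i) f"
    have eq: "map (l i) xs = map (\<lambda>x. e (i, x)) xs" using xs by (auto simp: l_def aargs_def)
    have "map (asort C) (map (\<lambda>x. e (i, x)) xs) = map (asort (fob X i)) xs"
      unfolding map_map using xs srt[OF i] by (intro map_cong) (auto simp: aargs_def)
    then have "map (\<lambda>x. e (i, x)) xs \<in> aargs Sg C f"
      using xs leg[OF i] by (auto simp: aargs_def C(1) simp del: map_map map_eq_conv)
    then show "l i (aint (fob X i) f xs) = aint C f (map (l i) xs)"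
      using op[OF i f xs] is_algD(4)[OF Model_alg[OF XM[OF i]] f xs] f unfolding eq by (simp add: aint l_def)
  qed
  \<comment> \<open>The finitely many variables of the equation take values in the image of one
    stage, where the equation holds.\<close>
  have "satisfies C (t, t')" if tt: "(t, t') \<in> E" for t t' unfolding satisfies_def prod.case
  proof (intro allI impI)
    fix v :: "nat \<times> 's \<Rightarrow> 'u" assume v: "\<forall>x\<in>tvars t \<union> tvars t'. v x \<in> acarrier C \<and> asort C (v x) = snd x"
    have fin: "finite (tvars r)" for r :: "('f, 's) trm" by (induction r) auto
    obtain i w where i: "i \<in> Ob J" and w: "\<And>c. c \<in> v ` (tvars t \<union> tvars t') \<Longrightarrow> w c \<in> ?X i \<and> e (i, w c) = c"
    proof -
      have "finite (v ` (tvars t \<union> tvars t'))" "v ` (tvars t \<union> tvars t') \<subseteq> e ` T" using v fin by (auto simp: C(1))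
      from finite_stage[OF this] that show ?thesis by blast
    qed
    have wv: "w (v x) \<in> ?X i \<and> asort (fob X i) (w (v x)) = snd x \<and> l i (w (v x)) = v x" if "x \<in> tvars t \<union> tvars t'" for x
      using w[of "v x"] v that srt[OF i, of "w (v x)"] by (auto simp: l_def)
    have wt: "wtm Sg snd t" "wtm Sg snd t'" using eqs[OF tt] by (auto simp: well_sorted_wtm)
    have ev: "teval (aint C) v r = l i (teval (aint (fob X i)) (\<lambda>x. w (v x)) r)" if r: "r = t \<or> r = t'" for r
    proof -
      have "teval (aint C) v r = teval (aint C) (\<lambda>x. l i (w (v x))) r"
        by (rule teval_cong) (use wv r in auto)
      also have "\<dots> = l i (teval (aint (fob X i)) (\<lambda>x. w (v x)) r)"
        by (rule ahom_teval[OF Model_alg[OF XM[OF i]] lhom[OF i], symmetric, where p=snd]) (use wt r wv in auto)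
      finally show ?thesis .
    qed
    have "teval (aint (fob X i)) (\<lambda>x. w (v x)) t = teval (aint (fob X i)) (\<lambda>x. w (v x)) t'"
      using XM[OF i] tt wv unfolding model_def satisfies_def by fastforce
    then show "teval (aint C) v t = teval (aint C) v t'" using ev by simp
  qed
  then have modC: "Model C" using algC by (auto simp: model_def)
  show ?thesis
  proof (rule that[OF modC, of "\<lambda>i. (fob X i, l i, C)"])
    show "(fob X i, l i, C) \<in> arrows D (fob X i) C" if "i \<in> Ob J" for i
      using lhom[OF that] modC XM[OF that] by (simp add: arrows_D)
    show "elementwise_colimit J ?X ?m (acarrier C) (\<lambda>i. fun_of (fob X i, l i, C))"
      using el unfolding elementwise_colimit_def C(1) by (auto simp: l_def)
  qed
qed

text \<open>A colimit is known only up to isomorphism, so the description is carried over from the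
  constructed one.\<close>

lemma alg_colimit_elementwise:
  assumes X: "is_functor J D X" and filt: "filtered J" and small: "small_cat U J" and col: "is_colimit D J X c l"
  shows "elementwise_colimit J (\<lambda>i. acarrier (fob X i)) (\<lambda>u. fun_of (far X u)) (acarrier c) (\<lambda>i. fun_of (l i))"
proof -
  obtain C l0 where C: "Model C" and l0: "\<And>i. i \<in> Ob J \<Longrightarrow> l0 i \<in> arrows D (fob X i) C"
    and el: "elementwise_colimit J (\<lambda>i. acarrier (fob X i)) (\<lambda>u. fun_of (far X u)) (acarrier C) (\<lambda>i. fun_of (l0 i))"
    using alg_filtered_colimit_exists[OF assms(1-3)] by blast
  obtain h g where h: "h \<in> arrows D C c" and g: "g \<in> arrows D c C" and gh: "Cmp D g h = Ide D C" and hg: "Cmp D h g = Ide D c"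
    and hl: "\<And>i. i \<in> Ob J \<Longrightarrow> Cmp D h (l0 i) = l i"
    using colimits_isomorphic[OF is_cat_alg_cat X elementwise_alg_colimit[OF X filt C l0 el] col] by metis
  have hh: "h = (C, fun_of h, c)" "fun_of h \<in> Hom C c" and gg: "g = (c, fun_of g, C)" "fun_of g \<in> Hom c C"
    using h g by (auto simp: arrows_D)
  have 1: "fun_of g (fun_of h x) = x" if "x \<in> acarrier C" for x
  proof -
    have "compose (acarrier C) (fun_of g) (fun_of h) = (\<lambda>x\<in>acarrier C. x)"
      using gh hh(1) gg(1) Cmp_D Ide_D by (metis fst_conv snd_conv)
    from fun_cong[OF this, of x] show ?thesis using that by (simp add: compose_def)
  qed
  have 2: "fun_of h (fun_of g x) = x" if "x \<in> acarrier c" for x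
  proof -
    have "compose (acarrier c) (fun_of h) (fun_of g) = (\<lambda>x\<in>acarrier c. x)"
      using hg hh(1) gg(1) Cmp_D Ide_D by (metis fst_conv snd_conv)
    from fun_cong[OF this, of x] show ?thesis using that by (simp add: compose_def)
  qed
  have 3: "fun_of (l i) x = fun_of h (fun_of (l0 i) x)" if "i \<in> Ob J" "x \<in> acarrier (fob X i)" for i x
  proof -
    have "l0 i = (fob X i, fun_of (l0 i), C)" using l0[OF that(1)] by (auto simp: arrows_D)
    then have "fun_of (l i) = compose (acarrier (fob X i)) (fun_of h) (fun_of (l0 i))"
      using hl[OF that(1)] hh(1) Cmp_D by (metis fst_conv snd_conv)
    then show ?thesis using that by (simp add: compose_def)
  qed
  have l0C: "fun_of (l0 i) x \<in> acarrier C" if "i \<in> Ob J" "x \<in> acarrier (fob X i)" for i x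
    using el that unfolding elementwise_colimit_def by blast
  show ?thesis unfolding elementwise_colimit_def
  proof (intro conjI ballI)
    show "fun_of (l i) x \<in> acarrier c" if "i \<in> Ob J" "x \<in> acarrier (fob X i)" for i x
      using 3[OF that] ahomD(1)[OF hh(2)] l0C[OF that] by simp
    show "\<exists>i\<in>Ob J. \<exists>x\<in>acarrier (fob X i). fun_of (l i) x = y" if y: "y \<in> acarrier c" for y
    proof -
      obtain i x where "i \<in> Ob J" "x \<in> acarrier (fob X i)" "fun_of (l0 i) x = fun_of g y"
        using el ahomD(1)[OF gg(2) y] unfolding elementwise_colimit_def by blast
      then show ?thesis using 3 2[OF y] by metis
    qed
    show "(fun_of (l i) x = fun_of (l j) y) = merges J (\<lambda>u. fun_of (far X u)) i x j y"
      if "i \<in> Ob J" "j \<in> Ob J" "x \<in> acarrier (fob X i)" "y \<in> acarrier (fob X j)" for i j x y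
    proof -
      have "fun_of (l i) x = fun_of (l j) y \<longleftrightarrow> fun_of (l0 i) x = fun_of (l0 j) y"
        using 3 that 1 l0C by metis
      then show ?thesis using el that unfolding elementwise_colimit_def by blast
    qed
  qed
qed

end

section \<open>Filtered colimits over S, and preorders as small categories\<close>

text \<open>The argument of \<open>elementwise_alg_colimit\<close> without operations. Together with
  the elementwise form of colimits of algebras it shows that forgetting the operations preserves
  filtered colimits.\<close>

lemma elementwise_set_colimit:
  assumes Y: "is_functor J (sets_over U S) Y" and filt: "filtered J" and C: "C \<in> Ob (sets_over U S)"
    and l: "\<And>i. i \<in> Ob J \<Longrightarrow> l i \<in> arrows (sets_over U S) (fob Y i) C"
    and el: "elementwise_colimit J (\<lambda>i. fst (fob Y i)) (\<lambda>u. fst (snd (far Y u))) (fst C) (\<lambda>i. fst (snd (l i)))"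
  shows "is_colimit (sets_over U S) J Y C l"
proof -
  let ?D = "sets_over U S"
  note J = functor_cats(1)[OF Y]
  have Yu: "far Y u = (fob Y i, fst (snd (far Y u)), fob Y j)" "fst (snd (far Y u)) \<in> fst (fob Y i) \<rightarrow>\<^sub>E fst (fob Y j)"
    if "u \<in> arrows J i j" for u i j
    using functor_arrow[OF Y that] by (auto simp: sets_over_arrows)
  have "filtered_diagram J (\<lambda>i. fst (fob Y i)) (\<lambda>u. fst (snd (far Y u)))"
  proof
    fix u v i j k x assume u: "u \<in> arrows J i j" and v: "v \<in> arrows J j k" and x: "x \<in> fst (fob Y i)"
    have "far Y (Cmp J v u) = Cmp ?D (fob Y j, fst (snd (far Y v)), fob Y k) (fob Y i, fst (snd (far Y u)), fob Y j)"
      using functor_Cmp[OF Y v u] Yu(1)[OF u] Yu(1)[OF v] by simp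
    then show "fst (snd (far Y (Cmp J v u))) x = fst (snd (far Y v)) (fst (snd (far Y u)) x)"
      using x by (simp add: sets_over_Cmp compose_def)
  next
    fix i x assume "i \<in> Ob J" "x \<in> fst (fob Y i)"
    then show "fst (snd (far Y (Ide J i))) x = x" using functor_Ide[OF Y] by (simp add: sets_over_Ide)
  qed (use filt J Yu(2) in \<open>auto simp: PiE_iff\<close>)
  then interpret filtered_colimit J "\<lambda>i. fst (fob Y i)" "\<lambda>u. fst (snd (far Y u))" "fst C" "\<lambda>i. fst (snd (l i))"
    using el by (simp add: filtered_colimit_def filtered_colimit_axioms_def)
  have lD: "l i = (fob Y i, fst (snd (l i)), C)" "fst (snd (l i)) \<in> fst (fob Y i) \<rightarrow>\<^sub>E fst C"
    "\<And>x. x \<in> fst (fob Y i) \<Longrightarrow> snd C (fst (snd (l i)) x) = snd (fob Y i) x" if "i \<in> Ob J" for i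
    using l[OF that] by (auto simp: sets_over_arrows)
  show ?thesis
  proof (rule is_colimitI)
    show "is_cocone ?D J Y C l"
    proof (rule is_coconeI[OF J])
      fix u i j assume u: "u \<in> arrows J i j"
      note i = arrowsD(1)[OF J u] and j = arrowsD(2)[OF J u]
      have "compose (fst (fob Y i)) (fst (snd (l j))) (fst (snd (far Y u))) = fst (snd (l i))"
        using leg_Xm[OF u] lD(2)[OF i] by (auto simp: compose_def fun_eq_iff PiE_def extensional_def)
      then show "Cmp ?D (l j) (far Y u) = l i"
        using lD(1)[OF i] sets_over_Cmp_eq[OF Yu(1)[OF u] lD(1)[OF j], of U S] by simp
    qed (simp_all add: C l)
  next
    fix B k assume cc: "is_cocone ?D J Y B k"
    then have B: "B \<in> Ob ?D" and karr: "\<And>i. i \<in> Ob J \<Longrightarrow> k i \<in> arrows ?D (fob Y i) B"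
      and kY: "\<And>u i j. u \<in> arrows J i j \<Longrightarrow> Cmp ?D (k j) (far Y u) = k i"
      by (auto simp: is_cocone_def arrows_def)
    have kD: "k i = (fob Y i, fst (snd (k i)), B)" "fst (snd (k i)) \<in> fst (fob Y i) \<rightarrow>\<^sub>E fst B"
      "\<And>x. x \<in> fst (fob Y i) \<Longrightarrow> snd B (fst (snd (k i)) x) = snd (fob Y i) x" if "i \<in> Ob J" for i
      using karr[OF that] by (auto simp: sets_over_arrows)
    have "fst (snd (k j)) (fst (snd (far Y u)) x) = fst (snd (k i)) x" if u: "u \<in> arrows J i j" and x: "x \<in> fst (fob Y i)" for u i j x
    proof -
      have "fst (snd (k i)) = compose (fst (fob Y i)) (fst (snd (k j))) (fst (snd (far Y u)))"
        using kY[OF u] sets_over_Cmp_eq[OF Yu(1)[OF u] kD(1)[OF arrowsD(2)[OF J u]], of U S] by (metis fst_conv snd_conv)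
      then show ?thesis using x by (simp add: compose_def)
    qed
    then obtain h0 where h0: "\<And>i x. i \<in> Ob J \<Longrightarrow> x \<in> fst (fob Y i) \<Longrightarrow> h0 (fst (snd (l i)) x) = fst (snd (k i)) x"
      using factor[of "\<lambda>i. fst (snd (k i))"] by blast
    define h where "h = restrict h0 (fst C)"
    have hl: "h (fst (snd (l i)) x) = fst (snd (k i)) x" if "i \<in> Ob J" "x \<in> fst (fob Y i)" for i x
      using h0[OF that] leg[OF that] by (simp add: h_def)
    have hB: "h c \<in> fst B \<and> snd B (h c) = snd C c" if c: "c \<in> fst C" for c
    proof -
      obtain i x where i: "i \<in> Ob J" "x \<in> fst (fob Y i)" "fst (snd (l i)) x = c" using leg_surj[OF c] by blast
      then show ?thesis using hl[OF i(1,2)] PiE_mem[OF kD(2)[OF i(1)] i(2)] kD(3)[OF i(1,2)] lD(3)[OF i(1,2)] by simp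
    qed
    then have harr: "(C, h, B) \<in> arrows ?D C B" using B C by (auto simp: sets_over_arrows h_def)
    show "\<exists>h\<in>arrows ?D C B. \<forall>i\<in>Ob J. Cmp ?D h (l i) = k i"
    proof (intro bexI[OF _ harr] ballI)
      fix i assume i: "i \<in> Ob J"
      have "compose (fst (fob Y i)) h (fst (snd (l i))) = fst (snd (k i))"
        using hl[OF i] kD(2)[OF i] by (auto simp: compose_def fun_eq_iff PiE_def extensional_def)
      then show "Cmp ?D (C, h, B) (l i) = k i"
        using kD(1)[OF i] sets_over_Cmp_eq[OF lD(1)[OF i] refl[of "(C, h, B)"], of U S] by simp
    qed
  next
    fix B h h' assume "h \<in> arrows ?D C B" "h' \<in> arrows ?D C B"
      and eq: "\<And>i. i \<in> Ob J \<Longrightarrow> Cmp ?D h (l i) = Cmp ?D h' (l i)"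
    then obtain g g' where g: "h = (C, g, B)" "g \<in> fst C \<rightarrow>\<^sub>E fst B" and g': "h' = (C, g', B)" "g' \<in> fst C \<rightarrow>\<^sub>E fst B"
      by (auto simp: sets_over_arrows)
    have "g c = g' c" if c: "c \<in> fst C" for c
    proof -
      obtain i x where i: "i \<in> Ob J" "x \<in> fst (fob Y i)" "fst (snd (l i)) x = c" using leg_surj[OF c] by blast
      have "compose (fst (fob Y i)) g (fst (snd (l i))) = compose (fst (fob Y i)) g' (fst (snd (l i)))"
        using eq[OF i(1)] sets_over_Cmp_eq[OF lD(1)[OF i(1)] g(1), of U S] sets_over_Cmp_eq[OF lD(1)[OF i(1)] g'(1), of U S]
        by simp
      from fun_cong[OF this, of x] show ?thesis using i by (simp add: compose_def)
    qed
    then have "g = g'" using g(2) g'(2) by (rule PiE_ext[rotated 2])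
    then show "h = h'" using g g' by simp
  qed
qed

text \<open>Objects and arrows must both have the type of the universe, so the arrow from a to b is
  a code of the pair (a, b); the category laws then reduce to reflexivity and transitivity.\<close>

lemma thin_category:
  fixes I :: "'u set" and le :: "'u \<Rightarrow> 'u \<Rightarrow> bool"
  assumes U: "universe U" and I: "I \<in> U" and refl: "\<And>a. a \<in> I \<Longrightarrow> le a a"
    and trans: "\<And>a b c. a \<in> I \<Longrightarrow> b \<in> I \<Longrightarrow> c \<in> I \<Longrightarrow> le a b \<Longrightarrow> le b c \<Longrightarrow> le a c"
  obtains J :: "('u, 'u) cat" and ar where "small_cat U J" "Ob J = I"
    "\<And>a b u. u \<in> arrows J a b \<longleftrightarrow> a \<in> I \<and> b \<in> I \<and> le a b \<and> u = ar a b"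
proof -
  obtain c :: "'u \<times> 'u \<Rightarrow> 'u" where c: "inj_on c (I \<times> I)" "c ` (I \<times> I) \<in> U"
    using small_Times[OF U small_member[OF I] small_member[OF I]] small_iff[OF U] by blast
  define d where "d = inv_into (I \<times> I) c"
  have d: "d (c (a, b)) = (a, b)" if "a \<in> I" "b \<in> I" for a b using c(1) that by (simp add: d_def)
  define J where "J = \<lparr>Ob = I, Ar = c ` {(a, b). a \<in> I \<and> b \<in> I \<and> le a b}, Src = (\<lambda>u. fst (d u)), Tgt = (\<lambda>u. snd (d u)),
    Ide = (\<lambda>a. c (a, a)), Cmp = (\<lambda>v u. c (fst (d u), snd (d v)))\<rparr>"
  have ar: "u \<in> arrows J a b \<longleftrightarrow> a \<in> I \<and> b \<in> I \<and> le a b \<and> u = c (a, b)" for u a b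
    by (auto simp: arrows_def J_def d)
  have Ar: "u \<in> Ar J \<longleftrightarrow> (\<exists>a b. a \<in> I \<and> b \<in> I \<and> le a b \<and> u = c (a, b))" for u
    by (auto simp: J_def)
  have st: "Src J (c (a, b)) = a" "Tgt J (c (a, b)) = b" if "a \<in> I" "b \<in> I" for a b
    using that by (simp_all add: J_def d)
  have "Ob J = I" by (simp add: J_def)
  moreover have "small_cat U J" unfolding small_cat_def is_cat_def
  proof (intro conjI)
    show "Ar J \<in> U" by (rule universe_subset[OF U c(2)]) (auto simp: J_def)
  qed (auto simp: Ar ar st, auto simp: J_def d I refl intro: trans)
  ultimately show ?thesis using that[of J "\<lambda>a b. c (a, b)"] ar by blast
qed

section \<open>Cocompleteness and finite presentability of algebras\<close>

context variety_spec
begin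

lemma presentsD:
  assumes "presents p G R A q"
  shows "Model A" "R \<subseteq> relators Sg p G" "assign p G R A q"
    "Model B \<Longrightarrow> assign p G R B v \<Longrightarrow> \<exists>h\<in>Hom A B. \<forall>x\<in>G. h (q x) = v x"
    "Model B \<Longrightarrow> h \<in> Hom A B \<Longrightarrow> h' \<in> Hom A B \<Longrightarrow> (\<And>x. x \<in> G \<Longrightarrow> h (q x) = h' (q x)) \<Longrightarrow> h = h'"
    "x \<in> G \<Longrightarrow> q x \<in> acarrier A" "x \<in> G \<Longrightarrow> asort A (q x) = p x"
  using assms unfolding presents_def assign_def by blast+

lemma D_eqI: "f \<in> arrows D A B \<Longrightarrow> g \<in> arrows D A B \<Longrightarrow> fun_of f = fun_of g \<Longrightarrow> f = g"
  by (auto simp: arrows_D)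

lemma D_Cmp_fun:
  assumes "f \<in> arrows D A B" "g \<in> arrows D B C"
  shows "fun_of (Cmp D g f) = compose (acarrier A) (fun_of g) (fun_of f)"
    "x \<in> acarrier A \<Longrightarrow> fun_of (Cmp D g f) x = fun_of g (fun_of f x)"
  using assms by (auto simp: arrows_D Cmp_D compose_def)

lemma D_arrow: "f \<in> arrows D A B \<Longrightarrow> f = (A, fun_of f, B) \<and> fun_of f \<in> Hom A B \<and> Model A \<and> Model B"
  by (auto simp: arrows_D)

lemma D_undef: "f \<in> arrows D A B \<Longrightarrow> x \<notin> acarrier A \<Longrightarrow> fun_of f x = undefined"
  using ahomD(3) by (auto simp: arrows_D)

text \<open>A colimit is presented by all elements of all algebras of the diagram. The relators are
  the operation tables of these algebras and the identifications along the arrows of the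
  diagram.\<close>

lemma D_cocomplete: "cocomplete U D"
  unfolding cocomplete_def
proof (intro allI impI)
  fix J :: "('u, 'u) cat" and X
  assume "small_cat U J \<and> is_functor J D X"
  then have small: "small_cat U J" and X: "is_functor J D X" by auto
  note J = functor_cats(1)[OF X] and XM = diagram_Model[OF X] and Xu = functor_arrow[OF X]
  \<comment> \<open>The component 0 is a dummy, present because variables of terms are pairs with a
    number.\<close>
  define G :: "(nat \<times> 'u \<times> 'u) set" where "G = {0} \<times> Sigma (Ob J) (\<lambda>i. acarrier (fob X i))"
  define p :: "nat \<times> 'u \<times> 'u \<Rightarrow> 's" where "p = (\<lambda>(n, i, x). asort (fob X i) x)"
  define R :: "(('f, 'u \<times> 'u) trm \<times> ('f, 'u \<times> 'u) trm) set" where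
    "R = (\<lambda>(i, f, xs). (App f (map (\<lambda>x. Var (0, i, x)) xs), Var (0, i, aint (fob X i) f xs))) `
        {(i, f, xs). i \<in> Ob J \<and> f \<in> symbols Sg \<and> xs \<in> aargs Sg (fob X i) f} \<union>
      (\<lambda>(i, j, u, x). (Var (0, j, fun_of (far X u) x), Var (0, i, x))) `
        {(i, j, u, x). u \<in> arrows J i j \<and> x \<in> acarrier (fob X i)}"
  have G: "(0, i, x) \<in> G \<longleftrightarrow> i \<in> Ob J \<and> x \<in> acarrier (fob X i)" for i x by (auto simp: G_def)
  have Gall: "\<exists>i x. g = (0, i, x) \<and> i \<in> Ob J \<and> x \<in> acarrier (fob X i)" if "g \<in> G" for g using that by (auto simp: G_def)
  have smG: "small U G" unfolding G_def
    using small XM by (intro small_Times small_Sigma univ small_countable small_member) (auto simp: small_cat_def model_def is_alg_def)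
  have pG: "p g \<in> S" if "g \<in> G" for g
    using Gall[OF that] is_algD(2)[OF Model_alg[OF XM]] by (auto simp: p_def)
  have R1: "(App f (map (\<lambda>x. Var (0, i, x)) xs), Var (0, i, aint (fob X i) f xs)) \<in> relators Sg p G"
    if "i \<in> Ob J" "f \<in> symbols Sg" "xs \<in> aargs Sg (fob X i) f" for i f xs
    using that is_algD(4,5)[OF Model_alg[OF XM[OF that(1)]] that(2,3)]
    by (auto simp: relators_def aargs_def G p_def list_all_iff o_def)
  have R2: "(Var (0, j, fun_of (far X u) x), Var (0, i, x)) \<in> relators Sg p G"
    if "u \<in> arrows J i j" "x \<in> acarrier (fob X i)" for u i j x
    using that arrowsD(1,2)[OF J that(1)] ahomD(1,2)[OF diagram_arrow(2)[OF X that(1)] that(2)]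
    by (simp add: relators_def G p_def)
  have "R \<subseteq> relators Sg p G" unfolding R_def using R1 R2 by auto
  from presentation_exists[OF smG pG this] obtain A q where A: "presents p G R A q" by blast
  note AM = presentsD(1)[OF A]
  \<comment> \<open>An assignment that satisfies the relators is the same as a cocone: a
    homomorphism from each stage, compatible with the arrows of the diagram.\<close>
  have assignR: "assign p G R B v \<longleftrightarrow>
      (\<forall>i\<in>Ob J. (\<lambda>x\<in>acarrier (fob X i). v (0, i, x)) \<in> Hom (fob X i) B) \<and>
      (\<forall>u i j x. u \<in> arrows J i j \<longrightarrow> x \<in> acarrier (fob X i) \<longrightarrow> v (0, j, fun_of (far X u) x) = v (0, i, x))" for B v
  proof -
    have 1: "(\<forall>x\<in>G. v x \<in> acarrier B \<and> asort B (v x) = p x) \<longleftrightarrow>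
      (\<forall>i\<in>Ob J. \<forall>x\<in>acarrier (fob X i). v (0, i, x) \<in> acarrier B \<and> asort B (v (0, i, x)) = asort (fob X i) x)"
      by (auto simp: G_def p_def)
    have 2: "(\<forall>(t, t')\<in>R. teval (aint B) v t = teval (aint B) v t') \<longleftrightarrow>
      (\<forall>i f xs. i \<in> Ob J \<longrightarrow> f \<in> symbols Sg \<longrightarrow> xs \<in> aargs Sg (fob X i) f \<longrightarrow>
         aint B f (map (\<lambda>x. v (0, i, x)) xs) = v (0, i, aint (fob X i) f xs)) \<and>
      (\<forall>u i j x. u \<in> arrows J i j \<longrightarrow> x \<in> acarrier (fob X i) \<longrightarrow> v (0, j, fun_of (far X u) x) = v (0, i, x))"
      unfolding R_def by (simp add: ball_Un o_def) blast
    have 3: "(\<lambda>x\<in>acarrier (fob X i). v (0, i, x)) \<in> Hom (fob X i) B \<longleftrightarrow>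
      (\<forall>x\<in>acarrier (fob X i). v (0, i, x) \<in> acarrier B \<and> asort B (v (0, i, x)) = asort (fob X i) x) \<and>
      (\<forall>f xs. f \<in> symbols Sg \<longrightarrow> xs \<in> aargs Sg (fob X i) f \<longrightarrow>
         aint B f (map (\<lambda>x. v (0, i, x)) xs) = v (0, i, aint (fob X i) f xs))" if i: "i \<in> Ob J" for i
    proof -
      have re: "map (\<lambda>x\<in>acarrier (fob X i). v (0, i, x)) xs = map (\<lambda>x. v (0, i, x)) xs"
        if "xs \<in> aargs Sg (fob X i) f" for xs f
        using that by (auto simp: aargs_def)
      show ?thesis using is_algD(4)[OF Model_alg[OF XM[OF i]]]
        unfolding ahom_def by (auto simp: re simp del: map_eq_conv)
    qed
    have 4: "(\<forall>i\<in>Ob J. (\<lambda>x\<in>acarrier (fob X i). v (0, i, x)) \<in> Hom (fob X i) B) \<longleftrightarrow>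
      (\<forall>i\<in>Ob J. \<forall>x\<in>acarrier (fob X i). v (0, i, x) \<in> acarrier B \<and> asort B (v (0, i, x)) = asort (fob X i) x) \<and>
      (\<forall>i f xs. i \<in> Ob J \<longrightarrow> f \<in> symbols Sg \<longrightarrow> xs \<in> aargs Sg (fob X i) f \<longrightarrow>
         aint B f (map (\<lambda>x. v (0, i, x)) xs) = v (0, i, aint (fob X i) f xs))"
      by (rule trans[OF ball_cong[OF refl 3]]) (assumption, blast)
    show ?thesis unfolding assign_def 1 2 4 by (simp only: conj_assoc)
  qed
  define l where "l i = (fob X i, \<lambda>x\<in>acarrier (fob X i). q (0, i, x), A)" for i
  have l: "l i \<in> arrows D (fob X i) A" if "i \<in> Ob J" for i
    using presentsD(3)[OF A] that AM XM[OF that] unfolding assignR by (simp add: arrows_D l_def)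
  have lx: "fun_of (l i) x = q (0, i, x)" if "x \<in> acarrier (fob X i)" for i x using that by (simp add: l_def)
  have "is_colimit D J X A l"
  proof (rule is_colimitI)
    show "is_cocone D J X A l"
    proof (rule is_coconeI[OF J])
      fix u i j assume u: "u \<in> arrows J i j"
      note i = arrowsD(1)[OF J u] and j = arrowsD(2)[OF J u]
      show "Cmp D (l j) (far X u) = l i"
      proof (rule D_eqI[OF Cmp_arrow[OF is_cat_alg_cat l[OF j] Xu[OF u]] l[OF i]], rule ext)
        fix x show "fun_of (Cmp D (l j) (far X u)) x = fun_of (l i) x"
        proof (cases "x \<in> acarrier (fob X i)")
          case True
          have "q (0, j, fun_of (far X u) x) = q (0, i, x)" using presentsD(3)[OF A] u True unfolding assignR by blast
          then show ?thesis using D_Cmp_fun(2)[OF Xu[OF u] l[OF j] True] lx[OF True]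
              lx[OF ahomD(1)[OF diagram_arrow(2)[OF X u] True]] by simp
        next
          case False
          then show ?thesis using D_Cmp_fun(1)[OF Xu[OF u] l[OF j]] by (simp add: l_def compose_def)
        qed
      qed
    qed (use l AM Ob_D in blast)+
  next
    fix B k assume "is_cocone D J X B k"
    then have B: "Model B" and karr: "\<And>i. i \<in> Ob J \<Longrightarrow> k i \<in> arrows D (fob X i) B"
      and kX: "\<And>u i j. u \<in> arrows J i j \<Longrightarrow> Cmp D (k j) (far X u) = k i"
      by (auto simp: is_cocone_def Ob_D arrows_def)
    define v :: "nat \<times> 'u \<times> 'u \<Rightarrow> 'u" where "v = (\<lambda>(n, i, x). fun_of (k i) x)"
    have "assign p G R B v" unfolding assignR
    proof (intro conjI ballI allI impI)
      fix i assume i: "i \<in> Ob J"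
      have "(\<lambda>x\<in>acarrier (fob X i). v (0, i, x)) = fun_of (k i)"
        using ahomD(3)[of "fun_of (k i)" Sg "fob X i" B] D_arrow[OF karr[OF i]] by (auto simp: v_def)
      then show "(\<lambda>x\<in>acarrier (fob X i). v (0, i, x)) \<in> Hom (fob X i) B" using D_arrow[OF karr[OF i]] by simp
    next
      fix u i j x assume u: "u \<in> arrows J i j" and x: "x \<in> acarrier (fob X i)"
      show "v (0, j, fun_of (far X u) x) = v (0, i, x)"
        using D_Cmp_fun(2)[OF Xu[OF u] karr[OF arrowsD(2)[OF J u]] x] kX[OF u] by (simp add: v_def)
    qed
    from presentsD(4)[OF A B this] obtain h where h: "h \<in> Hom A B" "\<And>x. x \<in> G \<Longrightarrow> h (q x) = v x" by blast
    have harr: "(A, h, B) \<in> arrows D A B" using AM B h by (simp add: arrows_D)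
    show "\<exists>h\<in>arrows D A B. \<forall>i\<in>Ob J. Cmp D h (l i) = k i"
    proof (intro bexI[OF _ harr] ballI)
      fix i assume i: "i \<in> Ob J"
      show "Cmp D (A, h, B) (l i) = k i"
      proof (rule D_eqI[OF Cmp_arrow[OF is_cat_alg_cat harr l[OF i]] karr[OF i]], rule ext)
        fix x show "fun_of (Cmp D (A, h, B) (l i)) x = fun_of (k i) x"
        proof (cases "x \<in> acarrier (fob X i)")
          case True
          then show ?thesis using D_Cmp_fun(2)[OF l[OF i] harr True] lx[OF True] h(2)[of "(0, i, x)"] i by (simp add: G v_def)
        next
          case False
          then show ?thesis
            using D_undef[OF karr[OF i]] D_undef[OF Cmp_arrow[OF is_cat_alg_cat harr l[OF i]]] by simp
        qed
      qed
    qed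
  next
    fix B h h' assume h: "h \<in> arrows D A B" and h': "h' \<in> arrows D A B"
      and eq: "\<And>i. i \<in> Ob J \<Longrightarrow> Cmp D h (l i) = Cmp D h' (l i)"
    have "fun_of h = fun_of h'"
    proof (rule presentsD(5)[OF A])
      show "Model B" "fun_of h \<in> Hom A B" "fun_of h' \<in> Hom A B" using D_arrow[OF h] D_arrow[OF h'] by auto
      fix g assume "g \<in> G"
      then obtain i x where g: "g = (0, i, x)" "i \<in> Ob J" "x \<in> acarrier (fob X i)" using Gall by blast
      show "fun_of h (q g) = fun_of h' (q g)"
        using eq[OF g(2)] D_Cmp_fun(2)[OF l[OF g(2)] h g(3)] D_Cmp_fun(2)[OF l[OF g(2)] h' g(3)] lx[OF g(3)] g(1) by simp
    qed
    then show "h = h'" by (rule D_eqI[OF h h'])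
  qed
  then show "\<exists>c l. is_colimit D J X c l" by blast
qed

text \<open>To lift an arrow into the colimit, the images of the finitely many generators are lifted
  to one stage; the finitely many relators, which hold in the colimit, then hold at a later stage.
  Two lifts agree at a later stage on the generators, hence altogether.\<close>

lemma finite_presentation_fp:
  fixes p :: "nat \<times> 'x \<Rightarrow> 's"
  assumes A: "presents p G R A q" and finG: "finite G" and finR: "finite R"
  shows "fp_object U D A"
  unfolding fp_object_def
proof (intro conjI allI impI)
  show "A \<in> Ob D" using presentsD(1)[OF A] Ob_D by blast
  fix J :: "('u, 'u) cat" and X c l
  assume "small_cat U J \<and> filtered J \<and> is_functor J D X \<and> is_colimit D J X c l"
  then have small: "small_cat U J" and filt: "filtered J" and X: "is_functor J D X" and col: "is_colimit D J X c l" by auto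
  note AM = presentsD(1)[OF A] and XM = diagram_Model[OF X] and Xu = functor_arrow[OF X]
  note l = colimitD(3)[OF col] and lX = colimitD(4)[OF col]
  have cM: "Model c" using colimitD(2)[OF col] Ob_D by blast
  interpret filtered_colimit J "\<lambda>i. acarrier (fob X i)" "\<lambda>u. fun_of (far X u)" "acarrier c" "\<lambda>i. fun_of (l i)"
    using diagram_filtered[OF X filt] alg_colimit_elementwise[OF X filt small col]
    by (simp add: filtered_colimit_def filtered_colimit_axioms_def)
  have lH: "fun_of (l i) \<in> Hom (fob X i) c" if "i \<in> Ob J" for i using D_arrow[OF l[OF that]] by blast
  have qA: "q x \<in> acarrier A" "asort A (q x) = p x" if "x \<in> G" for x using presentsD(6,7)[OF A] that by auto
  have eqG: "f = g" if "f \<in> arrows D A B" "g \<in> arrows D A B" "\<And>x. x \<in> G \<Longrightarrow> fun_of f (q x) = fun_of g (q x)" for f g B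
    using D_eqI[OF that(1,2)] presentsD(5)[OF A, of B "fun_of f" "fun_of g"] that(3) D_arrow[OF that(1)] D_arrow[OF that(2)]
    by blast
  have merge_arrows: "merges J (\<lambda>u. Cmp D (far X u)) i g j g'"
    if i: "i \<in> Ob J" and j: "j \<in> Ob J" and g: "g \<in> arrows D A (fob X i)" and g': "g' \<in> arrows D A (fob X j)"
      and eq: "Cmp D (l i) g = Cmp D (l j) g'" for i j g g'
  proof -
    have mm: "y \<in> acarrier (fob X i) \<and> z \<in> acarrier (fob X j) \<and> merges J (\<lambda>u. fun_of (far X u)) i y j z"
      if yz: "(y, z) \<in> (\<lambda>x. (fun_of g (q x), fun_of g' (q x))) ` G" for y z
    proof -
      obtain x where x: "x \<in> G" "y = fun_of g (q x)" "z = fun_of g' (q x)" using yz by auto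
      have "fun_of (l i) y = fun_of (l j) z"
        using D_Cmp_fun(2)[OF g l[OF i] qA(1)[OF x(1)]] D_Cmp_fun(2)[OF g' l[OF j] qA(1)[OF x(1)]] eq x by simp
      moreover have "y \<in> acarrier (fob X i)" "z \<in> acarrier (fob X j)"
        using x ahomD(1)[of "fun_of g"] ahomD(1)[of "fun_of g'"] D_arrow[OF g] D_arrow[OF g'] qA(1) by blast+
      ultimately show ?thesis using leg_eq[OF i j] by blast
    qed
    obtain k u v where uv: "u \<in> arrows J i k" "v \<in> arrows J j k"
      and m: "\<And>x y. (x, y) \<in> (\<lambda>x. (fun_of g (q x), fun_of g' (q x))) ` G \<Longrightarrow> fun_of (far X u) x = fun_of (far X v) y"
      by (rule finite_merge[OF finite_imageI[OF finG] i j mm]) blast+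
    have "Cmp D (far X u) g = Cmp D (far X v) g'"
    proof (rule eqG[OF Cmp_arrow[OF is_cat_alg_cat Xu[OF uv(1)] g] Cmp_arrow[OF is_cat_alg_cat Xu[OF uv(2)] g']])
      fix x assume x: "x \<in> G"
      show "fun_of (Cmp D (far X u) g) (q x) = fun_of (Cmp D (far X v) g') (q x)"
        using D_Cmp_fun(2)[OF g Xu[OF uv(1)] qA(1)[OF x]] D_Cmp_fun(2)[OF g' Xu[OF uv(2)] qA(1)[OF x]] m x by simp
    qed
    then show ?thesis unfolding merges_def using uv by blast
  qed
  have lift: "\<exists>i\<in>Ob J. \<exists>g\<in>arrows D A (fob X i). Cmp D (l i) g = f" if f: "f \<in> arrows D A c" for f
  proof -
    have fH: "fun_of f \<in> Hom A c" using D_arrow[OF f] by blast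
    obtain i s where i: "i \<in> Ob J" and s: "\<And>y. y \<in> (\<lambda>x. fun_of f (q x)) ` G \<Longrightarrow> s y \<in> acarrier (fob X i) \<and> fun_of (l i) (s y) = y"
      using finite_stage[OF finite_imageI[OF finG], of "\<lambda>x. fun_of f (q x)"] ahomD(1)[OF fH] qA(1) by blast
    \<comment> \<open>Elements of stage i over the images of the generators; the relators may still
      fail for them.\<close>
    define w where "w x = s (fun_of f (q x))" for x
    have w: "w x \<in> acarrier (fob X i)" "fun_of (l i) (w x) = fun_of f (q x)" "asort (fob X i) (w x) = p x" if "x \<in> G" for x
    proof -
      show 1: "w x \<in> acarrier (fob X i)" "fun_of (l i) (w x) = fun_of f (q x)"
        using s[OF imageI[OF that]] by (auto simp: w_def)
      show "asort (fob X i) (w x) = p x"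
        using ahomD(2)[OF lH[OF i] 1(1)] 1(2) ahomD(2)[OF fH qA(1)[OF that]] qA(2)[OF that] by simp
    qed
    let ?ev = "teval (aint (fob X i)) w"
    have ev: "?ev t \<in> acarrier (fob X i)" "fun_of (l i) (?ev t) = teval (aint c) (\<lambda>x. fun_of f (q x)) t"
      if t: "wtm Sg p t" "tvars t \<subseteq> G" for t
    proof -
      have 1: "w x \<in> acarrier (fob X i) \<and> asort (fob X i) (w x) = p x" if "x \<in> tvars t" for x using w t(2) that by blast
      show "?ev t \<in> acarrier (fob X i)" using teval_wtm[OF Model_alg[OF XM[OF i]] t(1) 1] by blast
      have "fun_of (l i) (?ev t) = teval (aint c) (\<lambda>x. fun_of (l i) (w x)) t"
        by (rule ahom_teval[OF Model_alg[OF XM[OF i]] lH[OF i] t(1) 1])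
      also have "\<dots> = teval (aint c) (\<lambda>x. fun_of f (q x)) t" by (rule teval_cong) (use w(2) t(2) in blast)
      finally show "fun_of (l i) (?ev t) = teval (aint c) (\<lambda>x. fun_of f (q x)) t" .
    qed
    have "assign p G R c (\<lambda>x. fun_of f (q x))"
      by (rule assign_ahom[OF Model_alg[OF AM] presentsD(2,3)[OF A] fH])
    then have Rc: "teval (aint c) (\<lambda>x. fun_of f (q x)) t = teval (aint c) (\<lambda>x. fun_of f (q x)) t'" if "(t, t') \<in> R" for t t'
      using that unfolding assign_def by blast
    have mm: "y \<in> acarrier (fob X i) \<and> z \<in> acarrier (fob X i) \<and> merges J (\<lambda>u. fun_of (far X u)) i y i z"
      if yz: "(y, z) \<in> (\<lambda>(t, t'). (?ev t, ?ev t')) ` R" for y z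
    proof -
      obtain t t' where t: "(t, t') \<in> R" "y = ?ev t" "z = ?ev t'" using yz by auto
      have "(t, t') \<in> relators Sg p G" using t(1) presentsD(2)[OF A] by blast
      then have tt: "wtm Sg p t" "tvars t \<subseteq> G" "wtm Sg p t'" "tvars t' \<subseteq> G" by (auto simp: relators_def)
      show ?thesis using leg_eq[OF i i ev(1)[OF tt(1,2)] ev(1)[OF tt(3,4)]] ev[OF tt(1,2)] ev[OF tt(3,4)] Rc[OF t(1)] t by simp
    qed
    \<comment> \<open>Both sides of each relator have the same image in the colimit, so one
      transition map u makes them equal for all relators.\<close>
    obtain k u where u: "u \<in> arrows J i k"
      and m: "\<And>y z. (y, z) \<in> (\<lambda>(t, t'). (?ev t, ?ev t')) ` R \<Longrightarrow> fun_of (far X u) y = fun_of (far X u) z"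
      by (rule finite_merge_single[OF finite_imageI[OF finR] i mm]) blast+
    note k = arrowsD(2)[OF J u]
    have uH: "fun_of (far X u) \<in> Hom (fob X i) (fob X k)" by (rule diagram_arrow(2)[OF X u])
    have "assign p G R (fob X k) (\<lambda>x. fun_of (far X u) (w x))" unfolding assign_def
    proof (intro conjI ballI, goal_cases)
      case (3 z)
      obtain t t' where t: "z = (t, t')" by (cases z)
      have "(t, t') \<in> relators Sg p G" using t 3 presentsD(2)[OF A] by blast
      then have tt: "wtm Sg p t" "tvars t \<subseteq> G" "wtm Sg p t'" "tvars t' \<subseteq> G" by (auto simp: relators_def)
      have "fun_of (far X u) (?ev r) = teval (aint (fob X k)) (\<lambda>x. fun_of (far X u) (w x)) r" if "r = t \<or> r = t'" for r
        by (rule ahom_teval[OF Model_alg[OF XM[OF i]] uH, where p=p]) (use that tt w in auto)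
      moreover have "fun_of (far X u) (?ev t) = fun_of (far X u) (?ev t')"
        by (rule m) (use 3 t in \<open>auto intro: rev_image_eqI\<close>)
      ultimately show ?case using t by simp
    qed (use w ahomD(1,2)[OF uH] in auto)
    from presentsD(4)[OF A XM[OF k] this] obtain g where
      g: "g \<in> Hom A (fob X k)" "\<And>x. x \<in> G \<Longrightarrow> g (q x) = fun_of (far X u) (w x)" by blast
    have garr: "(A, g, fob X k) \<in> arrows D A (fob X k)" using g(1) AM XM[OF k] by (simp add: arrows_D)
    have "Cmp D (l k) (A, g, fob X k) = f"
    proof (rule eqG[OF Cmp_arrow[OF is_cat_alg_cat l[OF k] garr] f])
      fix x assume x: "x \<in> G"
      show "fun_of (Cmp D (l k) (A, g, fob X k)) (q x) = fun_of f (q x)"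
        using D_Cmp_fun(2)[OF garr l[OF k] qA(1)[OF x]] g(2)[OF x] leg_Xm[OF u w(1)[OF x]] w(2)[OF x] by simp
    qed
    then show ?thesis using k garr by blast
  qed
  show "elementwise_colimit J (\<lambda>i. arrows D A (fob X i)) (\<lambda>u. Cmp D (far X u)) (arrows D A c) (\<lambda>i. Cmp D (l i))"
    unfolding elementwise_colimit_def
  proof (intro conjI ballI)
    show "Cmp D (l i) g \<in> arrows D A c" if "i \<in> Ob J" "g \<in> arrows D A (fob X i)" for i g
      by (rule Cmp_arrow[OF is_cat_alg_cat l[OF that(1)] that(2)])
    show "\<exists>i\<in>Ob J. \<exists>g\<in>arrows D A (fob X i). Cmp D (l i) g = f" if "f \<in> arrows D A c" for f by (rule lift[OF that])
    fix i j g g' assume i: "i \<in> Ob J" and j: "j \<in> Ob J" and g: "g \<in> arrows D A (fob X i)" and g': "g' \<in> arrows D A (fob X j)"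
    have "Cmp D (l i) g = Cmp D (l j) g'" if "merges J (\<lambda>u. Cmp D (far X u)) i g j g'"
    proof -
      from that obtain k u v where uv: "u \<in> arrows J i k" "v \<in> arrows J j k" "Cmp D (far X u) g = Cmp D (far X v) g'"
        unfolding merges_def by blast
      note k = arrowsD(2)[OF J uv(1)]
      show ?thesis
        using Cmp_assoc[OF is_cat_alg_cat l[OF k] Xu[OF uv(1)] g] Cmp_assoc[OF is_cat_alg_cat l[OF k] Xu[OF uv(2)] g']
          lX[OF uv(1)] lX[OF uv(2)] uv(3) by simp
    qed
    then show "(Cmp D (l i) g = Cmp D (l j) g') = merges J (\<lambda>u. Cmp D (far X u)) i g j g'"
      using merge_arrows[OF i j g g'] by blast
  qed
qed

text \<open>The renamed generators may have another type, which allows all finite presentations to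
  be taken over one fixed set of variables.\<close>

lemma presents_rename:
  fixes p :: "nat \<times> 'x \<Rightarrow> 's" and p' :: "nat \<times> 'y \<Rightarrow> 's"
  assumes \<rho>: "inj_on \<rho> G" and p: "\<And>x. x \<in> G \<Longrightarrow> p' (\<rho> x) = p x" and R: "R \<subseteq> relators Sg p G"
    and A: "presents p' (\<rho> ` G) ((\<lambda>(t, t'). (tsubst (\<lambda>x. Var (\<rho> x)) t, tsubst (\<lambda>x. Var (\<rho> x)) t')) ` R) A q"
  shows "presents p G R A (\<lambda>x. q (\<rho> x))"
proof -
  let ?R = "(\<lambda>(t, t'). (tsubst (\<lambda>x. Var (\<rho> x)) t, tsubst (\<lambda>x. Var (\<rho> x)) t')) ` R"
  have as1: "assign p G R B (\<lambda>x. v (\<rho> x))" if v: "assign p' (\<rho> ` G) ?R B v" for B :: "('f, 's, 'u) alg" and v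
    using v p unfolding assign_def by (auto simp: teval_tsubst split_beta)
  \<comment> \<open>\<open>inv_into\<close> undoes the renaming on G, and relators mention only
    generators in G.\<close>
  have as2: "assign p' (\<rho> ` G) ?R B (\<lambda>y. v (inv_into G \<rho> y))" if v: "assign p G R B v" for B :: "('f, 's, 'u) alg" and v
  proof -
    have 1: "v (inv_into G \<rho> (\<rho> x)) = v x" if "x \<in> G" for x using \<rho> that by simp
    have "teval (aint B) (\<lambda>y. v (inv_into G \<rho> y)) (tsubst (\<lambda>x. Var (\<rho> x)) t) = teval (aint B) v t" if "tvars t \<subseteq> G" for t
      unfolding teval_tsubst by (rule teval_cong) (use 1 that in auto)
    moreover have "tvars t \<subseteq> G \<and> tvars t' \<subseteq> G" if "(t, t') \<in> R" for t t' using that R by (auto simp: relators_def)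
    ultimately show ?thesis using v p 1 unfolding assign_def by (auto simp: split_beta)
  qed
  show ?thesis unfolding presents_def
  proof (intro conjI allI impI ballI R)
    show "Model A" by (rule presentsD(1)[OF A])
    show "assign p G R A (\<lambda>x. q (\<rho> x))" by (rule as1[OF presentsD(3)[OF A]])
    fix B v assume "Model B \<and> assign p G R B v"
    then have B: "Model B" and v: "assign p G R B v" by auto
    obtain h where "h \<in> Hom A B" "\<forall>y\<in>\<rho> ` G. h (q y) = v (inv_into G \<rho> y)"
      using presentsD(4)[OF A B as2[OF v]] by blast
    then show "\<exists>h\<in>Hom A B. \<forall>x\<in>G. h (q (\<rho> x)) = v x" using \<rho> by auto
  next
    fix B h h' assume "h \<in> Hom A B" "h' \<in> Hom A B" "Model B \<and> (\<forall>x\<in>G. h (q (\<rho> x)) = h' (q (\<rho> x)))"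
    then show "h = h'" by (intro presentsD(5)[OF A]) auto
  qed
qed

end

text \<open>
  Local finite presentability, with finite presentability of the generators in the elementwise form,
  which is visibly invariant under isomorphism of categories.
\<close>

definition lfp_elementwise :: "'u set set \<Rightarrow> ('o, 'm) cat \<Rightarrow> bool" where
  "lfp_elementwise U C \<longleftrightarrow> is_cat C \<and> locally_small U C \<and> cocomplete U C \<and>
     (\<exists>P. small U P \<and> (\<forall>a\<in>P. fp_object U C a) \<and>
        (\<forall>c\<in>Ob C. \<exists>(J :: ('u, 'u) cat) X l. small_cat U J \<and> filtered J \<and> is_functor J C X \<and>
           (\<forall>i\<in>Ob J. fob X i \<in> P) \<and> is_colimit C J X c l))"

lemma lfp_elementwise_imp: "lfp_elementwise U C \<Longrightarrow> locally_finitely_presentable U C"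
  unfolding lfp_elementwise_def locally_finitely_presentable_def
  by (elim conjE exE, intro conjI exI) (assumption+, simp add: finitely_presentableI)

section \<open>Local finite presentability of the category of algebras\<close>

context variety_spec
begin

text \<open>A homomorphism is determined by its graph, a subset of the product of the two carriers,
  and this product embeds into a member of \<open>U\<close>.\<close>

lemma D_locally_small: "locally_small U D"
  unfolding locally_small_def
proof (intro ballI)
  fix A B assume "A \<in> Ob D" "B \<in> Ob D"
  then have "small U (acarrier A \<times> acarrier B)"
    by (intro small_Times univ small_member) (auto simp: Ob_D model_def is_alg_def)
  then obtain X where X: "X \<in> U" "acarrier A \<times> acarrier B \<lesssim> X" unfolding small_def by blast
  let ?g = "\<lambda>f. (\<lambda>x. (x, fun_of f x)) ` acarrier A"
  have "arrows D A B \<lesssim> Pow (acarrier A \<times> acarrier B)" unfolding lepoll_def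
  proof (rule exI[of _ ?g], rule conjI)
    have "fun_of f x \<in> acarrier B" if "f \<in> arrows D A B" "x \<in> acarrier A" for f x
      using ahomD(1)[of "fun_of f" Sg A B x] D_arrow[OF that(1)] that(2) by simp
    then show "?g ` arrows D A B \<subseteq> Pow (acarrier A \<times> acarrier B)" by auto
    show "inj_on ?g (arrows D A B)"
    proof (rule inj_onI)
      fix f g assume f: "f \<in> arrows D A B" and g: "g \<in> arrows D A B" and eq: "?g f = ?g g"
      have "fun_of f x = fun_of g x" if "x \<in> acarrier A" for x
      proof -
        have "(x, fun_of f x) \<in> ?g g" using that eq by blast
        then show ?thesis by auto
      qed
      then have "fun_of f = fun_of g"
        using ahom_ext[of "fun_of f" Sg A B "fun_of g"] D_arrow[OF f] D_arrow[OF g] by simp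
      then show "f = g" by (rule D_eqI[OF f g])
    qed
  qed
  also have "Pow (acarrier A \<times> acarrier B) \<lesssim> Pow X"
  proof -
    obtain f where f: "inj_on f (acarrier A \<times> acarrier B)" "f ` (acarrier A \<times> acarrier B) \<subseteq> X"
      using X(2) unfolding lepoll_def by blast
    have "inj_on (image f) (Pow (acarrier A \<times> acarrier B))" using f(1) by (rule inj_on_image_Pow)
    moreover have "image f ` Pow (acarrier A \<times> acarrier B) \<subseteq> Pow X" using f(2) by blast
    ultimately show ?thesis unfolding lepoll_def by blast
  qed
  finally show "\<exists>X\<in>U. arrows D A B \<lesssim> Pow X" using X(1) by blast
qed

text \<open>
  The index category consists of the pairs of a finite subset F of A and a finite set R of equations
  between terms over F that hold in A.
\<close>

lemma directed_colimit_of_presentations: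
  assumes A: "Model A"
    and P: "\<And>(p :: nat \<times> 'u \<Rightarrow> 's) G R. finite G \<Longrightarrow> (\<And>x. x \<in> G \<Longrightarrow> p x \<in> S) \<Longrightarrow> finite R \<Longrightarrow> R \<subseteq> relators Sg p G \<Longrightarrow>
      \<exists>B\<in>P. \<exists>q. presents p G R B q"
  shows "\<exists>(J :: ('u, 'u) cat) X l. small_cat U J \<and> filtered J \<and> is_functor J D X \<and>
           (\<forall>i\<in>Ob J. fob X i \<in> P) \<and> is_colimit D J X A l"
proof -
  note algA = Model_alg[OF A]
  define p :: "nat \<times> 'u \<Rightarrow> 's" where "p g = asort A (snd g)" for g
  define g :: "'u set \<Rightarrow> (nat \<times> 'u) set" where "g F = {0} \<times> F" for F
  \<comment> \<open>The generator \<open>(0, x)\<close> stands for x itself, so a relator holds in A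
    if its two sides have the same value under \<open>snd\<close>.\<close>
  define I where "I = {(F, R). finite F \<and> F \<subseteq> acarrier A \<and> finite R \<and> R \<subseteq> relators Sg p (g F) \<and>
    (\<forall>(t, t')\<in>R. teval (aint A) snd t = teval (aint A) snd t')}"
  define T where "T = {t :: ('f, 'u) trm. set1_trm t \<subseteq> symbols Sg \<and> tvars t \<subseteq> UNIV \<times> acarrier A}"
  have smA: "small U (acarrier A)" using algA by (simp add: is_alg_def small_member)
  have smT: "small U T" unfolding T_def
    by (intro small_terms small_Times univ small_symbols smA small_countable) simp
  have "I \<subseteq> {F. finite F \<and> F \<subseteq> acarrier A} \<times> {R. finite R \<and> R \<subseteq> T \<times> T}"
  proof
    fix z assume "z \<in> I"
    then obtain F R where z: "z = (F, R)" "finite F" "F \<subseteq> acarrier A" "finite R" "R \<subseteq> relators Sg p (g F)"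
      unfolding I_def by blast
    have "t \<in> T \<and> t' \<in> T" if "(t, t') \<in> R" for t t'
    proof -
      have "(t, t') \<in> relators Sg p (g F)" using that z(5) by blast
      then have "set1_trm t \<subseteq> symbols Sg" "set1_trm t' \<subseteq> symbols Sg" "tvars t \<subseteq> g F" "tvars t' \<subseteq> g F"
        using wtm_symbols by (auto simp: relators_def)
      then show ?thesis using z(3) unfolding T_def g_def by blast
    qed
    then show "z \<in> {F. finite F \<and> F \<subseteq> acarrier A} \<times> {R. finite R \<and> R \<subseteq> T \<times> T}" using z by auto
  qed
  moreover have "small U ({F. finite F \<and> F \<subseteq> acarrier A} \<times> {R. finite R \<and> R \<subseteq> T \<times> T})"
    by (intro small_Times small_finite_subsets univ smA smT)
  ultimately have "small U I" by (blast intro: small_subset)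
  then obtain e :: "_ \<Rightarrow> 'u" where e: "inj_on e I" "e ` I \<in> U" using small_iff[OF univ] by blast
  \<comment> \<open>The indices are coded by e, since \<open>thin_category\<close> needs its objects
    in the universe; d decodes them.\<close>
  define d where "d = inv_into I e"
  have d: "d a \<in> I" if "a \<in> e ` I" for a using that by (simp add: d_def inv_into_into)
  have de: "d (e z) = z" if "z \<in> I" for z using that e(1) by (simp add: d_def)
  define le where "le a b \<longleftrightarrow> fst (d a) \<subseteq> fst (d b) \<and> snd (d a) \<subseteq> snd (d b)" for a b
  obtain J :: "('u, 'u) cat" and ar where J: "small_cat U J" "Ob J = e ` I"
    and arr: "\<And>a b u. u \<in> arrows J a b \<longleftrightarrow> a \<in> e ` I \<and> b \<in> e ` I \<and> le a b \<and> u = ar a b"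
    by (rule thin_category[OF univ e(2), of le]) (auto simp: le_def)
  have JC: "is_cat J" using J(1) by (simp add: small_cat_def)
  \<comment> \<open>Terms over F are also terms over any larger set, so both components can be
    united. These unions are the upper bounds in the index category.\<close>
  have I_un: "(F \<union> F', R \<union> R') \<in> I" if "(F, R) \<in> I" "(F', R') \<in> I" for F F' R R'
    using that unfolding I_def relators_def g_def by auto
  have filt: "filtered J" unfolding filtered_def
  proof (intro conjI ballI)
    have "({}, {}) \<in> I" by (simp add: I_def)
    then show "Ob J \<noteq> {}" by (auto simp: J)
  next
    fix a b assume ab: "a \<in> Ob J" "b \<in> Ob J"
    define c where "c = e (fst (d a) \<union> fst (d b), snd (d a) \<union> snd (d b))"
    have cI: "(fst (d a) \<union> fst (d b), snd (d a) \<union> snd (d b)) \<in> I" using I_un d ab by (simp add: J)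
    then have "c \<in> Ob J" "le a c" "le b c" by (auto simp: J c_def le_def de)
    moreover from this have "ar a c \<in> arrows J a c" "ar b c \<in> arrows J b c" using arr ab J(2) by simp_all
    ultimately show "\<exists>c\<in>Ob J. arrows J a c \<noteq> {} \<and> arrows J b c \<noteq> {}" by blast
  next
    fix a b u v assume "a \<in> Ob J" and b: "b \<in> Ob J" and "u \<in> arrows J a b" "v \<in> arrows J a b"
    then have "u = v" using arr by simp
    then show "\<exists>c\<in>Ob J. \<exists>h\<in>arrows J b c. Cmp J h u = Cmp J h v" using Ide_arrow[OF JC b] b by blast
  qed
  have "\<forall>a\<in>e ` I. \<exists>B q. B \<in> P \<and> presents p (g (fst (d a))) (snd (d a)) B q"
  proof
    fix a assume "a \<in> e ` I"
    then have "d a \<in> I" by (rule d)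
    then have "finite (g (fst (d a)))" "\<And>x. x \<in> g (fst (d a)) \<Longrightarrow> p x \<in> S" "finite (snd (d a))"
      "snd (d a) \<subseteq> relators Sg p (g (fst (d a)))"
      using is_algD(2)[OF algA] unfolding I_def g_def p_def by auto
    from P[OF this] show "\<exists>B q. B \<in> P \<and> presents p (g (fst (d a))) (snd (d a)) B q" by blast
  qed
  then obtain B q where BP: "\<And>a. a \<in> e ` I \<Longrightarrow> B a \<in> P"
    and Bq: "\<And>a. a \<in> e ` I \<Longrightarrow> presents p (g (fst (d a))) (snd (d a)) (B a) (q a)" by metis
  have BM: "Model (B a)" if "a \<in> e ` I" for a using presentsD(1)[OF Bq[OF that]] .
  have "\<exists>h\<in>Hom (B a) (B b). \<forall>x\<in>g (fst (d a)). h (q a x) = q b x" if a: "a \<in> e ` I" and b: "b \<in> e ` I" and ab: "le a b" for a b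
  proof (rule presentsD(4)[OF Bq[OF a] BM[OF b]])
    show "assign p (g (fst (d a))) (snd (d a)) (B b) (q b)"
      using presentsD(3)[OF Bq[OF b]] ab unfolding assign_def le_def g_def by blast
  qed
  then obtain tr where tr: "\<And>a b. a \<in> e ` I \<Longrightarrow> b \<in> e ` I \<Longrightarrow> le a b \<Longrightarrow> tr a b \<in> Hom (B a) (B b)"
    "\<And>a b x. a \<in> e ` I \<Longrightarrow> b \<in> e ` I \<Longrightarrow> le a b \<Longrightarrow> x \<in> g (fst (d a)) \<Longrightarrow> tr a b (q a x) = q b x" by metis
  \<comment> \<open>Arrows out of a presented algebra agree if they agree on the generators;
    functoriality of the diagram and the cocone laws are checked in this way.\<close>
  have eqB: "f = f'" if a: "a \<in> e ` I" and "f \<in> arrows D (B a) C" "f' \<in> arrows D (B a) C"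
    and "\<And>x. x \<in> g (fst (d a)) \<Longrightarrow> fun_of f (q a x) = fun_of f' (q a x)" for a C f f'
    using D_eqI[OF that(2,3)] presentsD(5)[OF Bq[OF a], of C "fun_of f" "fun_of f'"] that(4) D_arrow[OF that(2)] D_arrow[OF that(3)]
    by blast
  have qB: "q a x \<in> acarrier (B a)" if "a \<in> e ` I" "x \<in> g (fst (d a))" for a x
    using presentsD(6)[OF Bq[OF that(1)] that(2)] .
  define X where "X = \<lparr>fob = B, far = (\<lambda>u. (B (Src J u), tr (Src J u) (Tgt J u), B (Tgt J u)))\<rparr>"
  have Xo: "fob X = B" by (simp add: X_def)
  have Xa: "far X u = (B a, tr a b, B b)" if "u \<in> arrows J a b" for u a b
    using arrowsD(4,5)[OF JC that] by (simp add: X_def)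
  have Xarr: "far X u \<in> arrows D (B a) (B b)" if u: "u \<in> arrows J a b" for u a b
    using Xa[OF u] u tr(1) BM arr by (simp add: arrows_D)
  have Xq: "fun_of (far X u) (q a x) = q b x" if u: "u \<in> arrows J a b" and x: "x \<in> g (fst (d a))" for u a b x
    using Xa[OF u] tr(2)[OF _ _ _ x] u arr by simp
  have X: "is_functor J D X"
  proof (rule is_functorI[OF JC is_cat_alg_cat], unfold Xo)
    show "B a \<in> Ob D" if "a \<in> Ob J" for a using BM that by (simp add: Ob_D J)
    show "far X u \<in> arrows D (B a) (B b)" if "u \<in> arrows J a b" for a b u by (rule Xarr[OF that])
    fix a assume a: "a \<in> Ob J"
    then have aI: "a \<in> e ` I" by (simp add: J)
    show "far X (Ide J a) = Ide D (B a)"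
    proof (rule eqB[OF aI Xarr[OF Ide_arrow[OF JC a]] Ide_arrow[OF is_cat_alg_cat]])
      show "B a \<in> Ob D" using BM[OF aI] by (simp add: Ob_D)
      show "fun_of (far X (Ide J a)) (q a x) = fun_of (Ide D (B a)) (q a x)" if "x \<in> g (fst (d a))" for x
        using Xq[OF Ide_arrow[OF JC a] that] qB[OF aI that] by (simp add: Ide_D)
    qed
  next
    fix a b c u v assume u: "u \<in> arrows J a b" and v: "v \<in> arrows J b c"
    have aI: "a \<in> e ` I" using u arr by blast
    note vu = Cmp_arrow[OF JC v u]
    show "far X (Cmp J v u) = Cmp D (far X v) (far X u)"
    proof (rule eqB[OF aI Xarr[OF vu] Cmp_arrow[OF is_cat_alg_cat Xarr[OF v] Xarr[OF u]]])
      fix x assume x: "x \<in> g (fst (d a))"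
      then have "x \<in> g (fst (d b))" using u arr unfolding le_def g_def by blast
      then show "fun_of (far X (Cmp J v u)) (q a x) = fun_of (Cmp D (far X v) (far X u)) (q a x)"
        using D_Cmp_fun(2)[OF Xarr[OF u] Xarr[OF v] qB[OF aI x]] Xq[OF u x] Xq[OF v] Xq[OF vu x] by simp
    qed
  qed
  have "\<exists>h\<in>Hom (B a) A. \<forall>x\<in>g (fst (d a)). h (q a x) = snd x" if a: "a \<in> e ` I" for a
    by (rule presentsD(4)[OF Bq[OF a] A])
      (use d[OF a] in \<open>auto simp: assign_def I_def g_def p_def\<close>)
  then obtain l' where l': "\<And>a. a \<in> e ` I \<Longrightarrow> l' a \<in> Hom (B a) A"
    "\<And>a x. a \<in> e ` I \<Longrightarrow> x \<in> g (fst (d a)) \<Longrightarrow> l' a (q a x) = snd x" by metis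
  define l where "l a = (B a, l' a, A)" for a
  have l: "l a \<in> arrows D (B a) A" if "a \<in> e ` I" for a using l'(1)[OF that] A BM[OF that] by (simp add: l_def arrows_D)
  have lq: "fun_of (l a) (q a x) = snd x" if "a \<in> e ` I" "x \<in> g (fst (d a))" for a x using l'(2)[OF that] by (simp add: l_def)
  \<comment> \<open>The index of the presentation with the single generator x and no relators. The
    map out of A that belongs to a cocone is read off at these indices.\<close>
  define s where "s x = e ({x}, {})" for x
  have s: "s x \<in> e ` I" "d (s x) = ({x}, {})" if "x \<in> acarrier A" for x
  proof -
    have "({x}, {}) \<in> I" using that by (simp add: I_def)
    then show "s x \<in> e ` I" "d (s x) = ({x}, {})" by (simp_all add: s_def de)
  qed
  have "is_colimit D J X A l"
  proof (rule is_colimitI)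
    show "is_cocone D J X A l"
    proof (rule is_coconeI[OF JC], unfold Xo)
      show "A \<in> Ob D" using A by (simp add: Ob_D)
      show "l a \<in> arrows D (B a) A" if "a \<in> Ob J" for a using l that by (simp add: J)
      fix u a b assume u: "u \<in> arrows J a b"
      then have ab: "a \<in> e ` I" "b \<in> e ` I" "le a b" using arr by blast+
      show "Cmp D (l b) (far X u) = l a"
      proof (rule eqB[OF ab(1) Cmp_arrow[OF is_cat_alg_cat l[OF ab(2)] Xarr[OF u]] l[OF ab(1)]])
        fix x assume x: "x \<in> g (fst (d a))"
        then have xb: "x \<in> g (fst (d b))" using ab unfolding le_def g_def by blast
        show "fun_of (Cmp D (l b) (far X u)) (q a x) = fun_of (l a) (q a x)"
          using D_Cmp_fun(2)[OF Xarr[OF u] l[OF ab(2)] qB[OF ab(1) x]] Xq[OF u x] lq[OF ab(1) x] lq[OF ab(2) xb] by simp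
      qed
    qed
  next
    fix C k assume "is_cocone D J X C k"
    then have C: "Model C" and k: "\<And>a. a \<in> e ` I \<Longrightarrow> k a \<in> arrows D (B a) C"
      and kX: "\<And>u a b. u \<in> arrows J a b \<Longrightarrow> Cmp D (k b) (far X u) = k a"
      by (auto simp: is_cocone_def Ob_D arrows_def Xo J)
    have kH: "fun_of (k a) \<in> Hom (B a) C" if "a \<in> e ` I" for a using D_arrow[OF k[OF that]] by blast
    define h where "h = (\<lambda>x\<in>acarrier A. fun_of (k (s x)) (q (s x) (0, x)))"
    \<comment> \<open>Stage \<open>s x\<close> maps to every stage that contains x, so the value
      does not depend on the stage used.\<close>
    have kq: "fun_of (k a) (q a (0, x)) = h x" if a: "a \<in> e ` I" and x: "x \<in> fst (d a)" for a x
    proof -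
      have xA: "x \<in> acarrier A" using d[OF a] x unfolding I_def by auto
      have "le (s x) a" using s(2)[OF xA] x by (simp add: le_def)
      then have u: "ar (s x) a \<in> arrows J (s x) a" using arr a s(1)[OF xA] by blast
      have 0: "(0, x) \<in> g (fst (d (s x)))" using s(2)[OF xA] by (simp add: g_def)
      show ?thesis
        using D_Cmp_fun(2)[OF Xarr[OF u] k[OF a] qB[OF s(1)[OF xA] 0]] kX[OF u] Xq[OF u 0] xA by (simp add: h_def)
    qed
    have hC: "h x \<in> acarrier C \<and> asort C (h x) = asort A x" if x: "x \<in> acarrier A" for x
    proof -
      have 0: "(0, x) \<in> g (fst (d (s x)))" using s(2)[OF x] by (simp add: g_def)
      note qs = qB[OF s(1)[OF x] 0]
      show ?thesis using ahomD(1,2)[OF kH[OF s(1)[OF x]] qs] presentsD(7)[OF Bq[OF s(1)[OF x]] 0] x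
        by (simp add: h_def p_def)
    qed
    have "h \<in> Hom A C" unfolding ahom_def
    proof (intro CollectI conjI ballI)
      show "h \<in> acarrier A \<rightarrow>\<^sub>E acarrier C" using hC by (auto simp: h_def)
      show "asort C (h x) = asort A x" if "x \<in> acarrier A" for x using hC that by blast
      fix f xs assume f: "f \<in> symbols Sg" and xs: "xs \<in> aargs Sg A f"
      define y where "y = aint A f xs"
      have y: "y \<in> acarrier A" "asort A y = result Sg f" using is_algD(4,5)[OF algA f xs] by (auto simp: y_def)
      \<comment> \<open>The stage made for this one application of f: the generators are its
        arguments and its value y, and the single relator says that y is the value. The cocone arrow
        at this stage is a homomorphism, hence h respects the application.\<close>
      define F where "F = insert y (set xs)"
      define R :: "(('f, 'u) trm \<times> ('f, 'u) trm) set" where "R = {(App f (map (\<lambda>x. Var (0, x)) xs), Var (0, y))}"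
      have "(F, R) \<in> I" using f xs y
        by (auto simp: I_def F_def R_def relators_def g_def p_def aargs_def list_all_iff o_def y_def)
      then have a: "e (F, R) \<in> e ` I" and da: "d (e (F, R)) = (F, R)" by (simp_all add: de)
      let ?a = "e (F, R)"
      have inF: "y \<in> F" "\<And>x. x \<in> set xs \<Longrightarrow> x \<in> F" by (simp_all add: F_def)
      have kqF: "fun_of (k ?a) (q ?a (0, x)) = h x" if "x \<in> F" for x using kq[OF a] da that by simp
      have "aint (B ?a) f (map (\<lambda>x. q ?a (0, x)) xs) = q ?a (0, y)"
      proof -
        have "assign p (g F) R (B ?a) (q ?a)" using presentsD(3)[OF Bq[OF a]] by (simp add: da)
        moreover have "(App f (map (\<lambda>x. Var (0, x)) xs), Var (0, y)) \<in> R" by (simp add: R_def)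
        ultimately have "teval (aint (B ?a)) (q ?a) (App f (map (\<lambda>x. Var (0, x)) xs)) = teval (aint (B ?a)) (q ?a) (Var (0, y))"
          unfolding assign_def by blast
        then show ?thesis by (simp add: o_def)
      qed
      moreover have gF: "(0, x) \<in> g F" if "x \<in> insert y (set xs)" for x using that by (auto simp: g_def F_def)
      moreover have args: "map (\<lambda>x. q ?a (0, x)) xs \<in> aargs Sg (B ?a) f"
      proof -
        have "map (asort (B ?a)) (map (\<lambda>x. q ?a (0, x)) xs) = map (asort A) xs"
          unfolding map_map by (rule map_cong) (use presentsD(7)[OF Bq[OF a]] gF in \<open>auto simp: da p_def\<close>)
        then show ?thesis using xs qB[OF a] gF by (auto simp: aargs_def da simp del: map_map map_eq_conv)
      qed
      ultimately have "fun_of (k ?a) (q ?a (0, y)) = aint C f (map (fun_of (k ?a)) (map (\<lambda>x. q ?a (0, x)) xs))"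
        using ahomD(4)[OF kH[OF a] f args] by simp
      moreover have "map (fun_of (k ?a)) (map (\<lambda>x. q ?a (0, x)) xs) = map h xs"
        by (simp add: kqF inF)
      moreover have "fun_of (k ?a) (q ?a (0, y)) = h y" by (simp add: kqF inF)
      ultimately show "h (aint A f xs) = aint C f (map h xs)" by (simp only: y_def)
    qed
    then have harr: "(A, h, C) \<in> arrows D A C" using A C by (simp add: arrows_D)
    show "\<exists>h\<in>arrows D A C. \<forall>a\<in>Ob J. Cmp D h (l a) = k a"
    proof (intro bexI[OF _ harr] ballI)
      fix a assume "a \<in> Ob J"
      then have a: "a \<in> e ` I" by (simp add: J)
      show "Cmp D (A, h, C) (l a) = k a"
      proof (rule eqB[OF a Cmp_arrow[OF is_cat_alg_cat harr l[OF a]] k[OF a]])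
        fix x assume x: "x \<in> g (fst (d a))"
        then obtain z where z: "x = (0, z)" "z \<in> fst (d a)" by (auto simp: g_def)
        show "fun_of (Cmp D (A, h, C) (l a)) (q a x) = fun_of (k a) (q a x)"
          using D_Cmp_fun(2)[OF l[OF a] harr qB[OF a x]] lq[OF a x] kq[OF a z(2)] z by simp
      qed
    qed
  next
    fix C h h' assume h: "h \<in> arrows D A C" and h': "h' \<in> arrows D A C"
      and eq: "\<And>a. a \<in> Ob J \<Longrightarrow> Cmp D h (l a) = Cmp D h' (l a)"
    have "fun_of h x = fun_of h' x" if x: "x \<in> acarrier A" for x
    proof -
      note sx = s(1)[OF x]
      have 0: "(0, x) \<in> g (fst (d (s x)))" using s(2)[OF x] by (simp add: g_def)
      show ?thesis
        using D_Cmp_fun(2)[OF l[OF sx] h qB[OF sx 0]] D_Cmp_fun(2)[OF l[OF sx] h' qB[OF sx 0]] lq[OF sx 0] eq[of "s x"] sx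
        by (simp add: J)
    qed
    then have "fun_of h = fun_of h'"
      using ahom_ext[of "fun_of h" Sg A C "fun_of h'"] D_arrow[OF h] D_arrow[OF h'] by simp
    then show "h = h'" by (rule D_eqI[OF h h'])
  qed
  then show ?thesis using J(1) filt X BP Xo J(2) by metis
qed

text \<open>Up to renaming, generators are variables (n, s) with s as their sort. The finite
  presentations over these variables form the small set \<open>Idx\<close>, and one algebra is
  chosen for each of them.\<close>

lemma D_lfp:
  assumes S: "small U S"
  shows "lfp_elementwise U D"
proof -
  define Idx where "Idx = {(G, R). finite G \<and> G \<subseteq> UNIV \<times> S \<and> finite R \<and> R \<subseteq> relators Sg snd G}"
  define obj where "obj = (\<lambda>(G, R). SOME B. \<exists>q. presents snd G R B q)"
  have obj: "\<exists>q. presents snd G R (obj (G, R)) q" if "(G, R) \<in> Idx" for G R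
  proof -
    have GR: "finite G" "G \<subseteq> UNIV \<times> S" "R \<subseteq> relators Sg snd G" using that by (auto simp: Idx_def)
    have "snd x \<in> S" if "x \<in> G" for x using that GR(2) by auto
    from presentation_exists[OF small_countable[OF univ countable_finite[OF GR(1)]] this GR(3)]
    have "\<exists>B q. presents snd G R B q" by blast
    then show ?thesis unfolding obj_def prod.case by (rule someI_ex)
  qed
  define T where "T = {t :: ('f, 's) trm. set1_trm t \<subseteq> symbols Sg \<and> tvars t \<subseteq> UNIV \<times> S}"
  have smT: "small U T" unfolding T_def
    by (intro small_terms small_Times univ small_symbols S small_countable) simp
  have "Idx \<subseteq> {G. finite G \<and> G \<subseteq> UNIV \<times> S} \<times> {R. finite R \<and> R \<subseteq> T \<times> T}"
  proof
    fix z assume "z \<in> Idx"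
    then obtain G R where z: "z = (G, R)" "finite G" "G \<subseteq> UNIV \<times> S" "finite R" "R \<subseteq> relators Sg snd G"
      unfolding Idx_def by blast
    have "t \<in> T \<and> t' \<in> T" if "(t, t') \<in> R" for t t'
    proof -
      have "(t, t') \<in> relators Sg snd G" using that z(5) by blast
      then have "set1_trm t \<subseteq> symbols Sg" "set1_trm t' \<subseteq> symbols Sg" "tvars t \<subseteq> G" "tvars t' \<subseteq> G"
        using wtm_symbols by (auto simp: relators_def)
      then show ?thesis using z(3) unfolding T_def by blast
    qed
    then show "z \<in> {G. finite G \<and> G \<subseteq> UNIV \<times> S} \<times> {R. finite R \<and> R \<subseteq> T \<times> T}" using z by auto
  qed
  moreover have "small U ({G :: (nat \<times> 's) set. finite G \<and> G \<subseteq> UNIV \<times> S} \<times> {R. finite R \<and> R \<subseteq> T \<times> T})"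
    by (intro small_Times small_finite_subsets univ smT S small_countable) simp
  ultimately have "small U Idx" by (blast intro: small_subset)
  then have smP: "small U (obj ` Idx)" by (rule small_image)
  have fp: "fp_object U D B" if "B \<in> obj ` Idx" for B
  proof -
    from that obtain G R where GR: "(G, R) \<in> Idx" "B = obj (G, R)" by auto
    then obtain q where "presents snd G R B q" using obj by blast
    then show ?thesis by (rule finite_presentation_fp) (use GR in \<open>auto simp: Idx_def\<close>)
  qed
  have rep: "\<exists>B\<in>obj ` Idx. \<exists>q. presents p G R B q"
    if G: "finite G" "\<And>x. x \<in> G \<Longrightarrow> p x \<in> S" and R: "finite R" "R \<subseteq> relators Sg p G"
    for p :: "nat \<times> 'u \<Rightarrow> 's" and G R
  proof -
    obtain idx :: "nat \<times> 'u \<Rightarrow> nat" where idx: "inj_on idx G" using finite_imp_inj_to_nat_seg[OF G(1)] by blast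
    \<comment> \<open>The number keeps the renaming injective when generators share a sort; the
      second component records the sort.\<close>
    define \<rho> where "\<rho> x = (idx x, p x)" for x
    have \<rho>: "inj_on \<rho> G" using idx by (auto simp: inj_on_def \<rho>_def)
    let ?f = "\<lambda>t. tsubst (\<lambda>x. Var (\<rho> x)) t"
    let ?R = "(\<lambda>(t, t'). (?f t, ?f t')) ` R"
    have "(?f t, ?f t') \<in> relators Sg snd (\<rho> ` G)" if "(t, t') \<in> R" for t t'
    proof -
      have tt: "wtm Sg p t" "wtm Sg p t'" "tvars t \<subseteq> G" "tvars t' \<subseteq> G" "psort Sg p t = psort Sg p t'"
        using that R(2) by (auto simp: relators_def)
      have "wtm Sg snd (?f r) \<and> psort Sg snd (?f r) = psort Sg p r" if "wtm Sg p r" for r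
        by (rule wtm_tsubst[OF that]) (simp add: \<rho>_def)
      then show ?thesis using tt unfolding relators_def by (auto simp: tvars_tsubst)
    qed
    then have "(\<rho> ` G, ?R) \<in> Idx" unfolding Idx_def using G R by (auto simp: \<rho>_def)
    then obtain q where "presents snd (\<rho> ` G) ?R (obj (\<rho> ` G, ?R)) q" using obj by blast
    from presents_rename[OF \<rho> _ R(2) this] have "presents p G R (obj (\<rho> ` G, ?R)) (\<lambda>x. q (\<rho> x))" by (simp add: \<rho>_def)
    then show ?thesis using \<open>(\<rho> ` G, ?R) \<in> Idx\<close> by blast
  qed
  show ?thesis unfolding lfp_elementwise_def
  proof (intro conjI exI[of _ "obj ` Idx"] ballI)
    fix A assume "A \<in> Ob D"
    then have "Model A" by (simp add: Ob_D)
    from directed_colimit_of_presentations[OF this rep]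
    show "\<exists>(J :: ('u, 'u) cat) X l. small_cat U J \<and> filtered J \<and> is_functor J D X \<and>
           (\<forall>i\<in>Ob J. fob X i \<in> obj ` Idx) \<and> is_colimit D J X A l" by simp
  qed (use smP fp D_locally_small D_cocomplete is_cat_alg_cat in auto)
qed

end

section \<open>Monadicity\<close>

lemma is_cat_em_cat:
  assumes T: "is_functor X X T"
  shows "is_cat (em_cat X T \<eta> \<mu>)"
  unfolding em_cat_def
proof (rule is_cat_mk_cat, goal_cases)
  note X = functor_cats(1)[OF T]
  case (1 A)
  then obtain x a where A: "A = (x, a)" "x \<in> Ob X" "a \<in> arrows X (fob T x) x" by auto
  then show ?case using Ide_arrow[OF X A(2)] functor_Ide[OF T A(2)] Cmp_Ide[OF X A(3)] by simp
next
  note X = functor_cats(1)[OF T]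
  case (2 A B C f g)
  then obtain x a y b z c where A: "A = (x, a)" "a \<in> arrows X (fob T x) x" and B: "B = (y, b)" "b \<in> arrows X (fob T y) y"
    and C: "C = (z, c)" "c \<in> arrows X (fob T z) z"
    and f: "f \<in> arrows X x y" "Cmp X f a = Cmp X b (far T f)" and g: "g \<in> arrows X y z" "Cmp X g b = Cmp X c (far T g)" by auto
  have "Cmp X (Cmp X g f) a = Cmp X g (Cmp X b (far T f))" using Cmp_assoc[OF X g(1) f(1) A(2)] f(2) by simp
  also have "\<dots> = Cmp X (Cmp X c (far T g)) (far T f)"
    using Cmp_assoc[OF X g(1) B(2) functor_arrow[OF T f(1)]] g(2) by simp
  also have "\<dots> = Cmp X c (far T (Cmp X g f))"
    using Cmp_assoc[OF X C(2) functor_arrow[OF T g(1)] functor_arrow[OF T f(1)]] functor_Cmp[OF T g(1) f(1)] by simp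
  finally show ?case using A B C Cmp_arrow[OF X g(1) f(1)] by simp
next
  note X = functor_cats(1)[OF T]
  case (3 A B f)
  then show ?case using Cmp_Ide[OF X] by (auto split: prod.splits)
next
  note X = functor_cats(1)[OF T]
  case (4 A B f)
  then show ?case using Cmp_Ide[OF X] by (auto split: prod.splits)
next
  note X = functor_cats(1)[OF T]
  case (5 A B C D f g h)
  then show ?case using Cmp_assoc[OF X] by (auto split: prod.splits)
qed

lemma em_cat_Ob:
  "(x, a) \<in> Ob (em_cat X T \<eta> \<mu>) \<longleftrightarrow> x \<in> Ob X \<and> a \<in> arrows X (fob T x) x \<and>
     Cmp X a (\<eta> x) = Ide X x \<and> Cmp X a (far T a) = Cmp X a (\<mu> x)"
  by (simp add: em_cat_def)

lemma em_cat_arrows: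
  "f \<in> arrows (em_cat X T \<eta> \<mu>) (x, a) (y, b) \<longleftrightarrow> (\<exists>h. f = ((x, a), h, (y, b)) \<and>
     (x, a) \<in> Ob (em_cat X T \<eta> \<mu>) \<and> (y, b) \<in> Ob (em_cat X T \<eta> \<mu>) \<and> h \<in> arrows X x y \<and> Cmp X h a = Cmp X b (far T h))"
  by (auto simp: em_cat_def arrows_mk_cat)

lemma comparison_simps:
  "fob (comparison A G \<epsilon>) a = (fob G a, far G (\<epsilon> a))"
  "far (comparison A G \<epsilon>) f = ((fob G (Src A f), far G (\<epsilon> (Src A f))), far G f, (fob G (Tgt A f), far G (\<epsilon> (Tgt A f))))"
  by (simp_all add: comparison_def Let_def)

text \<open>The associativity law of the structure map \<open>far G (\<epsilon> a)\<close> is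
  naturality of the counit at the arrow \<open>\<epsilon> a\<close>; the unit law is a triangle
  identity.\<close>

lemma comparison_functor:
  assumes adj: "adjunction A X F G \<eta> \<epsilon>"
  shows "is_functor A (em_cat X (comp_fctr G F) \<eta> (\<lambda>x. far G (\<epsilon> (fob F x)))) (comparison A G \<epsilon>)"
proof -
  note F = adjunctionD(1)[OF adj] and G = adjunctionD(2)[OF adj] and \<epsilon> = adjunctionD(4)[OF adj]
    and \<epsilon>nat = adjunctionD(6)[OF adj] and tri1 = adjunctionD(7)[OF adj]
  note A = functor_cats(1)[OF G] and X = functor_cats(2)[OF G]
  let ?EM = "em_cat X (comp_fctr G F) \<eta> (\<lambda>x. far G (\<epsilon> (fob F x)))"
  have ob: "fob (comparison A G \<epsilon>) a \<in> Ob ?EM" if a: "a \<in> Ob A" for a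
  proof -
    note FGa = functor_ob[OF F functor_ob[OF G a]]
    have "Cmp A (\<epsilon> a) (far F (far G (\<epsilon> a))) = Cmp A (\<epsilon> a) (\<epsilon> (fob F (fob G a)))" by (rule \<epsilon>nat[OF \<epsilon>[OF a]])
    then have "Cmp X (far G (\<epsilon> a)) (far G (far F (far G (\<epsilon> a)))) = Cmp X (far G (\<epsilon> a)) (far G (\<epsilon> (fob F (fob G a))))"
      using functor_Cmp[OF G \<epsilon>[OF a] functor_arrow[OF F functor_arrow[OF G \<epsilon>[OF a]]]] functor_Cmp[OF G \<epsilon>[OF a] \<epsilon>[OF FGa]] by simp
    then show ?thesis using functor_ob[OF G a] functor_arrow[OF G \<epsilon>[OF a]] tri1[OF a] by (simp add: comparison_simps em_cat_Ob)
  qed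
  show ?thesis
  proof (rule is_functorI[OF A is_cat_em_cat[OF functor_comp[OF F G]] ob])
    fix a b f assume f: "f \<in> arrows A a b"
    note fD = arrowsD[OF A f]
    have "Cmp X (far G f) (far G (\<epsilon> a)) = Cmp X (far G (\<epsilon> b)) (far G (far F (far G f)))"
      using functor_Cmp[OF G f \<epsilon>[OF fD(1)]] functor_Cmp[OF G \<epsilon>[OF fD(2)] functor_arrow[OF F functor_arrow[OF G f]]] \<epsilon>nat[OF f]
      by simp
    then show "far (comparison A G \<epsilon>) f \<in> arrows ?EM (fob (comparison A G \<epsilon>) a) (fob (comparison A G \<epsilon>) b)"
      using ob[OF fD(1)] ob[OF fD(2)] functor_arrow[OF G f] fD(4,5) by (simp add: comparison_simps em_cat_arrows)
  next
    fix a assume a: "a \<in> Ob A"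
    show "far (comparison A G \<epsilon>) (Ide A a) = Ide ?EM (fob (comparison A G \<epsilon>) a)"
      using arrowsD(4,5)[OF A Ide_arrow[OF A a]] functor_Ide[OF G a] by (simp add: comparison_simps em_cat_def)
  next
    fix a b c f g assume f: "f \<in> arrows A a b" and g: "g \<in> arrows A b c"
    show "far (comparison A G \<epsilon>) (Cmp A g f) = Cmp ?EM (far (comparison A G \<epsilon>) g) (far (comparison A G \<epsilon>) f)"
      using arrowsD(4,5)[OF A f] arrowsD(4,5)[OF A g] arrowsD(4,5)[OF A Cmp_arrow[OF A g f]] functor_Cmp[OF G g f]
      by (simp add: comparison_simps em_cat_def)
  qed
qed

context variety_spec
begin

text \<open>
  The structure map of an Eilenberg-Moore algebra determines the operations on its underlying set:
  each operation is computed in the free algebra and mapped back.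
\<close>

lemma D_monadic:
  obtains F \<eta> \<epsilon> where "adjunction D SO F alg_forget \<eta> \<epsilon>"
    "is_isomorphism D (em_cat SO (comp_fctr alg_forget F) \<eta> (\<lambda>x. far alg_forget (\<epsilon> (fob F x)))) (comparison D alg_forget \<epsilon>)"
    "preserves_filtered_colimits U SO SO (comp_fctr alg_forget F)"
proof -
  let ?V = "alg_forget :: (('f, 's, 'u) alg, ('f, 's, 'u) alg \<times> ('u \<Rightarrow> 'u) \<times> ('f, 's, 'u) alg,
    ('u, 's) over, ('u, 's) over \<times> ('u \<Rightarrow> 'u) \<times> ('u, 's) over) fctr"
  note V = forget_functor
  define g :: "'u set \<Rightarrow> (nat \<times> 'u) set" where "g X = {0} \<times> X" for X
  \<comment> \<open>The free algebra on a set over S is presented by its elements, without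
    relators.\<close>
  have "\<forall>x\<in>Ob SO. \<exists>A q. presents (\<lambda>y. snd x (snd y)) (g (fst x)) {} A q"
  proof
    fix x assume "x \<in> Ob SO"
    then have "fst x \<in> U" "\<And>y. y \<in> fst x \<Longrightarrow> snd x y \<in> S" by (cases x; auto simp: sets_over_Ob)+
    then have "small U (g (fst x))" "\<And>y. y \<in> g (fst x) \<Longrightarrow> snd x (snd y) \<in> S"
      using small_Times[OF univ small_countable[OF univ, of "{0 :: nat}"] small_member] by (auto simp: g_def)
    from presentation_exists[where p = "\<lambda>y. snd x (snd y)", OF this empty_subsetI] show "\<exists>A q. presents (\<lambda>y. snd x (snd y)) (g (fst x)) {} A q" by blast
  qed
  then obtain M q where free: "\<And>x. x \<in> Ob SO \<Longrightarrow> presents (\<lambda>y. snd x (snd y)) (g (fst x)) {} (M x) (q x)" by metis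
  define \<eta> where "\<eta> x = (x, \<lambda>y\<in>fst x. q x (0, y), fob ?V (M x))" for x
  have MM: "Model (M x)" if "x \<in> Ob SO" for x using presentsD(1)[OF free[OF that]] .
  have qM: "q x (0, y) \<in> acarrier (M x)" "asort (M x) (q x (0, y)) = snd x y" if "x \<in> Ob SO" "y \<in> fst x" for x y
    using presentsD(6,7)[OF free[OF that(1)], of "(0, y)"] that(2) by (auto simp: g_def)
  have \<eta>y: "fun_of (\<eta> x) y = q x (0, y)" if "y \<in> fst x" for x y using that by (simp add: \<eta>_def)
  have \<eta>: "\<eta> x \<in> arrows SO x (fob ?V (M x))" if "x \<in> Ob SO" for x
    using that forget_Ob[OF MM[OF that]] qM[OF that] by (auto simp: sets_over_arrows \<eta>_def)
  have Vfun: "fun_of (far ?V f) = fun_of f" for f by (cases f) auto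
  have SO_eqI: "f = f'" if "f \<in> arrows SO x y" "f' \<in> arrows SO x y" "\<And>z. z \<in> fst x \<Longrightarrow> fun_of f z = fun_of f' z" for f f' x y
    using that by (auto simp: sets_over_arrows intro: PiE_ext)
  have SO_fun: "fun_of (Cmp SO f' f) z = fun_of f' (fun_of f z)" if "f \<in> arrows SO x y" "f' \<in> arrows SO y w" "z \<in> fst x" for f f' x y w z
    using that sets_over_Cmp_eq[of f x "fun_of f" y f' y "fun_of f'" w U S] by (auto simp: sets_over_arrows compose_def)
  have V\<eta>: "fun_of (Cmp SO (far ?V h) (\<eta> x)) y = fun_of h (q x (0, y))" if "x \<in> Ob SO" "h \<in> arrows D (M x) a" "y \<in> fst x" for x h a y
    using SO_fun[OF \<eta>[OF that(1)] functor_arrow[OF V that(2)] that(3)] \<eta>y[OF that(3)] by (simp add: Vfun)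
  obtain F \<epsilon> where adj: "adjunction D SO F ?V \<eta> \<epsilon>" and FM: "fob F = M"
  proof (rule adjunction_from_universal_arrows[OF V, of M \<eta>])
    show "M x \<in> Ob D" if "x \<in> Ob SO" for x using MM[OF that] by (simp add: Ob_D)
    show "\<eta> x \<in> arrows SO x (fob ?V (M x))" if "x \<in> Ob SO" for x by (rule \<eta>[OF that])
    fix x a f assume x: "x \<in> Ob SO" and a: "a \<in> Ob D" and f: "f \<in> arrows SO x (fob ?V a)"
    have aM: "Model a" using a by (simp add: Ob_D)
    have "fun_of f y \<in> acarrier a \<and> asort a (fun_of f y) = snd x y" if "y \<in> fst x" for y
      using f that by (auto simp: sets_over_arrows)
    then have "assign (\<lambda>y. snd x (snd y)) (g (fst x)) {} a (\<lambda>y. fun_of f (snd y))" by (auto simp: assign_def g_def)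
    from presentsD(4)[OF free[OF x] aM this] obtain h where h: "h \<in> Hom (M x) a" "\<forall>y\<in>g (fst x). h (q x y) = fun_of f (snd y)" by blast
    have harr: "(M x, h, a) \<in> arrows D (M x) a" using h(1) MM[OF x] aM by (simp add: arrows_D)
    have "Cmp SO (far ?V (M x, h, a)) (\<eta> x) = f"
    proof (rule SO_eqI[OF Cmp_arrow[OF is_cat_sets_over functor_arrow[OF V harr] \<eta>[OF x]] f])
      fix y assume "y \<in> fst x"
      then show "fun_of (Cmp SO (far ?V (M x, h, a)) (\<eta> x)) y = fun_of f y"
        using V\<eta>[OF x harr] h(2) by (simp add: g_def)
    qed
    then show "\<exists>h\<in>arrows D (M x) a. Cmp SO (far ?V h) (\<eta> x) = f" using harr by blast
  next
    fix x a h h' assume x: "x \<in> Ob SO" and h: "h \<in> arrows D (M x) a" and h': "h' \<in> arrows D (M x) a"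
      and eq: "Cmp SO (far ?V h) (\<eta> x) = Cmp SO (far ?V h') (\<eta> x)"
    have "fun_of h = fun_of h'"
    proof (rule presentsD(5)[OF free[OF x]])
      show "Model a" "fun_of h \<in> Hom (M x) a" "fun_of h' \<in> Hom (M x) a" using D_arrow[OF h] D_arrow[OF h'] by auto
      fix y assume "y \<in> g (fst x)"
      then obtain z where z: "y = (0, z)" "z \<in> fst x" by (auto simp: g_def)
      show "fun_of h (q x y) = fun_of h' (q x y)" using V\<eta>[OF x h z(2)] V\<eta>[OF x h' z(2)] eq z(1) by simp
    qed
    then show "h = h'" by (rule D_eqI[OF h h'])
  qed blast
  note F = adjunctionD(1)[OF adj] and \<epsilon> = adjunctionD(4)[OF adj] and \<eta>nat = adjunctionD(5)[OF adj] and tri1 = adjunctionD(7)[OF adj]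
  let ?T = "comp_fctr ?V F" and ?\<mu> = "\<lambda>x. far ?V (\<epsilon> (fob F x))"
  let ?K = "comparison D ?V \<epsilon>"
  let ?EM = "em_cat SO ?T \<eta> ?\<mu>"
  have VA: "fob ?V A = (acarrier A, asort A)" for A :: "('f, 's, 'u) alg" by simp
  have VO: "fob ?V A \<in> Ob SO" if "Model A" for A using forget_Ob[OF that] by simp
  have eps: "\<epsilon> A \<in> arrows D (M (fob ?V A)) A" if "Model A" for A using \<epsilon>[of A] that by (simp add: Ob_D FM)
  have epsH: "fun_of (\<epsilon> A) \<in> Hom (M (fob ?V A)) A" if "Model A" for A using D_arrow[OF eps[OF that]] by blast
  \<comment> \<open>The triangle identity on elements: the counit sends the generator named x to
    x.\<close>
  have epsq: "fun_of (\<epsilon> A) (q (fob ?V A) (0, x)) = x" if A: "Model A" and x: "x \<in> acarrier A" for A x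
  proof -
    have "fun_of (Cmp SO (far ?V (\<epsilon> A)) (\<eta> (fob ?V A))) x = x" using tri1[of A] A x by (simp add: Ob_D sets_over_Ide)
    then show ?thesis using V\<eta>[OF VO[OF A] eps[OF A], of x] x by simp
  qed
  have qargs: "map (\<lambda>x. q y (0, x)) xs \<in> aargs Sg (M y) f"
    if y: "y \<in> Ob SO" and xs: "set xs \<subseteq> fst y" "map (snd y) xs = arity Sg f" for y xs f
  proof -
    have "map (asort (M y)) (map (\<lambda>x. q y (0, x)) xs) = map (snd y) xs"
      unfolding map_map by (rule map_cong) (use qM[OF y] xs(1) in auto)
    then show ?thesis using xs qM(1)[OF y] by (auto simp: aargs_def simp del: map_map map_eq_conv)
  qed
  have aint_eps: "aint A f xs = fun_of (\<epsilon> A) (aint (M (fob ?V A)) f (map (\<lambda>x. q (fob ?V A) (0, x)) xs))"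
    if A: "Model A" and f: "f \<in> symbols Sg" and xs: "xs \<in> aargs Sg A f" for A f xs
  proof -
    have "map (fun_of (\<epsilon> A)) (map (\<lambda>x. q (fob ?V A) (0, x)) xs) = xs"
      unfolding map_map using epsq[OF A] xs by (intro map_idI) (auto simp: aargs_def)
    moreover have "map (\<lambda>x. q (fob ?V A) (0, x)) xs \<in> aargs Sg (M (fob ?V A)) f"
      using qargs[OF VO[OF A]] xs by (simp add: aargs_def)
    ultimately show ?thesis using ahomD(4)[OF epsH[OF A] f] by metis
  qed
  have Farr: "far F h \<in> arrows D (M x) (M y)" if "h \<in> arrows SO x y" for h x y
    using functor_arrow[OF F that] by (simp add: FM)
  have Fq: "fun_of (far F h) (q x (0, z)) = q y (0, fun_of h z)" if h: "h \<in> arrows SO x y" and z: "z \<in> fst x" for h x y z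
  proof -
    note x = arrowsD(1)[OF is_cat_sets_over h] and y = arrowsD(2)[OF is_cat_sets_over h]
    have hz: "fun_of h z \<in> fst y" using h z by (auto simp: sets_over_arrows)
    have "fun_of (Cmp SO (\<eta> y) h) z = fun_of (Cmp SO (far ?V (far F h)) (\<eta> x)) z" using \<eta>nat[OF h] by simp
    then show ?thesis using SO_fun[OF h \<eta>[OF y] z] V\<eta>[OF x Farr[OF h] z] \<eta>y[OF hz] by simp
  qed
  have K: "is_functor D ?EM ?K" by (rule comparison_functor[OF adj])
  \<comment> \<open>The structure map in \<open>fob ?K A\<close> is the counit, which by
    \<open>aint_eps\<close> determines the operations on well-sorted arguments; elsewhere they are
    \<open>undefined\<close>.\<close>
  have inj: "A = B" if A: "Model A" and B: "Model B" and eq: "fob ?K A = fob ?K B" for A B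
  proof -
    have V_eq: "fob ?V A = fob ?V B" and e_eq: "fun_of (\<epsilon> A) = fun_of (\<epsilon> B)"
      using eq Vfun[of "\<epsilon> A"] Vfun[of "\<epsilon> B"] by (simp_all add: comparison_simps)
    have c: "acarrier A = acarrier B" "asort A = asort B" using V_eq by simp_all
    have "aint A f xs = aint B f xs" for f xs
    proof (cases "f \<in> symbols Sg \<and> xs \<in> aargs Sg A f")
      case True
      then have "xs \<in> aargs Sg B f" by (simp add: aargs_def c)
      then show ?thesis using aint_eps[OF A, of f xs] aint_eps[OF B, of f xs] True V_eq e_eq by simp
    next
      case False
      moreover then have "\<not> (f \<in> symbols Sg \<and> xs \<in> aargs Sg B f)" by (simp add: aargs_def c)
      ultimately show ?thesis using is_algD(6)[OF Model_alg[OF A]] is_algD(6)[OF Model_alg[OF B]] by metis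
    qed
    then have "aint A = aint B" by blast
    then show ?thesis using c by simp
  qed
  have surj: "\<exists>A. Model A \<and> fob ?K A = (x, a)" if xa: "(x, a) \<in> Ob ?EM" for x a
  proof -
    have x: "x \<in> Ob SO" and aarr: "a \<in> arrows SO (fob ?V (M x)) x" and a\<eta>: "Cmp SO a (\<eta> x) = Ide SO x"
      and a\<mu>: "Cmp SO a (far ?V (far F a)) = Cmp SO a (far ?V (\<epsilon> (M x)))"
      using xa by (simp_all add: em_cat_Ob FM)
    define a' where "a' = fun_of a"
    note xM = MM[OF x]
    have aeq: "a = (fob ?V (M x), a', x)" and a'E: "a' \<in> acarrier (M x) \<rightarrow>\<^sub>E fst x"
      and a's: "\<And>t. t \<in> acarrier (M x) \<Longrightarrow> snd x (a' t) = asort (M x) t"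
      using aarr by (auto simp: sets_over_arrows a'_def)
    have a'q: "a' (q x (0, y)) = y" if "y \<in> fst x" for y
      using SO_fun[OF \<eta>[OF x] aarr that] a\<eta> \<eta>y[OF that] that by (simp add: sets_over_Ide a'_def)
    have xs_S: "snd x y \<in> S" if "y \<in> fst x" for y using x that by (cases x) (auto simp: sets_over_Ob)
    let ?N = "M (fob ?V (M x))" and ?q = "q (fob ?V (M x))"
    have a'T: "a' (fun_of (far F a) z) = a' (fun_of (\<epsilon> (M x)) z)" if z: "z \<in> acarrier ?N" for z
    proof -
      have 1: "far ?V (far F a) \<in> arrows SO (fob ?V ?N) (fob ?V (M x))" by (rule functor_arrow[OF V Farr[OF aarr]])
      have 2: "far ?V (\<epsilon> (M x)) \<in> arrows SO (fob ?V ?N) (fob ?V (M x))" by (rule functor_arrow[OF V eps[OF xM]])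
      have z': "z \<in> fst (fob ?V ?N)" using z by simp
      show ?thesis using SO_fun[OF 1 aarr z'] SO_fun[OF 2 aarr z'] a\<mu> Vfun by (simp add: a'_def)
    qed
    \<comment> \<open>Both sides come from one element of the free algebra on the carrier of
      \<open>M x\<close>, namely f applied to the generators named by \<open>ts\<close>. The
      multiplication evaluates it to f applied to \<open>ts\<close>, while \<open>far F a\<close>
      first replaces each generator t by the generator named \<open>a' t\<close>; the associativity
      law of the structure map equates the images under a'.\<close>
    have key: "a' (aint (M x) f ts) = a' (aint (M x) f (map (\<lambda>t. q x (0, a' t)) ts))"
      if f: "f \<in> symbols Sg" and ts: "ts \<in> aargs Sg (M x) f" for f ts
    proof -
      have ts': "set ts \<subseteq> acarrier (M x)" using ts by (simp add: aargs_def)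
      have args: "map (\<lambda>t. ?q (0, t)) ts \<in> aargs Sg ?N f" using qargs[OF VO[OF xM]] ts by (simp add: aargs_def)
      let ?z = "aint ?N f (map (\<lambda>t. ?q (0, t)) ts)"
      have FH: "fun_of (far F a) \<in> Hom ?N (M x)" using D_arrow[OF Farr[OF aarr]] by blast
      have "map (fun_of (far F a)) (map (\<lambda>t. ?q (0, t)) ts) = map (\<lambda>t. q x (0, a' t)) ts"
        unfolding map_map by (rule map_cong) (use Fq[OF aarr] ts' in \<open>auto simp: a'_def\<close>)
      then have "fun_of (far F a) ?z = aint (M x) f (map (\<lambda>t. q x (0, a' t)) ts)"
        using ahomD(4)[OF FH f args] by (simp only:)
      moreover have "fun_of (\<epsilon> (M x)) ?z = aint (M x) f ts" using aint_eps[OF xM f ts] by simp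
      ultimately show ?thesis using a'T[OF is_algD(4)[OF Model_alg[OF MM[OF VO[OF xM]]] f args]] by simp
    qed
    \<comment> \<open>An operation on x is computed on generators of the free algebra and mapped
      back by the structure map; by \<open>key\<close>, a' is then a homomorphism.\<close>
    define A :: "('f, 's, 'u) alg" where "A = \<lparr>acarrier = fst x, asort = snd x,
      aint = (\<lambda>f xs. if f \<in> symbols Sg \<and> set xs \<subseteq> fst x \<and> map (snd x) xs = arity Sg f
        then a' (aint (M x) f (map (\<lambda>y. q x (0, y)) xs)) else undefined)\<rparr>"
    have Ac: "acarrier A = fst x" "asort A = snd x" by (simp_all add: A_def)
    have Aargs: "xs \<in> aargs Sg A f \<longleftrightarrow> set xs \<subseteq> fst x \<and> map (snd x) xs = arity Sg f" for xs f
      by (simp add: aargs_def Ac)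
    have Aint: "aint A f xs = (if f \<in> symbols Sg \<and> xs \<in> aargs Sg A f then a' (aint (M x) f (map (\<lambda>y. q x (0, y)) xs)) else undefined)" for f xs
      unfolding Aargs by (simp add: A_def)
    have Aalg: "is_alg U S Sg A" unfolding is_alg_def
    proof (intro conjI allI)
      show "acarrier A \<in> U" using x by (cases x) (simp add: Ac sets_over_Ob)
      show "asort A \<in> acarrier A \<rightarrow>\<^sub>E S" using x by (cases x) (simp add: Ac sets_over_Ob)
      show "if f \<in> symbols Sg \<and> xs \<in> aargs Sg A f then aint A f xs \<in> acarrier A \<and> asort A (aint A f xs) = result Sg f
        else aint A f xs = undefined" for f xs
      proof (cases "f \<in> symbols Sg \<and> xs \<in> aargs Sg A f")
        case True
        then have args: "map (\<lambda>y. q x (0, y)) xs \<in> aargs Sg (M x) f" using qargs[OF x] by (simp add: Aargs)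
        have f: "f \<in> symbols Sg" using True by blast
        note r = is_algD(4,5)[OF Model_alg[OF xM] f args]
        show ?thesis using True r PiE_mem[OF a'E r(1)] a's[OF r(1)] by (simp add: Aint Ac)
      next
        case False
        then show ?thesis unfolding Aint by (simp only: if_False)
      qed
    qed
    have a'H: "a' \<in> Hom (M x) A" unfolding ahom_def
    proof (intro CollectI conjI ballI)
      show "a' \<in> acarrier (M x) \<rightarrow>\<^sub>E acarrier A" using a'E by (simp add: Ac)
      show "asort A (a' t) = asort (M x) t" if "t \<in> acarrier (M x)" for t using a's[OF that] by (simp add: Ac)
      fix f ts assume f: "f \<in> symbols Sg" and ts: "ts \<in> aargs Sg (M x) f"
      have "set ts \<subseteq> acarrier (M x)" using ts by (simp add: aargs_def)
      moreover from this have "map (snd x) (map a' ts) = map (asort (M x)) ts"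
        unfolding map_map by (intro map_cong) (use a's in auto)
      ultimately have "map a' ts \<in> aargs Sg A f"
        using ts PiE_mem[OF a'E] by (auto simp: Ac aargs_def simp del: map_map map_eq_conv)
      then show "a' (aint (M x) f ts) = aint A f (map a' ts)" using key[OF f ts] f by (simp add: Aint o_def)
    qed
    \<comment> \<open>The equation holds in the free algebra at the generators named by the values
      of v, and the homomorphism a' carries it to A.\<close>
    have "satisfies A (t, t')" if tt: "(t, t') \<in> E" for t t' unfolding satisfies_def prod.case
    proof (intro allI impI)
      fix v :: "nat \<times> 's \<Rightarrow> 'u" assume v: "\<forall>y\<in>tvars t \<union> tvars t'. v y \<in> acarrier A \<and> asort A (v y) = snd y"
      have wt: "wtm Sg snd t" "wtm Sg snd t'" using eqs[OF tt] by (auto simp: well_sorted_wtm)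
      let ?w = "\<lambda>y. q x (0, v y)"
      have w: "?w y \<in> acarrier (M x) \<and> asort (M x) (?w y) = snd y \<and> a' (?w y) = v y" if "y \<in> tvars t \<union> tvars t'" for y
        using v that qM[OF x] a'q by (auto simp: Ac)
      have ev: "teval (aint A) v r = a' (teval (aint (M x)) ?w r)" if r: "r = t \<or> r = t'" for r
      proof -
        have "teval (aint A) v r = teval (aint A) (\<lambda>y. a' (?w y)) r" by (rule teval_cong) (use w r in auto)
        also have "\<dots> = a' (teval (aint (M x)) ?w r)"
          by (rule ahom_teval[OF Model_alg[OF xM] a'H, symmetric, where p=snd]) (use wt r w in auto)
        finally show ?thesis .
      qed
      have "satisfies (M x) (t, t')" using xM tt by (auto simp: model_def)
      then have "teval (aint (M x)) ?w t = teval (aint (M x)) ?w t'" using w unfolding satisfies_def by auto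
      then show "teval (aint A) v t = teval (aint A) v t'" using ev by simp
    qed
    then have AM: "Model A" using Aalg by (auto simp: model_def)
    have VAx: "fob ?V A = x" by (simp add: Ac)
    \<comment> \<open>Both are homomorphisms out of the free algebra that send the generator named z
      to z.\<close>
    have "fun_of (\<epsilon> A) = a'"
    proof (rule presentsD(5)[OF free[OF x] AM])
      show "fun_of (\<epsilon> A) \<in> Hom (M x) A" using epsH[OF AM] VAx by simp
      show "a' \<in> Hom (M x) A" by (rule a'H)
      fix y assume "y \<in> g (fst x)"
      then obtain z where z: "y = (0, z)" "z \<in> fst x" by (auto simp: g_def)
      show "fun_of (\<epsilon> A) (q x y) = a' (q x y)" using epsq[OF AM, of z] a'q[OF z(2)] z VAx by (simp add: Ac)
    qed
    then have "\<epsilon> A = (M x, a', A)" using D_arrow[OF eps[OF AM]] VAx by metis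
    then have "far ?V (\<epsilon> A) = a" using aeq VAx by simp
    then show ?thesis using AM VAx by (auto simp: comparison_simps)
  qed
  have Karr: "far ?K f = (fob ?K A, far ?V f, fob ?K B)" if "f \<in> arrows D A B" for f A B
    using arrowsD(4,5)[OF is_cat_alg_cat that] by (simp add: comparison_simps)
  have arr: "\<exists>f\<in>Ar D. far ?K f = z" if z: "z \<in> Ar ?EM" for z
  proof -
    obtain x a y b where xy: "Src ?EM z = (x, a)" "Tgt ?EM z = (y, b)" by (metis surj_pair)
    have EMc: "is_cat ?EM" by (rule functor_cats[OF K])
    have "z \<in> arrows ?EM (x, a) (y, b)" using arrow_Ar[OF EMc z] xy by simp
    then obtain h where h: "z = ((x, a), h, (y, b))" "(x, a) \<in> Ob ?EM" "(y, b) \<in> Ob ?EM" "h \<in> arrows SO x y"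
      "Cmp SO h a = Cmp SO b (far ?T h)" unfolding em_cat_arrows by blast
    obtain A where A: "Model A" "fob ?K A = (x, a)" using surj[OF h(2)] by blast
    obtain B where B: "Model B" "fob ?K B = (y, b)" using surj[OF h(3)] by blast
    have xV: "x = fob ?V A" "a = far ?V (\<epsilon> A)" and yV: "y = fob ?V B" "b = far ?V (\<epsilon> B)"
      using A(2) B(2) by (simp_all add: comparison_simps)
    have hA: "h = (fob ?V A, fun_of h, fob ?V B)" "fun_of h \<in> acarrier A \<rightarrow>\<^sub>E acarrier B"
      "\<And>c. c \<in> acarrier A \<Longrightarrow> asort B (fun_of h c) = asort A c"
      using h(4) unfolding xV yV by (auto simp: sets_over_arrows)
    note harr = h(4)[unfolded xV yV]
    let ?M = "M (fob ?V A)" and ?q = "\<lambda>c. q (fob ?V A) (0, c)"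
    note VM = VO[OF A(1)]
    have FH: "fun_of (far F h) \<in> Hom ?M (M (fob ?V B))" using D_arrow[OF Farr[OF harr]] by blast
    \<comment> \<open>The defining square of an arrow of Eilenberg-Moore algebras, on elements;
      combined with \<open>aint_eps\<close> it says that h commutes with the operations.\<close>
    have sq: "fun_of h (fun_of (\<epsilon> A) m) = fun_of (\<epsilon> B) (fun_of (far F h) m)" if m: "m \<in> acarrier ?M" for m
    proof -
      have m': "m \<in> fst (fob ?V ?M)" using m by simp
      have "fun_of (Cmp SO h (far ?V (\<epsilon> A))) m = fun_of (Cmp SO (far ?V (\<epsilon> B)) (far ?V (far F h))) m"
        using h(5) unfolding xV yV by simp
      then show ?thesis
        using SO_fun[OF functor_arrow[OF V eps[OF A(1)]] harr m']
          SO_fun[OF functor_arrow[OF V Farr[OF harr]] functor_arrow[OF V eps[OF B(1)]] m'] Vfun by simp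
    qed
    have "fun_of h \<in> Hom A B" unfolding ahom_def
    proof (intro CollectI conjI ballI)
      fix f xs assume f: "f \<in> symbols Sg" and xs: "xs \<in> aargs Sg A f"
      have xs': "set xs \<subseteq> acarrier A" using xs by (simp add: aargs_def)
      have args: "map ?q xs \<in> aargs Sg ?M f" using qargs[OF VM] xs by (simp add: aargs_def)
      have "map (asort B) (map (fun_of h) xs) = map (asort A) xs"
        unfolding map_map by (rule map_cong) (use hA(3) xs' in auto)
      then have hxs: "map (fun_of h) xs \<in> aargs Sg B f"
        using xs PiE_mem[OF hA(2)] by (auto simp: aargs_def simp del: map_map map_eq_conv)
      have "fun_of h (aint A f xs) = fun_of (\<epsilon> B) (fun_of (far F h) (aint ?M f (map ?q xs)))"
        using aint_eps[OF A(1) f xs] sq[OF is_algD(4)[OF Model_alg[OF MM[OF VM]] f args]] by simp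
      also have "fun_of (far F h) (aint ?M f (map ?q xs)) = aint (M (fob ?V B)) f (map (fun_of (far F h)) (map ?q xs))"
        by (rule ahomD(4)[OF FH f args])
      also have "map (fun_of (far F h)) (map ?q xs) = map (\<lambda>c. q (fob ?V B) (0, c)) (map (fun_of h) xs)"
        unfolding map_map by (rule map_cong) (use Fq[OF harr] xs' in auto)
      also have "fun_of (\<epsilon> B) (aint (M (fob ?V B)) f (map (\<lambda>c. q (fob ?V B) (0, c)) (map (fun_of h) xs))) = aint B f (map (fun_of h) xs)"
        by (rule aint_eps[OF B(1) f hxs, symmetric])
      finally show "fun_of h (aint A f xs) = aint B f (map (fun_of h) xs)" .
    qed (use hA in auto)
    then have farr: "(A, fun_of h, B) \<in> arrows D A B" using A B by (simp add: arrows_D)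
    have "far ?V (A, fun_of h, B) = h" using hA(1) by simp
    then have "far ?K (A, fun_of h, B) = z" using Karr[OF farr] A(2) B(2) h(1) by simp
    then show ?thesis using arrowsD(3)[OF is_cat_alg_cat farr] by blast
  qed
  have "is_isomorphism D ?EM ?K"
  proof (rule bijective_functor_isomorphism[OF K])
    have "inj_on (fob ?K) (Ob D)" using inj by (auto simp: inj_on_def Ob_D)
    moreover have "fob ?K ` Ob D = Ob ?EM"
    proof (intro equalityI subsetI)
      show "z \<in> Ob ?EM" if "z \<in> fob ?K ` Ob D" for z using that functor_ob[OF K] by blast
      show "z \<in> fob ?K ` Ob D" if "z \<in> Ob ?EM" for z
      proof -
        obtain x a where "z = (x, a)" by (cases z)
        then show ?thesis using surj[of x a] that Ob_D by (metis imageI)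
      qed
    qed
    ultimately show "bij_betw (fob ?K) (Ob D) (Ob ?EM)" by (simp add: bij_betw_def)
    have "inj_on (far ?K) (Ar D)"
    proof (rule inj_onI)
      fix f f' assume "f \<in> Ar D" "f' \<in> Ar D" and eq: "far ?K f = far ?K f'"
      then obtain A B A' B' where f: "f \<in> arrows D A B" and f': "f' \<in> arrows D A' B'" using arrow_Ar[OF is_cat_alg_cat] by blast
      have "fob ?K A = fob ?K A'" "fob ?K B = fob ?K B'" "far ?V f = far ?V f'"
        using eq unfolding Karr[OF f] Karr[OF f'] by blast+
      then have "A = A'" "B = B'" "fun_of f = fun_of f'"
        using inj D_arrow[OF f] D_arrow[OF f'] Vfun[of f] Vfun[of f'] by simp_all
      then show "f = f'" using D_eqI f f' by blast
    qed
    moreover have "far ?K ` Ar D \<subseteq> Ar ?EM"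
      using functor_arrow[OF K arrow_Ar[OF is_cat_alg_cat]] arrowsD(3)[OF functor_cats(2)[OF K]] by blast
    moreover have "Ar ?EM \<subseteq> far ?K ` Ar D" using arr by blast
    ultimately show "bij_betw (far ?K) (Ar D) (Ar ?EM)" unfolding bij_betw_def by blast
  qed
  moreover have "preserves_filtered_colimits U SO SO ?T"
    unfolding preserves_filtered_colimits_def
  proof (intro allI impI)
    fix J :: "('u, 'u) cat" and X c l
    assume "small_cat U J \<and> filtered J \<and> is_functor J SO X \<and> is_colimit SO J X c l"
    then have small: "small_cat U J" and filt: "filtered J" and X: "is_functor J SO X" and col: "is_colimit SO J X c l" by auto
    \<comment> \<open>The left adjoint preserves the colimit. What results is a filtered colimit of
      algebras, hence elementwise, hence also a colimit over S.\<close>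
    have Fcol: "is_colimit D J (comp_fctr F X) (fob F c) (\<lambda>i. far F (l i))"
      by (rule left_adjoint_preserves_colimit[OF adj X col])
    have FX: "is_functor J D (comp_fctr F X)" by (rule functor_comp[OF X F])
    have el: "elementwise_colimit J (\<lambda>i. acarrier (fob F (fob X i))) (\<lambda>u. fun_of (far F (far X u))) (acarrier (fob F c))
      (\<lambda>i. fun_of (far F (l i)))"
      using alg_colimit_elementwise[OF FX filt small Fcol] by simp
    show "is_colimit SO J (comp_fctr ?T X) (fob ?T c) (\<lambda>i. far ?T (l i))"
    proof (rule elementwise_set_colimit[OF functor_comp[OF X functor_comp[OF F V]] filt])
      show "fob ?T c \<in> Ob SO" by (rule functor_ob[OF functor_comp[OF F V] colimitD(2)[OF col]])
      show "far ?T (l i) \<in> arrows SO (fob (comp_fctr ?T X) i) (fob ?T c)" if "i \<in> Ob J" for i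
        using functor_arrow[OF functor_comp[OF F V] colimitD(3)[OF col that]] by simp
    qed (use el Vfun in simp)
  qed
  ultimately show ?thesis using that[OF adj] by blast
qed

end

section \<open>Transfer along isomorphisms of categories\<close>

text \<open>The left adjoint is composed with the inverse isomorphism. The new monad agrees with the
  old one on all objects and arrows of X.\<close>

lemma monadic_transfer:
  fixes U :: "'u set set"
  assumes \<Phi>: "is_isomorphism C D \<Phi>" and G: "is_functor C X G"
    and Gob: "\<And>a. a \<in> Ob C \<Longrightarrow> fob V (fob \<Phi> a) = fob G a" and Gar: "\<And>f. f \<in> Ar C \<Longrightarrow> far V (far \<Phi> f) = far G f"
    and adj: "adjunction D X F V \<eta> \<epsilon>"
    and K: "is_isomorphism D (em_cat X (comp_fctr V F) \<eta> (\<lambda>x. far V (\<epsilon> (fob F x)))) (comparison D V \<epsilon>)"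
    and pres: "preserves_filtered_colimits U X X (comp_fctr V F)"
  shows "finitary_monadic U C X G"
proof -
  obtain \<Psi> where \<Phi>f: "is_functor C D \<Phi>" and \<Psi>: "is_functor D C \<Psi>"
    and \<Psi>\<Phi>: "\<And>a. a \<in> Ob C \<Longrightarrow> fob \<Psi> (fob \<Phi> a) = a" "\<And>f. f \<in> Ar C \<Longrightarrow> far \<Psi> (far \<Phi> f) = f"
    and \<Phi>\<Psi>: "\<And>b. b \<in> Ob D \<Longrightarrow> fob \<Phi> (fob \<Psi> b) = b" "\<And>g. g \<in> Ar D \<Longrightarrow> far \<Phi> (far \<Psi> g) = g"
    using \<Phi> unfolding is_isomorphism_def by blast
  note C = functor_cats(1)[OF \<Phi>f] and D = functor_cats(2)[OF \<Phi>f] and X = functor_cats(2)[OF G]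
  note F = adjunctionD(1)[OF adj] and V = adjunctionD(2)[OF adj] and \<eta> = adjunctionD(3)[OF adj] and \<epsilon> = adjunctionD(4)[OF adj]
    and \<eta>nat = adjunctionD(5)[OF adj] and \<epsilon>nat = adjunctionD(6)[OF adj] and tri1 = adjunctionD(7)[OF adj] and tri2 = adjunctionD(8)[OF adj]
  have G\<Psi>ob: "fob G (fob \<Psi> b) = fob V b" if "b \<in> Ob D" for b
    using Gob[OF functor_ob[OF \<Psi> that]] \<Phi>\<Psi>(1)[OF that] by simp
  have G\<Psi>ar: "far G (far \<Psi> g) = far V g" if "g \<in> arrows D a b" for g a b
    using Gar[OF arrowsD(3)[OF C functor_arrow[OF \<Psi> that]]] \<Phi>\<Psi>(2)[OF arrowsD(3)[OF D that]] by simp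
  define F' where "F' = comp_fctr \<Psi> F"
  define \<epsilon>' where "\<epsilon>' c = far \<Psi> (\<epsilon> (fob \<Phi> c))" for c
  have F': "is_functor X C F'" unfolding F'_def by (rule functor_comp[OF F \<Psi>])
  have T_ob: "fob (comp_fctr V F) x = fob (comp_fctr G F') x" if "x \<in> Ob X" for x
    using G\<Psi>ob[OF functor_ob[OF F that]] by (simp add: F'_def)
  have T_arr: "far (comp_fctr V F) f = far (comp_fctr G F') f" if "f \<in> arrows X x y" for f x y
    using G\<Psi>ar[OF functor_arrow[OF F that]] by (simp add: F'_def)
  have T_ar: "far (comp_fctr V F) f = far (comp_fctr G F') f" if "f \<in> Ar X" for f
    by (rule T_arr[OF arrow_Ar[OF X that]])
  have e': "\<epsilon>' c \<in> arrows C (fob F' (fob G c)) c" "far G (\<epsilon>' c) = far V (\<epsilon> (fob \<Phi> c))" if c: "c \<in> Ob C" for c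
  proof -
    note e = \<epsilon>[OF functor_ob[OF \<Phi>f c]]
    show "\<epsilon>' c \<in> arrows C (fob F' (fob G c)) c"
      using functor_arrow[OF \<Psi> e] \<Psi>\<Phi>(1)[OF c] Gob[OF c] by (simp add: \<epsilon>'_def F'_def)
    show "far G (\<epsilon>' c) = far V (\<epsilon> (fob \<Phi> c))" using G\<Psi>ar[OF e] by (simp add: \<epsilon>'_def)
  qed
  have e'F: "\<epsilon>' (fob F' x) = far \<Psi> (\<epsilon> (fob F x))" if "x \<in> Ob X" for x
    using \<Phi>\<Psi>(1)[OF functor_ob[OF F that]] by (simp add: \<epsilon>'_def F'_def)
  have adj': "adjunction C X F' G \<eta> \<epsilon>'" unfolding adjunction_def
  proof (intro conjI ballI F' G)
    have "is_nat X X id_fctr (comp_fctr V F) \<eta>" using adj by (simp add: adjunction_def)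
    then show "is_nat X X id_fctr (comp_fctr G F') \<eta>" by (rule nat_cong) (use T_ob T_ar in auto)
    show "is_nat C C (comp_fctr F' G) id_fctr \<epsilon>'" unfolding is_nat_def
    proof (intro conjI ballI functor_comp[OF G F'] functor_id[OF C])
      show "\<epsilon>' a \<in> arrows C (fob (comp_fctr F' G) a) (fob id_fctr a)" if "a \<in> Ob C" for a using e'(1)[OF that] by simp
      fix f assume "f \<in> Ar C"
      then obtain a b where f: "f \<in> arrows C a b" and ab: "Src C f = a" "Tgt C f = b" using arrow_Ar[OF C] by blast
      note a = arrowsD(1)[OF C f] and b = arrowsD(2)[OF C f] and fA = arrowsD(3)[OF C f]
      note \<Phi>f' = functor_arrow[OF \<Phi>f f]
      have "Cmp D (\<epsilon> (fob \<Phi> b)) (far F (far G f)) = Cmp D (far \<Phi> f) (\<epsilon> (fob \<Phi> a))"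
        using \<epsilon>nat[OF \<Phi>f'] Gar[OF fA] by simp
      moreover have Ff: "far F (far G f) \<in> arrows D (fob F (fob V (fob \<Phi> a))) (fob F (fob V (fob \<Phi> b)))"
        using functor_arrow[OF F functor_arrow[OF G f]] Gob[OF a] Gob[OF b] by simp
      ultimately have "Cmp C (\<epsilon>' b) (far F' (far G f)) = Cmp C (far \<Psi> (far \<Phi> f)) (\<epsilon>' a)"
        using functor_Cmp[OF \<Psi> \<epsilon>[OF functor_ob[OF \<Phi>f b]] Ff] functor_Cmp[OF \<Psi> \<Phi>f' \<epsilon>[OF functor_ob[OF \<Phi>f a]]]
        by (simp add: \<epsilon>'_def F'_def)
      then show "Cmp C (\<epsilon>' (Tgt C f)) (far (comp_fctr F' G) f) = Cmp C (far id_fctr f) (\<epsilon>' (Src C f))"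
        using \<Psi>\<Phi>(2)[OF fA] by (simp add: ab)
    qed
    show "Cmp X (far G (\<epsilon>' a)) (\<eta> (fob G a)) = Ide X (fob G a)" if "a \<in> Ob C" for a
      using tri1[OF functor_ob[OF \<Phi>f that]] e'(2)[OF that] Gob[OF that] by simp
    show "Cmp C (\<epsilon>' (fob F' x)) (far F' (\<eta> x)) = Ide C (fob F' x)" if x: "x \<in> Ob X" for x
    proof -
      note Fx = functor_ob[OF F x]
      have "far \<Psi> (Cmp D (\<epsilon> (fob F x)) (far F (\<eta> x))) = Ide C (fob F' x)"
        using tri2[OF x] functor_Ide[OF \<Psi> Fx] by (simp add: F'_def)
      then show ?thesis using functor_Cmp[OF \<Psi> \<epsilon>[OF Fx] functor_arrow[OF F \<eta>[OF x]]] e'F[OF x] by (simp add: F'_def)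
    qed
  qed
  let ?\<mu> = "\<lambda>x. far V (\<epsilon> (fob F x))" and ?\<mu>' = "\<lambda>x. far G (\<epsilon>' (fob F' x))"
  have \<mu>: "?\<mu>' x = ?\<mu> x" if "x \<in> Ob X" for x
    using e'F[OF that] G\<Psi>ar[OF \<epsilon>[OF functor_ob[OF F that]]] by simp
  \<comment> \<open>\<open>em_cat\<close> evaluates the monad only on objects and arrows of X, so
    the two Eilenberg-Moore categories are equal and not merely isomorphic.\<close>
  have EM: "em_cat X (comp_fctr G F') \<eta> ?\<mu>' = em_cat X (comp_fctr V F) \<eta> ?\<mu>"
  proof -
    have ob: "{(x, a). x \<in> Ob X \<and> a \<in> arrows X (fob (comp_fctr G F') x) x \<and> Cmp X a (\<eta> x) = Ide X x \<and>
        Cmp X a (far (comp_fctr G F') a) = Cmp X a (?\<mu>' x)} =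
      {(x, a). x \<in> Ob X \<and> a \<in> arrows X (fob (comp_fctr V F) x) x \<and> Cmp X a (\<eta> x) = Ide X x \<and>
        Cmp X a (far (comp_fctr V F) a) = Cmp X a (?\<mu> x)}"
      using T_ob T_arr \<mu> by (auto simp del: comp_fctr_simps)
    have H: "(\<lambda>(x, a) (y, b). {h \<in> arrows X x y. Cmp X h a = Cmp X b (far (comp_fctr G F') h)}) =
      (\<lambda>(x, a) (y, b). {h \<in> arrows X x y. Cmp X h a = Cmp X b (far (comp_fctr V F) h)})"
      by (intro ext) (auto simp: T_arr simp del: comp_fctr_simps)
    show ?thesis unfolding em_cat_def ob H ..
  qed
  have "is_isomorphism C (em_cat X (comp_fctr G F') \<eta> ?\<mu>') (comparison C G \<epsilon>')"
  proof (rule isomorphism_cong[OF isomorphism_comp[OF \<Phi> K], folded EM])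
    fix a assume a: "a \<in> Ob C"
    show "fob (comp_fctr (comparison D V \<epsilon>) \<Phi>) a = fob (comparison C G \<epsilon>') a"
      using Gob[OF a] e'(2)[OF a] by (simp add: comparison_simps)
  next
    fix f assume fA: "f \<in> Ar C"
    note f = arrow_Ar[OF C fA]
    show "far (comp_fctr (comparison D V \<epsilon>) \<Phi>) f = far (comparison C G \<epsilon>') f"
      using arrowsD(4,5)[OF D functor_arrow[OF \<Phi>f f]] Gar[OF fA] Gob[OF arrowsD(1)[OF C f]] Gob[OF arrowsD(2)[OF C f]]
        e'(2)[OF arrowsD(1)[OF C f]] e'(2)[OF arrowsD(2)[OF C f]] by (simp add: comparison_simps)
  qed
  moreover have "preserves_filtered_colimits U X X (comp_fctr G F')"
    unfolding preserves_filtered_colimits_def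
  proof (intro allI impI)
    fix J :: "('u, 'u) cat" and Y c l assume *: "small_cat U J \<and> filtered J \<and> is_functor J X Y \<and> is_colimit X J Y c l"
    then have Y: "is_functor J X Y" and col: "is_colimit X J Y c l" by auto
    note J = functor_cats(1)[OF Y]
    have "is_colimit X J (comp_fctr (comp_fctr V F) Y) (fob (comp_fctr V F) c) (\<lambda>i. far (comp_fctr V F) (l i))"
      using pres * unfolding preserves_filtered_colimits_def by blast
    then show "is_colimit X J (comp_fctr (comp_fctr G F') Y) (fob (comp_fctr G F') c) (\<lambda>i. far (comp_fctr G F') (l i))"
    proof (rule colimit_cong[OF _ _ _ _ _ J])
      show "fob (comp_fctr (comp_fctr V F) Y) i = fob (comp_fctr (comp_fctr G F') Y) i" if "i \<in> Ob J" for i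
        using T_ob[OF functor_ob[OF Y that]] by simp
      show "far (comp_fctr (comp_fctr V F) Y) u = far (comp_fctr (comp_fctr G F') Y) u" if "u \<in> Ar J" for u
        using T_arr[OF functor_arrow[OF Y arrow_Ar[OF J that]]] by simp
    qed (use T_ob[OF colimitD(2)[OF col]] T_arr[OF colimitD(3)[OF col]] in simp_all)
  qed
  ultimately show ?thesis unfolding finitary_monadic_def using adj' isomorphism_equivalence by blast
qed

text \<open>The clauses of \<open>lfp_elementwise\<close> concern only hom-sets, composition and
  colimits, so they pass along the isomorphism although the types of objects and arrows
  differ.\<close>

lemma lfp_transfer:
  fixes U :: "'u set set"
  assumes \<Phi>: "is_isomorphism C D \<Phi>" and D: "lfp_elementwise U D"
  shows "lfp_elementwise U C"
proof -
  obtain \<Psi> where \<Phi>f: "is_functor C D \<Phi>" and \<Psi>: "is_functor D C \<Psi>"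
    and \<Psi>\<Phi>: "\<And>a. a \<in> Ob C \<Longrightarrow> fob \<Psi> (fob \<Phi> a) = a" "\<And>f. f \<in> Ar C \<Longrightarrow> far \<Psi> (far \<Phi> f) = f"
    and \<Phi>\<Psi>: "\<And>b. b \<in> Ob D \<Longrightarrow> fob \<Phi> (fob \<Psi> b) = b" "\<And>g. g \<in> Ar D \<Longrightarrow> far \<Phi> (far \<Psi> g) = g"
    using \<Phi> unfolding is_isomorphism_def by blast
  note Cc = functor_cats(1)[OF \<Phi>f] and Dc = functor_cats(2)[OF \<Phi>f]
  have ls: "locally_small U C" unfolding locally_small_def
  proof (intro ballI)
    fix a b assume ab: "a \<in> Ob C" "b \<in> Ob C"
    have "arrows C a b \<lesssim> arrows D (fob \<Phi> a) (fob \<Phi> b)" unfolding lepoll_def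
    proof (intro exI[of _ "far \<Phi>"] conjI)
      show "inj_on (far \<Phi>) (arrows C a b)" using \<Psi>\<Phi>(2) arrowsD(3)[OF Cc] by (metis inj_onI)
      show "far \<Phi> ` arrows C a b \<subseteq> arrows D (fob \<Phi> a) (fob \<Phi> b)" using functor_arrow[OF \<Phi>f] by blast
    qed
    moreover obtain X where "X \<in> U" "arrows D (fob \<Phi> a) (fob \<Phi> b) \<lesssim> Pow X"
      using D functor_ob[OF \<Phi>f] ab unfolding lfp_elementwise_def locally_small_def by blast
    ultimately show "\<exists>X\<in>U. arrows C a b \<lesssim> Pow X" using lepoll_trans by blast
  qed
  have col_back: "is_colimit C J (comp_fctr \<Psi> X) (fob \<Psi> d) (\<lambda>i. far \<Psi> (l i))" if "is_functor J D X" "is_colimit D J X d l"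
    for J :: "('u, 'u) cat" and X d l
    by (rule colimit_transfer[OF \<Psi> \<Phi>f that(1) \<Phi>\<Psi> \<Psi>\<Phi> that(2)])
  have cc: "cocomplete U C" unfolding cocomplete_def
  proof (intro allI impI)
    fix J :: "('u, 'u) cat" and X assume *: "small_cat U J \<and> is_functor J C X"
    then have X: "is_functor J C X" by blast
    note J = functor_cats(1)[OF X] and \<Phi>X = functor_comp[OF X \<Phi>f]
    obtain d l where "is_colimit D J (comp_fctr \<Phi> X) d l"
      using D * \<Phi>X unfolding lfp_elementwise_def cocomplete_def by blast
    from col_back[OF \<Phi>X this] have "is_colimit C J X (fob \<Psi> d) (\<lambda>i. far \<Psi> (l i))"
      by (rule colimit_cong[OF _ _ _ refl refl J])
        (use \<Psi>\<Phi>(1)[OF functor_ob[OF X]] \<Psi>\<Phi>(2)[OF arrowsD(3)[OF Cc functor_arrow[OF X arrow_Ar[OF J]]]] in simp_all)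
    then show "\<exists>c l. is_colimit C J X c l" by blast
  qed
  obtain P where smP: "small U P" and fpP: "\<And>a. a \<in> P \<Longrightarrow> fp_object U D a"
    and genP: "\<And>c. c \<in> Ob D \<Longrightarrow> \<exists>(J :: ('u, 'u) cat) X l. small_cat U J \<and> filtered J \<and> is_functor J D X \<and>
           (\<forall>i\<in>Ob J. fob X i \<in> P) \<and> is_colimit D J X c l"
    using D unfolding lfp_elementwise_def by blast
  have fp: "fp_object U C (fob \<Psi> a)" if "fp_object U D a" for a
    unfolding fp_object_def
  proof (intro conjI allI impI)
    have aD: "a \<in> Ob D" using that by (simp add: fp_object_def)
    then show "fob \<Psi> a \<in> Ob C" by (rule functor_ob[OF \<Psi>])
    fix J :: "('u, 'u) cat" and X c l
    assume *: "small_cat U J \<and> filtered J \<and> is_functor J C X \<and> is_colimit C J X c l"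
    then have X: "is_functor J C X" and col: "is_colimit C J X c l" by auto
    note J = functor_cats(1)[OF X] and \<Phi>X = functor_comp[OF X \<Phi>f]
    note c = colimitD(2)[OF col] and l = colimitD(3)[OF col]
    let ?A = "\<lambda>i. arrows C (fob \<Psi> a) (fob X i)" and ?B = "\<lambda>i. arrows D a (fob \<Phi> (fob X i))"
    have col': "is_colimit D J (comp_fctr \<Phi> X) (fob \<Phi> c) (\<lambda>i. far \<Phi> (l i))"
      by (rule colimit_transfer[OF \<Phi>f \<Psi> X \<Psi>\<Phi> \<Phi>\<Psi> col])
    have el: "elementwise_colimit J ?B (\<lambda>u. Cmp D (far \<Phi> (far X u))) (arrows D a (fob \<Phi> c)) (\<lambda>i. Cmp D (far \<Phi> (l i)))"
    proof -
      have "elementwise_colimit J (\<lambda>i. arrows D a (fob (comp_fctr \<Phi> X) i)) (\<lambda>u. Cmp D (far (comp_fctr \<Phi> X) u))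
        (arrows D a (fob \<Phi> c)) (\<lambda>i. Cmp D (far \<Phi> (l i)))"
        using that * \<Phi>X col' unfolding fp_object_def by blast
      then show ?thesis by simp
    qed
    have to: "far \<Phi> g \<in> arrows D a (fob \<Phi> b)" if "g \<in> arrows C (fob \<Psi> a) b" for g b
      using functor_arrow[OF \<Phi>f that] \<Phi>\<Psi>(1)[OF aD] by simp
    have inj: "far \<Phi> g = far \<Phi> g' \<longleftrightarrow> g = g'" if "g \<in> arrows C b b'" "g' \<in> arrows C d d'" for g g' b b' d d'
      using \<Psi>\<Phi>(2) arrowsD(3)[OF Cc] that by metis
    show "elementwise_colimit J ?A (\<lambda>u. Cmp C (far X u)) (arrows C (fob \<Psi> a) c) (\<lambda>i. Cmp C (l i))"
      unfolding elementwise_colimit_def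
    proof (intro conjI ballI)
      show "Cmp C (l i) g \<in> arrows C (fob \<Psi> a) c" if "i \<in> Ob J" "g \<in> ?A i" for i g
        by (rule Cmp_arrow[OF Cc l[OF that(1)] that(2)])
      show "\<exists>i\<in>Ob J. \<exists>g\<in>?A i. Cmp C (l i) g = f" if f: "f \<in> arrows C (fob \<Psi> a) c" for f
      proof -
        obtain i g where i: "i \<in> Ob J" and g: "g \<in> ?B i" and eq: "Cmp D (far \<Phi> (l i)) g = far \<Phi> f"
          using el to[OF f] unfolding elementwise_colimit_def by blast
        have g': "far \<Psi> g \<in> ?A i" using functor_arrow[OF \<Psi> g] \<Psi>\<Phi>(1)[OF functor_ob[OF X i]] by simp
        have "far \<Phi> (Cmp C (l i) (far \<Psi> g)) = far \<Phi> f"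
          using functor_Cmp[OF \<Phi>f l[OF i] g'] \<Phi>\<Psi>(2)[OF arrowsD(3)[OF Dc g]] eq by simp
        then show ?thesis using inj[OF Cmp_arrow[OF Cc l[OF i] g'] f] g' i by blast
      qed
      fix i j g g' assume i: "i \<in> Ob J" and j: "j \<in> Ob J" and g: "g \<in> ?A i" and g': "g' \<in> ?A j"
      have "Cmp C (l i) g = Cmp C (l j) g' \<longleftrightarrow> Cmp D (far \<Phi> (l i)) (far \<Phi> g) = Cmp D (far \<Phi> (l j)) (far \<Phi> g')"
        using inj[OF Cmp_arrow[OF Cc l[OF i] g] Cmp_arrow[OF Cc l[OF j] g']] functor_Cmp[OF \<Phi>f l[OF i] g] functor_Cmp[OF \<Phi>f l[OF j] g']
        by simp
      also have "\<dots> \<longleftrightarrow> merges J (\<lambda>u. Cmp D (far \<Phi> (far X u))) i (far \<Phi> g) j (far \<Phi> g')"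
        using el i j to[OF g] to[OF g'] unfolding elementwise_colimit_def by blast
      also have "\<dots> \<longleftrightarrow> merges J (\<lambda>u. Cmp C (far X u)) i g j g'"
      proof -
        have "Cmp D (far \<Phi> (far X u)) (far \<Phi> g) = Cmp D (far \<Phi> (far X v)) (far \<Phi> g') \<longleftrightarrow> Cmp C (far X u) g = Cmp C (far X v) g'"
          if u: "u \<in> arrows J i k" and v: "v \<in> arrows J j k" for u v k
          using inj[OF Cmp_arrow[OF Cc functor_arrow[OF X u] g] Cmp_arrow[OF Cc functor_arrow[OF X v] g']]
            functor_Cmp[OF \<Phi>f functor_arrow[OF X u] g] functor_Cmp[OF \<Phi>f functor_arrow[OF X v] g'] by simp
        then show ?thesis unfolding merges_def by blast
      qed
      finally show "(Cmp C (l i) g = Cmp C (l j) g') = merges J (\<lambda>u. Cmp C (far X u)) i g j g'" .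
    qed
  qed
  show ?thesis unfolding lfp_elementwise_def
  proof (intro conjI exI[of _ "fob \<Psi> ` P"] ballI Cc ls cc small_image[OF smP])
    show "fp_object U C b" if "b \<in> fob \<Psi> ` P" for b using that fp fpP by blast
    fix c assume c: "c \<in> Ob C"
    obtain J :: "('u, 'u) cat" and X l where J: "small_cat U J" "filtered J" "is_functor J D X" "\<forall>i\<in>Ob J. fob X i \<in> P"
      "is_colimit D J X (fob \<Phi> c) l"
      using genP[OF functor_ob[OF \<Phi>f c]] by blast
    have "is_colimit C J (comp_fctr \<Psi> X) c (\<lambda>i. far \<Psi> (l i))" using col_back[OF J(3,5)] \<Psi>\<Phi>(1)[OF c] by simp
    then show "\<exists>(J :: ('u, 'u) cat) X l. small_cat U J \<and> filtered J \<and> is_functor J C X \<and>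
        (\<forall>i\<in>Ob J. fob X i \<in> fob \<Psi> ` P) \<and> is_colimit C J X c l"
      using J(1,2,4) functor_comp[OF J(3) \<Psi>] by (metis comp_fctr_simps(1) imageI)
  qed
qed

text \<open>Both conclusions are first proved for the category of algebras and then moved along the
  isomorphism. Smallness of S enters through the set of finite presentations.\<close>

theorem variety_finitary_monadic_lfp:
  fixes U :: "'u set set" and S :: "'s set"
  assumes U: "universe U" and S: "small U S" and var: "variety U S C G"
  shows "finitary_monadic U C (sets_over U S) G" "locally_finitely_presentable U C"
proof -
  obtain Sg :: "('u, 's) signature" and E \<Phi> where G: "is_functor C (sets_over U S) G" and symbols: "symbols Sg \<in> U"
    and sig: "\<forall>f\<in>symbols Sg. set (arity Sg f) \<subseteq> S \<and> result Sg f \<in> S"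
    and eqs: "\<forall>(t, t')\<in>E. well_sorted S Sg t \<and> well_sorted S Sg t' \<and> tsort Sg t = tsort Sg t'"
    and \<Phi>: "is_isomorphism C (alg_cat U S Sg E) \<Phi>"
    and ob: "\<forall>a\<in>Ob C. fob alg_forget (fob \<Phi> a) = fob G a" and ar: "\<forall>f\<in>Ar C. far alg_forget (far \<Phi> f) = far G f"
    using var unfolding variety_def by blast
  interpret variety_spec U S Sg E
    by unfold_locales (use U symbols sig eqs in \<open>auto simp: small_member\<close>)
  obtain F \<eta> \<epsilon> where "adjunction D SO F alg_forget \<eta> \<epsilon>"
    "is_isomorphism D (em_cat SO (comp_fctr alg_forget F) \<eta> (\<lambda>x. far alg_forget (\<epsilon> (fob F x)))) (comparison D alg_forget \<epsilon>)"
    "preserves_filtered_colimits U SO SO (comp_fctr alg_forget F)"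
    by (rule D_monadic)
  then show "finitary_monadic U C (sets_over U S) G"
    using monadic_transfer[OF \<Phi> G] ob ar by blast
  show "locally_finitely_presentable U C"
    by (rule lfp_elementwise_imp[OF lfp_transfer[OF \<Phi> D_lfp[OF S]]])
qed

section \<open>The operad of symmetric groups\<close>

text \<open>
  With \<open>enc ks i a\<close> the a-th element of block i (blocks counted from 0, elements from 1), the
  composite \<open>\<mu>(\<sigma>; \<tau>\<^sub>1, \<dots>, \<tau>\<^sub>n)\<close> sends element a of block i to element \<open>\<tau>\<^sub>i a\<close> of block \<open>\<sigma> i\<close> of the
  permuted list of block sizes.
\<close>

definition enc :: "nat list \<Rightarrow> nat \<Rightarrow> nat \<Rightarrow> nat" where
  "enc ks i a = sum_list (take i ks) + a"

text \<open>Entry i of the list moves to position \<sigma> i, positions being counted from 1. For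
  block sizes the result is the list \<open>ks'\<close> of the interchange axiom, whence the
  inverse.\<close>

definition pact :: "(nat \<Rightarrow> nat) \<Rightarrow> 'a list \<Rightarrow> 'a list" where
  "pact \<sigma> xs = map (\<lambda>j. xs ! (inv' \<sigma> j - 1)) [1..<Suc (length xs)]"

abbreviation smu :: "nat list \<Rightarrow> (nat \<Rightarrow> nat) \<Rightarrow> (nat \<Rightarrow> nat) list \<Rightarrow> nat \<Rightarrow> nat" where
  "smu ks \<sigma> \<tau>s \<equiv> block_perm ks \<sigma> \<circ> block_sum ks \<tau>s"

lemma sum_list_take_mono: "i \<le> j \<Longrightarrow> sum_list (take i ks) \<le> sum_list (take j (ks :: nat list))"
  by (metis le_add1 le_add_diff_inverse sum_list_append take_add)

lemma sum_list_take_Suc: "i < length ks \<Longrightarrow> sum_list (take (Suc i) ks) = sum_list (take i ks) + (ks ! i :: nat)"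
  by (simp add: take_Suc_conv_app_nth)

lemma sum_list_take_le: "sum_list (take i ks) \<le> sum_list (ks :: nat list)"
  by (metis append_take_drop_id le_add1 sum_list_append)

lemma block_enc:
  assumes "i < length ks" "a \<in> {1..ks ! i}"
  shows "block ks (enc ks i a) = Suc i"
  unfolding block_def
proof (rule Least_equality)
  show "enc ks i a \<le> sum_list (take (Suc i) ks)" using assms by (simp add: enc_def sum_list_take_Suc)
  fix j assume j: "enc ks i a \<le> sum_list (take j ks)"
  show "Suc i \<le> j"
  proof (rule ccontr)
    assume "\<not> Suc i \<le> j"
    then have "sum_list (take j ks) \<le> sum_list (take i ks)" by (intro sum_list_take_mono) simp
    then show False using j assms by (simp add: enc_def)
  qed
qed

lemma offset_enc: "i < length ks \<Longrightarrow> a \<in> {1..ks ! i} \<Longrightarrow> offset ks (enc ks i a) = a"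
  unfolding offset_def by (simp add: block_enc) (simp add: enc_def)

lemma enc_range: "i < length ks \<Longrightarrow> a \<in> {1..ks ! i} \<Longrightarrow> enc ks i a \<in> {1..sum_list ks}"
  using sum_list_take_le[of "Suc i" ks] by (auto simp: enc_def sum_list_take_Suc)

text \<open>By minimality of \<open>block\<close>, the number m exceeds the sum of the first i sizes
  but not that of the first i + 1.\<close>

lemma enc_cases:
  assumes "m \<in> {1..sum_list ks}"
  obtains i a where "i < length ks" "a \<in> {1..ks ! i}" "m = enc ks i a"
proof -
  have ex: "m \<le> sum_list (take (length ks) ks)" using assms by simp
  define b where "b = block ks m"
  have b: "m \<le> sum_list (take b ks)" unfolding b_def block_def by (rule LeastI[of _ "length ks"]) (rule ex)
  have bl: "b \<le> length ks" unfolding b_def block_def by (rule Least_le) (rule ex)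
  have "b \<noteq> 0" using b assms by (intro notI) simp
  then obtain i where i: "b = Suc i" by (cases b) auto
  have il: "i < length ks" using bl i by simp
  have "\<not> m \<le> sum_list (take i ks)"
    using not_less_Least[of i "\<lambda>i. m \<le> sum_list (take i ks)"] i unfolding b_def block_def by simp
  then have "m - sum_list (take i ks) \<in> {1..ks ! i}" "m = enc ks i (m - sum_list (take i ks))"
    using b i il by (auto simp: enc_def sum_list_take_Suc)
  then show ?thesis using that il by blast
qed

lemma length_pact [simp]: "length (pact \<sigma> xs) = length xs"
  by (simp add: pact_def del: upt_Suc)

lemma permutes_Suc:
  assumes "\<sigma> permutes {1..n}" "i < n"
  shows "\<sigma> (Suc i) - 1 < n" "Suc (\<sigma> (Suc i) - 1) = \<sigma> (Suc i)" "\<sigma> (Suc i) \<in> {1..n}"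
proof -
  show "\<sigma> (Suc i) \<in> {1..n}" using permutes_in_image[OF assms(1), of "Suc i"] assms(2) by simp
  then show "\<sigma> (Suc i) - 1 < n" "Suc (\<sigma> (Suc i) - 1) = \<sigma> (Suc i)" by auto
qed

lemma nth_pact:
  assumes "\<sigma> permutes {1..length xs}" "i < length xs"
  shows "pact \<sigma> xs ! (\<sigma> (Suc i) - 1) = xs ! i"
  using permutes_Suc[OF assms] permutes_inverses(2)[OF assms(1), of "Suc i"]
  by (simp add: pact_def del: upt_Suc)

text \<open>Every position is \<sigma> i for some i, so it suffices to know where each entry goes,
  without computing the inverse in \<open>pact\<close>.\<close>

lemma pact_eqI:
  assumes \<sigma>: "\<sigma> permutes {1..length xs}" and len: "length ys = length xs"
    and eq: "\<And>i. i < length xs \<Longrightarrow> ys ! (\<sigma> (Suc i) - 1) = xs ! i"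
  shows "pact \<sigma> xs = ys"
proof (rule nth_equalityI)
  fix j assume "j < length (pact \<sigma> xs)"
  then have j: "Suc j \<in> {1..length xs}" by simp
  then have "inv' \<sigma> (Suc j) \<in> {1..length xs}" using permutes_in_image[OF permutes_inv[OF \<sigma>]] by blast
  then obtain i where i: "i < length xs" "inv' \<sigma> (Suc j) = Suc i" by (cases "inv' \<sigma> (Suc j)") auto
  then have "\<sigma> (Suc i) = Suc j" using permutes_inverses(1)[OF \<sigma>] by metis
  then show "pact \<sigma> xs ! j = ys ! j" using eq[OF i(1)] nth_pact[OF \<sigma> i(1)] by simp
qed (simp add: len)

text \<open>The sum in \<open>block_perm\<close> runs over the blocks that are moved to the left of
  position j. Reindexed along \<sigma> it is a partial sum of the permuted sizes.\<close>

lemma sum_list_take_pact: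
  assumes \<sigma>: "\<sigma> permutes {1..length ks}" and j: "j \<in> {1..length ks}"
  shows "(\<Sum>i' | i' \<in> {1..length ks} \<and> \<sigma> i' < j. ks ! (i' - 1)) = sum_list (take (j - 1) (pact \<sigma> (ks :: nat list)))"
proof -
  have "sum_list (take (j - 1) (pact \<sigma> ks)) = (\<Sum>i<j - 1. pact \<sigma> ks ! i)"
  proof -
    have "min (length ks) (j - Suc 0) = j - Suc 0" using j by auto
    then show ?thesis by (simp add: sum_list_sum_nth lessThan_atLeast0)
  qed
  also have "\<dots> = (\<Sum>i<j - 1. ks ! (inv' \<sigma> (Suc i) - 1))"
    by (rule sum.cong) (use j in \<open>auto simp: pact_def simp del: upt_Suc\<close>)
  also have "\<dots> = (\<Sum>i' | i' \<in> {1..length ks} \<and> \<sigma> i' < j. ks ! (i' - 1))"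
  proof (rule sum.reindex_bij_witness[of _ "\<lambda>i'. \<sigma> i' - 1" "\<lambda>i. inv' \<sigma> (Suc i)"])
    fix i assume i: "i \<in> {..<j - 1}"
    then have "Suc i \<in> {1..length ks}" using j by auto
    then have "inv' \<sigma> (Suc i) \<in> {1..length ks}" using permutes_in_image[OF permutes_inv[OF \<sigma>]] by blast
    then show "inv' \<sigma> (Suc i) \<in> {i' \<in> {1..length ks}. \<sigma> i' < j}" "\<sigma> (inv' \<sigma> (Suc i)) - 1 = i"
      using i permutes_inverses(1)[OF \<sigma>] by auto
  next
    fix i assume i: "i \<in> {i' \<in> {1..length ks}. \<sigma> i' < j}"
    then have "\<sigma> i \<in> {1..length ks}" using permutes_in_image[OF \<sigma>] by blast
    then show "\<sigma> i - 1 \<in> {..<j - 1}" "inv' \<sigma> (Suc (\<sigma> i - 1)) = i"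
      using i permutes_inverses(2)[OF \<sigma>] by auto
  qed simp
  finally show ?thesis by simp
qed

text \<open>The formula for the composite in coordinates, by which all later identities are checked.
  Blocks are counted from 0 and permutations act on numbers from 1, hence
  \<open>\<sigma> (Suc i) - 1\<close>.\<close>

lemma smu_enc:
  assumes \<sigma>: "\<sigma> permutes {1..length ks}" and i: "i < length ks" and a: "a \<in> {1..ks ! i}"
    and \<tau>: "\<tau>s ! i permutes {1..ks ! i}"
  shows "smu ks \<sigma> \<tau>s (enc ks i a) = enc (pact \<sigma> ks) (\<sigma> (Suc i) - 1) ((\<tau>s ! i) a)"
proof -
  have t: "(\<tau>s ! i) a \<in> {1..ks ! i}" using permutes_in_image[OF \<tau>] a by blast
  have 1: "block_sum ks \<tau>s (enc ks i a) = enc ks i ((\<tau>s ! i) a)"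
    using enc_range[OF i a] block_enc[OF i a] offset_enc[OF i a] unfolding block_sum_def by (simp add: enc_def)
  have "block_perm ks \<sigma> (enc ks i ((\<tau>s ! i) a)) =
    (\<Sum>i' | i' \<in> {1..length ks} \<and> \<sigma> i' < \<sigma> (Suc i). ks ! (i' - 1)) + (\<tau>s ! i) a"
    unfolding block_perm_def using enc_range[OF i t] block_enc[OF i t] offset_enc[OF i t] by presburger
  also have "\<dots> = enc (pact \<sigma> ks) (\<sigma> (Suc i) - 1) ((\<tau>s ! i) a)"
    unfolding sum_list_take_pact[OF \<sigma> permutes_Suc(3)[OF \<sigma> i]] enc_def ..
  finally show ?thesis using 1 by simp
qed

lemma smu_outside: "m \<notin> {1..sum_list ks} \<Longrightarrow> smu ks \<sigma> \<tau>s m = m"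
  unfolding o_def block_sum_def block_perm_def by (simp only: if_False)

lemma sum_list_pact: "\<sigma> permutes {1..length ks} \<Longrightarrow> sum_list (pact \<sigma> ks) = sum_list (ks :: nat list)"
proof -
  assume \<sigma>: "\<sigma> permutes {1..length ks}"
  have "sum_list (pact \<sigma> ks) = (\<Sum>j\<in>{1..length ks}. ks ! (inv' \<sigma> j - 1))"
    by (simp add: pact_def sum_list_distinct_conv_sum_set atLeastLessThanSuc_atLeastAtMost del: upt_Suc)
  also have "\<dots> = (\<Sum>j\<in>{1..length ks}. ks ! (j - 1))"
    using sum.permute[OF permutes_inv[OF \<sigma>], of "\<lambda>j. ks ! (j - 1)"] by (simp add: o_def)
  also have "\<dots> = (\<Sum>j<length ks. ks ! j)"
    by (rule sum.reindex_bij_witness[of _ Suc "\<lambda>j. j - 1"]) auto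
  finally show ?thesis by (simp add: sum_list_sum_nth lessThan_atLeast0)
qed

abbreviation perms_list :: "nat list \<Rightarrow> (nat \<Rightarrow> nat) list \<Rightarrow> bool" where
  "perms_list ks \<tau>s \<equiv> list_all2 (\<lambda>k \<tau>. \<tau> permutes {1..k}) ks \<tau>s"

text \<open>Block and offset of the image determine first the block and then the element of the
  argument. This gives injectivity, and on a finite set bijectivity.\<close>

lemma smu_permutes:
  assumes \<sigma>: "\<sigma> permutes {1..length ks}" and \<tau>: "perms_list ks \<tau>s"
  shows "smu ks \<sigma> \<tau>s permutes {1..sum_list ks}"
proof -
  have \<tau>i: "\<tau>s ! i permutes {1..ks ! i}" if "i < length ks" for i using \<tau> that by (simp add: list_all2_conv_all_nth)
  have pe: "\<sigma> (Suc i) - 1 < length (pact \<sigma> ks)" "(\<tau>s ! i) a \<in> {1..pact \<sigma> ks ! (\<sigma> (Suc i) - 1)}"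
    if "i < length ks" "a \<in> {1..ks ! i}" for i a
    using permutes_Suc[OF \<sigma> that(1)] permutes_in_image[OF \<tau>i[OF that(1)]] that nth_pact[OF \<sigma> that(1)] by auto
  have into: "smu ks \<sigma> \<tau>s m \<in> {1..sum_list ks}" if m: "m \<in> {1..sum_list ks}" for m
  proof -
    obtain i a where ia: "i < length ks" "a \<in> {1..ks ! i}" "m = enc ks i a" using enc_cases[OF m] .
    show ?thesis
      using enc_range[OF pe[OF ia(1,2)]] smu_enc[OF \<sigma> ia(1,2) \<tau>i[OF ia(1)]] ia(3) by (simp only: sum_list_pact[OF \<sigma>])
  qed
  have "inj_on (smu ks \<sigma> \<tau>s) {1..sum_list ks}"
  proof (rule inj_onI)
    fix m m' assume m: "m \<in> {1..sum_list ks}" and m': "m' \<in> {1..sum_list ks}" and eq: "smu ks \<sigma> \<tau>s m = smu ks \<sigma> \<tau>s m'"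
    obtain i a where ia: "i < length ks" "a \<in> {1..ks ! i}" "m = enc ks i a" using enc_cases[OF m] .
    obtain j b where jb: "j < length ks" "b \<in> {1..ks ! j}" "m' = enc ks j b" using enc_cases[OF m'] .
    have e: "enc (pact \<sigma> ks) (\<sigma> (Suc i) - 1) ((\<tau>s ! i) a) = enc (pact \<sigma> ks) (\<sigma> (Suc j) - 1) ((\<tau>s ! j) b)"
      using eq smu_enc[OF \<sigma> ia(1,2) \<tau>i[OF ia(1)]] smu_enc[OF \<sigma> jb(1,2) \<tau>i[OF jb(1)]] ia(3) jb(3) by simp
    have "Suc (\<sigma> (Suc i) - 1) = Suc (\<sigma> (Suc j) - 1)"
      using block_enc[OF pe[OF ia(1,2)]] block_enc[OF pe[OF jb(1,2)]] e by simp
    then have "\<sigma> (Suc i) = \<sigma> (Suc j)" using permutes_Suc(2)[OF \<sigma> ia(1)] permutes_Suc(2)[OF \<sigma> jb(1)] by simp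
    then have ij: "i = j" using permutes_inj[OF \<sigma>] by (simp add: inj_eq)
    have "(\<tau>s ! i) a = (\<tau>s ! i) b"
      using offset_enc[OF pe[OF ia(1,2)]] offset_enc[OF pe[OF jb(1,2)]] unfolding e unfolding ij by (rule trans[OF sym])
    then have "a = b" using permutes_inj[OF \<tau>i[OF ia(1)]] by (simp add: inj_eq)
    then show "m = m'" using ij ia(3) jb(3) by simp
  qed
  then have "bij_betw (smu ks \<sigma> \<tau>s) {1..sum_list ks} {1..sum_list ks}"
    using into by (intro bij_betw_imageI endo_inj_surj) auto
  then show ?thesis by (rule bij_imp_permutes) (rule smu_outside)
qed

lemma smu_eqI:
  assumes "\<rho> permutes {1..sum_list ks}" "\<rho>' permutes {1..sum_list ks}"
    and "\<And>i a. i < length ks \<Longrightarrow> a \<in> {1..ks ! i} \<Longrightarrow> \<rho> (enc ks i a) = \<rho>' (enc ks i a)"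
  shows "\<rho> = \<rho>'"
proof
  fix m show "\<rho> m = \<rho>' m"
  proof (cases "m \<in> {1..sum_list ks}")
    case True
    then show ?thesis using assms(3) by (metis enc_cases)
  next
    case False
    then show ?thesis using permutes_not_in[OF assms(1) False] permutes_not_in[OF assms(2) False] by simp
  qed
qed

lemma smu_unit_left:
  assumes g: "g permutes {1..n}"
  shows "smu [n] id [g] = g"
proof (rule smu_eqI[of _ "[n]"])
  have id: "id permutes {1..length [n]}" by (rule permutes_id)
  show "smu [n] id [g] permutes {1..sum_list [n]}" by (rule smu_permutes[OF id]) (use g in simp)
  show "g permutes {1..sum_list [n]}" using g by simp
  fix i a assume i: "i < length [n]" and a: "a \<in> {1..[n] ! i}"
  then have "[g] ! i permutes {1..[n] ! i}" using g by simp
  from smu_enc[OF id i a this] show "smu [n] id [g] (enc [n] i a) = g (enc [n] i a)" using i by (simp add: enc_def)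
qed

lemma smu_unit_right:
  assumes g: "g permutes {1..n}"
  shows "smu (replicate n 1) g (replicate n id) = g"
proof (rule smu_eqI[of _ "replicate n 1"])
  have g': "g permutes {1..length (replicate n 1)}" using g by simp
  have sum: "sum_list (take i (replicate n 1)) = i" if "i \<le> n" for i using that by (simp add: sum_list_replicate)
  show "smu (replicate n 1) g (replicate n id) permutes {1..sum_list (replicate n 1)}"
    by (rule smu_permutes[OF g']) (simp add: list_all2_conv_all_nth permutes_id)
  show "g permutes {1..sum_list (replicate n 1)}" using g by (simp add: sum_list_replicate)
  fix i a assume i: "i < length (replicate n (1 :: nat))" and a: "a \<in> {1..replicate n (1 :: nat) ! i}"
  have p: "pact g (replicate n (1 :: nat)) = replicate n 1"
    by (rule pact_eqI[OF g']) (use permutes_Suc[OF g] in auto)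
  have "replicate n id ! i permutes {1..replicate n (1 :: nat) ! i}" using i by (simp add: permutes_id)
  from smu_enc[OF g' i a this] show "smu (replicate n 1) g (replicate n id) (enc (replicate n 1) i a) = g (enc (replicate n 1) i a)"
    using i a permutes_Suc[OF g, of i] sum[of i] sum[of "g (Suc i) - 1"] unfolding p by (simp add: enc_def)
qed

lemma nth_concat_enc:
  assumes "i < length xss" "j < length (xss ! i)"
  shows "concat xss ! (sum_list (take i (map length xss)) + j) = xss ! i ! j"
    "sum_list (take i (map length xss)) + j < length (concat xss)"
proof -
  have "concat xss ! (sum_list (take i (map length xss)) + j) = xss ! i ! j \<and>
    sum_list (take i (map length xss)) + j < length (concat xss)"
    using assms
  proof (induction xss arbitrary: i)
    case (Cons xs xss)
    then show ?case by (cases i) (auto simp: nth_append add.assoc)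
  qed simp
  then show "concat xss ! (sum_list (take i (map length xss)) + j) = xss ! i ! j"
    "sum_list (take i (map length xss)) + j < length (concat xss)" by auto
qed

lemma concat_index_cases:
  assumes "p < length (concat xss)"
  obtains i j where "i < length xss" "j < length (xss ! i)" "p = sum_list (take i (map length xss)) + j"
proof -
  have "Suc p \<in> {1..sum_list (map length xss)}" using assms by (simp add: length_concat)
  then obtain i a where "i < length (map length xss)" "a \<in> {1..map length xss ! i}" "Suc p = enc (map length xss) i a"
    by (rule enc_cases)
  then show ?thesis using that[of i "a - 1"] by (auto simp: enc_def)
qed

lemma sum_list_take_concat:
  assumes "i < length jss" "j < length (jss ! i)"
  shows "sum_list (take (sum_list (take i (map length jss)) + j) (concat jss)) =
    sum_list (take i (map sum_list jss)) + sum_list (take j (jss ! i :: nat list))"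
  using assms
proof (induction jss arbitrary: i)
  case (Cons js jss)
  then show ?case by (cases i) (auto simp: add.assoc)
qed simp

lemma enc_concat:
  assumes "i < length jss" "j < length (jss ! i)"
  shows "enc (concat jss) (sum_list (take i (map length jss)) + j) a = enc (map sum_list jss) i (enc (jss ! i) j a)"
  using sum_list_take_concat[OF assms] by (simp add: enc_def)

text \<open>Three coordinates are followed: the outer block i, the inner block j and the element a.
  Both sides move them by g, by \<open>fs ! i\<close> and by \<open>hss ! i ! j\<close>, and both
  results are read in the nested list of sizes permuted at both levels.\<close>

lemma smu_assoc:
  assumes g: "g permutes {1..length jss}" and fs: "perms_list (map length jss) fs" and hss: "list_all2 perms_list jss hss"
  shows "smu (concat jss) (smu (map length jss) g fs) (concat hss) =
    smu (map sum_list jss) g (map (\<lambda>i. smu (jss ! i) (fs ! i) (hss ! i)) [0..<length jss])"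
proof -
  let ?n = "length jss" and ?lens = "map length jss" and ?sums = "map sum_list jss"
  let ?F = "smu ?lens g fs" and ?H = "map (\<lambda>i. smu (jss ! i) (fs ! i) (hss ! i)) [0..<length jss]"
  have g1: "g permutes {1..length ?lens}" and g2: "g permutes {1..length ?sums}" using g by simp_all
  have f: "fs ! i permutes {1..length (jss ! i)}" if "i < ?n" for i
    using fs that by (auto simp: list_all2_conv_all_nth)
  have h: "perms_list (jss ! i) (hss ! i)" if "i < ?n" for i
    using hss that by (auto simp: list_all2_conv_all_nth)
  have hij: "hss ! i ! j permutes {1..jss ! i ! j}" if "i < ?n" "j < length (jss ! i)" for i j
    using h[OF that(1)] that(2) by (auto simp: list_all2_conv_all_nth)
  have lenh: "map length hss = ?lens" "length hss = ?n"
    using hss by (auto simp: list_all2_conv_all_nth intro!: nth_equalityI)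
  have F: "?F permutes {1..length (concat jss)}" using smu_permutes[OF g1 fs] by (simp add: length_concat)
  have Hi: "?H ! i permutes {1..?sums ! i}" if "i < ?n" for i using smu_permutes[OF f[OF that] h[OF that]] that by simp
  have Hl: "perms_list ?sums ?H" using Hi by (simp add: list_all2_conv_all_nth)
  have ch: "concat hss ! (sum_list (take i ?lens) + j) = hss ! i ! j" if "i < ?n" "j < length (jss ! i)" for i j
    using nth_concat_enc[of i hss j] that lenh by (metis nth_map)
  have hl: "perms_list (concat jss) (concat hss)"
  proof (rule list_all2_all_nthI)
    show "length (concat jss) = length (concat hss)" using lenh by (simp add: length_concat)
    fix p assume "p < length (concat jss)"
    then obtain i j where ij: "i < ?n" "j < length (jss ! i)" "p = sum_list (take i ?lens) + j" by (rule concat_index_cases)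
    then show "concat hss ! p permutes {1..concat jss ! p}" using ch[OF ij(1,2)] nth_concat_enc(1)[OF ij(1,2)] hij[OF ij(1,2)] by simp
  qed
  \<comment> \<open>The nested sizes after all moves: inner blocks permuted by the
    \<open>fs ! i\<close>, outer blocks by g.\<close>
  define jss' where "jss' = pact g (map (\<lambda>i. pact (fs ! i) (jss ! i)) [0..<?n])"
  have g3: "g permutes {1..length (map (\<lambda>i. pact (fs ! i) (jss ! i)) [0..<?n])}" using g by simp
  have len': "length jss' = ?n" by (simp add: jss'_def)
  have j': "jss' ! (g (Suc i) - 1) = pact (fs ! i) (jss ! i)" if "i < ?n" for i
    using nth_pact[OF g3, of i] that by (simp add: jss'_def)
  have lens': "map length jss' = pact g ?lens"
    by (rule pact_eqI[OF g1, symmetric]) (use j' permutes_Suc[OF g] in \<open>auto simp: len'\<close>)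
  have sums': "map sum_list jss' = pact g ?sums"
    by (rule pact_eqI[OF g2, symmetric])
      (use j' permutes_Suc[OF g] sum_list_pact[OF f] in \<open>auto simp: len'\<close>)
  have Fenc: "?F (Suc (sum_list (take i ?lens) + j)) - 1 = sum_list (take (g (Suc i) - 1) (map length jss')) + ((fs ! i) (Suc j) - 1)"
    if i: "i < ?n" and j: "j < length (jss ! i)" for i j
  proof -
    have fi: "fs ! i permutes {1..?lens ! i}" and i': "i < length ?lens" and sj: "Suc j \<in> {1..?lens ! i}" using f[OF i] i j by simp_all
    have "?F (enc ?lens i (Suc j)) = enc (pact g ?lens) (g (Suc i) - 1) ((fs ! i) (Suc j))" by (rule smu_enc[OF g1 i' sj fi])
    then show ?thesis using permutes_Suc(3)[OF f[OF i] j] unfolding lens' enc_def by simp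
  qed
  have f1: "(fs ! i) (Suc j) - 1 < length (jss' ! (g (Suc i) - 1))" if "i < ?n" "j < length (jss ! i)" for i j
    using permutes_Suc(1)[OF f[OF that(1)] that(2)] j'[OF that(1)] by simp
  have g1': "g (Suc i) - 1 < length jss'" if "i < ?n" for i using permutes_Suc(1)[OF g that] len' by simp
  \<comment> \<open>With this the left side, whose coordinates refer to the flattened list, can be
    compared with the right side, whose coordinates refer to the nested one.\<close>
  have pF: "pact ?F (concat jss) = concat jss'"
  proof (rule pact_eqI[OF F])
    show "length (concat jss') = length (concat jss)"
      using lens' sum_list_pact[OF g1] by (simp add: length_concat)
    fix p assume "p < length (concat jss)"
    then obtain i j where ij: "i < ?n" "j < length (jss ! i)" "p = sum_list (take i ?lens) + j" by (rule concat_index_cases)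
    have "concat jss' ! (?F (Suc p) - 1) = jss' ! (g (Suc i) - 1) ! ((fs ! i) (Suc j) - 1)"
      unfolding ij(3) Fenc[OF ij(1,2)] by (rule nth_concat_enc(1)[OF g1'[OF ij(1)] f1[OF ij(1,2)]])
    also have "\<dots> = jss ! i ! j" unfolding j'[OF ij(1)] by (rule nth_pact[OF f[OF ij(1)] ij(2)])
    finally show "concat jss' ! (?F (Suc p) - 1) = concat jss ! p" using nth_concat_enc(1)[OF ij(1,2)] ij(3) by simp
  qed
  have sum_eq: "sum_list ?sums = sum_list (concat jss)" by (induction jss) auto
  show ?thesis
  proof (rule smu_eqI[of _ ?sums])
    show "smu (concat jss) ?F (concat hss) permutes {1..sum_list ?sums}"
      unfolding sum_eq by (rule smu_permutes[OF F hl])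
    show "smu ?sums g ?H permutes {1..sum_list ?sums}" by (rule smu_permutes[OF g2 Hl])
    fix i b assume "i < length ?sums" and b: "b \<in> {1..?sums ! i}"
    then have i: "i < ?n" by simp
    then have "b \<in> {1..sum_list (jss ! i)}" using b by simp
    then obtain j a where j: "j < length (jss ! i)" and a: "a \<in> {1..jss ! i ! j}" and b_eq: "b = enc (jss ! i) j a" by (rule enc_cases)
    let ?p = "sum_list (take i ?lens) + j"
    have p: "?p < length (concat jss)" and cp: "concat jss ! ?p = jss ! i ! j" using nth_concat_enc[OF i j] by simp_all
    have a': "a \<in> {1..concat jss ! ?p}" and hp: "concat hss ! ?p permutes {1..concat jss ! ?p}"
      using a hij[OF i j] cp ch[OF i j] by simp_all
    have "smu (concat jss) ?F (concat hss) (enc ?sums i b) = smu (concat jss) ?F (concat hss) (enc (concat jss) ?p a)"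
      unfolding b_eq enc_concat[OF i j] ..
    also have "\<dots> = enc (concat jss') (sum_list (take (g (Suc i) - 1) (map length jss')) + ((fs ! i) (Suc j) - 1)) ((hss ! i ! j) a)"
      unfolding smu_enc[OF F p a' hp] pF Fenc[OF i j] ch[OF i j] ..
    also have "\<dots> = enc (map sum_list jss') (g (Suc i) - 1) (enc (jss' ! (g (Suc i) - 1)) ((fs ! i) (Suc j) - 1) ((hss ! i ! j) a))"
      by (rule enc_concat[OF g1'[OF i] f1[OF i j]])
    also have "\<dots> = enc (pact g ?sums) (g (Suc i) - 1) (smu (jss ! i) (fs ! i) (hss ! i) b)"
      unfolding sums' j'[OF i] b_eq smu_enc[OF f[OF i] j a hij[OF i j]] ..
    also have "\<dots> = enc (pact g ?sums) (g (Suc i) - 1) ((?H ! i) b)" using i by simp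
    also have "\<dots> = smu ?sums g ?H (enc ?sums i b)"
      by (rule smu_enc[OF g2 _ b Hi[OF i], symmetric]) (use i in simp)
    finally show "smu (concat jss) ?F (concat hss) (enc ?sums i b) = smu ?sums g ?H (enc ?sums i b)" .
  qed
qed

lemma pact_comp:
  assumes "g permutes {1..length xs}" "g' permutes {1..length xs}"
  shows "pact (g' \<circ> g) xs = pact g' (pact g xs)"
proof (rule pact_eqI)
  show "g' \<circ> g permutes {1..length xs}" using assms by (rule permutes_compose)
  fix i assume i: "i < length xs"
  have g': "g' permutes {1..length (pact g xs)}" using assms(2) by simp
  have "pact g' (pact g xs) ! (g' (Suc (g (Suc i) - 1)) - 1) = pact g xs ! (g (Suc i) - 1)"
    by (rule nth_pact[OF g']) (use permutes_Suc(1)[OF assms(1) i] in simp)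
  then show "pact g' (pact g xs) ! ((g' \<circ> g) (Suc i) - 1) = xs ! i"
    using permutes_Suc(2)[OF assms(1) i] nth_pact[OF assms(1) i] by simp
qed simp

text \<open>In coordinates, element a of block i passes through block g i of the list
  \<open>pact g ks\<close>, where the second factor acts with entry g i of
  \<open>fs'\<close>.\<close>

lemma smu_interchange:
  assumes g: "g permutes {1..length ks}" and g': "g' permutes {1..length ks}"
    and fs: "perms_list ks fs" and fs': "perms_list (pact g ks) fs'"
  shows "smu (pact g ks) g' fs' \<circ> smu ks g fs =
    smu ks (g' \<circ> g) (map (\<lambda>i. fs' ! (g i - 1) \<circ> fs ! (i - 1)) [1..<Suc (length ks)])"
proof -
  let ?H = "map (\<lambda>i. fs' ! (g i - 1) \<circ> fs ! (i - 1)) [1..<Suc (length ks)]"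
  have g2: "g' permutes {1..length (pact g ks)}" using g' by simp
  have f: "fs ! i permutes {1..ks ! i}" if "i < length ks" for i
    using fs that by (simp add: list_all2_conv_all_nth)
  have f'l: "fs' ! i permutes {1..pact g ks ! i}" if "i < length (pact g ks)" for i
    using fs' that by (simp add: list_all2_conv_all_nth)
  have f': "fs' ! (g (Suc i) - 1) permutes {1..ks ! i}" if "i < length ks" for i
    using f'l[of "g (Suc i) - 1"] permutes_Suc(1)[OF g that] nth_pact[OF g that] by simp
  have H: "?H ! i = fs' ! (g (Suc i) - 1) \<circ> fs ! i" if "i < length ks" for i using that by (simp del: upt_Suc)
  have Hp: "?H ! i permutes {1..ks ! i}" if "i < length ks" for i
    unfolding H[OF that] by (rule permutes_compose[OF f[OF that] f'[OF that]])
  have gg: "g' \<circ> g permutes {1..length ks}" by (rule permutes_compose[OF g g'])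
  show ?thesis
  proof (rule smu_eqI[of _ ks])
    show "smu (pact g ks) g' fs' \<circ> smu ks g fs permutes {1..sum_list ks}"
      using permutes_compose[OF smu_permutes[OF g fs]] smu_permutes[OF g2 fs'] sum_list_pact[OF g] by metis
    show "smu ks (g' \<circ> g) ?H permutes {1..sum_list ks}"
      by (rule smu_permutes[OF gg list_all2_all_nthI]) (use Hp in \<open>simp_all del: upt_Suc\<close>)
    fix i a assume i: "i < length ks" and a: "a \<in> {1..ks ! i}"
    let ?j = "g (Suc i) - 1"
    have j: "?j < length (pact g ks)" "pact g ks ! ?j = ks ! i" "Suc ?j = g (Suc i)"
      using permutes_Suc[OF g i] nth_pact[OF g i] by simp_all
    have fa: "(fs ! i) a \<in> {1..pact g ks ! ?j}" using permutes_in_image[OF f[OF i]] a j(2) by simp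
    have "(smu (pact g ks) g' fs' \<circ> smu ks g fs) (enc ks i a) = smu (pact g ks) g' fs' (enc (pact g ks) ?j ((fs ! i) a))"
      using smu_enc[OF g i a f[OF i]] by simp
    also have "\<dots> = enc (pact g' (pact g ks)) (g' (g (Suc i)) - 1) ((fs' ! ?j) ((fs ! i) a))"
      unfolding smu_enc[OF g2 j(1) fa f'l[OF j(1)]] j(3) ..
    also have "\<dots> = enc (pact (g' \<circ> g) ks) ((g' \<circ> g) (Suc i) - 1) ((?H ! i) a)"
      unfolding pact_comp[OF g g'] H[OF i] by simp
    also have "\<dots> = smu ks (g' \<circ> g) ?H (enc ks i a)" by (rule smu_enc[OF gg i a Hp[OF i], symmetric])
    finally show "(smu (pact g ks) g' fs' \<circ> smu ks g fs) (enc ks i a) = smu ks (g' \<circ> g) ?H (enc ks i a)" .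
  qed
qed

section \<open>Action operads as algebras\<close>

lemma all_perms_iff: "(n, \<sigma>) \<in> all_perms \<longleftrightarrow> \<sigma> permutes {1..n}"
  by (simp add: all_perms_def sym_group_def)

lemma countable_all_perms: "countable all_perms"
proof -
  have "countable (carrier (sym_group n))" for n
    using finite_permutations[of "{1..n}"] by (simp add: sym_group_def countable_finite)
  then show ?thesis unfolding all_perms_def by (intro countable_SIGMA) auto
qed

text \<open>A symbol must determine the sort of its result, so each operation of an action operad is
  split into one symbol for each choice of arities and permutations of its arguments.\<close>

datatype aop_sym = Id_sym | One_sym nat | Mult_sym nat "nat \<Rightarrow> nat" "nat \<Rightarrow> nat" | Inv_sym nat "nat \<Rightarrow> nat"
  | Mu_sym "nat list" "nat \<Rightarrow> nat" "(nat \<Rightarrow> nat) list"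

text \<open>Indices outside the symmetric groups are excluded; among all functions on the numbers
  they would not form a countable set of symbols.\<close>

primrec sym_ok :: "aop_sym \<Rightarrow> bool" where
  "sym_ok Id_sym \<longleftrightarrow> True"
| "sym_ok (One_sym n) \<longleftrightarrow> True"
| "sym_ok (Mult_sym n \<sigma> \<tau>) \<longleftrightarrow> \<sigma> permutes {1..n} \<and> \<tau> permutes {1..n}"
| "sym_ok (Inv_sym n \<sigma>) \<longleftrightarrow> \<sigma> permutes {1..n}"
| "sym_ok (Mu_sym ks \<sigma> \<tau>s) \<longleftrightarrow> \<sigma> permutes {1..length ks} \<and> perms_list ks \<tau>s"

primrec sym_arity :: "aop_sym \<Rightarrow> (nat \<times> (nat \<Rightarrow> nat)) list" where
  "sym_arity Id_sym = []"
| "sym_arity (One_sym n) = []"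
| "sym_arity (Mult_sym n \<sigma> \<tau>) = [(n, \<sigma>), (n, \<tau>)]"
| "sym_arity (Inv_sym n \<sigma>) = [(n, \<sigma>)]"
| "sym_arity (Mu_sym ks \<sigma> \<tau>s) = (length ks, \<sigma>) # zip ks \<tau>s"

primrec sym_result :: "aop_sym \<Rightarrow> nat \<times> (nat \<Rightarrow> nat)" where
  "sym_result Id_sym = (1, id)"
| "sym_result (One_sym n) = (n, id)"
| "sym_result (Mult_sym n \<sigma> \<tau>) = (n, \<sigma> \<circ> \<tau>)"
| "sym_result (Inv_sym n \<sigma>) = (n, inv' \<sigma>)"
| "sym_result (Mu_sym ks \<sigma> \<tau>s) = (sum_list ks, smu ks \<sigma> \<tau>s)"

text \<open>A symbol carries finitely many numbers and finitely many permutations of initial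
  segments, and there are countably many of each.\<close>

lemma countable_sym_ok: "countable (Collect sym_ok)"
proof -
  define P where "P = snd ` all_perms"
  have P: "countable P" unfolding P_def by (rule countable_image[OF countable_all_perms])
  have inP: "\<sigma> permutes {1..n} \<Longrightarrow> \<sigma> \<in> P" for \<sigma> n
    unfolding P_def by (metis all_perms_iff image_eqI snd_conv)
  have "Collect sym_ok \<subseteq> insert Id_sym (range One_sym \<union> (\<lambda>(n, \<sigma>, \<tau>). Mult_sym n \<sigma> \<tau>) ` (UNIV \<times> P \<times> P) \<union>
    (\<lambda>(n, \<sigma>). Inv_sym n \<sigma>) ` (UNIV \<times> P) \<union> (\<lambda>(ks, \<sigma>, \<tau>s). Mu_sym ks \<sigma> \<tau>s) ` (UNIV \<times> P \<times> lists P))" (is "_ \<subseteq> ?R")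
  proof
    fix s assume "s \<in> Collect sym_ok"
    then have ok: "sym_ok s" by simp
    show "s \<in> ?R"
    proof (cases s)
      case (Mult_sym n \<sigma> \<tau>)
      then have "(n, \<sigma>, \<tau>) \<in> UNIV \<times> P \<times> P" using ok by (auto intro: inP simp del: One_nat_def)
      then show ?thesis unfolding Mult_sym by (intro insertI2 UnI1 UnI2 image_eqI[of _ _ "(n, \<sigma>, \<tau>)"]) auto
    next
      case (Inv_sym n \<sigma>)
      then have "(n, \<sigma>) \<in> UNIV \<times> P" using ok by (auto intro: inP simp del: One_nat_def)
      then show ?thesis unfolding Inv_sym by (intro insertI2 UnI1 UnI2 image_eqI[of _ _ "(n, \<sigma>)"]) auto
    next
      case (Mu_sym ks \<sigma> \<tau>s)
      have "\<tau> \<in> P" if "\<tau> \<in> set \<tau>s" for \<tau>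
      proof -
        obtain i where "i < length \<tau>s" "\<tau> = \<tau>s ! i" using \<open>\<tau> \<in> set \<tau>s\<close> by (auto simp: in_set_conv_nth)
        then have "\<tau> permutes {1..ks ! i}" using ok Mu_sym by (simp add: list_all2_conv_all_nth del: One_nat_def)
        then show ?thesis by (rule inP)
      qed
      then have "(ks, \<sigma>, \<tau>s) \<in> UNIV \<times> P \<times> lists P" using ok Mu_sym by (auto intro: inP simp del: One_nat_def)
      then show ?thesis unfolding Mu_sym by (intro insertI2 UnI2 image_eqI[of _ _ "(ks, \<sigma>, \<tau>s)"]) auto
    qed simp_all
  qed
  moreover have "countable ?R" using P by (intro countable_insert countable_Un countable_image countable_SIGMA countable_lists) auto
  ultimately show ?thesis by (rule countable_subset)
qed

primrec op_interp :: "'u action_operad \<Rightarrow> aop_sym \<Rightarrow> 'u list \<Rightarrow> 'u" where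
  "op_interp L Id_sym xs = op_id L"
| "op_interp L (One_sym n) xs = op_one L n"
| "op_interp L (Mult_sym n \<sigma> \<tau>) xs = op_mult L n (xs ! 0) (xs ! 1)"
| "op_interp L (Inv_sym n \<sigma>) xs = m_inv (op_group L n) (xs ! 0)"
| "op_interp L (Mu_sym ks \<sigma> \<tau>s) xs = op_mu L ks (hd xs) (tl xs)"

lemma list_all2_concatI: "list_all2 (list_all2 P) xss yss \<Longrightarrow> list_all2 P (concat xss) (concat yss)"
  by (induction rule: list_all2_induct) (auto intro: list_all2_appendI)

text \<open>The k-ary part of an algebra, recovered from the sorts: the first component of a sort is
  the arity, the second one, \<open>prm\<close>, is the image in the symmetric group.\<close>

definition mem :: "('f, nat \<times> (nat \<Rightarrow> nat), 'u) alg \<Rightarrow> nat \<Rightarrow> 'u \<Rightarrow> bool" where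
  "mem B k x \<longleftrightarrow> x \<in> acarrier B \<and> fst (asort B x) = k"

definition prm :: "('f, nat \<times> (nat \<Rightarrow> nat), 'u) alg \<Rightarrow> 'u \<Rightarrow> nat \<Rightarrow> nat" where
  "prm B x = snd (asort B x)"

text \<open>The operation symbols of a variety are elements of the type underlying the universe; c codes them there.\<close>

locale aop_signature =
  fixes U :: "'u set set" and c :: "aop_sym \<Rightarrow> 'u"
  assumes univ: "universe U" and inj_c: "inj_on c (Collect sym_ok)" and c_U: "c ` Collect sym_ok \<in> U"
begin

definition sym_of :: "'u \<Rightarrow> aop_sym" where
  "sym_of = inv_into (Collect sym_ok) c"

definition Sg :: "('u, nat \<times> (nat \<Rightarrow> nat)) signature" where
  "Sg = \<lparr>symbols = c ` Collect sym_ok, arity = sym_arity \<circ> sym_of, result = sym_result \<circ> sym_of\<rparr>"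

lemma sym_of [simp]: "sym_ok s \<Longrightarrow> sym_of (c s) = s"
  using inj_c by (simp add: sym_of_def)

lemma Sg_simps [simp]:
  "sym_ok s \<Longrightarrow> c s \<in> symbols Sg" "sym_ok s \<Longrightarrow> arity Sg (c s) = sym_arity s" "sym_ok s \<Longrightarrow> result Sg (c s) = sym_result s"
  by (simp_all add: Sg_def)

lemma symbols_cases:
  assumes "f \<in> symbols Sg"
  obtains s where "f = c s" "sym_ok s"
  using assms by (auto simp: Sg_def)

lemma Sg_sorts: "f \<in> symbols Sg \<Longrightarrow> set (arity Sg f) \<subseteq> all_perms \<and> result Sg f \<in> all_perms"
proof -
  assume "f \<in> symbols Sg"
  then obtain s where s: "f = c s" "sym_ok s" by (rule symbols_cases)
  have "set (zip ks \<tau>s) \<subseteq> all_perms" if "perms_list ks \<tau>s" for ks \<tau>s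
    using that by (auto simp: list_all2_iff all_perms_iff)
  then have "set (sym_arity s) \<subseteq> all_perms \<and> sym_result s \<in> all_perms"
    using s(2) by (cases s) (auto simp: all_perms_iff permutes_id permutes_compose permutes_inv smu_permutes
      simp del: One_nat_def comp_apply)
  then show ?thesis using s by simp
qed

subsection \<open>The operations of an algebra\<close>

text \<open>The index of the symbol is read off the sorts of the arguments. This reassembles the
  split symbols into one operation of the form that it has in an action operad; the next definitions
  do the same for multiplication and inversion.\<close>

definition mmu :: "('u, nat \<times> (nat \<Rightarrow> nat), 'u) alg \<Rightarrow> nat list \<Rightarrow> 'u \<Rightarrow> 'u list \<Rightarrow> 'u" where
  "mmu B ks g fs = aint B (c (Mu_sym ks (prm B g) (map (prm B) fs))) (g # fs)"

definition mmul :: "('u, nat \<times> (nat \<Rightarrow> nat), 'u) alg \<Rightarrow> nat \<Rightarrow> 'u \<Rightarrow> 'u \<Rightarrow> 'u" where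
  "mmul B n x y = aint B (c (Mult_sym n (prm B x) (prm B y))) [x, y]"

definition minv :: "('u, nat \<times> (nat \<Rightarrow> nat), 'u) alg \<Rightarrow> nat \<Rightarrow> 'u \<Rightarrow> 'u" where
  "minv B n x = aint B (c (Inv_sym n (prm B x))) [x]"

definition mone :: "('u, nat \<times> (nat \<Rightarrow> nat), 'u) alg \<Rightarrow> nat \<Rightarrow> 'u" where
  "mone B n = aint B (c (One_sym n)) []"

definition mid :: "('u, nat \<times> (nat \<Rightarrow> nat), 'u) alg \<Rightarrow> 'u" where
  "mid B = aint B (c Id_sym) []"

abbreviation Alg :: "('u, nat \<times> (nat \<Rightarrow> nat), 'u) alg \<Rightarrow> bool" where
  "Alg \<equiv> is_alg U all_perms Sg"

lemma mem_asort: "mem B k x \<Longrightarrow> asort B x = (k, prm B x)"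
  by (auto simp: mem_def prm_def)

lemma mem_perm: "Alg B \<Longrightarrow> mem B k x \<Longrightarrow> prm B x permutes {1..k}"
  using is_algD(2)[of U all_perms Sg B x] mem_asort[of B k x] by (simp add: mem_def all_perms_iff)

lemma mems_perms: "Alg B \<Longrightarrow> list_all2 (mem B) ks fs \<Longrightarrow> perms_list ks (map (prm B) fs)"
  using mem_perm[of B] by (simp add: list_all2_conv_all_nth del: One_nat_def)

lemma mems_asort: "list_all2 (mem B) ks fs \<Longrightarrow> map (asort B) fs = zip ks (map (prm B) fs)"
  by (rule nth_equalityI) (auto simp: list_all2_conv_all_nth mem_asort)

lemma mems_carrier: "list_all2 (mem B) ks fs \<Longrightarrow> set fs \<subseteq> acarrier B"
  by (auto simp: list_all2_conv_all_nth in_set_conv_nth mem_def)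

lemma aargs_sym:
  assumes B: "Alg B"
  shows "[] \<in> aargs Sg B (c Id_sym)" "[] \<in> aargs Sg B (c (One_sym n))"
    "mem B n x \<Longrightarrow> [x] \<in> aargs Sg B (c (Inv_sym n (prm B x)))"
    "mem B n x \<Longrightarrow> mem B n y \<Longrightarrow> [x, y] \<in> aargs Sg B (c (Mult_sym n (prm B x) (prm B y)))"
    "mem B (length ks) g \<Longrightarrow> list_all2 (mem B) ks fs \<Longrightarrow> g # fs \<in> aargs Sg B (c (Mu_sym ks (prm B g) (map (prm B) fs)))"
proof -
  show "[] \<in> aargs Sg B (c Id_sym)" "[] \<in> aargs Sg B (c (One_sym n))" by (simp_all add: aargs_def)
  have car: "x \<in> acarrier B" if "mem B n x" for n x using that by (simp add: mem_def)
  show "[x] \<in> aargs Sg B (c (Inv_sym n (prm B x)))" if "mem B n x"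
    using mem_perm[OF B that] mem_asort[OF that] car[OF that] by (simp add: aargs_def)
  show "[x, y] \<in> aargs Sg B (c (Mult_sym n (prm B x) (prm B y)))" if "mem B n x" "mem B n y"
    using mem_perm[OF B that(1)] mem_asort[OF that(1)] car[OF that(1)]
      mem_perm[OF B that(2)] mem_asort[OF that(2)] car[OF that(2)] by (simp add: aargs_def)
  show "g # fs \<in> aargs Sg B (c (Mu_sym ks (prm B g) (map (prm B) fs)))" if "mem B (length ks) g" "list_all2 (mem B) ks fs"
    using mem_perm[OF B that(1)] mem_asort[OF that(1)] car[OF that(1)]
      mems_perms[OF B that(2)] mems_asort[OF that(2)] mems_carrier[OF that(2)] by (simp add: aargs_def)
qed

lemma aint_mem:
  assumes "Alg B" "sym_ok s" "xs \<in> aargs Sg B (c s)"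
  shows "mem B (fst (sym_result s)) (aint B (c s) xs)" "prm B (aint B (c s) xs) = snd (sym_result s)"
  using is_algD(4,5)[OF assms(1) _ assms(3)] assms(2) by (simp_all add: mem_def prm_def)

lemma mem_ops:
  assumes B: "Alg B"
  shows "mem B 1 (mid B)" "prm B (mid B) = id"
    "mem B n (mone B n)" "prm B (mone B n) = id"
    "mem B n x \<Longrightarrow> mem B n (minv B n x)" "mem B n x \<Longrightarrow> prm B (minv B n x) = inv' (prm B x)"
    "mem B n x \<Longrightarrow> mem B n y \<Longrightarrow> mem B n (mmul B n x y)"
    "mem B n x \<Longrightarrow> mem B n y \<Longrightarrow> prm B (mmul B n x y) = prm B x \<circ> prm B y"
    "mem B (length ks) g \<Longrightarrow> list_all2 (mem B) ks fs \<Longrightarrow> mem B (sum_list ks) (mmu B ks g fs)"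
    "mem B (length ks) g \<Longrightarrow> list_all2 (mem B) ks fs \<Longrightarrow> prm B (mmu B ks g fs) = smu ks (prm B g) (map (prm B) fs)"
proof -
  note a = aargs_sym[OF B]
  show "mem B 1 (mid B)" "prm B (mid B) = id" using aint_mem[OF B _ a(1)] by (simp_all add: mid_def)
  show "mem B n (mone B n)" "prm B (mone B n) = id" using aint_mem[OF B _ a(2)] by (simp_all add: mone_def)
  show "mem B n (minv B n x)" "prm B (minv B n x) = inv' (prm B x)" if "mem B n x"
    using aint_mem[OF B _ a(3)[OF that]] mem_perm[OF B that] by (simp_all add: minv_def)
  show "mem B n (mmul B n x y)" "prm B (mmul B n x y) = prm B x \<circ> prm B y" if "mem B n x" "mem B n y"
    using aint_mem[OF B _ a(4)[OF that]] mem_perm[OF B that(1)] mem_perm[OF B that(2)] by (simp_all add: mmul_def)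
  show "mem B (sum_list ks) (mmu B ks g fs)" "prm B (mmu B ks g fs) = smu ks (prm B g) (map (prm B) fs)"
    if "mem B (length ks) g" "list_all2 (mem B) ks fs"
    using aint_mem[OF B _ a(5)[OF that]] mem_perm[OF B that(1)] mems_perms[OF B that(2)] by (simp_all add: mmu_def)
qed

subsection \<open>The operations on terms\<close>

definition tprm :: "(nat \<times> 'x \<Rightarrow> nat \<times> (nat \<Rightarrow> nat)) \<Rightarrow> ('u, 'x) trm \<Rightarrow> nat \<Rightarrow> nat" where
  "tprm p t = snd (psort Sg p t)"

text \<open>The counterpart of \<open>mem\<close> for terms over generators in G. The last clause is
  imposed because p is arbitrary on generators; it makes the symbols in the terms built below
  satisfy \<open>sym_ok\<close>.\<close>

definition tmem :: "(nat \<times> 'x \<Rightarrow> nat \<times> (nat \<Rightarrow> nat)) \<Rightarrow> (nat \<times> 'x) set \<Rightarrow> nat \<Rightarrow> ('u, 'x) trm \<Rightarrow> bool" where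
  "tmem p G k t \<longleftrightarrow> wtm Sg p t \<and> tvars t \<subseteq> G \<and> fst (psort Sg p t) = k \<and> tprm p t permutes {1..k}"

definition tmu :: "(nat \<times> 'x \<Rightarrow> nat \<times> (nat \<Rightarrow> nat)) \<Rightarrow> nat list \<Rightarrow> ('u, 'x) trm \<Rightarrow> ('u, 'x) trm list \<Rightarrow> ('u, 'x) trm" where
  "tmu p ks t ts = App (c (Mu_sym ks (tprm p t) (map (tprm p) ts))) (t # ts)"

definition tmul :: "(nat \<times> 'x \<Rightarrow> nat \<times> (nat \<Rightarrow> nat)) \<Rightarrow> nat \<Rightarrow> ('u, 'x) trm \<Rightarrow> ('u, 'x) trm \<Rightarrow> ('u, 'x) trm" where
  "tmul p n t s = App (c (Mult_sym n (tprm p t) (tprm p s))) [t, s]"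

definition tinv :: "(nat \<times> 'x \<Rightarrow> nat \<times> (nat \<Rightarrow> nat)) \<Rightarrow> nat \<Rightarrow> ('u, 'x) trm \<Rightarrow> ('u, 'x) trm" where
  "tinv p n t = App (c (Inv_sym n (tprm p t))) [t]"

definition tone :: "nat \<Rightarrow> ('u, 'x) trm" where
  "tone n = App (c (One_sym n)) []"

definition tid :: "('u, 'x) trm" where
  "tid = App (c Id_sym) []"

lemma tmem_psort: "tmem p G k t \<Longrightarrow> psort Sg p t = (k, tprm p t)"
  by (auto simp: tmem_def tprm_def)

lemma tmems:
  assumes "list_all2 (tmem p G) ks ts"
  shows "list_all (wtm Sg p) ts" "\<Union> (tvars ` set ts) \<subseteq> G" "map (psort Sg p) ts = zip ks (map (tprm p) ts)"
    "perms_list ks (map (tprm p) ts)"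
proof -
  show "list_all (wtm Sg p) ts" using assms by (auto simp: list_all2_conv_all_nth list_all_length tmem_def)
  show "\<Union> (tvars ` set ts) \<subseteq> G" using assms by (fastforce simp: list_all2_conv_all_nth in_set_conv_nth tmem_def)
  show "map (psort Sg p) ts = zip ks (map (tprm p) ts)"
    by (rule nth_equalityI) (use assms in \<open>auto simp: list_all2_conv_all_nth tmem_psort\<close>)
  show "perms_list ks (map (tprm p) ts)" using assms by (auto simp: list_all2_conv_all_nth tmem_def)
qed

lemma tmem_ops:
  shows "tmem p G 1 tid" "tprm p tid = id" "tmem p G n (tone n)" "tprm p (tone n) = id"
    "tmem p G n t \<Longrightarrow> tmem p G n (tinv p n t)" "tmem p G n t \<Longrightarrow> tprm p (tinv p n t) = inv' (tprm p t)"
    "tmem p G n t \<Longrightarrow> tmem p G n s \<Longrightarrow> tmem p G n (tmul p n t s)"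
    "tmem p G n t \<Longrightarrow> tmem p G n s \<Longrightarrow> tprm p (tmul p n t s) = tprm p t \<circ> tprm p s"
    "tmem p G (length ks) t \<Longrightarrow> list_all2 (tmem p G) ks ts \<Longrightarrow> tmem p G (sum_list ks) (tmu p ks t ts)"
    "tmem p G (length ks) t \<Longrightarrow> list_all2 (tmem p G) ks ts \<Longrightarrow> tprm p (tmu p ks t ts) = smu ks (tprm p t) (map (tprm p) ts)"
proof -
  show "tprm p tid = id" "tprm p (tone n) = id" by (simp_all add: tid_def tone_def tprm_def)
  then show "tmem p G 1 tid" "tmem p G n (tone n)" by (simp_all add: tid_def tone_def tmem_def permutes_id)
  show 1: "tprm p (tinv p n t) = inv' (tprm p t)" if "tmem p G n t"
    using that by (simp add: tinv_def tprm_def tmem_def)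
  show "tmem p G n (tinv p n t)" if t: "tmem p G n t"
    using 1[OF t] t tmem_psort[OF t] permutes_inv[of "tprm p t" "{1..n}"] by (simp add: tinv_def tmem_def)
  show 2: "tprm p (tmul p n t s) = tprm p t \<circ> tprm p s" if "tmem p G n t" "tmem p G n s"
    using that by (simp add: tmul_def tprm_def tmem_def)
  show "tmem p G n (tmul p n t s)" if t: "tmem p G n t" and s: "tmem p G n s"
    using 2[OF t s] t s tmem_psort[OF t] tmem_psort[OF s] permutes_compose[of "tprm p s" "{1..n}" "tprm p t"]
    by (simp add: tmul_def tmem_def)
  show 3: "tprm p (tmu p ks t ts) = smu ks (tprm p t) (map (tprm p) ts)"
    if t: "tmem p G (length ks) t" and ts: "list_all2 (tmem p G) ks ts"
    using t tmems(4)[OF ts] unfolding tmem_def tmu_def by (subst tprm_def) simp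
  show "tmem p G (sum_list ks) (tmu p ks t ts)" if t: "tmem p G (length ks) t" and ts: "list_all2 (tmem p G) ks ts"
  proof -
    have ok: "sym_ok (Mu_sym ks (tprm p t) (map (tprm p) ts))" using t tmems(4)[OF ts] by (simp add: tmem_def)
    have "wtm Sg p (tmu p ks t ts)" "tvars (tmu p ks t ts) \<subseteq> G" "fst (psort Sg p (tmu p ks t ts)) = sum_list ks"
      using ok t tmems[OF ts] tmem_psort[OF t] by (simp_all add: tmu_def tmem_def)
    then show ?thesis using 3[OF t ts] smu_permutes[of "tprm p t" ks "map (tprm p) ts"] ok by (simp add: tmem_def)
  qed
qed

lemma teval_tmem:
  assumes B: "Alg B" and w: "\<forall>x\<in>G. w x \<in> acarrier B \<and> asort B (w x) = p x" and t: "tmem p G k t"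
  shows "mem B k (teval (aint B) w t)" "prm B (teval (aint B) w t) = tprm p t"
proof -
  have "teval (aint B) w t \<in> acarrier B \<and> asort B (teval (aint B) w t) = psort Sg p t"
    by (rule teval_wtm[OF B]) (use t w in \<open>auto simp: tmem_def\<close>)
  then show "mem B k (teval (aint B) w t)" "prm B (teval (aint B) w t) = tprm p t"
    using t by (simp_all add: tmem_def mem_def prm_def tprm_def)
qed

lemma teval_ops:
  assumes B: "Alg B" and w: "\<forall>x\<in>G. w x \<in> acarrier B \<and> asort B (w x) = p x"
  shows "teval (aint B) w tid = mid B" "teval (aint B) w (tone n) = mone B n"
    "tmem p G n t \<Longrightarrow> teval (aint B) w (tinv p n t) = minv B n (teval (aint B) w t)"
    "tmem p G n t \<Longrightarrow> tmem p G n s \<Longrightarrow> teval (aint B) w (tmul p n t s) = mmul B n (teval (aint B) w t) (teval (aint B) w s)"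
    "tmem p G (length ks) t \<Longrightarrow> list_all2 (tmem p G) ks ts \<Longrightarrow>
      teval (aint B) w (tmu p ks t ts) = mmu B ks (teval (aint B) w t) (map (teval (aint B) w) ts)"
proof -
  have pr: "prm B (teval (aint B) w t) = tprm p t" if "tmem p G k t" for k t by (rule teval_tmem(2)[OF B w that])
  show "teval (aint B) w tid = mid B" "teval (aint B) w (tone n) = mone B n"
    by (simp_all add: tid_def mid_def tone_def mone_def)
  show "teval (aint B) w (tinv p n t) = minv B n (teval (aint B) w t)" if "tmem p G n t"
    using pr[OF that] by (simp add: tinv_def minv_def)
  show "teval (aint B) w (tmul p n t s) = mmul B n (teval (aint B) w t) (teval (aint B) w s)" if "tmem p G n t" "tmem p G n s"
    using pr[OF that(1)] pr[OF that(2)] by (simp add: tmul_def mmul_def)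
  show "teval (aint B) w (tmu p ks t ts) = mmu B ks (teval (aint B) w t) (map (teval (aint B) w) ts)"
    if "tmem p G (length ks) t" "list_all2 (tmem p G) ks ts"
  proof -
    have "prm B (teval (aint B) w s) = tprm p s" if "s \<in> set ts" for s
      using pr \<open>list_all2 (tmem p G) ks ts\<close> that by (auto simp: list_all2_conv_all_nth in_set_conv_nth)
    then have "map (prm B) (map (teval (aint B) w) ts) = map (tprm p) ts" by simp
    then show ?thesis using pr[OF that(1)] by (simp add: tmu_def mmu_def del: map_map map_eq_conv)
  qed
qed

subsection \<open>The laws of action operads\<close>

text \<open>Apart from closure these are the premises of \<open>groupI\<close>; inverses are given
  by an operation.\<close>

definition group_laws :: "('u, nat \<times> (nat \<Rightarrow> nat), 'u) alg \<Rightarrow> bool" where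
  "group_laws B \<longleftrightarrow> (\<forall>n x. mem B n x \<longrightarrow> mmul B n (mone B n) x = x \<and> mmul B n (minv B n x) x = mone B n \<and>
     (\<forall>y z. mem B n y \<longrightarrow> mem B n z \<longrightarrow> mmul B n (mmul B n x y) z = mmul B n x (mmul B n y z)))"

definition unit_laws :: "('u, nat \<times> (nat \<Rightarrow> nat), 'u) alg \<Rightarrow> bool" where
  "unit_laws B \<longleftrightarrow> (\<forall>n g. mem B n g \<longrightarrow> mmu B [n] (mid B) [g] = g \<and> mmu B (replicate n 1) g (replicate n (mid B)) = g)"

definition assoc_law :: "('u, nat \<times> (nat \<Rightarrow> nat), 'u) alg \<Rightarrow> bool" where
  "assoc_law B \<longleftrightarrow> (\<forall>jss g fs hss. mem B (length jss) g \<longrightarrow> list_all2 (mem B) (map length jss) fs \<longrightarrow>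
     list_all2 (list_all2 (mem B)) jss hss \<longrightarrow>
     mmu B (concat jss) (mmu B (map length jss) g fs) (concat hss) =
     mmu B (map sum_list jss) g (map (\<lambda>i. mmu B (jss ! i) (fs ! i) (hss ! i)) [0..<length jss]))"

definition interchange_law :: "('u, nat \<times> (nat \<Rightarrow> nat), 'u) alg \<Rightarrow> bool" where
  "interchange_law B \<longleftrightarrow> (\<forall>ks g g' fs fs'. mem B (length ks) g \<longrightarrow> mem B (length ks) g' \<longrightarrow> list_all2 (mem B) ks fs \<longrightarrow>
     list_all2 (mem B) (pact (prm B g) ks) fs' \<longrightarrow>
     mmul B (sum_list ks) (mmu B (pact (prm B g) ks) g' fs') (mmu B ks g fs) =
     mmu B ks (mmul B (length ks) g' g)
       (map (\<lambda>i. mmul B (ks ! (i - 1)) (fs' ! (prm B g i - 1)) (fs ! (i - 1))) [1..<Suc (length ks)]))"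

definition action_laws :: "('u, nat \<times> (nat \<Rightarrow> nat), 'u) alg \<Rightarrow> bool" where
  "action_laws B \<longleftrightarrow> group_laws B \<and> unit_laws B \<and> assoc_law B \<and> interchange_law B"

text \<open>The laws of action operads are schemes ranging over all arities, block sizes and
  permutations. Taking every equation valid in the class avoids writing the schemes out with sorted
  variables.\<close>

definition valid_eqs :: "('u, nat \<times> (nat \<Rightarrow> nat), 'u) alg set \<Rightarrow>
    (('u, nat \<times> (nat \<Rightarrow> nat)) trm \<times> ('u, nat \<times> (nat \<Rightarrow> nat)) trm) set" where
  "valid_eqs \<A> = {(t, t'). well_sorted all_perms Sg t \<and> well_sorted all_perms Sg t' \<and> tsort Sg t = tsort Sg t' \<and>
     (\<forall>B\<in>\<A>. satisfies B (t, t'))}"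

text \<open>
  Equations are transported to a model A by taking elements of A, renamed to numbers, as variables.
\<close>

lemma valid_eqs_transport:
  assumes A: "Alg A" and sat: "\<And>e. e \<in> valid_eqs \<A> \<Longrightarrow> satisfies A e"
    and p: "p = (\<lambda>g :: nat \<times> 'u. asort A (snd g))" and G: "G \<subseteq> {0} \<times> acarrier A" "G \<subseteq> tvars t \<union> tvars t'"
    and t: "tmem p G k t" and t': "tmem p G k t'" and tt': "tprm p t = tprm p t'"
    and valid: "\<And>B w. B \<in> \<A> \<Longrightarrow> (\<forall>x\<in>G. w x \<in> acarrier B \<and> asort B (w x) = p x) \<Longrightarrow>
      teval (aint B) w t = teval (aint B) w t'"
  shows "teval (aint A) snd t = teval (aint A) snd t'"
proof -
  let ?W = "tvars t \<union> tvars t'"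
  have fin: "finite (tvars r)" for r :: "('u, 'u) trm" by (induction r) auto
  then have "finite ?W" by blast
  from finite_imp_inj_to_nat_seg[OF this] obtain idx :: "nat \<times> 'u \<Rightarrow> nat" where idx: "inj_on idx ?W" by blast
  \<comment> \<open>The number separates the variables, the second component gives the sort, as
    \<open>valid_eqs\<close> consists of equations in sorted variables.\<close>
  define \<rho> where "\<rho> x = (idx x, p x)" for x
  have \<rho>: "inj_on \<rho> ?W" using idx by (auto simp: inj_on_def \<rho>_def)
  have W: "?W \<subseteq> G" using t t' by (auto simp: tmem_def)
  let ?r = "\<lambda>s. tsubst (\<lambda>x. Var (\<rho> x)) s"
  have r: "wtm Sg snd (?r s) \<and> psort Sg snd (?r s) = psort Sg p s" if "wtm Sg p s" for s
    by (rule wtm_tsubst[OF that]) (simp add: \<rho>_def)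
  have "p x \<in> all_perms" if "x \<in> G" for x using that G(1) is_algD(2)[OF A] by (auto simp: p)
  then have vars: "tvars (?r s) \<subseteq> {y. snd y \<in> all_perms}" if "tvars s \<subseteq> G" for s
    using that by (auto simp: tvars_tsubst \<rho>_def)
  have ws: "well_sorted all_perms Sg (?r s)" if "tmem p G k s" for s
    unfolding well_sorted_wtm using r[of s] vars[of s] that by (simp add: tmem_def)
  have "(?r t, ?r t') \<in> valid_eqs \<A>" unfolding valid_eqs_def
  proof (intro CollectI, unfold prod.case, intro conjI ballI ws t t')
    show "tsort Sg (?r t) = tsort Sg (?r t')"
      using r t t' tt' tmem_psort[OF t] tmem_psort[OF t'] by (simp add: tsort_psort tmem_def)
    fix B assume B: "B \<in> \<A>"
    show "satisfies B (?r t, ?r t')" unfolding satisfies_def prod.case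
    proof (intro allI impI)
      fix v assume v: "\<forall>x\<in>tvars (?r t) \<union> tvars (?r t'). v x \<in> acarrier B \<and> asort B (v x) = snd x"
      \<comment> \<open>\<open>satisfies\<close> constrains a valuation only at variables that
        occur. All elements of G occur, so v is admissible on the whole of G.\<close>
      have "teval (aint B) (\<lambda>x. v (\<rho> x)) t = teval (aint B) (\<lambda>x. v (\<rho> x)) t'"
      proof (rule valid[OF B], rule ballI)
        fix x assume "x \<in> G"
        then have "\<rho> x \<in> tvars (?r t) \<union> tvars (?r t')" using G(2) by (auto simp: tvars_tsubst)
        then show "v (\<rho> x) \<in> acarrier B \<and> asort B (v (\<rho> x)) = p x" using v by (simp add: \<rho>_def)
      qed
      then show "teval (aint B) v (?r t) = teval (aint B) v (?r t')" by (simp add: teval_tsubst)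
    qed
  qed
  then have s: "satisfies A (?r t, ?r t')" by (rule sat)
  \<comment> \<open>Each variable is given the element of A from which it was made.\<close>
  let ?v = "\<lambda>y. snd (inv_into ?W \<rho> y)"
  have vr: "?v (\<rho> x) = snd x" if "x \<in> ?W" for x using \<rho> that by simp
  have "\<forall>y\<in>tvars (?r t) \<union> tvars (?r t'). ?v y \<in> acarrier A \<and> asort A (?v y) = snd y"
  proof
    fix y assume "y \<in> tvars (?r t) \<union> tvars (?r t')"
    then obtain x where x: "x \<in> ?W" "y = \<rho> x" by (auto simp: tvars_tsubst)
    then have "snd x \<in> acarrier A" using W G(1) by auto
    then show "?v y \<in> acarrier A \<and> asort A (?v y) = snd y" using vr[OF x(1)] x(2) by (simp add: \<rho>_def p)
  qed
  then have "teval (aint A) ?v (?r t) = teval (aint A) ?v (?r t')"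
    by (rule s[unfolded satisfies_def prod.case, THEN spec, of ?v, THEN mp])
  moreover have "teval (aint A) ?v (?r s) = teval (aint A) snd s" if "tvars s \<subseteq> ?W" for s
    unfolding teval_tsubst by (rule teval_cong) (use vr that in auto)
  ultimately show ?thesis by simp
qed

text \<open>The elements in an instance of a law become variables, and the two sides become terms.
  \<open>law\<close> then asks that both terms are well formed, that they have the same permutation,
  which is the law in the symmetric groups, and that they agree in the algebras where the laws are
  known.\<close>

lemma action_laws_transport:
  assumes A: "Alg A" and sat: "\<And>e. e \<in> valid_eqs \<A> \<Longrightarrow> satisfies A e"
    and B: "\<And>B. B \<in> \<A> \<Longrightarrow> Alg B \<and> action_laws B"
  shows "action_laws A"
proof -
  define p where "p = (\<lambda>g :: nat \<times> 'u. asort A (snd g))"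
  define V :: "'u \<Rightarrow> ('u, 'u) trm" where "V x = Var (0, x)" for x
  define G :: "'u set \<Rightarrow> (nat \<times> 'u) set" where "G W = {0} \<times> W" for W
  have V: "tmem p (G W) k (V x)" if "mem A k x" "x \<in> W" for W k x
    using that mem_perm[OF A that(1)] by (auto simp: tmem_def V_def p_def G_def mem_def tprm_def prm_def)
  have Vp: "tprm p (V x) = prm A x" for x by (simp add: V_def tprm_def p_def prm_def)
  have Vs: "list_all2 (tmem p (G W)) ks (map V xs)" if "list_all2 (mem A) ks xs" "set xs \<subseteq> W" for W ks xs
    using that by (auto simp: list_all2_conv_all_nth subset_iff intro!: V)
  have Vps: "map (tprm p) (map V xs) = map (prm A) xs" for xs by (simp add: Vp)
  have evA: "teval (aint A) snd (V x) = x" for x by (simp add: V_def)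
  have wA: "\<forall>x\<in>G W. snd x \<in> acarrier A \<and> asort A (snd x) = p x" if "W \<subseteq> acarrier A" for W
    using that by (auto simp: G_def p_def)
  \<comment> \<open>The common step for all laws. The elements of W must all occur in the terms,
    because valuations of other variables are not constrained.\<close>
  have law: "teval (aint A) snd t = teval (aint A) snd t'"
    if "W \<subseteq> acarrier A" "G W \<subseteq> tvars t \<union> tvars t'" "tmem p (G W) k t" "tmem p (G W) k t'" "tprm p t = tprm p t'"
      and "\<And>B w. Alg B \<Longrightarrow> action_laws B \<Longrightarrow> (\<forall>x\<in>G W. w x \<in> acarrier B \<and> asort B (w x) = p x) \<Longrightarrow>
        teval (aint B) w t = teval (aint B) w t'" for k t t' W
  proof (rule valid_eqs_transport[OF A sat p_def _ that(2-5)])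
    show "G W \<subseteq> {0} \<times> acarrier A" using that(1) by (auto simp: G_def)
  qed (use that(6) B in blast)+
  have evw: "teval (aint B) w (V x) = w (0, x)" for B :: "('u, nat \<times> (nat \<Rightarrow> nat), 'u) alg" and w x by (simp add: V_def)
  have mw: "mem B k (w (0, x))" "prm B (w (0, x)) = prm A x"
    if "Alg B" "\<forall>x\<in>G W. w x \<in> acarrier B \<and> asort B (w x) = p x" "mem A k x" "x \<in> W" for B W w k x
    using teval_tmem[OF that(1,2) V[OF that(3,4)]] evw[of B w x] Vp by simp_all
  have mws: "list_all2 (mem B) ks (map (\<lambda>x. w (0, x)) xs)"
    if "Alg B" "\<forall>x\<in>G W. w x \<in> acarrier B \<and> asort B (w x) = p x" "list_all2 (mem A) ks xs" "set xs \<subseteq> W" for B W w ks xs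
    using that(3,4) by (auto simp: list_all2_conv_all_nth subset_iff intro!: mw(1)[OF that(1,2)])
  have "group_laws A" unfolding group_laws_def
  proof (intro allI impI conjI)
    fix n x assume x: "mem A n x"
    let ?W = "{x}"
    have W: "?W \<subseteq> acarrier A" using x by (simp add: mem_def)
    note tx = V[OF x, of ?W, simplified]
    note one = tmem_ops(3)[of p "G ?W" n] and inv = tmem_ops(5)[OF tx]
    have "teval (aint A) snd (tmul p n (tone n) (V x)) = teval (aint A) snd (V x)"
    proof (rule law[OF W _ tmem_ops(7)[OF one tx] tx])
      show "tprm p (tmul p n (tone n) (V x)) = tprm p (V x)" using tmem_ops(8)[OF one tx] tmem_ops(4)[of p n] by simp
      fix B w assume BA: "Alg B" and BL: "action_laws B" and w: "\<forall>x\<in>G ?W. w x \<in> acarrier B \<and> asort B (w x) = p x"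
      show "teval (aint B) w (tmul p n (tone n) (V x)) = teval (aint B) w (V x)"
        using teval_ops(4)[OF BA w one tx] teval_ops(2)[OF BA w] mw(1)[OF BA w x] BL
        by (simp add: evw action_laws_def group_laws_def)
    qed (simp add: G_def tmul_def V_def)
    then show "mmul A n (mone A n) x = x"
      using teval_ops(4)[OF A wA[OF W] one tx] teval_ops(2)[OF A wA[OF W]] by (simp add: evA)
    have "teval (aint A) snd (tmul p n (tinv p n (V x)) (V x)) = teval (aint A) snd (tone n)"
    proof (rule law[OF W _ tmem_ops(7)[OF inv tx] one])
      have "inv' (prm A x) \<circ> prm A x = id" using permutes_inv_o(2)[OF mem_perm[OF A x]] .
      then show "tprm p (tmul p n (tinv p n (V x)) (V x)) = tprm p (tone n)"
        using tmem_ops(8)[OF inv tx] tmem_ops(6)[OF tx] tmem_ops(4)[of p n] Vp by simp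
      fix B w assume BA: "Alg B" and BL: "action_laws B" and w: "\<forall>x\<in>G ?W. w x \<in> acarrier B \<and> asort B (w x) = p x"
      show "teval (aint B) w (tmul p n (tinv p n (V x)) (V x)) = teval (aint B) w (tone n)"
        using teval_ops(4)[OF BA w inv tx] teval_ops(3)[OF BA w tx] teval_ops(2)[OF BA w] mw(1)[OF BA w x] BL
        by (simp add: evw action_laws_def group_laws_def)
    qed (simp add: G_def tmul_def V_def)
    then show "mmul A n (minv A n x) x = mone A n"
      using teval_ops(4)[OF A wA[OF W] inv tx] teval_ops(3)[OF A wA[OF W] tx] teval_ops(2)[OF A wA[OF W]] by (simp add: evA)
  next
    fix n x y z assume x: "mem A n x" and y: "mem A n y" and z: "mem A n z"
    let ?W = "{x, y, z}"
    have W: "?W \<subseteq> acarrier A" using x y z by (simp add: mem_def)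
    have tx: "tmem p (G ?W) n (V x)" and ty: "tmem p (G ?W) n (V y)" and tz: "tmem p (G ?W) n (V z)"
      using V[OF x] V[OF y] V[OF z] by simp_all
    note xy = tmem_ops(7)[OF tx ty] and yz = tmem_ops(7)[OF ty tz]
    note ops = tx ty tz xy yz
    have "teval (aint A) snd (tmul p n (tmul p n (V x) (V y)) (V z)) = teval (aint A) snd (tmul p n (V x) (tmul p n (V y) (V z)))"
    proof (rule law[OF W _ tmem_ops(7)[OF xy tz] tmem_ops(7)[OF tx yz]])
      show "tprm p (tmul p n (tmul p n (V x) (V y)) (V z)) = tprm p (tmul p n (V x) (tmul p n (V y) (V z)))"
        using ops by (simp add: tmem_ops(8) comp_assoc)
      fix B w assume BA: "Alg B" and BL: "action_laws B" and w: "\<forall>x\<in>G ?W. w x \<in> acarrier B \<and> asort B (w x) = p x"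
      have "mem B n (w (0, x))" "mem B n (w (0, y))" "mem B n (w (0, z))"
        using mw(1)[OF BA w x] mw(1)[OF BA w y] mw(1)[OF BA w z] by simp_all
      then show "teval (aint B) w (tmul p n (tmul p n (V x) (V y)) (V z)) = teval (aint B) w (tmul p n (V x) (tmul p n (V y) (V z)))"
        using teval_ops(4)[OF BA w xy tz] teval_ops(4)[OF BA w tx yz] teval_ops(4)[OF BA w tx ty] teval_ops(4)[OF BA w ty tz] BL
        by (simp add: evw action_laws_def group_laws_def)
    qed (auto simp: G_def tmul_def V_def)
    then show "mmul A n (mmul A n x y) z = mmul A n x (mmul A n y z)"
      using teval_ops(4)[OF A wA[OF W] xy tz] teval_ops(4)[OF A wA[OF W] tx yz] teval_ops(4)[OF A wA[OF W] tx ty]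
        teval_ops(4)[OF A wA[OF W] ty tz] by (simp add: evA)
  qed
  moreover have "unit_laws A" unfolding unit_laws_def
  proof (intro allI impI conjI)
    fix n g assume g: "mem A n g"
    let ?W = "{g}"
    have W: "?W \<subseteq> acarrier A" using g by (simp add: mem_def)
    note tg = V[OF g, of ?W, simplified]
    have id: "tmem p (G ?W) (length [n]) tid" and tgs: "list_all2 (tmem p (G ?W)) [n] [V g]" using tmem_ops(1)[of p "G ?W"] tg by simp_all
    have tg': "tmem p (G ?W) (length (replicate n (1 :: nat))) (V g)"
      and ids: "list_all2 (tmem p (G ?W)) (replicate n 1) (replicate n tid)" using tmem_ops(1)[of p "G ?W"] tg by (simp_all add: list_all2_conv_all_nth)
    note l = tmem_ops(9)[OF id tgs, simplified] and r = tmem_ops(9)[OF tg' ids, simplified sum_list_replicate mult_1_right of_nat_id]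
    have "teval (aint A) snd (tmu p [n] tid [V g]) = teval (aint A) snd (V g)"
    proof (rule law[OF W _ l tg])
      show "tprm p (tmu p [n] tid [V g]) = tprm p (V g)"
        using tmem_ops(10)[OF id tgs] tmem_ops(2)[of p] smu_unit_left[OF mem_perm[OF A g]] Vp by simp
      fix B w assume BA: "Alg B" and BL: "action_laws B" and w: "\<forall>x\<in>G ?W. w x \<in> acarrier B \<and> asort B (w x) = p x"
      show "teval (aint B) w (tmu p [n] tid [V g]) = teval (aint B) w (V g)"
        using teval_ops(5)[OF BA w id tgs] teval_ops(1)[OF BA w] mw(1)[OF BA w g] BL
        by (simp add: evw action_laws_def unit_laws_def)
    qed (simp add: G_def V_def)
    then show "mmu A [n] (mid A) [g] = g"
      using teval_ops(5)[OF A wA[OF W] id tgs] teval_ops(1)[OF A wA[OF W]] by (simp add: evA)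
    have "teval (aint A) snd (tmu p (replicate n 1) (V g) (replicate n tid)) = teval (aint A) snd (V g)"
    proof (rule law[OF W _ r tg])
      show "tprm p (tmu p (replicate n 1) (V g) (replicate n tid)) = tprm p (V g)"
        using tmem_ops(10)[OF tg' ids] tmem_ops(2)[of p] smu_unit_right[OF mem_perm[OF A g]] Vp by simp
      fix B w assume BA: "Alg B" and BL: "action_laws B" and w: "\<forall>x\<in>G ?W. w x \<in> acarrier B \<and> asort B (w x) = p x"
      show "teval (aint B) w (tmu p (replicate n 1) (V g) (replicate n tid)) = teval (aint B) w (V g)"
        using teval_ops(5)[OF BA w tg' ids] teval_ops(1)[OF BA w] mw(1)[OF BA w g] BL
        by (simp add: evw action_laws_def unit_laws_def)
    qed (simp add: G_def V_def)
    then show "mmu A (replicate n 1) g (replicate n (mid A)) = g"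
      using teval_ops(5)[OF A wA[OF W] tg' ids] teval_ops(1)[OF A wA[OF W]] by (simp add: evA)
  qed
  moreover have "assoc_law A" unfolding assoc_law_def
  proof (intro allI impI)
    fix jss g fs hss assume g: "mem A (length jss) g" and fs: "list_all2 (mem A) (map length jss) fs"
      and hss: "list_all2 (list_all2 (mem A)) jss hss"
    let ?W = "insert g (set fs \<union> set (concat hss))"
    note hs = list_all2_concatI[OF hss]
    have W: "?W \<subseteq> acarrier A" using g mems_carrier[OF fs] mems_carrier[OF hs] by (simp add: mem_def)
    have tg: "tmem p (G ?W) (length (map length jss)) (V g)" "tmem p (G ?W) (length (map sum_list jss)) (V g)" using V[OF g, of ?W] by simp_all
    have tfs: "list_all2 (tmem p (G ?W)) (map length jss) (map V fs)" and ths: "list_all2 (tmem p (G ?W)) (concat jss) (map V (concat hss))"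
      using Vs[OF fs, of ?W] Vs[OF hs, of ?W] by auto
    have len: "length fs = length jss" "length hss = length jss" using fs hss by (auto dest: list_all2_lengthD)
    have fi: "mem A (length (jss ! i)) (fs ! i)" "fs ! i \<in> ?W" if "i < length jss" for i
      using fs that len by (auto simp: list_all2_conv_all_nth)
    have hi: "list_all2 (mem A) (jss ! i) (hss ! i)" "set (hss ! i) \<subseteq> ?W" if "i < length jss" for i
      using hss that len by (auto simp: list_all2_conv_all_nth)
    have tfi: "tmem p (G ?W) (length (jss ! i)) (V (fs ! i))" if "i < length jss" for i using V[OF fi[OF that]] .
    have thi: "list_all2 (tmem p (G ?W)) (jss ! i) (map V (hss ! i))" if "i < length jss" for i using Vs[OF hi[OF that]] .
    have tF: "tmem p (G ?W) (length (concat jss)) (tmu p (map length jss) (V g) (map V fs))"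
      using tmem_ops(9)[OF tg(1) tfs] by (simp add: length_concat)
    define Hs where "Hs = map (\<lambda>i. tmu p (jss ! i) (V (fs ! i)) (map V (hss ! i))) [0..<length jss]"
    have tHs: "list_all2 (tmem p (G ?W)) (map sum_list jss) Hs"
      by (rule list_all2_all_nthI) (use tmem_ops(9)[OF tfi thi] in \<open>auto simp: Hs_def\<close>)
    note l = tmem_ops(9)[OF tF ths] and r = tmem_ops(9)[OF tg(2) tHs]
    have sums: "sum_list (map sum_list jss) = sum_list (concat jss)" by (induction jss) auto
    have evalH: "map (teval (aint B) w) Hs = map (\<lambda>i. mmu B (jss ! i) (w (0, fs ! i)) (map (\<lambda>x. w (0, x)) (hss ! i))) [0..<length jss]"
      if BA: "Alg B" and w: "\<forall>x\<in>G ?W. w x \<in> acarrier B \<and> asort B (w x) = p x" for B w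
      using teval_ops(5)[OF BA w tfi thi] by (auto simp: Hs_def evw o_def)
    have "teval (aint A) snd (tmu p (concat jss) (tmu p (map length jss) (V g) (map V fs)) (map V (concat hss))) =
      teval (aint A) snd (tmu p (map sum_list jss) (V g) Hs)"
    proof (rule law[OF W _ l r[unfolded sums]])
      have "map (tprm p) Hs = map (\<lambda>i. smu (jss ! i) (map (prm A) fs ! i) (map (map (prm A)) hss ! i)) [0..<length jss]"
        using tmem_ops(10)[OF tfi thi] len by (simp add: Hs_def Vp o_def del: comp_apply) 
      moreover have "map (prm A) (concat hss) = concat (map (map (prm A)) hss)" by (simp add: map_concat)
      moreover have "perms_list (map length jss) (map (prm A) fs)" by (rule mems_perms[OF A fs])
      moreover have "list_all2 perms_list jss (map (map (prm A)) hss)"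
        using hi(1) mems_perms[OF A] len by (simp add: list_all2_conv_all_nth[of perms_list] del: One_nat_def)
      \<comment> \<open>Equality of the sorts is associativity in the operad of symmetric groups,
        applied to the permutations of the elements.\<close>
      ultimately show "tprm p (tmu p (concat jss) (tmu p (map length jss) (V g) (map V fs)) (map V (concat hss))) =
          tprm p (tmu p (map sum_list jss) (V g) Hs)"
        unfolding tmem_ops(10)[OF tF ths] tmem_ops(10)[OF tg(2) tHs] tmem_ops(10)[OF tg(1) tfs] Vps Vp
        using smu_assoc[OF mem_perm[OF A g]] by presburger
      fix B w assume BA: "Alg B" and BL: "action_laws B" and w: "\<forall>x\<in>G ?W. w x \<in> acarrier B \<and> asort B (w x) = p x"
      let ?w = "\<lambda>x. w (0, x)"
      have mg: "mem B (length jss) (?w g)" using mw(1)[OF BA w g] by simp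
      have mfs: "list_all2 (mem B) (map length jss) (map ?w fs)" using mws[OF BA w fs] by auto
      have mhss: "list_all2 (list_all2 (mem B)) jss (map (map ?w) hss)"
        using mws[OF BA w hi] len by (simp add: list_all2_conv_all_nth[of "list_all2 (mem B)"])
      have "mmu B (concat jss) (mmu B (map length jss) (?w g) (map ?w fs)) (concat (map (map ?w) hss)) =
        mmu B (map sum_list jss) (?w g) (map (\<lambda>i. mmu B (jss ! i) (map ?w fs ! i) (map (map ?w) hss ! i)) [0..<length jss])"
        using BL mg mfs mhss unfolding action_laws_def assoc_law_def by blast
      moreover have "map (\<lambda>i. mmu B (jss ! i) (map ?w fs ! i) (map (map ?w) hss ! i)) [0..<length jss] = map (teval (aint B) w) Hs"
        unfolding evalH[OF BA w] using len by simp
      moreover have "map (teval (aint B) w) (map V fs) = map ?w fs" "map (teval (aint B) w) (map V (concat hss)) = concat (map (map ?w) hss)"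
        by (simp_all add: evw map_concat o_def)
      ultimately show "teval (aint B) w (tmu p (concat jss) (tmu p (map length jss) (V g) (map V fs)) (map V (concat hss))) =
        teval (aint B) w (tmu p (map sum_list jss) (V g) Hs)"
        unfolding teval_ops(5)[OF BA w tF ths] teval_ops(5)[OF BA w tg(2) tHs] teval_ops(5)[OF BA w tg(1) tfs] evw by (simp only:)
    qed (auto simp: G_def tmu_def V_def)
    moreover have "map (teval (aint A) snd) (map V xs) = xs" for xs by (simp add: evA o_def)
    ultimately show "mmu A (concat jss) (mmu A (map length jss) g fs) (concat hss) =
        mmu A (map sum_list jss) g (map (\<lambda>i. mmu A (jss ! i) (fs ! i) (hss ! i)) [0..<length jss])"
      unfolding teval_ops(5)[OF A wA[OF W] tF ths] teval_ops(5)[OF A wA[OF W] tg(2) tHs] teval_ops(5)[OF A wA[OF W] tg(1) tfs]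
        evA evalH[OF A wA[OF W]] by (simp only: snd_conv map_ident)
  qed
  moreover have "interchange_law A" unfolding interchange_law_def
  proof (intro allI impI)
    fix ks g g' fs fs' assume g: "mem A (length ks) g" and g': "mem A (length ks) g'" and fs: "list_all2 (mem A) ks fs"
      and fs': "list_all2 (mem A) (pact (prm A g) ks) fs'"
    let ?W = "insert g (insert g' (set fs \<union> set fs'))" and ?ks' = "pact (prm A g) ks"
    note gp = mem_perm[OF A g] and g'p = mem_perm[OF A g']
    have W: "?W \<subseteq> acarrier A" using g g' mems_carrier[OF fs] mems_carrier[OF fs'] by (simp add: mem_def)
    have tg: "tmem p (G ?W) (length ks) (V g)" and tg': "tmem p (G ?W) (length ks) (V g')" "tmem p (G ?W) (length ?ks') (V g')"
      using V[OF g, of ?W] V[OF g', of ?W] by simp_all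
    have tfs: "list_all2 (tmem p (G ?W)) ks (map V fs)" and tfs': "list_all2 (tmem p (G ?W)) ?ks' (map V fs')"
      using Vs[OF fs, of ?W] Vs[OF fs', of ?W] by auto
    have len: "length fs = length ks" "length fs' = length ks" using fs fs' by (auto dest: list_all2_lengthD)
    define F where "F i = tmul p (ks ! (i - 1)) (V (fs' ! (prm A g i - 1))) (V (fs ! (i - 1)))" for i
    have fi: "mem A (ks ! i) (fs ! i)" "fs ! i \<in> ?W" if "i < length ks" for i
      using fs that len by (auto simp: list_all2_conv_all_nth)
    \<comment> \<open>\<open>pact\<close> moves the size of block i to position
      \<open>prm A g (Suc i)\<close>, so the entry of \<open>fs'\<close> found there can be
      multiplied with \<open>fs ! i\<close>.\<close>
    have fi': "mem A (ks ! i) (fs' ! (prm A g (Suc i) - 1))" "fs' ! (prm A g (Suc i) - 1) \<in> ?W" if "i < length ks" for i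
    proof -
      have j: "prm A g (Suc i) - 1 < length ks" by (rule permutes_Suc(1)[OF gp that])
      then have "mem A (?ks' ! (prm A g (Suc i) - 1)) (fs' ! (prm A g (Suc i) - 1))" using fs' len by (simp add: list_all2_conv_all_nth)
      then show "mem A (ks ! i) (fs' ! (prm A g (Suc i) - 1))" using nth_pact[OF gp that] by simp
      show "fs' ! (prm A g (Suc i) - 1) \<in> ?W" using j len by simp
    qed
    have tF: "list_all2 (tmem p (G ?W)) ks (map F [1..<Suc (length ks)])"
      by (rule list_all2_all_nthI) (use tmem_ops(7)[OF V[OF fi'] V[OF fi]] in \<open>auto simp: F_def simp del: upt_Suc\<close>)
    have l1: "tmem p (G ?W) (sum_list ks) (tmu p ?ks' (V g') (map V fs'))" using tmem_ops(9)[OF tg'(2) tfs'] sum_list_pact[OF gp] by simp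
    note l2 = tmem_ops(9)[OF tg tfs] and gg = tmem_ops(7)[OF tg'(1) tg]
    note l = tmem_ops(7)[OF l1 l2] and r = tmem_ops(9)[OF gg tF]
    have evalF: "map (teval (aint B) w) (map F [1..<Suc (length ks)]) =
        map (\<lambda>i. mmul B (ks ! (i - 1)) (w (0, fs' ! (prm A g i - 1))) (w (0, fs ! (i - 1)))) [1..<Suc (length ks)]"
      if BA: "Alg B" and w: "\<forall>x\<in>G ?W. w x \<in> acarrier B \<and> asort B (w x) = p x" for B w
    proof (rule nth_equalityI)
      fix i assume "i < length (map (teval (aint B) w) (map F [1..<Suc (length ks)]))"
      then have i: "i < length ks" by (simp del: upt_Suc)
      then show "map (teval (aint B) w) (map F [1..<Suc (length ks)]) ! i =
        map (\<lambda>i. mmul B (ks ! (i - 1)) (w (0, fs' ! (prm A g i - 1))) (w (0, fs ! (i - 1)))) [1..<Suc (length ks)] ! i"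
        using teval_ops(4)[OF BA w V[OF fi'[OF i]] V[OF fi[OF i]]] by (simp add: F_def evw del: upt_Suc)
    qed (simp del: upt_Suc)
    let ?l = "tmul p (sum_list ks) (tmu p ?ks' (V g') (map V fs')) (tmu p ks (V g) (map V fs))"
    let ?r = "tmu p ks (tmul p (length ks) (V g') (V g)) (map F [1..<Suc (length ks)])"
    have "teval (aint A) snd ?l = teval (aint A) snd ?r"
    proof (rule law[OF W _ l r])
      have "map (tprm p) (map F [1..<Suc (length ks)]) =
        map (\<lambda>i. map (prm A) fs' ! (prm A g i - 1) \<circ> map (prm A) fs ! (i - 1)) [1..<Suc (length ks)]"
      proof (rule nth_equalityI)
        fix i assume "i < length (map (tprm p) (map F [1..<Suc (length ks)]))"
        then have i: "i < length ks" by (simp del: upt_Suc)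
        then show "map (tprm p) (map F [1..<Suc (length ks)]) ! i =
          map (\<lambda>i. map (prm A) fs' ! (prm A g i - 1) \<circ> map (prm A) fs ! (i - 1)) [1..<Suc (length ks)] ! i"
          using tmem_ops(8)[OF V[OF fi'[OF i]] V[OF fi[OF i]]] permutes_Suc(1)[OF gp i] len
          by (simp add: F_def Vp del: upt_Suc)
      qed (simp del: upt_Suc)
      then show "tprm p ?l = tprm p ?r"
        unfolding tmem_ops(8)[OF l1 l2] tmem_ops(10)[OF gg tF] tmem_ops(10)[OF tg'(2) tfs'] tmem_ops(10)[OF tg tfs] tmem_ops(8)[OF tg'(1) tg] Vps Vp
        using smu_interchange[OF gp g'p mems_perms[OF A fs] mems_perms[OF A fs']] by presburger
      fix B w assume BA: "Alg B" and BL: "action_laws B" and w: "\<forall>x\<in>G ?W. w x \<in> acarrier B \<and> asort B (w x) = p x"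
      let ?w = "\<lambda>x. w (0, x)"
      have mg: "mem B (length ks) (?w g)" "prm B (?w g) = prm A g" and mg': "mem B (length ks) (?w g')"
        using mw[OF BA w g] mw(1)[OF BA w g'] by simp_all
      have mfs: "list_all2 (mem B) ks (map ?w fs)" and mfs': "list_all2 (mem B) (pact (prm B (?w g)) ks) (map ?w fs')"
        using mws[OF BA w fs] mws[OF BA w fs'] mg(2) by auto
      have "mmul B (sum_list ks) (mmu B (pact (prm B (?w g)) ks) (?w g') (map ?w fs')) (mmu B ks (?w g) (map ?w fs)) =
        mmu B ks (mmul B (length ks) (?w g') (?w g))
          (map (\<lambda>i. mmul B (ks ! (i - 1)) (map ?w fs' ! (prm B (?w g) i - 1)) (map ?w fs ! (i - 1))) [1..<Suc (length ks)])"
        using BL mg(1) mg' mfs mfs' unfolding action_laws_def interchange_law_def by blast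
      moreover have "map (\<lambda>i. mmul B (ks ! (i - 1)) (map ?w fs' ! (prm B (?w g) i - 1)) (map ?w fs ! (i - 1))) [1..<Suc (length ks)] =
        map (teval (aint B) w) (map F [1..<Suc (length ks)])"
        unfolding evalF[OF BA w] mg(2)
      proof (rule map_cong[OF refl])
        fix i assume "i \<in> set [1..<Suc (length ks)]"
        then have "1 \<le> i" "i < Suc (length ks)" unfolding set_upt by simp_all
        then obtain j where j: "i = Suc j" "j < length ks" by (cases i) auto
        then show "mmul B (ks ! (i - 1)) (map ?w fs' ! (prm A g i - 1)) (map ?w fs ! (i - 1)) =
          mmul B (ks ! (i - 1)) (?w (fs' ! (prm A g i - 1))) (?w (fs ! (i - 1)))"
          using permutes_Suc(1)[OF gp j(2)] len by simp
      qed
      moreover have "map (teval (aint B) w) (map V xs) = map ?w xs" for xs by (simp add: evw)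
      ultimately show "teval (aint B) w ?l = teval (aint B) w ?r"
        unfolding teval_ops(4)[OF BA w l1 l2] teval_ops(5)[OF BA w gg tF] teval_ops(5)[OF BA w tg'(2) tfs'] teval_ops(5)[OF BA w tg tfs]
          teval_ops(4)[OF BA w tg'(1) tg] evw mg(2) by (simp only:)
    qed (auto simp: G_def tmul_def tmu_def V_def)
    moreover have "map (teval (aint A) snd) (map V xs) = xs" for xs by (simp add: evA o_def)
    ultimately show "mmul A (sum_list ks) (mmu A ?ks' g' fs') (mmu A ks g fs) =
       mmu A ks (mmul A (length ks) g' g)
         (map (\<lambda>i. mmul A (ks ! (i - 1)) (fs' ! (prm A g i - 1)) (fs ! (i - 1))) [1..<Suc (length ks)])"
      unfolding teval_ops(4)[OF A wA[OF W] l1 l2] teval_ops(5)[OF A wA[OF W] gg tF] teval_ops(5)[OF A wA[OF W] tg'(2) tfs']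
        teval_ops(5)[OF A wA[OF W] tg tfs] teval_ops(4)[OF A wA[OF W] tg'(1) tg] evA evalF[OF A wA[OF W]] by (simp only: snd_conv)
  qed
  ultimately show ?thesis by (simp add: action_laws_def)
qed

end

section \<open>Objects and arrows of the category of action operads\<close>

lemma AOp_Ob:
  "L \<in> Ob (AOp U) \<longleftrightarrow> is_action_operad L \<and> op_extensional L \<and> (\<forall>n. op_set L n \<in> U) \<and>
     (\<forall>m n. m \<noteq> n \<longrightarrow> op_set L m \<inter> op_set L n = {})"
  by (simp add: AOp_def)

definition aop_hom :: "'u action_operad \<Rightarrow> 'u action_operad \<Rightarrow> (nat \<Rightarrow> 'u \<Rightarrow> 'u) set" where
  "aop_hom L M = {f. is_action_operad_map L M f \<and> (\<forall>n. f n \<in> extensional (op_set L n))}"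

lemma AOp_arrows:
  "x \<in> arrows (AOp U) L M \<longleftrightarrow> (\<exists>f. x = (L, f, M) \<and> L \<in> Ob (AOp U) \<and> M \<in> Ob (AOp U) \<and> f \<in> aop_hom L M)"
  by (simp add: AOp_def arrows_mk_cat aop_hom_def)

lemma map2_eq_map:
  assumes "list_all2 P ks fs" "\<And>k f. P k f \<Longrightarrow> h k f = h' f"
  shows "map2 h ks fs = map h' fs"
  by (rule nth_equalityI) (use assms in \<open>auto simp: list_all2_conv_all_nth\<close>)

context aop_signature
begin

text \<open>Converse to \<open>aargs_sym\<close>: well-sorted arguments carry the arities and
  permutations recorded in the symbol, so the symbol is the one that \<open>minv\<close>,
  \<open>mmul\<close> or \<open>mmu\<close> selects for them.\<close>

lemma aargs_cases:
  assumes "sym_ok s" "xs \<in> aargs Sg B (c s)"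
  shows "s = Id_sym \<or> s = One_sym n \<Longrightarrow> xs = []"
    "s = Inv_sym n \<sigma> \<Longrightarrow> \<exists>x. xs = [x] \<and> mem B n x \<and> \<sigma> = prm B x"
    "s = Mult_sym n \<sigma> \<tau> \<Longrightarrow> \<exists>x y. xs = [x, y] \<and> mem B n x \<and> mem B n y \<and> \<sigma> = prm B x \<and> \<tau> = prm B y"
    "s = Mu_sym ks \<sigma> \<tau>s \<Longrightarrow> \<exists>g fs. xs = g # fs \<and> mem B (length ks) g \<and> list_all2 (mem B) ks fs \<and>
       \<sigma> = prm B g \<and> \<tau>s = map (prm B) fs"
proof -
  have xs: "set xs \<subseteq> acarrier B" "map (asort B) xs = sym_arity s" using assms by (auto simp: aargs_def)
  show "s = Id_sym \<or> s = One_sym n \<Longrightarrow> xs = []" using xs by auto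
  show "s = Inv_sym n \<sigma> \<Longrightarrow> \<exists>x. xs = [x] \<and> mem B n x \<and> \<sigma> = prm B x" using xs by (auto simp: mem_def prm_def)
  show "s = Mult_sym n \<sigma> \<tau> \<Longrightarrow> \<exists>x y. xs = [x, y] \<and> mem B n x \<and> mem B n y \<and> \<sigma> = prm B x \<and> \<tau> = prm B y"
    using xs by (auto simp: mem_def prm_def)
  show "\<exists>g fs. xs = g # fs \<and> mem B (length ks) g \<and> list_all2 (mem B) ks fs \<and> \<sigma> = prm B g \<and> \<tau>s = map (prm B) fs"
    if s: "s = Mu_sym ks \<sigma> \<tau>s"
  proof -
    have len: "length ks = length \<tau>s" using assms(1) s by (auto dest: list_all2_lengthD)
    obtain g fs where g: "xs = g # fs" "asort B g = (length ks, \<sigma>)" "map (asort B) fs = zip ks \<tau>s"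
      using xs(2) s by auto
    have "length fs = length ks" using arg_cong[OF g(3), of length] len by simp
    moreover have "asort B (fs ! i) = (ks ! i, \<tau>s ! i)" if "i < length fs" for i
      using arg_cong[OF g(3), of "\<lambda>l. l ! i"] that calculation len by simp
    ultimately have "list_all2 (mem B) ks fs" "\<tau>s = map (prm B) fs"
      using xs(1) g(1) len by (auto simp: list_all2_conv_all_nth mem_def prm_def intro!: nth_equalityI)
    then show ?thesis using g xs(1) by (auto simp: mem_def prm_def)
  qed
qed

text \<open>The symbol selected by an operation depends on the permutations of its arguments, and h
  leaves these unchanged because it preserves sorts. Hence preserving the split symbols amounts to
  preserving the reassembled operations.\<close>

lemma ahom_iff:
  assumes B: "Alg B"
  shows "h \<in> ahom Sg B C \<longleftrightarrow> h \<in> acarrier B \<rightarrow>\<^sub>E acarrier C \<and> (\<forall>x\<in>acarrier B. asort C (h x) = asort B x) \<and>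
    h (mid B) = mid C \<and> (\<forall>n. h (mone B n) = mone C n) \<and> (\<forall>n x. mem B n x \<longrightarrow> h (minv B n x) = minv C n (h x)) \<and>
    (\<forall>n x y. mem B n x \<longrightarrow> mem B n y \<longrightarrow> h (mmul B n x y) = mmul C n (h x) (h y)) \<and>
    (\<forall>ks g fs. mem B (length ks) g \<longrightarrow> list_all2 (mem B) ks fs \<longrightarrow> h (mmu B ks g fs) = mmu C ks (h g) (map h fs))"
    (is "_ \<longleftrightarrow> ?E \<and> ?S \<and> ?ops")
proof -
  have core: "(\<forall>f\<in>symbols Sg. \<forall>xs\<in>aargs Sg B f. h (aint B f xs) = aint C f (map h xs)) \<longleftrightarrow> ?ops" if S: ?S
  proof -
    have pr: "prm C (h x) = prm B x" if "mem B n x" for n x using S that by (simp add: mem_def prm_def)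
    have prs: "map (prm C) (map h fs) = map (prm B) fs" if "list_all2 (mem B) ks fs" for ks fs
      using S mems_carrier[OF that] by (auto simp: prm_def)
    show ?thesis
    proof
      assume *: "\<forall>f\<in>symbols Sg. \<forall>xs\<in>aargs Sg B f. h (aint B f xs) = aint C f (map h xs)"
      then have *: "h (aint B (c s) xs) = aint C (c s) (map h xs)" if "sym_ok s" "xs \<in> aargs Sg B (c s)" for s xs
        using that by simp
      note a = aargs_sym[OF B]
      have "h (mid B) = mid C" using *[OF _ a(1)] by (simp add: mid_def)
      moreover have "h (mone B n) = mone C n" for n using *[OF _ a(2)] by (simp add: mone_def)
      moreover have "h (minv B n x) = minv C n (h x)" if "mem B n x" for n x
        using *[OF _ a(3)[OF that]] mem_perm[OF B that] pr[OF that] by (simp add: minv_def)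
      moreover have "h (mmul B n x y) = mmul C n (h x) (h y)" if "mem B n x" "mem B n y" for n x y
        using *[OF _ a(4)[OF that]] mem_perm[OF B that(1)] mem_perm[OF B that(2)] pr[OF that(1)] pr[OF that(2)] by (simp add: mmul_def)
      moreover have "h (mmu B ks g fs) = mmu C ks (h g) (map h fs)" if "mem B (length ks) g" "list_all2 (mem B) ks fs" for ks g fs
        using *[OF _ a(5)[OF that]] mem_perm[OF B that(1)] mems_perms[OF B that(2)] unfolding mmu_def pr[OF that(1)] prs[OF that(2)] by simp
      ultimately show ?ops by blast
    next
      assume ops: ?ops
      show "\<forall>f\<in>symbols Sg. \<forall>xs\<in>aargs Sg B f. h (aint B f xs) = aint C f (map h xs)"
      proof (intro ballI)
        fix f xs assume "f \<in> symbols Sg" and xs: "xs \<in> aargs Sg B f"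
        then obtain s where s: "f = c s" "sym_ok s" by (auto elim: symbols_cases)
        note ca = aargs_cases[OF s(2) xs[unfolded s(1)]]
        show "h (aint B f xs) = aint C f (map h xs)"
        proof (cases s)
          case Id_sym
          then show ?thesis using ops ca(1) s(1) by (simp add: mid_def)
        next
          case (One_sym n)
          then show ?thesis using ops ca(1) s(1) by (simp add: mone_def)
        next
          case (Mult_sym n \<sigma> \<tau>)
          then obtain x y where xy: "xs = [x, y]" "mem B n x" "mem B n y" "\<sigma> = prm B x" "\<tau> = prm B y" using ca(3) by blast
          then have "h (mmul B n x y) = mmul C n (h x) (h y)" using ops by blast
          then show ?thesis using xy pr s(1) Mult_sym by (simp add: mmul_def)
        next
          case (Inv_sym n \<sigma>)
          then obtain x where x: "xs = [x]" "mem B n x" "\<sigma> = prm B x" using ca(2) by blast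
          then have "h (minv B n x) = minv C n (h x)" using ops by blast
          then show ?thesis using x pr s(1) Inv_sym by (simp add: minv_def)
        next
          case (Mu_sym ks \<sigma> \<tau>s)
          then obtain g fs where g: "xs = g # fs" "mem B (length ks) g" "list_all2 (mem B) ks fs" "\<sigma> = prm B g" "\<tau>s = map (prm B) fs"
            using ca(4) by blast
          then have "h (mmu B ks g fs) = mmu C ks (h g) (map h fs)" using ops by blast
          then show ?thesis unfolding mmu_def pr[OF g(2)] prs[OF g(3)] using g s(1) Mu_sym by simp
        qed
      qed
    qed
  qed
  show ?thesis unfolding ahom_def mem_Collect_eq by (intro conj_cong refl core)
qed

subsection \<open>The algebra of an action operad\<close>

text \<open>Carrier and sort function are those that appear in \<open>AOp_forget\<close>, which
  makes the isomorphism commute strictly with the forgetful functors.\<close>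

definition alg_of :: "'u action_operad \<Rightarrow> ('u, nat \<times> (nat \<Rightarrow> nat), 'u) alg" where
  "alg_of L = (let s = (\<lambda>x\<in>op_total L. (op_degree L x, op_pi L (op_degree L x) x)) in
     \<lparr>acarrier = op_total L, asort = s,
      aint = (\<lambda>f xs. if f \<in> symbols Sg \<and> set xs \<subseteq> op_total L \<and> map s xs = arity Sg f
        then op_interp L (sym_of f) xs else undefined)\<rparr>)"

lemma alg_of_simps:
  "acarrier (alg_of L) = op_total L"
  "asort (alg_of L) = (\<lambda>x\<in>op_total L. (op_degree L x, op_pi L (op_degree L x) x))"
  "aint (alg_of L) f xs = (if f \<in> symbols Sg \<and> xs \<in> aargs Sg (alg_of L) f then op_interp L (sym_of f) xs else undefined)"
  by (simp_all add: alg_of_def Let_def aargs_def)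

lemma op_degree:
  assumes "L \<in> Ob (AOp U)" "x \<in> op_set L n"
  shows "op_degree L x = n"
  unfolding op_degree_def by (rule the_equality) (use assms in \<open>auto simp: AOp_Ob\<close>)

lemma mem_alg_of: "L \<in> Ob (AOp U) \<Longrightarrow> mem (alg_of L) n x \<longleftrightarrow> x \<in> op_set L n"
proof -
  assume L: "L \<in> Ob (AOp U)"
  show ?thesis
  proof
    assume "mem (alg_of L) n x"
    then have "x \<in> op_total L" "op_degree L x = n" by (auto simp: mem_def alg_of_simps)
    then obtain m where "x \<in> op_set L m" "op_degree L x = n" by (auto simp: op_total_def)
    then show "x \<in> op_set L n" using op_degree[OF L] by simp
  next
    assume x: "x \<in> op_set L n"
    have "x \<in> op_total L" using x by (auto simp: op_total_def)
    then show "mem (alg_of L) n x" using op_degree[OF L x] by (simp add: mem_def alg_of_simps)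
  qed
qed

lemma prm_alg_of: "L \<in> Ob (AOp U) \<Longrightarrow> x \<in> op_set L n \<Longrightarrow> prm (alg_of L) x = op_pi L n x"
proof -
  assume L: "L \<in> Ob (AOp U)" and x: "x \<in> op_set L n"
  have "x \<in> op_total L" using x by (auto simp: op_total_def)
  then show ?thesis using op_degree[OF L x] by (simp add: prm_def alg_of_simps)
qed

lemma op_list_iff: "L \<in> Ob (AOp U) \<Longrightarrow> list_all2 (mem (alg_of L)) ks fs \<longleftrightarrow> op_list L ks fs"
  by (simp add: mem_alg_of list_all2_conv_all_nth)

lemma map2_op_pi: "L \<in> Ob (AOp U) \<Longrightarrow> op_list L ks fs \<Longrightarrow> map2 (op_pi L) ks fs = map (prm (alg_of L)) fs"
  by (rule map2_eq_map[where P="\<lambda>k f. f \<in> op_set L k"]) (simp_all add: prm_alg_of)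

lemma action_operadD:
  assumes L: "L \<in> Ob (AOp U)"
  shows "op_id L \<in> op_set L 1" "op_pi L 1 (op_id L) = id"
    "g \<in> op_set L (length ks) \<Longrightarrow> op_list L ks fs \<Longrightarrow> op_mu L ks g fs \<in> op_set L (sum_list ks)"
    "g \<in> op_set L (length ks) \<Longrightarrow> op_list L ks fs \<Longrightarrow>
      op_pi L (sum_list ks) (op_mu L ks g fs) = smu ks (op_pi L (length ks) g) (map2 (op_pi L) ks fs)"
    "group (op_group L n)" "op_pi L n \<in> hom (op_group L n) (sym_group n)"
    "x \<in> op_set L n \<Longrightarrow> op_pi L n x permutes {1..n}"
    "op_one L n \<in> op_set L n" "op_pi L n (op_one L n) = id"
    "x \<in> op_set L n \<Longrightarrow> y \<in> op_set L n \<Longrightarrow> op_mult L n x y \<in> op_set L n"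
    "x \<in> op_set L n \<Longrightarrow> y \<in> op_set L n \<Longrightarrow> op_pi L n (op_mult L n x y) = op_pi L n x \<circ> op_pi L n y"
    "x \<in> op_set L n \<Longrightarrow> inv\<^bsub>op_group L n\<^esub> x \<in> op_set L n"
    "x \<in> op_set L n \<Longrightarrow> op_pi L n (inv\<^bsub>op_group L n\<^esub> x) = inv' (op_pi L n x)"
proof -
  have a: "is_operad L" "\<And>n. group (op_group L n)" "is_operad_map L sym_operad (op_pi L)"
    "\<And>n. op_pi L n \<in> hom (op_group L n) (sym_group n)"
    using L by (auto simp: AOp_Ob is_action_operad_def)
  show "op_id L \<in> op_set L 1" using a(1) by (simp add: is_operad_def)
  show "op_pi L 1 (op_id L) = id" using a(3) by (simp add: is_operad_map_def sym_operad_def)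
  show "op_mu L ks g fs \<in> op_set L (sum_list ks)" if "g \<in> op_set L (length ks)" "op_list L ks fs"
    using a(1) that unfolding is_operad_def by blast
  show "op_pi L (sum_list ks) (op_mu L ks g fs) = smu ks (op_pi L (length ks) g) (map2 (op_pi L) ks fs)"
    if "g \<in> op_set L (length ks)" "op_list L ks fs"
    using a(3) that unfolding is_operad_map_def sym_operad_def by simp
  show gr: "group (op_group L n)" and hom: "op_pi L n \<in> hom (op_group L n) (sym_group n)" by (rule a)+
  interpret h: group_hom "op_group L n" "sym_group n" "op_pi L n"
    by (intro group_hom.intro group_hom_axioms.intro gr hom sym_group_is_group)
  have car: "carrier (op_group L n) = op_set L n" and one: "\<one>\<^bsub>op_group L n\<^esub> = op_one L n"
    and mul: "x \<otimes>\<^bsub>op_group L n\<^esub> y = op_mult L n x y" for x y by (simp_all add: op_group_def)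
  have scar: "carrier (sym_group n) = {p. p permutes {1..n}}" and sone: "\<one>\<^bsub>sym_group n\<^esub> = id" and smul: "p \<otimes>\<^bsub>sym_group n\<^esub> q = p \<circ> q" for p q
    by (simp_all add: sym_group_def)
  show "op_pi L n x permutes {1..n}" if "x \<in> op_set L n" using h.hom_closed[of x] that by (simp add: car scar)
  show "op_one L n \<in> op_set L n" using h.G.one_closed by (simp add: car one)
  show "op_pi L n (op_one L n) = id" using h.hom_one by (simp add: one sone)
  show "op_mult L n x y \<in> op_set L n" "op_pi L n (op_mult L n x y) = op_pi L n x \<circ> op_pi L n y"
    if "x \<in> op_set L n" "y \<in> op_set L n"
    using h.G.m_closed[of x y] h.hom_mult[of x y] that by (simp_all add: car mul smul)
  show "inv\<^bsub>op_group L n\<^esub> x \<in> op_set L n" "op_pi L n (inv\<^bsub>op_group L n\<^esub> x) = inv' (op_pi L n x)" if "x \<in> op_set L n"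
    using h.G.inv_closed[of x] h.hom_inv[of x] h.hom_closed[of x] that sym_group_inv_equality by (simp_all add: car)
qed

lemma op_total_U:
  assumes "L \<in> Ob (AOp U)"
  shows "op_total L \<in> U"
  unfolding op_total_def by (rule small_UN_aux[OF univ small_countable[OF univ]]) (use assms in \<open>auto simp: AOp_Ob\<close>)

text \<open>Results have the prescribed sorts because \<pi> is a map of operads and, in each arity,
  a homomorphism of groups.\<close>

lemma Alg_alg_of:
  assumes L: "L \<in> Ob (AOp U)"
  shows "Alg (alg_of L)"
  unfolding is_alg_def
proof (intro conjI allI)
  note D = action_operadD[OF L] and m = mem_alg_of[OF L] and pr = prm_alg_of[OF L]
  show "acarrier (alg_of L) \<in> U" using op_total_U[OF L] by (simp add: alg_of_simps)
  show "asort (alg_of L) \<in> acarrier (alg_of L) \<rightarrow>\<^sub>E all_perms"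
    using D(7) by (auto simp: alg_of_simps op_total_def op_degree[OF L] all_perms_iff)
  fix f xs
  show "if f \<in> symbols Sg \<and> xs \<in> aargs Sg (alg_of L) f
    then aint (alg_of L) f xs \<in> acarrier (alg_of L) \<and> asort (alg_of L) (aint (alg_of L) f xs) = result Sg f
    else aint (alg_of L) f xs = undefined"
  proof (cases "f \<in> symbols Sg \<and> xs \<in> aargs Sg (alg_of L) f")
    case True
    then obtain s where s: "f = c s" "sym_ok s" by (auto elim: symbols_cases)
    have xs: "xs \<in> aargs Sg (alg_of L) (c s)" using True s by simp
    note ca = aargs_cases[OF s(2) xs]
    have "op_interp L s xs \<in> op_set L (fst (sym_result s)) \<and> op_pi L (fst (sym_result s)) (op_interp L s xs) = snd (sym_result s)"
    proof (cases s)
      case Id_sym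
      then show ?thesis using D(1,2) by simp
    next
      case (One_sym n)
      then show ?thesis using D(8,9) by simp
    next
      case (Mult_sym n \<sigma> \<tau>)
      then obtain x y where "xs = [x, y]" "x \<in> op_set L n" "y \<in> op_set L n" "\<sigma> = op_pi L n x" "\<tau> = op_pi L n y"
        using ca(3) m pr by metis
      then show ?thesis using D(10,11) Mult_sym by simp
    next
      case (Inv_sym n \<sigma>)
      then obtain x where "xs = [x]" "x \<in> op_set L n" "\<sigma> = op_pi L n x" using ca(2) m pr by metis
      then show ?thesis using D(12,13) Inv_sym by simp
    next
      case (Mu_sym ks \<sigma> \<tau>s)
      then obtain g fs where g: "xs = g # fs" "g \<in> op_set L (length ks)" "op_list L ks fs" "\<sigma> = op_pi L (length ks) g"
        "\<tau>s = map2 (op_pi L) ks fs"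
        using ca(4) m pr op_list_iff[OF L] map2_op_pi[OF L] by metis
      then show ?thesis using D(3)[OF g(2,3)] D(4)[OF g(2,3)] Mu_sym by simp
    qed
    moreover have "aint (alg_of L) f xs = op_interp L s xs" using True s by (simp add: alg_of_simps(3))
    ultimately have r: "aint (alg_of L) f xs \<in> op_set L (fst (sym_result s))"
      "op_pi L (fst (sym_result s)) (aint (alg_of L) f xs) = snd (sym_result s)" by simp_all
    have "mem (alg_of L) (fst (sym_result s)) (aint (alg_of L) f xs)" using r(1) m by simp
    from mem_asort[OF this] this have "asort (alg_of L) (aint (alg_of L) f xs) = sym_result s"
      "aint (alg_of L) f xs \<in> acarrier (alg_of L)" using pr[OF r(1)] r(2) by (simp_all add: mem_def)
    then show ?thesis using True s by simp
  next
    case False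
    then show ?thesis unfolding alg_of_simps(3) by (simp only: if_False)
  qed
qed

lemma alg_of_ops:
  assumes L: "L \<in> Ob (AOp U)"
  shows "mid (alg_of L) = op_id L" "mone (alg_of L) n = op_one L n"
    "x \<in> op_set L n \<Longrightarrow> minv (alg_of L) n x = inv\<^bsub>op_group L n\<^esub> x"
    "x \<in> op_set L n \<Longrightarrow> y \<in> op_set L n \<Longrightarrow> mmul (alg_of L) n x y = op_mult L n x y"
    "g \<in> op_set L (length ks) \<Longrightarrow> op_list L ks fs \<Longrightarrow> mmu (alg_of L) ks g fs = op_mu L ks g fs"
proof -
  note B = Alg_alg_of[OF L]
  note a = aargs_sym[OF B] and m = mem_alg_of[OF L] and ml = op_list_iff[OF L]
  show "mid (alg_of L) = op_id L" "mone (alg_of L) n = op_one L n"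
    using a(1,2) by (simp_all add: mid_def mone_def alg_of_simps(3))
  show "minv (alg_of L) n x = inv\<^bsub>op_group L n\<^esub> x" if "x \<in> op_set L n"
    using a(3)[of n x] mem_perm[OF B, of n x] that m by (simp add: minv_def alg_of_simps(3))
  show "mmul (alg_of L) n x y = op_mult L n x y" if "x \<in> op_set L n" "y \<in> op_set L n"
    using a(4)[of n x y] mem_perm[OF B, of n x] mem_perm[OF B, of n y] that m by (simp add: mmul_def alg_of_simps(3))
  show "mmu (alg_of L) ks g fs = op_mu L ks g fs" if "g \<in> op_set L (length ks)" "op_list L ks fs"
    using a(5)[of ks g fs] mem_perm[OF B, of "length ks" g] mems_perms[OF B, of ks fs] that m ml by (simp add: mmu_def alg_of_simps(3))
qed

lemma action_laws_alg_of:
  assumes L: "L \<in> Ob (AOp U)"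
  shows "action_laws (alg_of L)"
proof -
  note D = action_operadD[OF L] and m = mem_alg_of[OF L] and pr = prm_alg_of[OF L] and ml = op_list_iff[OF L] and ops = alg_of_ops[OF L]
  have op: "is_operad L" and ao: "is_action_operad L" using L by (auto simp: AOp_Ob is_action_operad_def)
  have car: "carrier (op_group L n) = op_set L n" and one: "\<one>\<^bsub>op_group L n\<^esub> = op_one L n"
    and mul: "x \<otimes>\<^bsub>op_group L n\<^esub> y = op_mult L n x y" for x y n by (simp_all add: op_group_def)
  have "group_laws (alg_of L)" unfolding group_laws_def m
  proof (intro allI impI conjI)
    fix n x assume x: "x \<in> op_set L n"
    interpret group "op_group L n" by (rule D(5))
    show "mmul (alg_of L) n (mone (alg_of L) n) x = x"
      using l_one[of x] x D(8) ops(2,4) by (simp add: car one mul)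
    show "mmul (alg_of L) n (minv (alg_of L) n x) x = mone (alg_of L) n"
      using l_inv[of x] x D(12) ops(2,3,4) by (simp add: car one mul)
    fix y z assume y: "y \<in> op_set L n" and z: "z \<in> op_set L n"
    show "mmul (alg_of L) n (mmul (alg_of L) n x y) z = mmul (alg_of L) n x (mmul (alg_of L) n y z)"
      using m_assoc[of x y z] x y z D(10) ops(4) by (simp add: car mul)
  qed
  moreover have "unit_laws (alg_of L)" unfolding unit_laws_def m
  proof (intro allI impI conjI)
    fix n g assume g: "g \<in> op_set L n"
    show "mmu (alg_of L) [n] (mid (alg_of L)) [g] = g"
      using op g ops(5)[of "op_id L" "[n]" "[g]"] D(1) ops(1) by (simp add: is_operad_def)
    show "mmu (alg_of L) (replicate n 1) g (replicate n (mid (alg_of L))) = g"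
      using op g ops(5)[of g "replicate n 1" "replicate n (op_id L)"] D(1) ops(1)
      by (simp add: is_operad_def list_all2_conv_all_nth)
  qed
  moreover have "assoc_law (alg_of L)" unfolding assoc_law_def
  proof (intro allI impI)
    fix jss g fs hss assume "mem (alg_of L) (length jss) g" "list_all2 (mem (alg_of L)) (map length jss) fs"
      "list_all2 (list_all2 (mem (alg_of L))) jss hss"
    moreover have "list_all2 (mem (alg_of L)) = op_list L" by (intro ext) (rule ml)
    ultimately have g: "g \<in> op_set L (length jss)" and fs: "op_list L (map length jss) fs"
      and hss: "list_all2 (op_list L) jss hss" by (simp_all add: m)
    have hs: "op_list L (concat jss) (concat hss)" by (rule list_all2_concatI[OF hss])
    have len: "length fs = length jss" "length hss = length jss" using fs hss by (auto dest: list_all2_lengthD)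
    have i: "fs ! i \<in> op_set L (length (jss ! i))" "op_list L (jss ! i) (hss ! i)" if "i < length jss" for i
      using fs hss that len by (auto simp: list_all2_conv_all_nth[of "\<lambda>k f. f \<in> op_set L k" "map length jss"] list_all2_conv_all_nth[of "op_list L"])
    have F: "op_mu L (map length jss) g fs \<in> op_set L (length (concat jss))"
      using D(3)[of g "map length jss" fs] g fs by (simp add: length_concat)
    have H: "map (\<lambda>i. mmu (alg_of L) (jss ! i) (fs ! i) (hss ! i)) [0..<length jss] =
      map (\<lambda>i. op_mu L (jss ! i) (fs ! i) (hss ! i)) [0..<length jss]" using i ops(5) by simp
    have Hs: "op_list L (map sum_list jss) (map (\<lambda>i. op_mu L (jss ! i) (fs ! i) (hss ! i)) [0..<length jss])"
      using i D(3) by (simp add: list_all2_conv_all_nth)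
    have "op_mu L (concat jss) (op_mu L (map length jss) g fs) (concat hss) =
      op_mu L (map sum_list jss) g (map (\<lambda>i. op_mu L (jss ! i) (fs ! i) (hss ! i)) [0..<length jss])"
      using op g fs hss unfolding is_operad_def by blast
    then show "mmu (alg_of L) (concat jss) (mmu (alg_of L) (map length jss) g fs) (concat hss) =
       mmu (alg_of L) (map sum_list jss) g (map (\<lambda>i. mmu (alg_of L) (jss ! i) (fs ! i) (hss ! i)) [0..<length jss])"
      unfolding H using ops(5)[OF _ fs] ops(5)[OF F hs] ops(5)[OF _ Hs] g by simp
  qed
  moreover have "interchange_law (alg_of L)" unfolding interchange_law_def
  proof (intro allI impI)
    fix ks g g' fs fs' assume "mem (alg_of L) (length ks) g" "mem (alg_of L) (length ks) g'"
      "list_all2 (mem (alg_of L)) ks fs" "list_all2 (mem (alg_of L)) (pact (prm (alg_of L) g) ks) fs'"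
    then have g: "g \<in> op_set L (length ks)" and g': "g' \<in> op_set L (length ks)" and fs: "op_list L ks fs"
      and "op_list L (pact (prm (alg_of L) g) ks) fs'" by (simp_all only: m ml)
    define \<sigma> where "\<sigma> = op_pi L (length ks) g"
    have \<sigma>: "prm (alg_of L) g = \<sigma>" using pr[OF g] by (simp add: \<sigma>_def)
    then have fs': "op_list L (pact \<sigma> ks) fs'" using \<open>op_list L (pact (prm (alg_of L) g) ks) fs'\<close> by simp
    have p: "\<sigma> permutes {1..length ks}" using D(7)[OF g] by (simp add: \<sigma>_def)
    have len: "length fs = length ks" "length fs' = length ks" using fs fs' by (auto dest: list_all2_lengthD)
    have i: "fs ! i \<in> op_set L (ks ! i)" "fs' ! (\<sigma> (Suc i) - 1) \<in> op_set L (ks ! i)" if "i < length ks" for i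
      using fs fs' that len permutes_Suc(1)[OF p that] nth_pact[OF p that] by (auto simp: list_all2_conv_all_nth)
    have ij: "\<exists>j<length ks. i = Suc j" if "i \<in> set [1..<Suc (length ks)]" for i
    proof -
      have "1 \<le> i" "i < Suc (length ks)" using that unfolding set_upt by simp_all
      then show ?thesis by (cases i) auto
    qed
    have H: "map (\<lambda>i. mmul (alg_of L) (ks ! (i - 1)) (fs' ! (\<sigma> i - 1)) (fs ! (i - 1))) [1..<Suc (length ks)] =
      map (\<lambda>i. op_mult L (ks ! (i - 1)) (fs' ! (\<sigma> i - 1)) (fs ! (i - 1))) [1..<Suc (length ks)]"
      by (rule map_cong[OF refl]) (use ij i ops(4) in fastforce)
    have Hs: "op_list L ks (map (\<lambda>i. op_mult L (ks ! (i - 1)) (fs' ! (\<sigma> i - 1)) (fs ! (i - 1))) [1..<Suc (length ks)])"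
      using i D(10) by (simp add: list_all2_conv_all_nth del: upt_Suc)
    have "op_mult L (sum_list ks) (op_mu L (pact \<sigma> ks) g' fs') (op_mu L ks g fs) =
      op_mu L ks (op_mult L (length ks) g' g) (map (\<lambda>i. op_mult L (ks ! (i - 1)) (fs' ! (\<sigma> i - 1)) (fs ! (i - 1))) [1..<Suc (length ks)])"
      using ao g g' fs fs' unfolding is_action_operad_def Let_def pact_def \<sigma>_def by blast
    moreover have "op_mu L (pact \<sigma> ks) g' fs' \<in> op_set L (sum_list ks)"
      using D(3)[OF _ fs'] g' sum_list_pact[OF p] by simp
    ultimately show "mmul (alg_of L) (sum_list ks) (mmu (alg_of L) (pact (prm (alg_of L) g) ks) g' fs') (mmu (alg_of L) ks g fs) =
       mmu (alg_of L) ks (mmul (alg_of L) (length ks) g' g)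
         (map (\<lambda>i. mmul (alg_of L) (ks ! (i - 1)) (fs' ! (prm (alg_of L) g i - 1)) (fs ! (i - 1))) [1..<Suc (length ks)])"
      unfolding \<sigma> H using ops(4)[OF _ D(3)[OF g fs]] ops(4)[OF g' g] ops(5)[OF g fs] ops(5)[OF _ fs'] ops(5)[OF D(10)[OF g' g] Hs] g'
      by (simp del: upt_Suc)
  qed
  ultimately show ?thesis by (simp add: action_laws_def)
qed

subsection \<open>The action operad of an algebra\<close>

text \<open>Outside their domains the operations are \<open>undefined\<close> and \<pi> is
  restricted, so as to meet \<open>op_extensional\<close>.\<close>

definition op_of :: "('u, nat \<times> (nat \<Rightarrow> nat), 'u) alg \<Rightarrow> 'u action_operad" where
  "op_of A = \<lparr>op_set = (\<lambda>n. {x. mem A n x}), op_id = mid A,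
     op_mu = (\<lambda>ks g fs. if mem A (length ks) g \<and> list_all2 (mem A) ks fs then mmu A ks g fs else undefined),
     op_mult = (\<lambda>n x y. if mem A n x \<and> mem A n y then mmul A n x y else undefined),
     op_one = mone A, op_pi = (\<lambda>n. \<lambda>x\<in>{x. mem A n x}. prm A x)\<rparr>"

lemma op_of_simps:
  "x \<in> op_set (op_of A) n \<longleftrightarrow> mem A n x" "op_id (op_of A) = mid A" "op_one (op_of A) n = mone A n"
  "op_list (op_of A) ks fs \<longleftrightarrow> list_all2 (mem A) ks fs"
  "mem A (length ks) g \<Longrightarrow> list_all2 (mem A) ks fs \<Longrightarrow> op_mu (op_of A) ks g fs = mmu A ks g fs"
  "mem A n x \<Longrightarrow> mem A n y \<Longrightarrow> op_mult (op_of A) n x y = mmul A n x y"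
  "mem A n x \<Longrightarrow> op_pi (op_of A) n x = prm A x"
  by (simp_all add: op_of_def)

text \<open>The operad and group axioms are the action laws. That \<pi> preserves composition and
  multiplication is built into the result sorts of the symbols.\<close>

lemma op_of_AOp:
  assumes A: "Alg A" and laws: "action_laws A"
  shows "op_of A \<in> Ob (AOp U)"
proof -
  let ?L = "op_of A"
  note m = mem_ops[OF A] and s = op_of_simps
  have gl: "group_laws A" and ul: "unit_laws A" and al: "assoc_law A" and il: "interchange_law A"
    using laws by (auto simp: action_laws_def)
  have gr: "group (op_group ?L n)" for n
  proof (rule groupI)
    show "\<exists>y\<in>carrier (op_group ?L n). y \<otimes>\<^bsub>op_group ?L n\<^esub> x = \<one>\<^bsub>op_group ?L n\<^esub>" if "x \<in> carrier (op_group ?L n)" for x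
      using that gl m(5)[of n x] by (intro bexI[of _ "minv A n x"]) (auto simp: op_group_def s group_laws_def)
  qed (use gl m in \<open>auto simp: op_group_def s group_laws_def\<close>)
  have op: "is_operad ?L" unfolding is_operad_def
  proof (intro conjI allI ballI impI)
    show "op_id ?L \<in> op_set ?L 1" using m(1) by (simp add: s)
    show "op_mu ?L ks g fs \<in> op_set ?L (sum_list ks)" if "g \<in> op_set ?L (length ks)" "op_list ?L ks fs" for ks g fs
      using that m(9)[of ks g fs] by (simp add: s)
    show "op_mu ?L [n] (op_id ?L) [g] = g" "op_mu ?L (replicate n 1) g (replicate n (op_id ?L)) = g" if "g \<in> op_set ?L n" for n g
      using that ul m(1) by (simp_all add: s unit_laws_def list_all2_conv_all_nth)
    fix jss g fs hss assume g: "g \<in> op_set ?L (length jss)" and *: "op_list ?L (map length jss) fs \<and> list_all2 (op_list ?L) jss hss"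
    moreover have "op_list ?L = list_all2 (mem A)" by (intro ext) (rule s)
    ultimately have fs: "list_all2 (mem A) (map length jss) fs" and hss: "list_all2 (list_all2 (mem A)) jss hss"
      by simp_all
    have g': "mem A (length jss) g" using g by (simp add: s)
    have hs: "list_all2 (mem A) (concat jss) (concat hss)" by (rule list_all2_concatI[OF hss])
    have len: "length fs = length jss" "length hss = length jss" using fs hss by (auto dest: list_all2_lengthD)
    have i: "mem A (length (jss ! i)) (fs ! i)" "list_all2 (mem A) (jss ! i) (hss ! i)" if "i < length jss" for i
      using fs hss that len by (auto simp: list_all2_conv_all_nth[of "mem A" "map length jss"] list_all2_conv_all_nth[of "list_all2 (mem A)"])
    have F: "mem A (length (concat jss)) (mmu A (map length jss) g fs)"
      using m(9)[of "map length jss" g fs] g' fs by (simp add: length_concat)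
    have H: "map (\<lambda>i. op_mu ?L (jss ! i) (fs ! i) (hss ! i)) [0..<length jss] =
      map (\<lambda>i. mmu A (jss ! i) (fs ! i) (hss ! i)) [0..<length jss]" using i by (simp add: s)
    have Hs: "list_all2 (mem A) (map sum_list jss) (map (\<lambda>i. mmu A (jss ! i) (fs ! i) (hss ! i)) [0..<length jss])"
      using i m(9) by (simp add: list_all2_conv_all_nth)
    have "mmu A (concat jss) (mmu A (map length jss) g fs) (concat hss) =
      mmu A (map sum_list jss) g (map (\<lambda>i. mmu A (jss ! i) (fs ! i) (hss ! i)) [0..<length jss])"
      using al g' fs hss unfolding assoc_law_def by blast
    then show "op_mu ?L (concat jss) (op_mu ?L (map length jss) g fs) (concat hss) =
        op_mu ?L (map sum_list jss) g (map (\<lambda>i. op_mu ?L (jss ! i) (fs ! i) (hss ! i)) [0..<length jss])"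
      unfolding H using s(5)[OF _ fs] s(5)[OF F hs] s(5)[OF _ Hs] g' by simp
  qed
  have opm: "is_operad_map ?L sym_operad (op_pi ?L)" unfolding is_operad_map_def
  proof (intro conjI allI ballI impI)
    show "op_pi ?L n \<in> op_set ?L n \<rightarrow> op_set sym_operad n" for n
      using mem_perm[OF A] by (auto simp: s sym_operad_def sym_group_def)
    show "op_pi ?L 1 (op_id ?L) = op_id sym_operad" using m(1,2) s(7)[OF m(1)] by (simp add: s(2) sym_operad_def)
    fix ks g fs assume g: "g \<in> op_set ?L (length ks)" and fs: "op_list ?L ks fs"
    have g': "mem A (length ks) g" and fs': "list_all2 (mem A) ks fs" using g fs by (simp_all add: s)
    have "map2 (op_pi ?L) ks fs = map (prm A) fs" by (rule map2_eq_map[OF fs']) (simp add: s)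
    then show "op_pi ?L (sum_list ks) (op_mu ?L ks g fs) = op_mu sym_operad ks (op_pi ?L (length ks) g) (map2 (op_pi ?L) ks fs)"
      using m(9,10)[OF g' fs'] s(5)[OF g' fs'] s(7)[OF g'] s(7)[OF m(9)[OF g' fs']] by (simp add: sym_operad_def)
  qed
  have hom: "op_pi ?L n \<in> hom (op_group ?L n) (sym_group n)" for n
    using mem_perm[OF A] m(7,8) by (auto simp: hom_def op_group_def s sym_group_def)
  have "is_action_operad ?L" unfolding is_action_operad_def Let_def
  proof (intro conjI allI ballI impI op gr opm hom)
    fix ks g g' fs fs' assume "g \<in> op_set ?L (length ks)" "g' \<in> op_set ?L (length ks)"
      and *: "op_list ?L ks fs \<and> op_list ?L (map (\<lambda>i. ks ! (inv' (op_pi ?L (length ks) g) i - 1)) [1..<Suc (length ks)]) fs'"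
    then have g: "mem A (length ks) g" and g': "mem A (length ks) g'" and fs: "list_all2 (mem A) ks fs" by (simp_all add: s)
    let ?\<sigma> = "prm A g"
    have \<sigma>: "op_pi ?L (length ks) g = ?\<sigma>" using g by (simp add: s)
    have fs': "list_all2 (mem A) (pact ?\<sigma> ks) fs'" using * by (simp only: \<sigma> s pact_def)
    have p: "?\<sigma> permutes {1..length ks}" by (rule mem_perm[OF A g])
    have len: "length fs = length ks" "length fs' = length ks" using fs fs' by (auto dest: list_all2_lengthD)
    have i: "mem A (ks ! i) (fs ! i)" "mem A (ks ! i) (fs' ! (?\<sigma> (Suc i) - 1))" if "i < length ks" for i
      using fs fs' that len permutes_Suc(1)[OF p that] nth_pact[OF p that] by (auto simp: list_all2_conv_all_nth)
    have ij: "\<exists>j<length ks. i = Suc j" if "i \<in> set [1..<Suc (length ks)]" for i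
    proof -
      have "1 \<le> i" "i < Suc (length ks)" using that unfolding set_upt by simp_all
      then show ?thesis by (cases i) auto
    qed
    have H: "map (\<lambda>i. op_mult ?L (ks ! (i - 1)) (fs' ! (?\<sigma> i - 1)) (fs ! (i - 1))) [1..<Suc (length ks)] =
      map (\<lambda>i. mmul A (ks ! (i - 1)) (fs' ! (?\<sigma> i - 1)) (fs ! (i - 1))) [1..<Suc (length ks)]"
      by (rule map_cong[OF refl]) (use ij i s(6) in fastforce)
    have Hs: "list_all2 (mem A) ks (map (\<lambda>i. mmul A (ks ! (i - 1)) (fs' ! (?\<sigma> i - 1)) (fs ! (i - 1))) [1..<Suc (length ks)])"
      using i m(7) by (simp add: list_all2_conv_all_nth del: upt_Suc)
    have "mmul A (sum_list ks) (mmu A (pact ?\<sigma> ks) g' fs') (mmu A ks g fs) =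
      mmu A ks (mmul A (length ks) g' g) (map (\<lambda>i. mmul A (ks ! (i - 1)) (fs' ! (?\<sigma> i - 1)) (fs ! (i - 1))) [1..<Suc (length ks)])"
      using il g g' fs fs' unfolding interchange_law_def by blast
    moreover have "mem A (sum_list ks) (mmu A (pact ?\<sigma> ks) g' fs')"
      using m(9)[OF _ fs'] g' sum_list_pact[OF p] by simp
    ultimately show "op_mult ?L (sum_list ks)
        (op_mu ?L (map (\<lambda>i. ks ! (inv' (op_pi ?L (length ks) g) i - 1)) [1..<Suc (length ks)]) g' fs') (op_mu ?L ks g fs) =
      op_mu ?L ks (op_mult ?L (length ks) g' g)
        (map (\<lambda>i. op_mult ?L (ks ! (i - 1)) (fs' ! (op_pi ?L (length ks) g i - 1)) (fs ! (i - 1))) [1..<Suc (length ks)])"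
      unfolding \<sigma> H pact_def[symmetric]
      using s(6)[OF _ m(9)[OF g fs]] s(6)[OF g' g] s(5)[OF g fs] s(5)[OF _ fs'] s(5)[OF m(7)[OF g' g] Hs] g'
      by (simp del: upt_Suc)
  qed
  moreover have "op_extensional ?L" by (auto simp: op_extensional_def op_of_def)
  moreover have "op_set ?L n \<in> U" for n
    by (rule universe_subset[OF univ is_algD(1)[OF A]]) (auto simp: op_of_def mem_def)
  moreover have "op_set ?L k \<inter> op_set ?L n = {}" if "k \<noteq> n" for k n using that by (auto simp: op_of_def mem_def)
  ultimately show ?thesis unfolding AOp_Ob by blast
qed

text \<open>An equality of records, not merely an isomorphism: \<open>op_extensional\<close> settles
  the arguments outside the domains.\<close>

lemma op_of_alg_of:
  assumes L: "L \<in> Ob (AOp U)"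
  shows "op_of (alg_of L) = L"
proof (rule action_operad.equality)
  note m = mem_alg_of[OF L] and pr = prm_alg_of[OF L] and ml = op_list_iff[OF L] and ops = alg_of_ops[OF L]
  have opext: "op_extensional L" using L by (simp add: AOp_Ob)
  show "op_set (op_of (alg_of L)) = op_set L" by (auto simp: op_of_def m)
  show "op_id (op_of (alg_of L)) = op_id L" "op_one (op_of (alg_of L)) = op_one L"
    using ops(1,2) by (auto simp: op_of_def)
  show "op_mu (op_of (alg_of L)) = op_mu L"
  proof (intro ext)
    show "op_mu (op_of (alg_of L)) ks g fs = op_mu L ks g fs" for ks g fs
      using opext ops(5)[of g ks fs] unfolding op_extensional_def by (auto simp: op_of_def m ml)
  qed
  show "op_mult (op_of (alg_of L)) = op_mult L"
  proof (intro ext)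
    show "op_mult (op_of (alg_of L)) n x y = op_mult L n x y" for n x y
      using opext ops(4)[of x n y] unfolding op_extensional_def by (auto simp: op_of_def m)
  qed
  show "op_pi (op_of (alg_of L)) = op_pi L"
  proof (rule ext, rule ext)
    show "op_pi (op_of (alg_of L)) n x = op_pi L n x" for n x
      using opext pr[of x n] unfolding op_extensional_def by (auto simp: op_of_def m extensional_def)
  qed
qed simp

lemma op_of_total: "op_total (op_of A) = acarrier A"
  by (auto simp: op_total_def op_of_def mem_def)

text \<open>Inversion is not among the fields of an action operad; it is recovered because inverses
  in a group are unique.\<close>

lemma alg_of_op_of:
  assumes A: "Alg A" and laws: "action_laws A"
  shows "alg_of (op_of A) = A"
proof -
  let ?L = "op_of A"
  note L = op_of_AOp[OF assms]
  have srt: "asort (alg_of ?L) = asort A"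
  proof
    fix x show "asort (alg_of ?L) x = asort A x"
    proof (cases "x \<in> acarrier A")
      case True
      define n where "n = fst (asort A x)"
      have "mem A n x" using True by (simp add: mem_def n_def)
      then show ?thesis using op_degree[OF L, of x n] mem_asort[of A n x] True
        by (simp add: alg_of_simps op_of_total op_of_simps)
    next
      case False
      then show ?thesis using is_algD(3)[OF A False] by (simp add: alg_of_simps op_of_total)
    qed
  qed
  have car: "acarrier (alg_of ?L) = acarrier A" by (simp add: alg_of_simps op_of_total)
  have args: "aargs Sg (alg_of ?L) f = aargs Sg A f" for f by (simp add: aargs_def car srt)
  have "aint (alg_of ?L) f xs = aint A f xs" for f xs
  proof (cases "f \<in> symbols Sg \<and> xs \<in> aargs Sg A f")
    case True
    then obtain s where s: "f = c s" "sym_ok s" by (auto elim: symbols_cases)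
    have xs: "xs \<in> aargs Sg A (c s)" using True s by simp
    note ca = aargs_cases[OF s(2) xs]
    have "op_interp ?L s xs = aint A (c s) xs"
    proof (cases s)
      case Id_sym
      then show ?thesis using ca(1) by (simp add: op_of_simps mid_def)
    next
      case (One_sym n)
      then show ?thesis using ca(1) by (simp add: op_of_simps mone_def)
    next
      case (Mult_sym n \<sigma> \<tau>)
      then obtain x y where "xs = [x, y]" "mem A n x" "mem A n y" "\<sigma> = prm A x" "\<tau> = prm A y" using ca(3) by blast
      then show ?thesis using Mult_sym by (simp add: op_of_simps mmul_def)
    next
      case (Inv_sym n \<sigma>)
      then obtain x where x: "xs = [x]" "mem A n x" "\<sigma> = prm A x" using ca(2) by blast
      interpret group "op_group ?L n" by (rule action_operadD(5)[OF L])
      have "inv\<^bsub>op_group ?L n\<^esub> x = minv A n x"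
      proof (rule inv_equality)
        show "minv A n x \<otimes>\<^bsub>op_group ?L n\<^esub> x = \<one>\<^bsub>op_group ?L n\<^esub>"
          using laws x(2) mem_ops(5)[OF A x(2)] by (simp add: op_group_def op_of_simps action_laws_def group_laws_def)
      qed (use x(2) mem_ops(5)[OF A x(2)] in \<open>simp_all add: op_group_def op_of_simps\<close>)
      then show ?thesis using Inv_sym x by (simp add: minv_def)
    next
      case (Mu_sym ks \<sigma> \<tau>s)
      then obtain g fs where "xs = g # fs" "mem A (length ks) g" "list_all2 (mem A) ks fs" "\<sigma> = prm A g" "\<tau>s = map (prm A) fs"
        using ca(4) by blast
      then show ?thesis using Mu_sym by (simp add: op_of_simps mmu_def)
    qed
    then show ?thesis using True s by (simp add: alg_of_simps(3) args)
  next
    case False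
    then show ?thesis unfolding alg_of_simps(3) args using is_algD(6)[OF A False] by (simp only: if_False)
  qed
  then have "aint (alg_of ?L) = aint A" by blast
  then show ?thesis using car srt by simp
qed

subsection \<open>Maps of action operads\<close>

text \<open>The sets of L are disjoint, so a family of functions indexed by arity amounts to one
  function on their union; \<open>aop_map_of\<close> is the way back.\<close>

definition hom_of :: "'u action_operad \<Rightarrow> (nat \<Rightarrow> 'u \<Rightarrow> 'u) \<Rightarrow> 'u \<Rightarrow> 'u" where
  "hom_of L f = (\<lambda>x\<in>op_total L. f (op_degree L x) x)"

definition aop_map_of :: "'u action_operad \<Rightarrow> ('u \<Rightarrow> 'u) \<Rightarrow> nat \<Rightarrow> 'u \<Rightarrow> 'u" where
  "aop_map_of L h n = (\<lambda>x\<in>op_set L n. h x)"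

lemma hom_of_eq: "L \<in> Ob (AOp U) \<Longrightarrow> x \<in> op_set L n \<Longrightarrow> hom_of L f x = f n x"
  by (auto simp: hom_of_def op_degree op_total_def)

lemma aop_map_of_hom_of:
  assumes L: "L \<in> Ob (AOp U)" and f: "f \<in> aop_hom L M"
  shows "aop_map_of L (hom_of L f) = f"
  using f hom_of_eq[OF L] by (auto simp: aop_map_of_def aop_hom_def extensional_def fun_eq_iff)

lemma hom_of_aop_map_of:
  assumes L: "L \<in> Ob (AOp U)" and h: "h \<in> extensional (op_total L)"
  shows "hom_of L (aop_map_of L h) = h"
proof
  fix x show "hom_of L (aop_map_of L h) x = h x"
  proof (cases "x \<in> op_total L")
    case True
    then obtain n where "x \<in> op_set L n" by (auto simp: op_total_def)
    then show ?thesis using hom_of_eq[OF L, of x n] by (simp add: aop_map_of_def)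
  qed (use h in \<open>simp add: hom_of_def extensional_def\<close>)
qed

text \<open>Homomorphisms of algebras must also preserve group units and inverses, which follows
  from preservation of the multiplication.\<close>

lemma hom_of_ahom:
  assumes L: "L \<in> Ob (AOp U)" and M: "M \<in> Ob (AOp U)" and f: "f \<in> aop_hom L M"
  shows "hom_of L f \<in> ahom Sg (alg_of L) (alg_of M)"
proof -
  let ?h = "hom_of L f"
  note h = hom_of_eq[OF L] and DL = action_operadD[OF L] and DM = action_operadD[OF M]
  have am: "is_operad_map L M f" "\<And>n x. x \<in> op_set L n \<Longrightarrow> op_pi M n (f n x) = op_pi L n x"
    "\<And>n. f n \<in> hom (op_group L n) (op_group M n)"
    using f by (auto simp: aop_hom_def is_action_operad_map_def)
  have fs: "f n x \<in> op_set M n" if "x \<in> op_set L n" for n x using am(1) that unfolding is_operad_map_def by blast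
  have mapf: "map2 f ks xs = map ?h xs" "op_list M ks (map ?h xs)" if "op_list L ks xs" for ks xs
  proof -
    show "map2 f ks xs = map ?h xs" by (rule map2_eq_map[OF that]) (simp add: h)
    show "op_list M ks (map ?h xs)" using that by (auto simp: list_all2_conv_all_nth) (metis fs h)
  qed
  have gh: "group_hom (op_group L n) (op_group M n) (f n)" for n
    by (intro group_hom.intro group_hom_axioms.intro DL(5) DM(5) am(3))
  show ?thesis unfolding ahom_iff[OF Alg_alg_of[OF L]] mem_alg_of[OF L] op_list_iff[OF L]
  proof (intro conjI ballI allI impI)
    show "?h \<in> acarrier (alg_of L) \<rightarrow>\<^sub>E acarrier (alg_of M)"
      using fs h by (auto simp: alg_of_simps op_total_def hom_of_def op_degree[OF L])
    show "asort (alg_of M) (?h x) = asort (alg_of L) x" if x: "x \<in> acarrier (alg_of L)" for x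
    proof -
      obtain n where n: "x \<in> op_set L n" using x by (auto simp: alg_of_simps op_total_def)
      then have "mem (alg_of L) n x" "mem (alg_of M) n (?h x)" using h fs mem_alg_of[OF L] mem_alg_of[OF M] by simp_all
      then show ?thesis using mem_asort n h fs am(2) prm_alg_of[OF L n] prm_alg_of[OF M fs[OF n]] by metis
    qed
    show "?h (mid (alg_of L)) = mid (alg_of M)"
      using am(1) h[OF DL(1)] by (simp add: alg_of_ops[OF L] alg_of_ops[OF M] is_operad_map_def)
    show "?h (mone (alg_of L) n) = mone (alg_of M) n" for n
      using group_hom.hom_one[OF gh[of n]] h[OF DL(8)] by (simp add: alg_of_ops[OF L] alg_of_ops[OF M] op_group_def)
    show "?h (minv (alg_of L) n x) = minv (alg_of M) n (?h x)" if "x \<in> op_set L n" for n x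
      using group_hom.hom_inv[OF gh[of n], of x] that h[OF DL(12)[OF that]] h[OF that] fs[OF that]
      by (simp add: alg_of_ops(3)[OF L that] alg_of_ops(3)[OF M] op_group_def)
    show "?h (mmul (alg_of L) n x y) = mmul (alg_of M) n (?h x) (?h y)" if "x \<in> op_set L n" "y \<in> op_set L n" for n x y
      using group_hom.hom_mult[OF gh[of n], of x y] that h[OF DL(10)[OF that]] h[OF that(1)] h[OF that(2)] fs[OF that(1)] fs[OF that(2)]
      by (simp add: alg_of_ops(4)[OF L that] alg_of_ops(4)[OF M] op_group_def)
    show "?h (mmu (alg_of L) ks g xs) = mmu (alg_of M) ks (?h g) (map ?h xs)" if "g \<in> op_set L (length ks)" "op_list L ks xs" for ks g xs
    proof -
      have "f (sum_list ks) (op_mu L ks g xs) = op_mu M ks (f (length ks) g) (map2 f ks xs)"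
        using am(1) that unfolding is_operad_map_def by blast
      then show ?thesis using h[OF DL(3)[OF that]] h[OF that(1)] alg_of_ops(5)[OF L that] alg_of_ops(5)[OF M fs[OF that(1)] mapf(2)[OF that(2)]]
        unfolding mapf(1)[OF that(2)] by simp
    qed
  qed
qed

text \<open>As h preserves sorts, it respects arities and commutes with \<pi>.\<close>

lemma aop_map_of_aop_hom:
  assumes L: "L \<in> Ob (AOp U)" and M: "M \<in> Ob (AOp U)" and hH: "h \<in> ahom Sg (alg_of L) (alg_of M)"
  shows "aop_map_of L h \<in> aop_hom L M"
proof -
  let ?f = "aop_map_of L h"
  note DL = action_operadD[OF L]
  have f: "?f n x = h x" if "x \<in> op_set L n" for n x using that by (simp add: aop_map_of_def)
  note H = hH[unfolded ahom_iff[OF Alg_alg_of[OF L]] mem_alg_of[OF L] op_list_iff[OF L]]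
  have hm: "h x \<in> op_set M n" "op_pi M n (h x) = op_pi L n x" if x: "x \<in> op_set L n" for n x
  proof -
    have xm: "mem (alg_of L) n x" using x mem_alg_of[OF L] by simp
    then have "mem (alg_of M) n (h x)" "prm (alg_of M) (h x) = prm (alg_of L) x"
      using ahomD(1,2)[OF hH] by (simp_all add: mem_def prm_def)
    then show "h x \<in> op_set M n" "op_pi M n (h x) = op_pi L n x"
      using mem_alg_of[OF M] prm_alg_of[OF M] prm_alg_of[OF L x] by metis+
  qed
  have "is_operad_map L M ?f" unfolding is_operad_map_def
  proof (intro conjI allI ballI impI)
    show "?f n \<in> op_set L n \<rightarrow> op_set M n" for n using f hm(1) by auto
    show "?f 1 (op_id L) = op_id M" using H f[OF DL(1)] by (simp add: alg_of_ops(1)[OF L] alg_of_ops(1)[OF M])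
    fix ks g xs assume g: "g \<in> op_set L (length ks)" and xs: "op_list L ks xs"
    have "map2 ?f ks xs = map h xs" by (rule map2_eq_map[OF xs]) (simp add: f)
    moreover have "op_list M ks (map h xs)" using xs hm(1) by (simp add: list_all2_conv_all_nth)
    moreover have "h (mmu (alg_of L) ks g xs) = mmu (alg_of M) ks (h g) (map h xs)" using H g xs by blast
    ultimately show "?f (sum_list ks) (op_mu L ks g xs) = op_mu M ks (?f (length ks) g) (map2 ?f ks xs)"
      using f[OF DL(3)[OF g xs]] f[OF g] alg_of_ops(5)[OF L g xs] alg_of_ops(5)[OF M hm(1)[OF g]] by simp
  qed
  moreover have "?f n \<in> hom (op_group L n) (op_group M n)" for n
  proof -
    have "?f n (op_mult L n x y) = op_mult M n (?f n x) (?f n y)" if x: "x \<in> op_set L n" and y: "y \<in> op_set L n" for x y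
    proof -
      have "h (mmul (alg_of L) n x y) = mmul (alg_of M) n (h x) (h y)" using H x y by blast
      then show ?thesis
        using f[OF x] f[OF y] f[OF DL(10)[OF x y]] alg_of_ops(4)[OF L x y] alg_of_ops(4)[OF M hm(1)[OF x] hm(1)[OF y]] by simp
    qed
    then show ?thesis using f hm(1) by (auto simp: hom_def op_group_def)
  qed
  moreover have "op_pi M n (?f n x) = op_pi L n x" if "x \<in> op_set L n" for n x using f[OF that] hm(2)[OF that] by simp
  ultimately show ?thesis by (auto simp: aop_hom_def is_action_operad_map_def aop_map_of_def)
qed

lemma hom_of_id: "L \<in> Ob (AOp U) \<Longrightarrow> hom_of L (\<lambda>n. \<lambda>x\<in>op_set L n. x) = (\<lambda>x\<in>acarrier (alg_of L). x)"
  by (auto simp: hom_of_def alg_of_simps op_total_def op_degree fun_eq_iff)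

lemma hom_of_compose:
  assumes L: "L \<in> Ob (AOp U)" and M: "M \<in> Ob (AOp U)" and f: "f \<in> aop_hom L M"
  shows "hom_of L (\<lambda>n. compose (op_set L n) (g n) (f n)) = compose (acarrier (alg_of L)) (hom_of M g) (hom_of L f)"
proof
  fix x show "hom_of L (\<lambda>n. compose (op_set L n) (g n) (f n)) x = compose (acarrier (alg_of L)) (hom_of M g) (hom_of L f) x"
  proof (cases "x \<in> op_total L")
    case True
    then obtain n where n: "x \<in> op_set L n" by (auto simp: op_total_def)
    have "f n x \<in> op_set M n" using f n by (auto simp: aop_hom_def is_action_operad_map_def is_operad_map_def)
    then show ?thesis using n True hom_of_eq[OF L n] hom_of_eq[OF M, of "f n x" n] by (simp add: compose_def alg_of_simps)
  qed (simp add: hom_of_def compose_def alg_of_simps)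
qed

text \<open>Closure under identities and composition is inherited from homomorphisms of algebras
  through \<open>hom_of\<close> and \<open>aop_map_of\<close>.\<close>

lemma is_cat_AOp: "is_cat (AOp U)"
proof -
  have eq: "AOp U = mk_cat (Ob (AOp U)) aop_hom (\<lambda>L n. \<lambda>x\<in>op_set L n. x) (\<lambda>L g f n. compose (op_set L n) (g n) (f n))"
    unfolding AOp_def aop_hom_def mk_cat_simps ..
  have idH: "(\<lambda>n. \<lambda>x\<in>op_set L n. x) \<in> aop_hom L L" if L: "L \<in> Ob (AOp U)" for L
  proof -
    have "aop_map_of L (\<lambda>x\<in>acarrier (alg_of L). x) = (\<lambda>n. \<lambda>x\<in>op_set L n. x)"
      by (auto simp: aop_map_of_def alg_of_simps op_total_def fun_eq_iff)
    then show ?thesis using aop_map_of_aop_hom[OF L L ahom_id[OF Alg_alg_of[OF L]]] by simp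
  qed
  have compH: "(\<lambda>n. compose (op_set L n) (g n) (f n)) \<in> aop_hom L N"
    if L: "L \<in> Ob (AOp U)" and M: "M \<in> Ob (AOp U)" and N: "N \<in> Ob (AOp U)" and f: "f \<in> aop_hom L M" and g: "g \<in> aop_hom M N" for L M N f g
  proof -
    let ?c = "\<lambda>n. compose (op_set L n) (g n) (f n)"
    have "hom_of L ?c \<in> ahom Sg (alg_of L) (alg_of N)"
      unfolding hom_of_compose[OF L M f] by (rule ahom_compose[OF Alg_alg_of[OF L] hom_of_ahom[OF L M f] hom_of_ahom[OF M N g]])
    moreover have "aop_map_of L (hom_of L ?c) = ?c" using hom_of_eq[OF L, where f = ?c] by (auto simp: aop_map_of_def compose_def fun_eq_iff)
    ultimately show ?thesis using aop_map_of_aop_hom[OF L N] by metis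
  qed
  show ?thesis
  proof (subst eq, rule is_cat_mk_cat, goal_cases)
    case (1 L)
    then show ?case by (rule idH)
  next
    case (2 L M N f g)
    then show ?case by (rule compH)
  next
    case (3 L M f)
    then show ?case by (auto simp: aop_hom_def compose_def extensional_def fun_eq_iff)
  next
    case (4 L M f)
    have "f n x \<in> op_set M n" if "x \<in> op_set L n" for n x
      using 4(3) that by (auto simp: aop_hom_def is_action_operad_map_def is_operad_map_def)
    then show ?case using 4(3) by (auto simp: aop_hom_def compose_def extensional_def fun_eq_iff)
  next
    case (5 L M N P f g h)
    have "f n x \<in> op_set M n" if "x \<in> op_set L n" for n x
      using 5(5) that by (auto simp: aop_hom_def is_action_operad_map_def is_operad_map_def)
    then show ?case by (auto simp: compose_def fun_eq_iff)
  qed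
qed

section \<open>The isomorphism between action operads and models of the equations\<close>

definition aop_eqs where
  "aop_eqs = valid_eqs (alg_of ` Ob (AOp U))"

definition aop_iso :: "('u action_operad, 'u action_operad \<times> (nat \<Rightarrow> 'u \<Rightarrow> 'u) \<times> 'u action_operad,
    ('u, nat \<times> (nat \<Rightarrow> nat), 'u) alg,
    ('u, nat \<times> (nat \<Rightarrow> nat), 'u) alg \<times> ('u \<Rightarrow> 'u) \<times> ('u, nat \<times> (nat \<Rightarrow> nat), 'u) alg) fctr" where
  "aop_iso = \<lparr>fob = alg_of, far = (\<lambda>(L, f, M). (alg_of L, hom_of L f, alg_of M))\<rparr>"

sublocale variety_spec U all_perms Sg aop_eqs
proof
  have "symbols Sg \<in> U" using c_U by (simp add: Sg_def)
  then show "small U (symbols Sg)" by (rule small_member)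
qed (use univ Sg_sorts in \<open>auto simp: aop_eqs_def valid_eqs_def\<close>)

lemma alg_of_Model: "L \<in> Ob (AOp U) \<Longrightarrow> Model (alg_of L)"
  using Alg_alg_of by (auto simp: model_def aop_eqs_def valid_eqs_def)

text \<open>A model satisfies whatever holds in all algebras of action operads, and these satisfy
  the laws. It follows that \<open>op_of\<close> turns every model into an action operad.\<close>

lemma Model_action_laws: "Model A \<Longrightarrow> action_laws A"
  by (rule action_laws_transport[of A "alg_of ` Ob (AOp U)"])
    (auto simp: model_def aop_eqs_def Alg_alg_of action_laws_alg_of)

lemma aop_iso_functor: "is_functor (AOp U) D aop_iso"
proof (rule is_functorI[OF is_cat_AOp is_cat_alg_cat])
  show "fob aop_iso L \<in> Ob D" if "L \<in> Ob (AOp U)" for L using alg_of_Model[OF that] by (simp add: Ob_D aop_iso_def)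
  show "far aop_iso f \<in> arrows D (fob aop_iso L) (fob aop_iso M)" if "f \<in> arrows (AOp U) L M" for L M f
    using that alg_of_Model hom_of_ahom by (auto simp: AOp_arrows arrows_D aop_iso_def)
  show "far aop_iso (Ide (AOp U) L) = Ide D (fob aop_iso L)" if "L \<in> Ob (AOp U)" for L
    using hom_of_id[OF that] by (simp add: aop_iso_def AOp_def Ide_D)
  show "far aop_iso (Cmp (AOp U) g f) = Cmp D (far aop_iso g) (far aop_iso f)"
    if "f \<in> arrows (AOp U) L M" "g \<in> arrows (AOp U) M N" for L M N f g
    using that hom_of_compose[of L M] by (auto simp: AOp_arrows aop_iso_def Cmp_D) (simp add: AOp_def)
qed

text \<open>The inverse is \<open>op_of\<close> on objects; on arrows it restricts a homomorphism to
  the set of each arity.\<close>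

lemma aop_iso_isomorphism: "is_isomorphism (AOp U) D aop_iso"
proof (rule bijective_functor_isomorphism[OF aop_iso_functor])
  show "bij_betw (fob aop_iso) (Ob (AOp U)) (Ob D)"
  proof (rule bij_betw_byWitness[where f' = op_of])
    show "\<forall>L\<in>Ob (AOp U). op_of (fob aop_iso L) = L" using op_of_alg_of by (simp add: aop_iso_def)
    show "\<forall>A\<in>Ob D. fob aop_iso (op_of A) = A"
      using alg_of_op_of Model_action_laws Model_alg by (simp add: aop_iso_def Ob_D)
    show "fob aop_iso ` Ob (AOp U) \<subseteq> Ob D" using functor_ob[OF aop_iso_functor] by blast
    show "op_of ` Ob D \<subseteq> Ob (AOp U)" using op_of_AOp Model_action_laws Model_alg by (auto simp: Ob_D)
  qed
  show "bij_betw (far aop_iso) (Ar (AOp U)) (Ar D)"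
  proof (rule bij_betw_byWitness[where f' = "\<lambda>(A, h, B). (op_of A, aop_map_of (op_of A) h, op_of B)"])
    show "\<forall>f\<in>Ar (AOp U). (\<lambda>(A, h, B). (op_of A, aop_map_of (op_of A) h, op_of B)) (far aop_iso f) = f"
    proof
      fix f assume "f \<in> Ar (AOp U)"
      then obtain L M where "f \<in> arrows (AOp U) L M" using arrow_Ar[OF is_cat_AOp] by blast
      then obtain f' where "f = (L, f', M)" "L \<in> Ob (AOp U)" "M \<in> Ob (AOp U)" "f' \<in> aop_hom L M" by (auto simp: AOp_arrows)
      then show "(\<lambda>(A, h, B). (op_of A, aop_map_of (op_of A) h, op_of B)) (far aop_iso f) = f"
        using op_of_alg_of aop_map_of_hom_of[of L f' M] by (simp add: aop_iso_def)
    qed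
    have *: "\<exists>A h B. z = (A, h, B) \<and> op_of A \<in> Ob (AOp U) \<and> op_of B \<in> Ob (AOp U) \<and> alg_of (op_of A) = A \<and> alg_of (op_of B) = B \<and>
        h \<in> ahom Sg A B" if z: "z \<in> Ar D" for z
    proof -
      obtain A B where "z \<in> arrows D A B" using arrow_Ar[OF is_cat_alg_cat z] by blast
      then obtain h where "z = (A, h, B)" "Model A" "Model B" "h \<in> ahom Sg A B" by (auto simp: arrows_D)
      then show ?thesis using op_of_AOp alg_of_op_of Model_action_laws Model_alg by blast
    qed
    show "\<forall>z\<in>Ar D. far aop_iso ((\<lambda>(A, h, B). (op_of A, aop_map_of (op_of A) h, op_of B)) z) = z"
    proof
      fix z assume "z \<in> Ar D"
      from *[OF this] obtain A h B where z: "z = (A, h, B)" "op_of A \<in> Ob (AOp U)" "alg_of (op_of A) = A" "alg_of (op_of B) = B"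
        "h \<in> ahom Sg A B" by blast
      have "h \<in> extensional (op_total (op_of A))" using z(5) by (simp add: op_of_total ahom_def PiE_def)
      then show "far aop_iso ((\<lambda>(A, h, B). (op_of A, aop_map_of (op_of A) h, op_of B)) z) = z"
        using hom_of_aop_map_of[OF z(2)] z by (simp add: aop_iso_def)
    qed
    show "far aop_iso ` Ar (AOp U) \<subseteq> Ar D"
      using functor_arrow[OF aop_iso_functor arrow_Ar[OF is_cat_AOp]] arrowsD(3)[OF is_cat_alg_cat] by blast
    show "(\<lambda>(A, h, B). (op_of A, aop_map_of (op_of A) h, op_of B)) ` Ar D \<subseteq> Ar (AOp U)"
    proof
      fix y assume "y \<in> (\<lambda>(A, h, B). (op_of A, aop_map_of (op_of A) h, op_of B)) ` Ar D"
      then obtain z where "z \<in> Ar D" "y = (\<lambda>(A, h, B). (op_of A, aop_map_of (op_of A) h, op_of B)) z" by blast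
      moreover from *[OF this(1)] obtain A h B where "z = (A, h, B)" "op_of A \<in> Ob (AOp U)" "op_of B \<in> Ob (AOp U)"
        "alg_of (op_of A) = A" "alg_of (op_of B) = B" "h \<in> ahom Sg A B" by blast
      ultimately have "y \<in> arrows (AOp U) (op_of A) (op_of B)"
        using aop_map_of_aop_hom[of "op_of A" "op_of B" h] by (simp add: AOp_arrows)
      then show "y \<in> Ar (AOp U)" using arrowsD(3)[OF is_cat_AOp] by blast
    qed
  qed
qed

lemma aop_variety: "variety U all_perms (AOp U) AOp_forget"
proof -
  have ob: "fob alg_forget (fob aop_iso L) = fob AOp_forget L" for L
    by (simp add: aop_iso_def alg_of_simps AOp_forget_def Let_def)
  have ar: "far alg_forget (far aop_iso f) = far AOp_forget f" for f
    by (cases f) (simp add: aop_iso_def alg_of_simps AOp_forget_def Let_def hom_of_def)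
  have "is_functor (AOp U) (sets_over U all_perms) AOp_forget"
    by (rule functor_cong[OF functor_comp[OF aop_iso_functor forget_functor]]) (simp_all only: comp_fctr_simps ob ar)
  moreover have "symbols Sg \<in> U" using c_U by (simp add: Sg_def)
  moreover have "\<forall>(t, t')\<in>aop_eqs. well_sorted all_perms Sg t \<and> well_sorted all_perms Sg t' \<and> tsort Sg t = tsort Sg t'"
    using eqs by blast
  moreover have "\<forall>f\<in>symbols Sg. set (arity Sg f) \<subseteq> all_perms \<and> result Sg f \<in> all_perms"
    using Sg_sorts by blast
  ultimately show ?thesis unfolding variety_def
    by (intro conjI exI[of _ Sg] exI[of _ aop_eqs] exI[of _ aop_iso])
      (assumption | rule aop_iso_isomorphism | rule ballI, rule ob ar)+
qed

end

theorem theorem7p3: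
  fixes U :: "'u set set"
  assumes "universe U"
  shows "variety U all_perms (AOp U) AOp_forget \<and>
         finitary_monadic U (AOp U) (sets_over U all_perms) AOp_forget \<and>
         locally_finitely_presentable U (AOp U)"
proof -
  \<comment> \<open>There are countably many operation symbols, so they can be coded inside any
    universe.\<close>
  obtain c :: "aop_sym \<Rightarrow> 'u" where "inj_on c (Collect sym_ok)" "c ` Collect sym_ok \<in> U"
    using small_countable[OF assms countable_sym_ok] small_iff[OF assms] by blast
  then interpret aop_signature U c using assms by unfold_locales
  show ?thesis
    using aop_variety variety_finitary_monadic_lfp[OF assms small_countable[OF assms countable_all_perms] aop_variety] by blast
qed

end
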